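(* Let $d\in\{1,2,3\}$, $\alpha\in\,]0,2-\frac d2[$ and $g\in\mathscr C^\alpha$. Then there exist a stopping time $\tau:\Omega\to\,]0,+\infty]$ and a unique stochastic process $(f_r)_{r\in[0,\tau[}$ with state space $(\mathscr C^\alpha,\mathcal B(\mathscr C^\alpha))$ such that for every $\omega\in\Omega$ the function $[0,\tau(\omega)[\,\to\mathscr C^\alpha$, $r\mapsto f_r(\omega)$, is continuous, $$\forall U\in[0,\tau(\omega)[,\quad f_U(\omega)=G_Ug+\widetilde X_{U,1}(\omega)+\int_0^UG_{U-q}\Big(\Delta\big((f_q(\omega))^3-f_q(\omega)\big)\Big)\,\mathrm dq,$$ and $$\tau(\omega)<+\infty\implies\limsup_{q\uparrow\tau(\omega)}\|f_q(\omega)\|_{\mathscr C^\alpha}=+\infty.$$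
   Context: Notation: $\mathbb N=\{0,1,2,\dots\}$, $\mathbb R_+=[0,\infty[$, $\mathbb T^d=\mathbb R^d/\mathbb Z^d$, $\mathscr S=C^\infty(\mathbb T^d,\mathbb R)$ with its usual Fréchet topology, $\mathscr S'$ its space of continuous linear functionals $\mathscr S\to\mathbb R$ with the weak$^*$ topology. For $\phi\in\mathscr S,f\in\mathscr S'$: $(\phi*f)(x)=f(\phi(\cdot-x))$. Besov spaces. Fix non-negative radial $\rho_{-1},\rho_0\in C_c^\infty(\mathbb R^d,\mathbb R)$ with $\mathrm{supp}\,\rho_{-1}\subset\{|y|\le 4/3\}$, $\mathrm{supp}\,\rho_0\subset\{3/4\le|y|\le 8/3\}$, $\rho_{-1}(x)+\sum_{q\in\mathbb N}\rho_0(2^{-q}x)=1$; put $\rho_q=\rho_0(2^{-q}\cdot)$ for $q\ge1$, $K_j(x)=\sum_{m\in\mathbb Z^d}\rho_j(m)\cos(2\pi\langle x,m\rangle)$, $\delta_jf=K_j*f$ ($j\ge-1$). For $\alpha\in\mathbb R$: $\|f\|_{\mathscr C^\alpha}=\sup_{j\ge-1}2^{\alpha j}\|\delta_jf\|_{L^\infty(\mathbb T^d)}$, $\mathscr C^\alpha=\{f\in\mathscr S':\lim_{j\to\infty}2^{\alpha j}\|\delta_jf\|_{L^\infty}=0\}$. For $\alpha>0$ elements of $\mathscr C^\alpha$ are continuous functions and products are the usual ones. Semigroup: $G_0f=f$, and for $r>0$, $\eta_r(x)=\sum_{q\in\mathbb Z^d}\cos(2\pi\langle x,q\rangle)e^{-r|2\pi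 q|^4}$, $G_rf=\eta_r*f$. $\Delta$ is the distributional Laplacian. Noise. $(\Omega,\mathcal H,\mathbb P)$ is a complete probability space carrying a space-time white noise: a linear family $(\xi_\varphi)_{\varphi\in L^2(\mathbb R_+\times\mathbb T^d)}$ of centred normal random variables with $\mathbb E[\xi_\varphi^2]=\|\varphi\|_{L^2}^2$. The filtration is $\mathcal H_r=\bigcap_{q>r}\sigma(\{M\in\mathcal H:\mathbb P(M)=0\}\cup\sigma(\xi_\varphi:\varphi\in L^2(\mathbb R_+\times\mathbb T^d),\ \varphi=0\text{ on }]q,\infty[\times\mathbb T^d))$; stopping times and processes are taken on this filtered space. $\widetilde X_{\cdot,1}$ is the process with sample paths continuous from $\mathbb R_+$ to $\mathscr C^\theta$ for every $\theta<2-\frac d2$ such that for all $r\in\mathbb R_+$, $\varphi\in\mathscr S$, almost surely $\widetilde X_{r,1}(\varphi)=\int_{[0,r]\times\mathbb T^d}(\eta_{r-q}*\varphi)(x)\,\xi(\mathrm dq,\mathrm dx)$ (such a process exists). *)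

theory Defs
  imports "HOL-Probability.Probability"
begin

section \<open>Functions and distributions on the torus\<close>

text \<open>
  Functions on the torus are represented by functions on \<open>real ^ 'd\<close> that are periodic with
  respect to the integer lattice; integrals over the torus are integrals over the
  fundamental domain \<open>[0,1[\<^sup>d\<close>. Space-time functions on \<open>[0,\<infinity>[\<close> times the torus are only
  looked at on \<open>[0,\<infinity>[ \<times> [0,1[\<^sup>d\<close>.
\<close>

definition int_lattice :: "(real ^ 'd) set" where
  "int_lattice = {m. \<forall>i. m $ i \<in> \<int>}"

definition unit_cube :: "(real ^ 'd) set" where
  "unit_cube = {x. \<forall>i. 0 \<le> x $ i \<and> x $ i < 1}"

definition torus :: "(real ^ 'd) measure" where
  "torus = restrict_space lborel unit_cube"

definition periodic :: "(real ^ 'd \<Rightarrow> real) \<Rightarrow> bool" where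
  "periodic u \<longleftrightarrow> (\<forall>x. \<forall>m\<in>int_lattice. u (x + m) = u x)"

definition pderivative :: "'d \<Rightarrow> (real ^ 'd \<Rightarrow> real) \<Rightarrow> real ^ 'd \<Rightarrow> real" where
  "pderivative i u = (\<lambda>x. frechet_derivative u (at x) (axis i 1))"

definition smooth :: "(real ^ 'd \<Rightarrow> real) \<Rightarrow> bool" where
  "smooth u \<longleftrightarrow> (\<forall>is. foldr pderivative is u differentiable_on UNIV)"

definition laplacian :: "(real ^ 'd \<Rightarrow> real) \<Rightarrow> real ^ 'd \<Rightarrow> real" where
  "laplacian u = (\<lambda>x. \<Sum>i\<in>UNIV. pderivative i (pderivative i u) x)"

definition test_funs :: "(real ^ 'd \<Rightarrow> real) set" where
  "test_funs = {\<phi>. smooth \<phi> \<and> periodic \<phi>}"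

text \<open>
  The Frechet topology: the balls of all seminorms \<open>sup \<bar>\<partial>\<^sup>a \<phi>\<bar>\<close> form a subbase.
\<close>

definition test_topology :: "(real ^ 'd \<Rightarrow> real) topology" where
  "test_topology = topology_generated_by
     {{\<psi> \<in> test_funs. (SUP x. \<bar>foldr pderivative is \<psi> x - foldr pderivative is \<phi> x\<bar>) < \<epsilon>}
       | is \<phi> \<epsilon>. \<phi> \<in> test_funs \<and> \<epsilon> > 0}"

type_synonym 'd functional = "(real ^ 'd \<Rightarrow> real) \<Rightarrow> real"

text \<open>
  A distribution is extended by \<open>0\<close> outside the test functions, so that equality of functionals
  is equality of distributions.
\<close>

definition distributions :: "'d::finite functional set" where
  "distributions = {f.
     (\<forall>\<phi>. \<phi> \<notin> test_funs \<longrightarrow> f \<phi> = 0) \<and>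
     (\<forall>\<phi>\<in>test_funs. \<forall>\<psi>\<in>test_funs. \<forall>a b.
        f (\<lambda>x. a * \<phi> x + b * \<psi> x) = a * f \<phi> + b * f \<psi>) \<and>
     continuous_map test_topology euclideanreal f}"

definition dist_of :: "(real ^ 'd \<Rightarrow> real) \<Rightarrow> 'd::finite functional" where
  "dist_of u = (\<lambda>\<phi>. if \<phi> \<in> test_funs then LINT x|torus. u x * \<phi> x else 0)"

text \<open>The continuous function that a distribution is, if there is one.\<close>

definition fun_of :: "'d::finite functional \<Rightarrow> real ^ 'd \<Rightarrow> real" where
  "fun_of f = (THE u. continuous_on UNIV u \<and> periodic u \<and> f = dist_of u)"

definition convolve :: "(real ^ 'd \<Rightarrow> real) \<Rightarrow> 'd::finite functional \<Rightarrow> real ^ 'd \<Rightarrow> real" where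
  "convolve \<phi> f = (\<lambda>x. f (\<lambda>y. \<phi> (y - x)))"

definition dist_laplacian :: "'d::finite functional \<Rightarrow> 'd functional" where
  "dist_laplacian f = (\<lambda>\<phi>. if \<phi> \<in> test_funs then f (laplacian \<phi>) else 0)"


section \<open>Besov spaces\<close>

text \<open>The family \<open>\<rho>\<close> is indexed by the integers \<open>j \<ge> -1\<close>.\<close>

definition dyadic_partition :: "(int \<Rightarrow> real ^ 'd \<Rightarrow> real) \<Rightarrow> bool" where
  "dyadic_partition \<rho> \<longleftrightarrow>
     (\<forall>j\<in>{-1, 0}. smooth (\<rho> j) \<and> (\<forall>x. 0 \<le> \<rho> j x) \<and>
        (\<forall>x y. norm x = norm y \<longrightarrow> \<rho> j x = \<rho> j y)) \<and>
     closure {y. \<rho> (-1) y \<noteq> 0} \<subseteq> {y. norm y \<le> 4/3} \<and>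
     closure {y. \<rho> 0 y \<noteq> 0} \<subseteq> {y. 3/4 \<le> norm y \<and> norm y \<le> 8/3} \<and>
     (\<forall>x. \<rho> (-1) x + (\<Sum>q::nat. \<rho> 0 ((1 / 2 ^ q) *\<^sub>R x)) = 1) \<and>
     (\<forall>q::nat. q \<ge> 1 \<longrightarrow> \<rho> (int q) = (\<lambda>x. \<rho> 0 ((1 / 2 ^ q) *\<^sub>R x)))"

definition LP_kernel :: "(int \<Rightarrow> real ^ 'd \<Rightarrow> real) \<Rightarrow> int \<Rightarrow> real ^ 'd \<Rightarrow> real" where
  "LP_kernel \<rho> j = (\<lambda>x. \<Sum>\<^sub>\<infinity>m\<in>int_lattice. \<rho> j m * cos (2 * pi * (x \<bullet> m)))"

definition LP_block ::
    "(int \<Rightarrow> real ^ 'd \<Rightarrow> real) \<Rightarrow> int \<Rightarrow> 'd::finite functional \<Rightarrow> real ^ 'd \<Rightarrow> real" where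
  "LP_block \<rho> j f = convolve (LP_kernel \<rho> j) f"

definition Linf_norm :: "(real ^ 'd \<Rightarrow> real) \<Rightarrow> ennreal" where
  "Linf_norm u = esssup torus (\<lambda>x. ennreal \<bar>u x\<bar>)"

definition besov_norm ::
    "(int \<Rightarrow> real ^ 'd \<Rightarrow> real) \<Rightarrow> real \<Rightarrow> 'd::finite functional \<Rightarrow> ennreal" where
  "besov_norm \<rho> \<alpha> f =
     (SUP j\<in>{-1..}. ennreal (2 powr (\<alpha> * of_int j)) * Linf_norm (LP_block \<rho> j f))"

definition besov_space ::
    "(int \<Rightarrow> real ^ 'd \<Rightarrow> real) \<Rightarrow> real \<Rightarrow> 'd::finite functional set" where
  "besov_space \<rho> \<alpha> = {f \<in> distributions.
     (\<lambda>n. ennreal (2 powr (\<alpha> * real n)) * Linf_norm (LP_block \<rho> (int n) f)) \<longlonglongrightarrow> 0}"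

definition besov_topology ::
    "(int \<Rightarrow> real ^ 'd \<Rightarrow> real) \<Rightarrow> real \<Rightarrow> 'd::finite functional topology" where
  "besov_topology \<rho> \<alpha> = Metric_space.mtopology (besov_space \<rho> \<alpha>)
     (\<lambda>f g. enn2real (besov_norm \<rho> \<alpha> (\<lambda>\<phi>. f \<phi> - g \<phi>)))"

definition besov_borel ::
    "(int \<Rightarrow> real ^ 'd \<Rightarrow> real) \<Rightarrow> real \<Rightarrow> 'd::finite functional measure" where
  "besov_borel \<rho> \<alpha> =
     sigma (topspace (besov_topology \<rho> \<alpha>)) {A. openin (besov_topology \<rho> \<alpha>) A}"


section \<open>The biharmonic semigroup\<close>

definition biharmonic_kernel :: "real \<Rightarrow> real ^ 'd \<Rightarrow> real" where
  "biharmonic_kernel r =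
     (\<lambda>x. \<Sum>\<^sub>\<infinity>q\<in>int_lattice. cos (2 * pi * (x \<bullet> q)) * exp (- r * norm ((2 * pi) *\<^sub>R q) ^ 4))"

definition biharmonic_semigroup :: "real \<Rightarrow> 'd::finite functional \<Rightarrow> 'd functional" where
  "biharmonic_semigroup r f =
     (if r = 0 then f else dist_of (convolve (biharmonic_kernel r) f))"


section \<open>White noise and its filtration\<close>

definition spacetime :: "(real \<times> (real ^ 'd)) measure" where
  "spacetime = restrict_space lborel ({0..} \<times> unit_cube)"

definition L2_spacetime :: "(real \<times> (real ^ 'd) \<Rightarrow> real) set" where
  "L2_spacetime =
     {\<phi> \<in> borel_measurable spacetime. integrable spacetime (\<lambda>z. (\<phi> z)\<^sup>2)}"

text \<open>The point mass at \<open>0\<close> counts as a normal distribution.\<close>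

definition centred_normal :: "'a measure \<Rightarrow> ('a \<Rightarrow> real) \<Rightarrow> bool" where
  "centred_normal M Y \<longleftrightarrow> Y \<in> borel_measurable M \<and>
     ((AE \<omega> in M. Y \<omega> = 0) \<or> (\<exists>\<sigma>>0. distributed M lborel Y (normal_density 0 \<sigma>)))"

text \<open>
  The noise is indexed by square integrable functions rather than by their classes; linearity, and
  with it independence of the representative, holds almost surely.
\<close>

definition white_noise ::
    "'a measure \<Rightarrow> ((real \<times> (real ^ 'd) \<Rightarrow> real) \<Rightarrow> 'a \<Rightarrow> real) \<Rightarrow> bool" where
  "white_noise M \<xi> \<longleftrightarrow>
     (\<forall>\<phi>\<in>L2_spacetime. centred_normal M (\<xi> \<phi>) \<and>
        (LINT \<omega>|M. (\<xi> \<phi> \<omega>)\<^sup>2) = (LINT z|spacetime. (\<phi> z)\<^sup>2)) \<and>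
     (\<forall>\<phi>\<in>L2_spacetime. \<forall>\<psi>\<in>L2_spacetime. \<forall>a b.
        AE \<omega> in M. \<xi> (\<lambda>z. a * \<phi> z + b * \<psi> z) \<omega> = a * \<xi> \<phi> \<omega> + b * \<xi> \<psi> \<omega>)"

definition noise_events ::
    "'a measure \<Rightarrow> ((real \<times> (real ^ 'd) \<Rightarrow> real) \<Rightarrow> 'a \<Rightarrow> real) \<Rightarrow> real \<Rightarrow> 'a set set" where
  "noise_events M \<xi> q = sigma_sets (space M)
     (null_sets M \<union>
      {\<xi> \<phi> -` B \<inter> space M | \<phi> B. \<phi> \<in> L2_spacetime \<and>
         (AE z in spacetime. q < fst z \<longrightarrow> \<phi> z = 0) \<and> B \<in> sets borel})"

text \<open>
  The time index is \<open>ennreal\<close> so that stopping times may take the value \<open>\<infinity>\<close>. At a finite time the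
  intersection with \<open>sets M\<close> changes nothing; at \<open>\<infinity>\<close> it makes the filtration end with \<open>sets M\<close>.
\<close>

definition noise_filtration ::
    "'a measure \<Rightarrow> ((real \<times> (real ^ 'd) \<Rightarrow> real) \<Rightarrow> 'a \<Rightarrow> real) \<Rightarrow> ennreal \<Rightarrow> 'a measure" where
  "noise_filtration M \<xi> r =
     sigma (space M) (sets M \<inter> (\<Inter>q\<in>{q. 0 \<le> q \<and> r < ennreal q}. noise_events M \<xi> q))"

text \<open>
  Processes with lifetime \<open>\<tau>\<close>, adapted to \<open>F\<close>: the variable at time \<open>r\<close> lives on \<open>{r < \<tau>}\<close>. With
  a constant \<open>F\<close> adaptedness is just measurability.
\<close>

definition besov_process ::
    "(int \<Rightarrow> real ^ 'd \<Rightarrow> real) \<Rightarrow> real \<Rightarrow> (ennreal \<Rightarrow> 'a measure) \<Rightarrow> ('a \<Rightarrow> ennreal) \<Rightarrow>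
     (real \<Rightarrow> 'a \<Rightarrow> 'd::finite functional) \<Rightarrow> bool" where
  "besov_process \<rho> \<theta> F \<tau> f \<longleftrightarrow>
     (\<forall>r\<ge>0. f r \<in> measurable
        (restrict_space (F (ennreal r)) {\<omega>. ennreal r < \<tau> \<omega>}) (besov_borel \<rho> \<theta>))"

text \<open>
  The integrand of the stochastic convolution tested against \<open>\<phi>\<close>, cut off outside \<open>[0,r]\<close>; the
  null set \<open>{r} \<times> [0,1[\<^sup>d\<close>, where the kernel is not defined, is left out.
\<close>

definition stoch_conv_integrand ::
    "real \<Rightarrow> (real ^ 'd \<Rightarrow> real) \<Rightarrow> real \<times> (real ^ 'd::finite) \<Rightarrow> real" where
  "stoch_conv_integrand r \<phi> = (\<lambda>(q, x).
     if 0 \<le> q \<and> q < r then convolve (biharmonic_kernel (r - q)) (dist_of \<phi>) x else 0)"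

definition stochastic_convolution ::
    "(int \<Rightarrow> real ^ 'd \<Rightarrow> real) \<Rightarrow> 'a measure \<Rightarrow> ((real \<times> (real ^ 'd) \<Rightarrow> real) \<Rightarrow> 'a \<Rightarrow> real) \<Rightarrow>
     (real \<Rightarrow> 'a \<Rightarrow> 'd::finite functional) \<Rightarrow> bool" where
  "stochastic_convolution \<rho> M \<xi> X \<longleftrightarrow>
     (\<forall>\<theta> < 2 - real CARD('d) / 2.
        besov_process \<rho> \<theta> (noise_filtration M \<xi>) (\<lambda>_. \<infinity>) X \<and>
        (\<forall>\<omega>\<in>space M. continuous_map (top_of_set {0..}) (besov_topology \<rho> \<theta>) (\<lambda>r. X r \<omega>))) \<and>
     (\<forall>r\<ge>0. \<forall>\<phi>\<in>test_funs. AE \<omega> in M. X r \<omega> \<phi> = \<xi> (stoch_conv_integrand r \<phi>) \<omega>)"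


section \<open>Maximal mild solutions\<close>

definition cubic_drift :: "'d::finite functional \<Rightarrow> 'd functional" where
  "cubic_drift f = dist_laplacian (dist_of (\<lambda>x. fun_of f x ^ 3 - fun_of f x))"

text \<open>
  The path-wise requirements, for a forcing path \<open>Y\<close> and a lifetime \<open>T\<close>. The time integral is the
  weak-star integral of distributions: it is taken after testing against an arbitrary \<open>\<phi>\<close>.
\<close>

definition maximal_mild_solution ::
    "(int \<Rightarrow> real ^ 'd \<Rightarrow> real) \<Rightarrow> real \<Rightarrow> 'd functional \<Rightarrow> (real \<Rightarrow> 'd functional) \<Rightarrow> ennreal \<Rightarrow>
     (real \<Rightarrow> 'd::finite functional) \<Rightarrow> bool" where
  "maximal_mild_solution \<rho> \<alpha> g Y T u \<longleftrightarrow>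
     continuous_map (top_of_set {r. 0 \<le> r \<and> ennreal r < T}) (besov_topology \<rho> \<alpha>) u \<and>
     (\<forall>U. 0 \<le> U \<and> ennreal U < T \<longrightarrow> (\<forall>\<phi>\<in>test_funs.
        set_integrable lborel {0..U} (\<lambda>q. biharmonic_semigroup (U - q) (cubic_drift (u q)) \<phi>) \<and>
        u U \<phi> = biharmonic_semigroup U g \<phi> + Y U \<phi> +
          (LINT q:{0..U}|lborel. biharmonic_semigroup (U - q) (cubic_drift (u q)) \<phi>))) \<and>
     (T < \<infinity> \<longrightarrow> Limsup (at_left (enn2real T)) (\<lambda>q. besov_norm \<rho> \<alpha> (u q)) = \<infinity>)"

end

theory Submission
  imports Defs
begin

text \<open>
  On the Fourier side the drift of a continuous function \<open>w\<close> is \<open>- lam m\<close> times the integral of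
  \<open>exp (- (t - s) (lam m)\<^sup>2)\<close> times the coefficient of \<open>w s\<close>. By Parseval it is bounded in \<open>L\<^sup>2\<close> by the
  \<open>L\<^sup>2\<close> norm of \<open>w\<close> in space-time, and its dyadic blocks are small in the supremum norm as soon as
  \<open>\<alpha> < 2 - d/2\<close>. With the cubic truncated to \<open>[-n, n]\<close> the nonlinearity is bounded and Lipschitz, so Picard
  iteration converges globally, first in \<open>L\<^sup>2\<close> and then, by the block estimate, uniformly. The
  truncated solutions agree as long as they stay below their truncation level, and the lifetime is the
  supremum of these times. A bounded Besov norm near a finite lifetime would bound the solution
  uniformly, so that one truncation level would do up to and beyond the lifetime. Measurability is inherited
  by the Picard iterates and then by the limits, since all functionals involved are determined by countably
  many point evaluations.
\<close>

section \<open>Lattice sums\<close>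

text \<open>The initial value is the term that the \<open>L\<^sup>2\<close> estimates do not reach:
  \<open>g\<close> has the regularity \<alpha> and none to spare, so the semigroup has to be bounded
  on every dyadic block in the supremum norm, uniformly in time. A fourth order semigroup has no
  positive kernel, hence no maximum principle. Its kernel is controlled by a weighted Cauchy-Schwarz
  inequality instead. The weight is a trigonometric polynomial, so that multiplication by it is a
  finite difference of Fourier coefficients, and its reciprocal has an \<open>L\<^sup>2\<close> norm
  of the right order because \<open>d <= 3\<close>. For the drift each mode is estimated separately:
  the factor \<open>lam m\<close> is paid for by the mass \<open>1 / (lam m)\<^sup>2\<close> of the
  exponential weight in time. The probabilistic input is a continuous adapted path \<open>X\<close>;
  existence, uniqueness and blow-up are proved for one fixed sample path at a time. The lifetime
  comes from a closed condition on the truncated solutions, which makes survival up to a time an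
  event of the past of that time.\<close>

text \<open>Compared with a telescoping sum: \<open>(N + k) ^ 2 / 2 <= N ^ 2 + k ^ 2\<close>, and
  \<open>1 / (N + k) ^ 2\<close> is at most the difference of the reciprocals of
  \<open>N + k - 1\<close> and \<open>N + k\<close>. The two signs of \<open>k\<close> together give
  \<open>4 * N\<close>, the term \<open>k = 0\<close> gives \<open>1\<close>.\<close>

lemma sum_int_inverse_quadratic_le:
  fixes N :: real assumes "N \<ge> 1"
  shows "(\<Sum>k\<in>{-int n..int n}. 1 / (1 + (real_of_int k / N)\<^sup>2)) \<le> 5 * N"
proof -
  have "(\<Sum>k\<in>{-int n..int n}. 1 / (1 + (real_of_int k / N)\<^sup>2)) \<le> 1 + 4 * N\<^sup>2 * (1 / N - 1 / (N + n))"
  proof (induction n)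
    case 0 then show ?case by simp
  next
    case (Suc n)
    have eq: "{-int (Suc n)..int (Suc n)} = insert (-int (Suc n)) (insert (int (Suc n)) {-int n..int n})" by auto
    let ?k = "real (Suc n)"
    have p: "N + ?k > 0" "N + n > 0" using assms by auto
    have "1 / (1 + (?k / N)\<^sup>2) = N\<^sup>2 / (N\<^sup>2 + ?k\<^sup>2)" using assms by (simp add: field_simps)
    also have "\<dots> \<le> N\<^sup>2 / ((N + ?k)\<^sup>2 / 2)"
    proof (rule divide_left_mono)
      have "0 \<le> (N - ?k)\<^sup>2" by simp
      then show "(N + ?k)\<^sup>2 / 2 \<le> N\<^sup>2 + ?k\<^sup>2" by (simp add: power2_eq_square algebra_simps)
      show "0 < (N\<^sup>2 + ?k\<^sup>2) * ((N + ?k)\<^sup>2 / 2)" using assms p by (simp add: add_pos_nonneg)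
    qed simp
    also have "\<dots> = 2 * N\<^sup>2 * (1 / (N + ?k)\<^sup>2)" by simp
    also have "\<dots> \<le> 2 * N\<^sup>2 * (1 / (N + n) - 1 / (N + ?k))"
    proof (rule mult_left_mono)
      have "1 / (N + ?k)\<^sup>2 \<le> 1 / ((N + n) * (N + ?k))"
        using p by (intro divide_left_mono) (auto simp: power2_eq_square intro!: mult_mono)
      also have "\<dots> = 1 / (N + n) - 1 / (N + ?k)" using p by (simp add: field_simps)
      finally show "1 / (N + ?k)\<^sup>2 \<le> 1 / (N + n) - 1 / (N + ?k)" .
    qed simp
    finally have b: "1 / (1 + (?k / N)\<^sup>2) \<le> 2 * N\<^sup>2 * (1 / (N + n) - 1 / (N + ?k))" .
    define f where "f k = 1 / (1 + (real_of_int k / N)\<^sup>2)" for k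
    have fk: "f (int (Suc n)) = 1 / (1 + (?k / N)\<^sup>2)" "f (- int (Suc n)) = 1 / (1 + (?k / N)\<^sup>2)"
      unfolding f_def by (simp_all only: of_int_minus minus_divide_left[symmetric] power2_minus of_int_of_nat_eq)
    have "sum f {-int (Suc n)..int (Suc n)} = f (- int (Suc n)) + (f (int (Suc n)) + sum f {-int n..int n})" 
      unfolding eq by (subst sum.insert, simp, simp, subst sum.insert) auto
    also have "\<dots> = 2 * (1 / (1 + (?k / N)\<^sup>2)) + sum f {-int n..int n}" unfolding fk by simp
    also have "\<dots> \<le> 1 + 4 * N\<^sup>2 * (1 / N - 1 / (N + Suc n))"
    proof -
      have "4 * N\<^sup>2 * (1 / N - 1 / (N + Suc n)) = 4 * N\<^sup>2 * (1 / N - 1 / (N + n)) + 2 * (2 * N\<^sup>2 * (1 / (N + n) - 1 / (N + ?k)))"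
        by (simp add: right_diff_distrib)
      then show ?thesis using Suc b unfolding f_def by linarith
    qed
    finally show ?case unfolding f_def .
  qed
  also have "\<dots> \<le> 1 + 4 * N\<^sup>2 * (1 / N)" using assms by (intro add_left_mono mult_left_mono) auto
  also have "\<dots> = 1 + 4 * N" using assms by (simp add: power2_eq_square)
  finally show ?thesis using assms by linarith
qed

text \<open>A product over the coordinates, so that its sum over a box factors into one-dimensional
  sums. It dominates \<open>(1 + m \<bullet> m / N ^ 2) ^ (- d)\<close>, the expression with which
  summands are compared later.\<close>

definition lattice_weight :: "real \<Rightarrow> real ^ 'd \<Rightarrow> real" where
  "lattice_weight N m = (\<Prod>i\<in>UNIV. 1 / (1 + (m $ i / N)\<^sup>2))"

lemma lattice_weight_pos: "lattice_weight N m > 0"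
  unfolding lattice_weight_def by (intro prod_pos) (auto simp: add_pos_nonneg)

text \<open>On the lattice the coordinates equal their floors, so \<open>F\<close> embeds into a box
  of integer-valued functions; there the sum of products is the product of the one-dimensional
  sums.\<close>

lemma sum_lattice_weight_le:
  fixes F :: "(real ^ 'd::finite) set"
  assumes "N \<ge> 1" "finite F" "F \<subseteq> int_lattice"
  shows "(\<Sum>m\<in>F. lattice_weight N m) \<le> (5 * N) ^ CARD('d)"
proof -
  \<comment> \<open>The inserted \<open>0\<close> keeps the maximum meaningful for empty
    \<open>F\<close>.\<close>
  define n where "n = nat \<lceil>Max (insert 0 ((\<lambda>(m,i). \<bar>m $ i\<bar>) ` (F \<times> UNIV)))\<rceil>"
  have n: "\<bar>m $ i\<bar> \<le> real n" if "m \<in> F" for m i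
  proof -
    have "\<bar>m $ i\<bar> \<le> Max (insert 0 ((\<lambda>(m,i). \<bar>m $ i\<bar>) ` (F \<times> UNIV)))"
      using that assms by (intro Max_ge) auto
    then show ?thesis unfolding n_def by linarith
  qed
  let ?g = "\<lambda>m i. \<lfloor>m $ i\<rfloor> :: int"
  have int: "real_of_int (?g m i) = m $ i" if "m \<in> F" for m i
    using that assms(3) unfolding int_lattice_def by (auto simp: subset_iff floor_of_int elim!: Ints_cases allE[of _ m] allE[of _ i])
  have inj: "inj_on ?g F"
    by (rule inj_onI) (metis int vec_eq_iff)
  have sub: "?g ` F \<subseteq> PiE UNIV (\<lambda>_. {-int n..int n})"
  proof -
    have "- int n \<le> ?g m i \<and> ?g m i \<le> int n" if "m \<in> F" for m i
      using n[OF that, of i] int[OF that, of i] by linarith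
    then show ?thesis by auto
  qed
  have "(\<Sum>m\<in>F. lattice_weight N m) = (\<Sum>m\<in>F. \<Prod>i\<in>UNIV. 1 / (1 + (real_of_int (?g m i) / N)\<^sup>2))"
    unfolding lattice_weight_def by (intro sum.cong prod.cong refl) (simp only: int)
  also have "\<dots> = (\<Sum>h\<in>?g ` F. \<Prod>i\<in>UNIV. 1 / (1 + (real_of_int (h i) / N)\<^sup>2))"
    using inj by (simp add: sum.reindex)
  also have "\<dots> \<le> (\<Sum>h\<in>PiE UNIV (\<lambda>_. {-int n..int n}). \<Prod>i\<in>(UNIV :: 'd set). 1 / (1 + (real_of_int (h i) / N)\<^sup>2))"
    by (intro sum_mono2 sub finite_PiE prod_nonneg) (auto simp: add_nonneg_nonneg)
  also have "\<dots> = (\<Prod>i\<in>(UNIV :: 'd set). \<Sum>k\<in>{-int n..int n}. 1 / (1 + (real_of_int k / N)\<^sup>2))"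
    by (rule prod_sum_PiE[symmetric]) auto
  also have "\<dots> \<le> (\<Prod>i\<in>(UNIV :: 'd set). 5 * N)"
    by (intro prod_mono conjI sum_int_inverse_quadratic_le assms sum_nonneg) (auto simp: add_nonneg_nonneg)
  finally show ?thesis by simp
qed

lemma lattice_weight_summable:
  assumes "N \<ge> 1"
  shows "lattice_weight N summable_on (int_lattice :: (real ^ 'd::finite) set)"
  using sum_lattice_weight_le[OF assms] 
  by (intro nonneg_bdd_above_summable_on bdd_aboveI2[where M="(5 * N) ^ CARD('d)"])
     (auto simp: lattice_weight_pos less_imp_le)

lemma component_sq_le_inner: "(m $ i)\<^sup>2 \<le> m \<bullet> (m :: real ^ 'd::finite)"
  unfolding inner_vec_def by (simp add: power2_eq_square) (rule member_le_sum, auto)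

text \<open>On the ball of radius \<open>R\<close> every factor of \<open>lattice_weight R\<close>
  is at least \<open>1/2\<close>, so counting costs \<open>2 ^ d\<close> over the sum of the weight:
  \<open>10 = 2 * 5\<close>. The count is made for arbitrary finite subsets, which yields finiteness
  as well.\<close>

lemma lattice_ball:
  fixes R :: real assumes "R \<ge> 1"
  shows finite_lattice_ball': "finite {m \<in> int_lattice. norm (m :: real ^ 'd::finite) \<le> R}"
    and card_lattice_ball: "real (card {m \<in> int_lattice. norm (m :: real ^ 'd) \<le> R}) \<le> (10 * R) ^ CARD('d)"
proof -
  let ?B = "{m \<in> int_lattice. norm (m :: real ^ 'd) \<le> R}"
  have w: "(1/2) ^ CARD('d) \<le> lattice_weight R m" if "norm m \<le> R" for m :: "real ^ 'd"
  proof -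
    have "(1/2) ^ CARD('d) = (\<Prod>i\<in>(UNIV :: 'd set). 1/2 :: real)" by simp
    also have "\<dots> \<le> lattice_weight R m" unfolding lattice_weight_def
    proof (intro prod_mono conjI)
      fix i :: 'd
      have "\<bar>m $ i\<bar> \<le> R" using component_le_norm_cart[of m i] that by linarith
      then have "\<bar>m $ i / R\<bar> \<le> 1" using assms by (simp add: divide_simps)
      then have "(m $ i / R)\<^sup>2 \<le> 1" by (simp add: abs_square_le_1)
      then show "1/2 \<le> 1 / (1 + (m $ i / R)\<^sup>2)" by (simp add: field_simps add_pos_nonneg)
    qed simp
    finally show ?thesis .
  qed
  have c: "real (card F) \<le> (10 * R) ^ CARD('d)" if "F \<subseteq> ?B" "finite F" for F
  proof -
    have "real (card F) * (1/2) ^ CARD('d) = (\<Sum>m\<in>F. (1/2) ^ CARD('d))" by simp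
    also have "\<dots> \<le> (\<Sum>m\<in>F. lattice_weight R m)" using that w by (intro sum_mono) auto
    also have "\<dots> \<le> (5 * R) ^ CARD('d)" using that assms by (intro sum_lattice_weight_le) auto
    finally have "real (card F) \<le> 2 ^ CARD('d) * (5 * R) ^ CARD('d)" by (simp add: field_simps)
    also have "\<dots> = (10 * R) ^ CARD('d)" by (simp only: power_mult_distrib[symmetric]) simp
    finally show ?thesis .
  qed
  obtain K :: nat where K: "(10 * R) ^ CARD('d) \<le> real K" using real_arch_simple by blast
  have "card F \<le> K" if "F \<subseteq> ?B" "finite F" for F
    using order_trans[OF c[OF that] K] by simp
  then show fin: "finite ?B" using conjunct1[OF finite_if_finite_subsets_card_bdd[of ?B K]] by simp
  show "real (card ?B) \<le> (10 * R) ^ CARD('d)" by (rule c[OF subset_refl fin])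
qed

lemma finite_lattice_ball: "finite {m \<in> int_lattice. norm (m :: real ^ 'd::finite) \<le> R}"
  by (rule finite_subset[OF _ finite_lattice_ball'[of "max 1 R"]]) auto

lemma inverse_power_le_lattice_weight:
  "1 / (1 + m \<bullet> m) ^ CARD('d) \<le> lattice_weight 1 (m :: real ^ 'd::finite)"
proof -
  have "1 / (1 + m \<bullet> m) ^ CARD('d) = (\<Prod>i\<in>(UNIV :: 'd set). 1 / (1 + m \<bullet> m))"
    by (simp add: power_one_over)
  also have "\<dots> \<le> lattice_weight 1 m" unfolding lattice_weight_def
    by (intro prod_mono conjI divide_left_mono) (auto simp: component_sq_le_inner add_pos_nonneg intro!: mult_pos_pos)
  finally show ?thesis .
qed

lemma inverse_power_summable:
  "(\<lambda>m. 1 / (1 + m \<bullet> m) ^ CARD('d)) summable_on (int_lattice :: (real ^ 'd::finite) set)"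
  by (rule summable_on_comparison_test[OF lattice_weight_summable[of 1]])
     (auto simp: inverse_power_le_lattice_weight)

lemma int_lattice_0 [simp]: "0 \<in> int_lattice"
  by (simp add: int_lattice_def)

lemma int_lattice_add [intro]: "x \<in> int_lattice \<Longrightarrow> y \<in> int_lattice \<Longrightarrow> x + y \<in> int_lattice"
  by (simp add: int_lattice_def)

lemma int_lattice_diff [intro]: "x \<in> int_lattice \<Longrightarrow> y \<in> int_lattice \<Longrightarrow> x - y \<in> int_lattice"
  by (simp add: int_lattice_def)

lemma int_lattice_minus_iff [simp]: "- x \<in> int_lattice \<longleftrightarrow> x \<in> int_lattice"
  by (auto simp: int_lattice_def minus_in_Ints_iff)

lemma int_lattice_axis [simp]: "axis i 1 \<in> int_lattice"
  by (auto simp: int_lattice_def axis_def)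

lemma int_lattice_inner: "x \<in> int_lattice \<Longrightarrow> y \<in> int_lattice \<Longrightarrow> x \<bullet> y \<in> \<int>"
  by (auto simp: int_lattice_def inner_vec_def intro!: Ints_sum)

lemma int_lattice_norm_ge_1:
  assumes "m \<in> int_lattice" "m \<noteq> 0" shows "norm (m :: real ^ 'd::finite) \<ge> 1"
proof -
  obtain i where i: "m $ i \<noteq> 0" using assms by (auto simp: vec_eq_iff)
  have "m $ i \<in> \<int>" using assms by (simp add: int_lattice_def)
  then have "\<bar>m $ i\<bar> \<ge> 1" using i by (rule Ints_nonzero_abs_ge1)
  then show ?thesis using component_le_norm_cart[of m i] by linarith
qed

section \<open>Fourier coefficients on the torus\<close>

lemma unit_cube_bounds: "box 0 1 \<subseteq> unit_cube" "unit_cube \<subseteq> cbox 0 (1 :: real ^ 'd::finite)"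
  by (auto simp: unit_cube_def mem_box_cart less_imp_le)

lemma unit_cube_sets [measurable, simp]: "(unit_cube :: (real ^ 'd::finite) set) \<in> sets borel"
proof -
  have "unit_cube = (\<Inter>i. {x :: real ^ 'd. 0 \<le> x $ i} \<inter> {x. x $ i < 1})"
    by (auto simp: unit_cube_def)
  also have "\<dots> \<in> sets borel"
    by (intro sets.countable_INT'' sets.Int borel_closed borel_open closed_Collect_le open_Collect_less)
       (auto intro: continuous_intros)
  finally show ?thesis .
qed

lemma emeasure_unit_cube: "emeasure lborel (unit_cube :: (real ^ 'd::finite) set) = 1"
proof (rule antisym)
  have b: "(1 :: real ^ 'd) \<bullet> b = 1" if "b \<in> Basis" for b
    using that by (auto simp: Basis_vec_def inner_axis)
  have "emeasure lborel (unit_cube :: (real ^ 'd) set) \<le> emeasure lborel (cbox 0 (1 :: real ^ 'd))"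
    using unit_cube_bounds by (intro emeasure_mono) auto
  also have "\<dots> = 1" by (simp add: emeasure_lborel_cbox_eq b)
  finally show "emeasure lborel (unit_cube :: (real ^ 'd) set) \<le> 1" .
  have "1 = emeasure lborel (box 0 (1 :: real ^ 'd))" by (simp add: emeasure_lborel_box_eq b)
  also have "\<dots> \<le> emeasure lborel (unit_cube :: (real ^ 'd) set)"
    using unit_cube_bounds by (intro emeasure_mono) auto
  finally show "1 \<le> emeasure lborel (unit_cube :: (real ^ 'd) set)" .
qed

lemma space_torus: "space torus = unit_cube"
  by (simp add: torus_def space_restrict_space)

interpretation torus: prob_space "torus :: (real ^ 'd::finite) measure"
  by standard (simp add: space_torus, simp add: torus_def emeasure_restrict_space emeasure_unit_cube)

lemma torus_measurable_borel: "f \<in> borel_measurable borel \<Longrightarrow> f \<in> borel_measurable torus"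
  unfolding torus_def by (intro measurable_restrict_space1) simp

lemma integrable_torus_bounded:
  fixes f :: "real ^ 'd::finite \<Rightarrow> 'b::{banach,second_countable_topology}"
  assumes "f \<in> borel_measurable borel" "\<And>x. x \<in> unit_cube \<Longrightarrow> norm (f x) \<le> B"
  shows "integrable torus f"
  using assms by (intro torus.integrable_const_bound[where B=B] torus_measurable_borel AE_I2) (auto simp: space_torus)

lemma continuous_bounded_unit_cube:
  fixes f :: "real ^ 'd::finite \<Rightarrow> 'b::real_normed_vector"
  assumes "continuous_on UNIV f"
  shows "\<exists>B. \<forall>x\<in>unit_cube. norm (f x) \<le> B"
proof -
  have "compact (f ` cbox 0 1)" using assms by (intro compact_continuous_image) (auto intro: continuous_on_subset)
  then have "bounded (f ` cbox 0 1)" by (rule compact_imp_bounded)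
  then obtain B where "\<forall>y\<in>f ` cbox 0 1. norm y \<le> B" unfolding bounded_iff by blast
  then show ?thesis using unit_cube_bounds(2) by blast
qed

lemma integrable_torus_continuous:
  fixes f :: "real ^ 'd::finite \<Rightarrow> 'b::{banach,second_countable_topology}"
  assumes "continuous_on UNIV f"
  shows "integrable torus f"
proof -
  obtain B where "\<And>x. x \<in> unit_cube \<Longrightarrow> norm (f x) \<le> B" using continuous_bounded_unit_cube[OF assms] by blast
  then show ?thesis using assms by (intro integrable_torus_bounded borel_measurable_continuous_onI)
qed

lemma norm_torus_integral_le:
  fixes f :: "real ^ 'd::finite \<Rightarrow> 'b::{banach,second_countable_topology}"
  assumes "continuous_on UNIV f" "\<And>x. norm (f x) \<le> B"
  shows "norm (LINT x|torus. f x) \<le> B"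
proof -
  have "norm (LINT x|torus. f x) \<le> (LINT x|torus. norm (f x))"
    by (rule integral_norm_bound)
  also have "\<dots> \<le> (LINT x|(torus :: (real ^ 'd) measure). B)"
    using assms by (intro integral_mono integrable_torus_continuous continuous_intros) auto
  also have "\<dots> = B" by (simp add: torus.prob_space)
  finally show ?thesis .
qed

definition torus_periodic :: "(real ^ 'd \<Rightarrow> 'b) \<Rightarrow> bool" where
  "torus_periodic u \<longleftrightarrow> (\<forall>x. \<forall>m\<in>int_lattice. u (x + m) = u x)"

lemma periodic_iff: "periodic u \<longleftrightarrow> torus_periodic u"
  by (simp add: periodic_def torus_periodic_def)

lemma torus_periodicD: "torus_periodic u \<Longrightarrow> m \<in> int_lattice \<Longrightarrow> u (x + m) = u x"
  by (simp add: torus_periodic_def)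

lemma torus_periodic_shift: "torus_periodic u \<Longrightarrow> torus_periodic (\<lambda>x. u (x + c))"
  by (simp add: torus_periodic_def) (metis add.assoc add.commute)

lemma unit_cube_representative:
  obtains m where "m \<in> int_lattice" "x + m \<in> (unit_cube :: (real ^ 'd::finite) set)"
proof
  show "(\<chi> i. - of_int \<lfloor>x $ i\<rfloor>) \<in> int_lattice" by (simp add: int_lattice_def)
  show "x + (\<chi> i. - of_int \<lfloor>x $ i\<rfloor>) \<in> unit_cube"
    by (auto simp: unit_cube_def) linarith
qed

text \<open>The shifted cube consists of the slab \<open>C1\<close> of the unit cube and of a piece
  that the lattice vector \<open>axis i 1\<close> carries onto the complementary slab
  \<open>C2\<close>. Both pieces are translates, so invariance of Lebesgue measure finishes.\<close>

lemma torus_integral_shift_axis: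
  fixes f :: "real ^ 'd::finite \<Rightarrow> 'b::{banach,second_countable_topology}"
  assumes c: "continuous_on UNIV f" and p: "torus_periodic f" and h: "0 \<le> h" "h < 1"
  shows "(LINT x|torus. f (x + h *\<^sub>R axis i 1)) = (LINT x|torus. f x)"
proof -
  have [measurable]: "f \<in> borel_measurable borel" using c by (rule borel_measurable_continuous_onI)
  obtain B where B: "\<And>x. x \<in> unit_cube \<Longrightarrow> norm (f x) \<le> B" using continuous_bounded_unit_cube[OF c] by blast
  let ?e = "axis i 1 :: real ^ 'd"
  define C1 where "C1 = unit_cube \<inter> {y :: real ^ 'd. h \<le> y $ i}"
  define C2 where "C2 = unit_cube \<inter> {y :: real ^ 'd. y $ i < h}"
  have cl: "{y :: real ^ 'd. h \<le> y $ i} \<in> sets borel" "{y :: real ^ 'd. y $ i < h} \<in> sets borel"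
    by (auto intro!: borel_closed borel_open closed_Collect_le open_Collect_less continuous_intros)
  then have [measurable]: "C1 \<in> sets borel" "C2 \<in> sets borel"
    unfolding C1_def C2_def by (auto intro!: sets.Int)
  define F1 where "F1 = (\<lambda>y. indicator C1 y *\<^sub>R f y)"
  define F2 where "F2 = (\<lambda>y. indicator C2 y *\<^sub>R f y)"
  have [measurable]: "F1 \<in> borel_measurable borel" "F2 \<in> borel_measurable borel"
    unfolding F1_def F2_def by measurable
  have int: "integrable lborel F1" "integrable lborel F2"
  proof -
    have "integrable lborel (\<lambda>x. indicator unit_cube x *\<^sub>R f x)"
      using integrable_torus_continuous[OF c] unfolding torus_def by (subst (asm) integrable_restrict_space) auto
    then show "integrable lborel F1" "integrable lborel F2"
      by (auto intro!: Bochner_Integration.integrable_bound[where f="\<lambda>x. indicator unit_cube x *\<^sub>R f x"]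
          simp: F1_def F2_def C1_def C2_def split: split_indicator)
  qed
  have tr: "integral\<^sup>L lborel (\<lambda>x. F (a + x)) = integral\<^sup>L lborel F"
    if [measurable]: "F \<in> borel_measurable borel" for F :: "real ^ 'd \<Rightarrow> 'b" and a
    using integral_distr[of "(+) a" lborel borel F] by (simp add: lborel_distr_plus)
  have tri: "integrable lborel (\<lambda>x. F (a + x))"
    if [measurable]: "F \<in> borel_measurable borel" and "integrable lborel F" for F :: "real ^ 'd \<Rightarrow> 'b" and a
    using integrable_distr_eq[of "(+) a" lborel borel F] that by (simp add: lborel_distr_plus)
  have eq: "indicator unit_cube x *\<^sub>R f (x + h *\<^sub>R ?e) = F1 (h *\<^sub>R ?e + x) + F2 ((h - 1) *\<^sub>R ?e + x)" for x
  proof -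
    have per: "f ((h - 1) *\<^sub>R ?e + x) = f (x + h *\<^sub>R ?e)"
      using torus_periodicD[OF p int_lattice_axis[of i], of "(h - 1) *\<^sub>R ?e + x"] by (simp add: algebra_simps)
    have comp: "(h *\<^sub>R ?e + x) $ j = (if j = i then h + x $ i else x $ j)"
      "((h - 1) *\<^sub>R ?e + x) $ j = (if j = i then h - 1 + x $ i else x $ j)" for j
      by (simp_all add: axis_def)
    have uc: "y \<in> unit_cube \<longleftrightarrow> (\<forall>j. j \<noteq> i \<longrightarrow> 0 \<le> y $ j \<and> y $ j < 1) \<and> 0 \<le> y $ i \<and> y $ i < 1" for y :: "real ^ 'd"
      unfolding unit_cube_def mem_Collect_eq by metis
    have m1: "h *\<^sub>R ?e + x \<in> C1 \<longleftrightarrow> x \<in> unit_cube \<and> h + x $ i < 1"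
      unfolding C1_def Int_iff mem_Collect_eq uc comp using h by auto
    have m2: "(h - 1) *\<^sub>R ?e + x \<in> C2 \<longleftrightarrow> x \<in> unit_cube \<and> h + x $ i \<ge> 1"
      unfolding C2_def Int_iff mem_Collect_eq uc comp using h by auto
    show ?thesis unfolding F1_def F2_def indicator_def m1 m2 per by (auto simp: add.commute)
  qed
  have eq2: "F1 y + F2 y = indicator unit_cube y *\<^sub>R f y" for y
    unfolding F1_def F2_def C1_def C2_def by (auto simp: indicator_def)
  have "(LINT x|torus. f (x + h *\<^sub>R ?e)) = integral\<^sup>L lborel (\<lambda>x. F1 (h *\<^sub>R ?e + x) + F2 ((h - 1) *\<^sub>R ?e + x))"
    unfolding torus_def by (subst integral_restrict_space) (auto simp: eq)
  also have "\<dots> = integral\<^sup>L lborel F1 + integral\<^sup>L lborel F2"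
    by (subst Bochner_Integration.integral_add) (auto intro!: tri int simp: tr)
  also have "\<dots> = integral\<^sup>L lborel (\<lambda>x. F1 x + F2 x)" using int by simp
  also have "\<dots> = (LINT x|torus. f x)"
    unfolding torus_def eq2 by (subst integral_restrict_space) auto
  finally show ?thesis .
qed

text \<open>Along one axis only the fractional part of the shift matters, by periodicity; the
  coordinates of \<open>a\<close> are then added one at a time.\<close>

lemma torus_integral_shift:
  fixes f :: "real ^ 'd::finite \<Rightarrow> 'b::{banach,second_countable_topology}"
  assumes c: "continuous_on UNIV f" and p: "torus_periodic f"
  shows "(LINT x|torus. f (x + a)) = (LINT x|torus. f x)"
proof -
  have ax: "(LINT x|torus. g (x + h *\<^sub>R axis i 1)) = (LINT x|torus. g x)"
    if g: "continuous_on UNIV g" "torus_periodic g" for g :: "real ^ 'd \<Rightarrow> 'b" and h i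
  proof -
    have "g (x + h *\<^sub>R axis i 1) = g (x + frac h *\<^sub>R axis i 1)" for x
    proof -
      have "of_int \<lfloor>h\<rfloor> *\<^sub>R axis i 1 \<in> (int_lattice :: (real ^ 'd) set)"
        by (auto simp: int_lattice_def axis_def)
      from torus_periodicD[OF g(2) this, of "x + frac h *\<^sub>R axis i 1"] show ?thesis
        by (simp add: frac_def algebra_simps)
    qed
    then show ?thesis using torus_integral_shift_axis[OF g, of "frac h" i] by (simp add: frac_lt_1)
  qed
  have "(LINT x|torus. f (x + (\<Sum>i\<in>A. (a $ i) *\<^sub>R axis i 1))) = (LINT x|torus. f x)" if "finite A" for A
    using that
  proof (induction A)
    case (insert i A)
    let ?s = "\<Sum>i\<in>A. (a $ i) *\<^sub>R axis i (1::real)"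
    have "(LINT x|torus. f (x + (\<Sum>i\<in>insert i A. (a $ i) *\<^sub>R axis i 1))) = (LINT x|torus. (\<lambda>x. f (x + ?s)) (x + (a $ i) *\<^sub>R axis i 1))"
      using insert by (simp add: add.assoc)
    also have "\<dots> = (LINT x|torus. f (x + ?s))"
      by (intro ax torus_periodic_shift p continuous_on_compose2[OF c]) (auto intro!: continuous_intros)
    finally show ?case using insert by simp
  qed simp
  from this[of UNIV] show ?thesis
    by (simp add: basis_expansion[of a, unfolded scalar_mult_eq_scaleR])
qed

section \<open>Characters of the torus, their orthogonality and Fourier coefficients\<close>

definition mode :: "real ^ 'd \<Rightarrow> real ^ 'd \<Rightarrow> complex" where
  "mode m x = cis (2 * pi * (m \<bullet> x))"

definition fourier :: "(real ^ 'd \<Rightarrow> real) \<Rightarrow> real ^ 'd \<Rightarrow> complex" where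
  "fourier u m = (LINT x|torus. of_real (u x) * cnj (mode m x))"

lemma continuous_mode [continuous_intros]:
  "continuous_on S g \<Longrightarrow> continuous_on S (\<lambda>x. mode m (g x))"
  unfolding mode_def by (auto intro!: continuous_intros)

lemma norm_mode [simp]: "cmod (mode m x) = 1" by (simp add: mode_def)

lemma mode_0 [simp]: "mode 0 x = 1" "mode m 0 = 1" by (simp_all add: mode_def)

lemma mode_add: "mode (m + n) x = mode m x * mode n x"
  by (simp add: mode_def cis_mult inner_add_left ring_distribs)

lemma mode_add_right: "mode m (x + y) = mode m x * mode m y"
  by (simp add: mode_def cis_mult inner_add_right ring_distribs)

lemma mode_minus: "mode (- m) x = cnj (mode m x)"
  by (simp add: mode_def cis_cnj)

lemma mode_diff_right: "mode m (x - y) = mode m x * cnj (mode m y)"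
  by (simp add: mode_def cis_cnj cis_mult inner_diff_right ring_distribs)

lemma mode_mult_cnj [simp]: "mode m x * cnj (mode m x) = 1" "cnj (mode m x) * mode m x = 1"
  by (simp_all add: mode_def cis_cnj cis_mult)

lemma mode_lattice: "m \<in> int_lattice \<Longrightarrow> n \<in> int_lattice \<Longrightarrow> mode m n = 1"
  using cis_multiple_2pi[OF int_lattice_inner, of m n] by (simp add: mode_def mult.commute mult.left_commute)

lemma mode_periodic: "m \<in> int_lattice \<Longrightarrow> torus_periodic (mode m)"
  by (simp add: torus_periodic_def mode_add_right mode_lattice)

text \<open>A shift by half a period along a coordinate with \<open>m $ i \<noteq> 0\<close> changes
  the sign of the mode but not its integral.\<close>

lemma torus_integral_mode:
  assumes "m \<in> int_lattice" "(m :: real ^ 'd::finite) \<noteq> 0"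
  shows "(LINT x|torus. mode m x) = 0"
proof -
  obtain i where i: "m $ i \<noteq> 0" using assms by (auto simp: vec_eq_iff)
  define a :: "real ^ 'd" where "a = (1 / (2 * m $ i)) *\<^sub>R axis i 1"
  have "m \<bullet> a = 1/2" using i by (simp add: a_def inner_axis)
  then have "2 * pi * (m \<bullet> a) = pi" by simp
  then have ma: "mode m a = -1" by (simp only: mode_def cis_pi)
  have "(LINT x|torus. mode m x) = (LINT x|torus. mode m (x + a))"
    by (rule torus_integral_shift[symmetric]) (auto intro!: continuous_intros mode_periodic assms)
  also have "\<dots> = - (LINT x|torus. mode m x)" by (simp add: mode_add_right ma)
  finally show ?thesis by simp
qed

lemma torus_integral_mode_mult:
  assumes "m \<in> int_lattice" "n \<in> int_lattice"
  shows "(LINT x|torus. mode (m :: real ^ 'd::finite) x * cnj (mode n x)) = (if m = n then 1 else 0)"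
proof -
  have e: "mode m x * cnj (mode n x) = mode (m - n) x" for x
    using mode_add[of m "-n" x] by (simp add: mode_minus)
  show ?thesis unfolding e using torus_integral_mode[of "m - n"] int_lattice_diff[OF assms] by (auto simp: torus.prob_space)
qed

lemma continuous_of_real_mult_mode:
  "continuous_on UNIV u \<Longrightarrow> continuous_on UNIV (\<lambda>x. of_real (u x) * cnj (mode m x))"
  by (auto intro!: continuous_intros)

lemma fourier_minus: "fourier u (- m) = cnj (fourier u m)"
  unfolding fourier_def by (subst Bochner_Integration.integral_cnj[symmetric]) (simp add: mode_minus)

lemma fourier_add:
  assumes "continuous_on UNIV u" "continuous_on UNIV v"
  shows "fourier (\<lambda>x. u x + v x) m = fourier u m + fourier v m"
  unfolding fourier_def of_real_add ring_distribs
  by (intro Bochner_Integration.integral_add integrable_torus_continuous continuous_of_real_mult_mode assms)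

lemma fourier_cmult: "fourier (\<lambda>x. c * u x) m = of_real c * fourier u m"
  unfolding fourier_def by (simp add: mult.assoc)

lemma fourier_diff:
  assumes "continuous_on UNIV u" "continuous_on UNIV v"
  shows "fourier (\<lambda>x. u x - v x) m = fourier u m - fourier v m"
  unfolding fourier_def of_real_diff left_diff_distrib
  by (intro Bochner_Integration.integral_diff integrable_torus_continuous continuous_of_real_mult_mode assms)

lemma fourier_bound:
  assumes "continuous_on UNIV u" "\<And>x. \<bar>u x\<bar> \<le> B"
  shows "cmod (fourier u m) \<le> B"
  unfolding fourier_def using assms by (intro norm_torus_integral_le continuous_of_real_mult_mode) (auto simp: norm_mult)

lemma fourier_shift:
  assumes "continuous_on UNIV u" "torus_periodic u" "m \<in> int_lattice"
  shows "fourier (\<lambda>y. u (y + x)) m = mode m x * fourier u m"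
proof -
  have "fourier u m = (LINT y|torus. of_real (u (y + x)) * cnj (mode m (y + x)))"
    unfolding fourier_def using assms mode_periodic[of m]
    by (intro torus_integral_shift[symmetric] continuous_of_real_mult_mode) (auto simp: torus_periodic_def)
  also have "\<dots> = (LINT y|torus. cnj (mode m x) * (of_real (u (y + x)) * cnj (mode m y)))"
    by (simp add: mode_add_right mult_ac)
  also have "\<dots> = cnj (mode m x) * fourier (\<lambda>y. u (y + x)) m"
    unfolding fourier_def by simp
  finally show ?thesis
    by (simp add: mult.assoc[symmetric])
qed

text \<open>The points of the open cube that violate the bound form an open null set, which is
  empty; continuity extends the bound to the closed cube.\<close>

lemma AE_torus_le_continuous:
  fixes f :: "real ^ 'd::finite \<Rightarrow> real"
  assumes c: "continuous_on UNIV f" and ae: "AE x in torus. f x \<le> B" and x: "x \<in> unit_cube"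
  shows "f x \<le> B"
proof -
  define V where "V = box 0 1 \<inter> {x. B < f x}"
  have "open V" unfolding V_def using c by (auto intro!: open_Int open_Collect_less)
  have "AE x in lborel. x \<in> unit_cube \<longrightarrow> f x \<le> B"
    using ae unfolding torus_def by (subst (asm) AE_restrict_space_iff) auto
  then have "AE x in lborel. x \<notin> V"
    by eventually_elim (use unit_cube_bounds(1) in \<open>auto simp: V_def\<close>)
  then have "V \<in> null_sets lborel" using \<open>open V\<close> by (subst (asm) AE_iff_null_sets[symmetric]) auto
  then have "negligible V" unfolding negligible_iff_null_sets by (rule null_sets_completionI)
  then have "V = {}" using open_not_negligible \<open>open V\<close> by blast
  then have s: "box 0 1 \<subseteq> {x. f x \<le> B}" by (auto simp: V_def not_less)
  have "box 0 (1 :: real ^ 'd) \<noteq> {}"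
    by (auto simp: box_ne_empty Basis_vec_def inner_axis)
  then have "cbox 0 1 = closure (box 0 (1 :: real ^ 'd))" by simp
  also have "\<dots> \<subseteq> {x. f x \<le> B}"
    using s c by (intro closure_minimal) (auto intro!: closed_Collect_le)
  finally show ?thesis using x unit_cube_bounds(2) by auto
qed

lemma torus_periodic_unit_cube:
  assumes "torus_periodic u" "\<And>x. x \<in> unit_cube \<Longrightarrow> P (u x)"
  shows "P (u (x :: real ^ 'd::finite))"
  using unit_cube_representative[of x] assms by (metis torus_periodicD)

lemma continuous_torus_bounded:
  fixes u :: "real ^ 'd::finite \<Rightarrow> 'b::real_normed_vector"
  assumes "continuous_on UNIV u" "torus_periodic u"
  shows "\<exists>B. \<forall>x. norm (u x) \<le> B"
proof -
  obtain B where B: "\<forall>x\<in>unit_cube. norm (u x) \<le> B" using continuous_bounded_unit_cube[OF assms(1)] by blast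
  then show ?thesis using torus_periodic_unit_cube[OF assms(2), of "\<lambda>y. norm y \<le> B"] by blast
qed

section \<open>Mean square approximation: Bessel, Stone-Weierstrass, Parseval\<close>

text \<open>Completing the square in the coefficients, after orthonormality has collapsed the double
  sum. The choice \<open>c = fourier u\<close> gives Bessel's inequality; a uniform approximation
  \<open>c\<close> gives the converse needed for Parseval.\<close>

lemma torus_l2_error:
  fixes u :: "real ^ 'd::finite \<Rightarrow> real"
  assumes u: "continuous_on UNIV u" and F: "finite F" "F \<subseteq> int_lattice"
  shows "(LINT x|torus. (cmod (of_real (u x) - (\<Sum>m\<in>F. c m * mode m x)))\<^sup>2) =
    (LINT x|torus. (u x)\<^sup>2) - (\<Sum>m\<in>F. (cmod (fourier u m))\<^sup>2) + (\<Sum>m\<in>F. (cmod (c m - fourier u m))\<^sup>2)"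
proof -
  let ?S = "\<lambda>x. \<Sum>m\<in>F. c m * mode m x"
  have i: "integrable torus f" if "continuous_on UNIV f" for f :: "real ^ 'd \<Rightarrow> complex"
    using that by (rule integrable_torus_continuous)
  have e: "of_real ((cmod (of_real (u x) - ?S x))\<^sup>2) = of_real ((u x)\<^sup>2)
      - (\<Sum>m\<in>F. cnj (c m) * (of_real (u x) * cnj (mode m x))) - (\<Sum>m\<in>F. c m * cnj (of_real (u x) * cnj (mode m x)))
      + (\<Sum>m\<in>F. \<Sum>n\<in>F. (c m * cnj (c n)) * (mode m x * cnj (mode n x)))" for x
  proof -
    have "(\<Sum>m\<in>F. \<Sum>n\<in>F. (c m * cnj (c n)) * (mode m x * cnj (mode n x))) = ?S x * cnj (?S x)"
      by (simp add: sum_product mult_ac)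
    moreover have "(\<Sum>m\<in>F. cnj (c m) * (of_real (u x) * cnj (mode m x))) = of_real (u x) * cnj (?S x)"
      by (simp add: sum_distrib_left mult_ac)
    moreover have "(\<Sum>m\<in>F. c m * cnj (of_real (u x) * cnj (mode m x))) = of_real (u x) * ?S x"
      by (simp add: sum_distrib_left mult_ac)
    ultimately show ?thesis
      by (simp only: complex_norm_square) (simp add: algebra_simps power2_eq_square)
  qed
  have "complex_of_real (LINT x|torus. (cmod (of_real (u x) - ?S x))\<^sup>2) = (LINT x|torus. of_real ((cmod (of_real (u x) - ?S x))\<^sup>2))"
    by (rule integral_complex_of_real[symmetric])
  also have "\<dots> = (LINT x|torus. of_real ((u x)\<^sup>2)) - (\<Sum>m\<in>F. cnj (c m) * fourier u m) - (\<Sum>m\<in>F. c m * cnj (fourier u m))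
      + (\<Sum>m\<in>F. \<Sum>n\<in>F. (c m * cnj (c n)) * (LINT x|torus. mode m x * cnj (mode n x)))"
    unfolding e
  proof (rule has_bochner_integral_integral_eq)
    have h: "has_bochner_integral torus f (integral\<^sup>L torus f)" if "continuous_on UNIV f" for f :: "real ^ 'd \<Rightarrow> complex"
      using i[OF that] by (rule has_bochner_integral_integrable)
    have "has_bochner_integral torus (\<lambda>x. of_real (u x) * cnj (mode m x)) (fourier u m)" for m
      unfolding fourier_def by (rule h) (intro continuous_intros u)
    moreover have "has_bochner_integral torus (\<lambda>x. mode m x * cnj (mode n x)) (LINT x|torus. mode m x * cnj (mode n x))" for m n :: "real ^ 'd"
      by (rule h) (intro continuous_intros)
    moreover have "has_bochner_integral torus (\<lambda>x. complex_of_real ((u x)\<^sup>2)) (LINT x|torus. of_real ((u x)\<^sup>2))"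
      by (rule h) (intro continuous_intros u)
    ultimately show "has_bochner_integral torus (\<lambda>x. of_real ((u x)\<^sup>2)
      - (\<Sum>m\<in>F. cnj (c m) * (of_real (u x) * cnj (mode m x))) - (\<Sum>m\<in>F. c m * cnj (of_real (u x) * cnj (mode m x)))
      + (\<Sum>m\<in>F. \<Sum>n\<in>F. (c m * cnj (c n)) * (mode m x * cnj (mode n x))))
      ((LINT x|torus. of_real ((u x)\<^sup>2)) - (\<Sum>m\<in>F. cnj (c m) * fourier u m) - (\<Sum>m\<in>F. c m * cnj (fourier u m))
      + (\<Sum>m\<in>F. \<Sum>n\<in>F. (c m * cnj (c n)) * (LINT x|torus. mode m x * cnj (mode n x))))"
      by (intro has_bochner_integral_add has_bochner_integral_diff has_bochner_integral_sum
          has_bochner_integral_mult_right has_bochner_integral_cnj)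
  qed
  also have "(\<Sum>m\<in>F. \<Sum>n\<in>F. (c m * cnj (c n)) * (LINT x|torus. mode m x * cnj (mode n x))) = (\<Sum>m\<in>F. c m * cnj (c m))"
  proof (rule sum.cong[OF refl])
    fix m assume m: "m \<in> F"
    have "(\<Sum>n\<in>F. (c m * cnj (c n)) * (LINT x|torus. mode m x * cnj (mode n x))) = (\<Sum>n\<in>F. if n = m then c m * cnj (c n) else 0)"
      using F m by (intro sum.cong refl) (subst torus_integral_mode_mult, auto)
    then show "(\<Sum>n\<in>F. (c m * cnj (c n)) * (LINT x|torus. mode m x * cnj (mode n x))) = c m * cnj (c m)"
      using F m by simp
  qed
  also have "(LINT x|torus. complex_of_real ((u x)\<^sup>2)) = of_real (LINT x|torus. (u x)\<^sup>2)"
    by (rule integral_complex_of_real)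
  finally have "complex_of_real (LINT x|torus. (cmod (of_real (u x) - ?S x))\<^sup>2) = 
     of_real (LINT x|torus. (u x)\<^sup>2) - (\<Sum>m\<in>F. cnj (c m) * fourier u m + c m * cnj (fourier u m) - c m * cnj (c m))"
    by (simp add: sum.distrib sum_subtractf)
  also have "\<dots> = of_real (LINT x|torus. (u x)\<^sup>2) - (\<Sum>m\<in>F. of_real ((cmod (fourier u m))\<^sup>2 - (cmod (c m - fourier u m))\<^sup>2))"
    by (intro arg_cong2[where f="(-)"] sum.cong refl) (simp only: of_real_diff complex_norm_square complex_cnj_diff, simp add: algebra_simps)
  also have "\<dots> = of_real ((LINT x|torus. (u x)\<^sup>2) - (\<Sum>m\<in>F. (cmod (fourier u m))\<^sup>2) + (\<Sum>m\<in>F. (cmod (c m - fourier u m))\<^sup>2))"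
    by (simp add: sum_subtractf)
  finally show ?thesis by (simp only: of_real_eq_iff)
qed

lemma bessel:
  fixes u :: "real ^ 'd::finite \<Rightarrow> real"
  assumes u: "continuous_on UNIV u" and F: "finite F" "F \<subseteq> int_lattice"
  shows "(\<Sum>m\<in>F. (cmod (fourier u m))\<^sup>2) \<le> (LINT x|torus. (u x)\<^sup>2)"
proof -
  have "0 \<le> (LINT x|torus. (cmod (of_real (u x) - (\<Sum>m\<in>F. fourier u m * mode m x)))\<^sup>2)"
    by (rule integral_nonneg_AE) simp
  then show ?thesis unfolding torus_l2_error[OF assms] by simp
qed

inductive trig_poly :: "(real ^ 'd \<Rightarrow> complex) \<Rightarrow> bool" where
  mode: "m \<in> int_lattice \<Longrightarrow> trig_poly (\<lambda>x. c * mode m x)"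
| add: "trig_poly f \<Longrightarrow> trig_poly g \<Longrightarrow> trig_poly (\<lambda>x. f x + g x)"

lemma trig_poly_const: "trig_poly (\<lambda>x. c)"
  using trig_poly.mode[of 0 c] by simp

lemma trig_poly_sum: "finite A \<Longrightarrow> (\<And>i. i \<in> A \<Longrightarrow> trig_poly (f i)) \<Longrightarrow> trig_poly (\<lambda>x. \<Sum>i\<in>A. f i x)"
  by (induction A rule: finite_induct) (auto intro: trig_poly_const trig_poly.add)

lemma trig_poly_mult_mode: "trig_poly g \<Longrightarrow> m \<in> int_lattice \<Longrightarrow> trig_poly (\<lambda>x. (c * mode m x) * g x)"
proof (induction rule: trig_poly.induct)
  case (mode n c')
  have "(\<lambda>x. (c * mode m x) * (c' * mode n x)) = (\<lambda>x. (c * c') * mode (m + n) x)"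
    by (simp add: mode_add mult_ac)
  then show ?case using mode by (auto intro: trig_poly.mode)
qed (auto simp: ring_distribs intro: trig_poly.add)

lemma trig_poly_mult: "trig_poly f \<Longrightarrow> trig_poly g \<Longrightarrow> trig_poly (\<lambda>x. f x * g x)"
  by (induction rule: trig_poly.induct) (auto simp: ring_distribs intro: trig_poly.add trig_poly_mult_mode)

lemma trig_poly_cases_sum:
  assumes "trig_poly f"
  shows "\<exists>F c. finite F \<and> F \<subseteq> int_lattice \<and> f = (\<lambda>x. \<Sum>m\<in>F. c m * mode m x)"
  using assms
proof (induction rule: trig_poly.induct)
  case (mode m c)
  then show ?case by (intro exI[of _ "{m}"] exI[of _ "\<lambda>_. c"]) auto
next
  case (add f g)
  then obtain F c G d where F: "finite F" "F \<subseteq> int_lattice" "f = (\<lambda>x. \<Sum>m\<in>F. c m * mode m x)"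
    and G: "finite G" "G \<subseteq> int_lattice" "g = (\<lambda>x. \<Sum>m\<in>G. d m * mode m x)" by blast
  let ?e = "\<lambda>m. (if m \<in> F then c m else 0) + (if m \<in> G then d m else 0)"
  have "(\<Sum>m\<in>F \<union> G. ?e m * mode m x) = f x + g x" for x
  proof -
    have "(\<Sum>m\<in>F \<union> G. ?e m * mode m x) = (\<Sum>m\<in>F \<union> G. if m \<in> F then c m * mode m x else 0) + (\<Sum>m\<in>F \<union> G. if m \<in> G then d m * mode m x else 0)"
      unfolding sum.distrib[symmetric] by (intro sum.cong) (auto simp: ring_distribs)
    also have "\<dots> = f x + g x" using F G by (auto simp: sum.If_cases Int_absorb1 Int_commute)
    finally show ?thesis .
  qed
  then show ?case using F G by (intro exI[of _ "F \<union> G"] exI[of _ ?e]) auto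
qed

text \<open>Realises the torus as a compact subset of a Euclidean space: the fibres are the cosets
  of the lattice, and real polynomials on the image pull back to trigonometric polynomials.\<close>

definition torus_embed :: "real ^ 'd \<Rightarrow> complex ^ 'd" where
  "torus_embed x = (\<chi> i. mode (axis i 1) x)"

text \<open>A real linear functional is a combination of the real and imaginary parts of the
  coordinates, and on the image these are combinations of \<open>mode (axis i 1)\<close> and its
  conjugate. Sums and products stay within \<open>trig_poly\<close>.\<close>

lemma trig_poly_real_polynomial:
  fixes p :: "complex ^ 'd::finite \<Rightarrow> real"
  assumes "real_polynomial_function p"
  shows "trig_poly (\<lambda>x. of_real (p (torus_embed x)))"
  using assms
proof (induction rule: real_polynomial_function.induct)
  case (linear f)
  interpret bounded_linear f by fact
  let ?a = "\<lambda>i. f (axis i 1)" and ?b = "\<lambda>i. f (axis i \<i>)"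
  let ?c = "\<lambda>i. (of_real (?a i) - \<i> * of_real (?b i)) / 2" and ?d = "\<lambda>i. (of_real (?a i) + \<i> * of_real (?b i)) / 2"
  have z: "(\<Sum>i\<in>UNIV. Re (z $ i) *\<^sub>R axis i 1 + Im (z $ i) *\<^sub>R axis i \<i>) = z" for z :: "complex ^ 'd"
  proof (subst vec_eq_iff, rule allI)
    fix j
    have "(\<Sum>i\<in>UNIV. Re (z $ i) *\<^sub>R axis i 1 + Im (z $ i) *\<^sub>R axis i \<i>) $ j
      = (\<Sum>i\<in>UNIV. if i = j then of_real (Re (z $ j)) + \<i> * of_real (Im (z $ j)) else 0)"
      unfolding sum_component by (intro sum.cong refl) (auto simp: axis_def complex_eq_iff)
    also have "\<dots> = z $ j" by (simp add: complex_eq[symmetric])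
    finally show "(\<Sum>i\<in>UNIV. Re (z $ i) *\<^sub>R axis i 1 + Im (z $ i) *\<^sub>R axis i \<i>) $ j = z $ j" .
  qed
  have fz: "f z = (\<Sum>i\<in>UNIV. Re (z $ i) * ?a i + Im (z $ i) * ?b i)" for z
  proof -
    have "f z = f (\<Sum>i\<in>UNIV. Re (z $ i) *\<^sub>R axis i 1 + Im (z $ i) *\<^sub>R axis i \<i>)" by (simp only: z)
    also have "\<dots> = (\<Sum>i\<in>UNIV. Re (z $ i) * ?a i + Im (z $ i) * ?b i)" by (simp only: sum add scaleR real_scaleR_def)
    finally show ?thesis .
  qed
  have "complex_of_real (f (torus_embed x)) = (\<Sum>i\<in>UNIV. ?c i * mode (axis i 1) x + ?d i * mode (- axis i 1) x)" for x
    by (subst fz, unfold of_real_sum torus_embed_def vec_lambda_beta mode_minus, intro sum.cong refl) (auto simp: complex_eq_iff algebra_simps diff_divide_distrib add_divide_distrib)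
  then show ?case by (simp only:) (intro trig_poly_sum trig_poly.intros, auto)
qed (auto intro: trig_poly_const trig_poly.add trig_poly_mult)

lemma torus_embed_eq:
  assumes "torus_embed x = torus_embed y" shows "y - x \<in> int_lattice"
proof -
  have "\<exists>n. (y - x) $ i = of_int n" for i
  proof -
    have "mode (axis i 1) x = mode (axis i 1) y" using assms by (simp add: torus_embed_def vec_eq_iff)
    then have "mode (axis i 1) (y - x) = 1" by (simp add: mode_diff_right)
    then have "cos (2 * pi * ((y - x) $ i)) = 1"
      by (simp add: mode_def inner_axis' complex_eq_iff)
    then obtain n :: int where n: "2 * pi * ((y - x) $ i) = real_of_int n * 2 * pi"
      unfolding cos_one_2pi_int by (elim exE)
    have "(y - x) $ i = of_int n" using n by (simp del: vector_minus_component)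
    then show ?thesis ..
  qed
  then show ?thesis by (simp add: int_lattice_def Ints_def image_iff)
qed

text \<open>The function factors through \<open>torus_embed\<close>, so Stone-Weierstrass applies to
  the factor on the compact image.\<close>

lemma trig_poly_dense:
  fixes u :: "real ^ 'd::finite \<Rightarrow> real"
  assumes u: "continuous_on UNIV u" "torus_periodic u" and e: "e > 0"
  shows "\<exists>F c. finite F \<and> F \<subseteq> int_lattice \<and> (\<forall>x. cmod (of_real (u x) - (\<Sum>m\<in>F. c m * mode m x)) < e)"
proof -
  let ?K = "cbox 0 1 :: (real ^ 'd) set"
  define S where "S = torus_embed ` ?K"
  have ce: "continuous_on X (torus_embed :: real ^ 'd \<Rightarrow> _)" for X
    unfolding torus_embed_def by (intro continuous_intros continuous_on_vec_lambda)
  have S: "compact S" unfolding S_def by (intro compact_continuous_image ce) simp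
  \<comment> \<open>Any preimage does: two of them differ by a lattice vector, and \<open>u\<close>
    is periodic.\<close>
  define U where "U z = u (SOME x. torus_embed x = z)" for z
  have U: "U (torus_embed x) = u x" for x
  proof -
    have "torus_embed (SOME y. torus_embed y = torus_embed x) = torus_embed x" by (rule someI) simp
    from torus_periodicD[OF u(2) torus_embed_eq[OF this], of "SOME y. torus_embed y = torus_embed x"] show ?thesis
      unfolding U_def by simp
  qed
  \<comment> \<open>The preimage under \<open>U\<close> of a closed set is the image of a compact
    part of the cube, hence closed: a continuous map from a compact set is a quotient map.\<close>
  have "continuous_on S U"
    unfolding continuous_on_closed_vimage[OF compact_imp_closed[OF S]]
  proof (intro allI impI)
    fix B :: "real set" assume B: "closed B"
    have "U -` B \<inter> S = torus_embed ` (u -` B \<inter> ?K)" unfolding S_def using U by auto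
    moreover have "closed (u -` B)" by (rule closed_vimage[OF B u(1)])
    then have "compact (u -` B \<inter> ?K)" by (simp add: closed_Int_compact)
    then have "compact (torus_embed ` (u -` B \<inter> ?K))" by (rule compact_continuous_image[OF ce])
    ultimately show "closed (U -` B \<inter> S)" by (simp add: compact_imp_closed)
  qed
  from Stone_Weierstrass_real_polynomial_function[OF S this e] obtain p where
    p: "real_polynomial_function p" "\<And>z. z \<in> S \<Longrightarrow> \<bar>U z - p z\<bar> < e" by blast
  obtain F c where F: "finite F" "F \<subseteq> int_lattice"
    and eq: "(\<lambda>x. complex_of_real (p (torus_embed x))) = (\<lambda>x. \<Sum>m\<in>F. c m * mode m x)"
    using trig_poly_cases_sum[OF trig_poly_real_polynomial[OF p(1)]] by blast
  have "cmod (of_real (u x) - (\<Sum>m\<in>F. c m * mode m x)) < e" for x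
  proof -
    obtain m where m: "m \<in> int_lattice" "x + m \<in> unit_cube" by (rule unit_cube_representative)
    have te: "torus_embed (x + m) = torus_embed x"
      using m unfolding torus_embed_def by (simp add: mode_add_right mode_lattice)
    then have "torus_embed x \<in> S" unfolding S_def using m unit_cube_bounds(2) by (metis imageI subsetD)
    from p(2)[OF this] show ?thesis
      unfolding U fun_cong[OF eq, symmetric] of_real_diff[symmetric] norm_of_real .
  qed
  then show ?thesis using F by blast
qed

text \<open>One inequality is Bessel's. For the other, a trigonometric polynomial uniformly within
  \<open>sqrt e\<close> has mean square error at most \<open>e\<close>, and
  \<open>torus_l2_error\<close> bounds what the coefficients on \<open>F\<close> miss by this
  error.\<close>

lemma parseval:
  fixes u :: "real ^ 'd::finite \<Rightarrow> real"
  assumes u: "continuous_on UNIV u" "torus_periodic u"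
  shows "((\<lambda>m. (cmod (fourier u m))\<^sup>2) has_sum (LINT x|torus. (u x)\<^sup>2)) int_lattice"
proof -
  let ?f = "\<lambda>m. (cmod (fourier u m))\<^sup>2" and ?I = "LINT x|torus. (u x)\<^sup>2"
  have s: "?f summable_on int_lattice"
    using bessel[OF u(1)] by (intro nonneg_bdd_above_summable_on bdd_aboveI2[where M="?I"]) auto
  have "infsum ?f int_lattice \<le> ?I"
    by (rule infsum_le_finite_sums[OF s]) (rule bessel[OF u(1)])
  moreover have "?I \<le> infsum ?f int_lattice"
  proof (rule field_le_epsilon)
    fix e :: real assume e: "e > 0"
    show "?I \<le> infsum ?f int_lattice + e"
  proof -
    obtain F c where F: "finite F" "F \<subseteq> int_lattice"
      and c: "\<And>x. cmod (of_real (u x) - (\<Sum>m\<in>F. c m * mode m x)) < sqrt e"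
      using trig_poly_dense[OF u, of "sqrt e"] e by auto
    have "?I - sum ?f F + (\<Sum>m\<in>F. (cmod (c m - fourier u m))\<^sup>2) \<le> e"
      unfolding torus_l2_error[OF u(1) F, symmetric]
    proof (rule order_trans[OF _ norm_torus_integral_le[of _ e]])
      show "norm ((cmod (of_real (u x) - (\<Sum>m\<in>F. c m * mode m x)))\<^sup>2) \<le> e" for x
        using power_mono[OF less_imp_le[OF c[of x]], of 2] e by simp
    qed (auto intro!: continuous_intros u)
    moreover have "sum ?f F \<le> infsum ?f int_lattice" by (rule finite_sum_le_infsum[OF s F]) simp
    moreover have "0 \<le> (\<Sum>m\<in>F. (cmod (c m - fourier u m))\<^sup>2)" by (intro sum_nonneg) simp
    ultimately show ?thesis by linarith
  qed
  qed
  ultimately have "infsum ?f int_lattice = ?I" by (rule antisym)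
  then show ?thesis using s has_sum_infsum by metis
qed

lemma torus_l2_zero:
  fixes u :: "real ^ 'd::finite \<Rightarrow> real"
  assumes u: "continuous_on UNIV u" "torus_periodic u" and z: "(LINT x|torus. (u x)\<^sup>2) \<le> 0"
  shows "u x = 0"
proof -
  have i: "integrable torus (\<lambda>x. (u x)\<^sup>2)" by (intro integrable_torus_continuous continuous_intros u)
  have "(LINT x|torus. (u x)\<^sup>2) = 0" using z by (intro antisym integral_nonneg_AE) auto
  then have "AE x in torus. (u x)\<^sup>2 = 0" by (subst (asm) integral_nonneg_eq_0_iff_AE[OF i]) auto
  then have ae: "AE x in torus. (u x)\<^sup>2 \<le> 0" by eventually_elim simp
  have "(u x)\<^sup>2 \<le> 0" if "x \<in> unit_cube" for x
    by (rule AE_torus_le_continuous[OF _ ae that]) (intro continuous_intros u)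
  then show ?thesis using torus_periodic_unit_cube[OF u(2), of "\<lambda>y. y\<^sup>2 \<le> 0"] by simp
qed

lemma fourier_eq_imp_eq:
  fixes u v :: "real ^ 'd::finite \<Rightarrow> real"
  assumes u: "continuous_on UNIV u" "torus_periodic u" and v: "continuous_on UNIV v" "torus_periodic v"
    and eq: "\<And>m. m \<in> int_lattice \<Longrightarrow> fourier u m = fourier v m"
  shows "u = v"
proof
  fix x
  have c: "continuous_on UNIV (\<lambda>x. u x - v x)" by (intro continuous_intros u v)
  have p: "torus_periodic (\<lambda>x. u x - v x)" using u v by (simp add: torus_periodic_def)
  have "((\<lambda>m. (cmod (fourier (\<lambda>x. u x - v x) m))\<^sup>2) has_sum 0) int_lattice"
    by (rule has_sum_0) (simp add: fourier_diff u v eq)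
  with parseval[OF c p] have "(LINT x|torus. (u x - v x)\<^sup>2) = 0" by (rule has_sum_unique)
  then have "u x - v x = 0" using torus_l2_zero[OF c p] by simp
  then show "u x = v x" by simp
qed

section \<open>Rapidly decaying Fourier series\<close>

text \<open>Taking real parts makes the series a real function for arbitrary coefficients; its
  Fourier coefficients are then the hermitian part of \<open>c\<close>, see
  \<open>fourier_rser\<close>. Only hermitian \<open>c\<close> are recovered.\<close>

definition rser :: "(real ^ 'd \<Rightarrow> complex) \<Rightarrow> real ^ 'd \<Rightarrow> real" where
  "rser c x = (\<Sum>\<^sub>\<infinity>m\<in>int_lattice. Re (c m * mode m x))"

definition rpart :: "(real ^ 'd) set \<Rightarrow> (real ^ 'd \<Rightarrow> complex) \<Rightarrow> real ^ 'd \<Rightarrow> real" where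
  "rpart F c x = (\<Sum>m\<in>F. Re (c m * mode m x))"

lemma has_sum_diff_real:
  fixes f g :: "'a \<Rightarrow> real"
  assumes "(f has_sum a) A" "(g has_sum b) A"
  shows "((\<lambda>x. f x - g x) has_sum (a - b)) A"
  using has_sum_add[OF assms(1) has_sum_uminusI[OF assms(2)]] by simp

lemma has_sum_finite_sum:
  fixes f :: "'i \<Rightarrow> 'a \<Rightarrow> real"
  assumes "finite I" "\<And>i. i \<in> I \<Longrightarrow> (f i has_sum a i) A"
  shows "((\<lambda>x. \<Sum>i\<in>I. f i x) has_sum (\<Sum>i\<in>I. a i)) A"
  using assms by (induction I rule: finite_induct) (auto intro!: has_sum_add)

lemma norm_Re_mode_le: "norm (Re (c * mode m x)) \<le> cmod c"
  unfolding real_norm_def using abs_Re_le_cmod[of "c * mode m x"] by (simp only: norm_mult norm_mode mult_1_right)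

lemma abs_Re_mode_le: "\<bar>Re (c * mode m x)\<bar> \<le> cmod c"
  by (rule norm_Re_mode_le[unfolded real_norm_def])

lemma rser_has_sum:
  assumes "(\<lambda>m. cmod (c m)) summable_on int_lattice"
  shows "((\<lambda>m. Re (c m * mode m x)) has_sum rser c x) int_lattice"
  unfolding rser_def
  by (rule has_sum_infsum, rule Infinite_Sum.abs_summable_summable,
      rule Infinite_Sum.abs_summable_on_comparison_test'[OF assms], rule norm_Re_mode_le)

lemma rser_uniform_limit:
  assumes "(\<lambda>m. cmod (c m)) summable_on int_lattice"
  shows "uniform_limit UNIV (\<lambda>F. rpart F c) (rser c) (finite_subsets_at_top int_lattice)"
  unfolding rpart_def[abs_def] rser_def[abs_def]
  by (rule Weierstrass_m_test_general[OF _ assms]) (rule norm_Re_mode_le)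

lemma continuous_rpart: "continuous_on S (rpart F c)"
  unfolding rpart_def by (intro continuous_intros)

lemma rpart_periodic: "F \<subseteq> int_lattice \<Longrightarrow> torus_periodic (rpart F c)"
  unfolding torus_periodic_def rpart_def
  by (auto intro!: sum.cong simp: subset_iff torus_periodicD[OF mode_periodic] simp del: times_complex.sel)

lemma continuous_rser:
  assumes "(\<lambda>m. cmod (c m)) summable_on int_lattice"
  shows "continuous_on S (rser c)"
  by (rule continuous_on_subset[OF uniform_limit_theorem[OF _ rser_uniform_limit[OF assms]]])
     (auto intro: continuous_rpart)

lemma rser_periodic: "torus_periodic (rser c)"
  unfolding torus_periodic_def rser_def
  by (auto intro!: infsum_cong simp: torus_periodicD[OF mode_periodic] simp del: times_complex.sel)

lemma rpart_eq_rser: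
  assumes "finite F" "F \<subseteq> int_lattice"
  shows "rpart F c = rser (\<lambda>m. if m \<in> F then c m else 0)"
proof
  fix x
  have "rser (\<lambda>m. if m \<in> F then c m else 0) x = (\<Sum>\<^sub>\<infinity>m\<in>F. Re (c m * mode m x))"
    unfolding rser_def by (rule infsum_cong_neutral) (use assms in auto)
  then show "rpart F c x = rser (\<lambda>m. if m \<in> F then c m else 0) x"
    using assms by (simp add: rpart_def)
qed

lemma fourier_Re_mode:
  assumes "m \<in> int_lattice" "n \<in> int_lattice"
  shows "fourier (\<lambda>x. Re (c * mode n x)) m = (if m = n then c / 2 else 0) + (if m = - n then cnj c / 2 else 0)"
proof -
  have e: "complex_of_real (Re (c * mode n x)) * cnj (mode m x) =
      (c / 2) * (mode n x * cnj (mode m x)) + (cnj c / 2) * (mode (- n) x * cnj (mode m x))" for x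
    by (simp add: mode_minus complex_eq_iff algebra_simps add_divide_distrib diff_divide_distrib) 
  have "fourier (\<lambda>x. Re (c * mode n x)) m = (c / 2) * (LINT x|torus. mode n x * cnj (mode m x))
      + (cnj c / 2) * (LINT x|torus. mode (- n) x * cnj (mode m x))"
    unfolding fourier_def e
    by (subst Bochner_Integration.integral_add) (auto intro!: integrable_torus_continuous continuous_intros)
  then show ?thesis using assms by (auto simp: torus_integral_mode_mult)
qed

lemma fourier_rpart:
  assumes F: "finite F" "F \<subseteq> int_lattice" and m: "m \<in> int_lattice"
  shows "fourier (rpart F c) m = (if m \<in> F then c m / 2 else 0) + (if - m \<in> F then cnj (c (- m)) / 2 else 0)"
proof -
  have "fourier (rpart F c) m = (\<Sum>n\<in>F. fourier (\<lambda>x. Re (c n * mode n x)) m)"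
    using F(1) unfolding rpart_def
  proof (induction F rule: finite_induct)
    case empty then show ?case by (simp add: fourier_def)
  next
    case (insert n F)
    have "fourier (\<lambda>x. Re (c n * mode n x) + (\<Sum>m\<in>F. Re (c m * mode m x))) m =
       fourier (\<lambda>x. Re (c n * mode n x)) m + fourier (\<lambda>x. \<Sum>m\<in>F. Re (c m * mode m x)) m"
      by (intro fourier_add continuous_intros)
    then show ?case using insert by simp
  qed
  also have "\<dots> = (\<Sum>n\<in>F. (if m = n then c n / 2 else 0) + (if n = - m then cnj (c n) / 2 else 0))"
    using F m by (intro sum.cong refl) (subst fourier_Re_mode, auto)
  also have "\<dots> = (if m \<in> F then c m / 2 else 0) + (if - m \<in> F then cnj (c (- m)) / 2 else 0)"
    using F by (simp add: sum.distrib)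
  finally show ?thesis .
qed

lemma fourier_uniform_limit:
  assumes "uniform_limit UNIV f u F" "\<And>n. continuous_on UNIV (f n)" "continuous_on UNIV u"
  shows "((\<lambda>n. fourier (f n) m) \<longlongrightarrow> fourier u m) F"
proof (rule tendstoI)
  fix e :: real assume e: "e > 0"
  have "\<forall>\<^sub>F n in F. \<forall>x\<in>UNIV. dist (f n x) (u x) < e / 2"
    using uniform_limitD[OF assms(1), of "e / 2"] e by simp
  then show "\<forall>\<^sub>F n in F. dist (fourier (f n) m) (fourier u m) < e"
  proof eventually_elim
    case (elim n)
    have "cmod (fourier (\<lambda>x. f n x - u x) m) \<le> e / 2"
      using elim by (intro fourier_bound continuous_intros assms) (auto simp: dist_real_def less_imp_le)
    then show ?case using e by (simp add: dist_norm fourier_diff assms)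
  qed
qed

text \<open>The coefficient passes to the uniform limit, and it is already final for every finite
  set of frequencies that contains \<open>m\<close> and \<open>- m\<close>.\<close>

lemma fourier_rser:
  assumes c: "(\<lambda>m. cmod (c m)) summable_on int_lattice" and m: "m \<in> int_lattice"
  shows "fourier (rser c) m = (c m + cnj (c (- m))) / 2"
proof -
  have "((\<lambda>F. fourier (rpart F c) m) \<longlongrightarrow> fourier (rser c) m) (finite_subsets_at_top int_lattice)"
    by (intro fourier_uniform_limit rser_uniform_limit continuous_rpart continuous_rser c)
  moreover have "((\<lambda>F. fourier (rpart F c) m) \<longlongrightarrow> (c m + cnj (c (- m))) / 2) (finite_subsets_at_top int_lattice)"
  proof (rule tendsto_eventually)
    have "\<forall>\<^sub>F F in finite_subsets_at_top int_lattice. finite F \<and> {m, -m} \<subseteq> F \<and> F \<subseteq> int_lattice"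
      using m by (intro eventually_finite_subsets_at_top[THEN iffD2]) (auto intro!: exI[of _ "{m, -m}"])
    then show "\<forall>\<^sub>F F in finite_subsets_at_top int_lattice. fourier (rpart F c) m = (c m + cnj (c (- m))) / 2"
      by eventually_elim (use m in \<open>auto simp: fourier_rpart add_divide_distrib\<close>)
  qed
  ultimately show ?thesis by (rule tendsto_unique[OF finite_subsets_at_top_neq_bot])
qed

lemma fourier_rser_hermitian:
  assumes c: "(\<lambda>m. cmod (c m)) summable_on int_lattice" and m: "m \<in> int_lattice" and h: "c (- m) = cnj (c m)"
  shows "fourier (rser c) m = c m"
  using fourier_rser[OF c m] h by simp

lemma rser_fourier:
  fixes u :: "real ^ 'd::finite \<Rightarrow> real"
  assumes u: "continuous_on UNIV u" "torus_periodic u"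
    and s: "(\<lambda>m. cmod (fourier u m)) summable_on int_lattice"
  shows "rser (fourier u) = u"
  by (rule fourier_eq_imp_eq)
     (auto intro: continuous_rser rser_periodic u s fourier_rser_hermitian simp: fourier_minus)

section \<open>Smoothness of rapidly decaying series\<close>

definition rdecay :: "(real ^ 'd \<Rightarrow> complex) \<Rightarrow> bool" where
  "rdecay c \<longleftrightarrow> (\<forall>k. (\<lambda>m. (1 + m \<bullet> m) ^ k * cmod (c m)) summable_on int_lattice)"

lemma rdecay_summable: "rdecay c \<Longrightarrow> (\<lambda>m. cmod (c m)) summable_on int_lattice"
  unfolding rdecay_def by (drule spec[of _ 0]) simp

lemma rdecay_mult:
  assumes "rdecay c" "\<And>m. m \<in> int_lattice \<Longrightarrow> cmod (d m) \<le> K * (1 + m \<bullet> m) ^ j * cmod (c m)"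
  shows "rdecay d"
  unfolding rdecay_def
proof
  fix k
  have "(\<lambda>m. K * ((1 + m \<bullet> m) ^ (k + j) * cmod (c m))) summable_on int_lattice"
    using assms(1) unfolding rdecay_def by (intro summable_on_cmult_right) auto
  then show "(\<lambda>m. (1 + m \<bullet> m) ^ k * cmod (d m)) summable_on int_lattice"
  proof (rule summable_on_comparison_test)
    fix m :: "real ^ 'a" assume "m \<in> int_lattice"
    then have "(1 + m \<bullet> m) ^ k * cmod (d m) \<le> (1 + m \<bullet> m) ^ k * (K * (1 + m \<bullet> m) ^ j * cmod (c m))"
      by (intro mult_left_mono assms) auto
    then show "(1 + m \<bullet> m) ^ k * cmod (d m) \<le> K * ((1 + m \<bullet> m) ^ (k + j) * cmod (c m))"
      by (simp add: power_add mult_ac)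
  qed auto
qed

text \<open>The bound is used with \<open>d\<close> further powers of
  \<open>1 + m \<bullet> m\<close>; their reciprocal is summable over the lattice.\<close>

lemma rdecay_bounded:
  fixes c :: "real ^ 'd::finite \<Rightarrow> complex"
  assumes "\<And>k. \<exists>K. \<forall>m\<in>int_lattice. (1 + m \<bullet> m) ^ k * cmod (c m) \<le> K"
  shows "rdecay c"
  unfolding rdecay_def
proof
  fix k
  obtain K where K: "\<forall>m\<in>int_lattice. (1 + m \<bullet> m) ^ (k + CARD('d)) * cmod (c m) \<le> K" using assms by blast
  have "(\<lambda>m. K * (1 / (1 + m \<bullet> m) ^ CARD('d))) summable_on (int_lattice :: (real ^ 'd) set)"
    by (intro summable_on_cmult_right inverse_power_summable)
  then show "(\<lambda>m. (1 + m \<bullet> m) ^ k * cmod (c m)) summable_on int_lattice"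
  proof (rule summable_on_comparison_test)
    fix m :: "real ^ 'd" assume m: "m \<in> int_lattice"
    have "(1 + m \<bullet> m) ^ CARD('d) > 0" by (simp add: add_pos_nonneg)
    then show "(1 + m \<bullet> m) ^ k * cmod (c m) \<le> K * (1 / (1 + m \<bullet> m) ^ CARD('d))"
      using K m by (simp add: field_simps power_add)
  qed auto
qed

lemma rdecay_finite:
  fixes c :: "real ^ 'd::finite \<Rightarrow> complex"
  assumes "finite F" shows "rdecay (\<lambda>m. if m \<in> F then c m else 0)"
  unfolding rdecay_def
  by (intro allI summable_on_cong_neutral[THEN iffD1, OF _ _ _ summable_on_finite[of "F \<inter> int_lattice"]])
     (use assms in auto)

definition dcoef :: "'d \<Rightarrow> (real ^ 'd \<Rightarrow> complex) \<Rightarrow> real ^ 'd \<Rightarrow> complex" where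
  "dcoef i c = (\<lambda>m. 2 * pi * \<i> * of_real (m $ i) * c m)"

lemma abs_component_le: "\<bar>m $ i\<bar> \<le> 1 + m \<bullet> (m :: real ^ 'd::finite)"
proof -
  have "0 \<le> (\<bar>m $ i\<bar> - 1)\<^sup>2" by simp
  then have "2 * \<bar>m $ i\<bar> \<le> 1 + (m $ i)\<^sup>2" by (simp add: power2_eq_square algebra_simps)
  then show ?thesis using component_sq_le_inner[of m i] by linarith
qed

lemma rdecay_dcoef: "rdecay c \<Longrightarrow> rdecay (dcoef i (c :: real ^ 'd::finite \<Rightarrow> complex))"
proof (rule rdecay_mult[of c _ "2 * pi" 1])
  fix m :: "real ^ 'd"
  show "cmod (dcoef i c m) \<le> 2 * pi * (1 + m \<bullet> m) ^ 1 * cmod (c m)"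
    unfolding dcoef_def using abs_component_le[of m i] by (auto simp: norm_mult intro!: mult_right_mono)
qed

lemma cmod_cis_taylor: "cmod (cis t - 1 - \<i> * of_real t) \<le> t\<^sup>2"
proof -
  have "cmod (exp (\<i> * of_real t) - (\<Sum>i\<le>1. (\<i> * of_real t) ^ i / fact i)) \<le> exp \<bar>Re (\<i> * of_real t)\<bar> * cmod (\<i> * of_real t) ^ Suc 1 / fact 1"
    by (rule Taylor_exp)
  then show ?thesis by (simp add: cis_conv_exp norm_mult diff_diff_eq power2_eq_square)
qed

text \<open>Mode by mode, \<open>cmod_cis_taylor\<close> with
  \<open>t = 2 \<pi> (m \<bullet> h)\<close> bounds the remainder of the linearisation by a multiple
  of \<open>(m \<bullet> m) * (norm h) ^ 2 * cmod (c m)\<close>. The second moment of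
  \<open>c\<close> is finite, so the total remainder is quadratic in \<open>h\<close> and no limits
  have to be interchanged.\<close>

lemma rser_has_derivative:
  fixes c :: "real ^ 'd::finite \<Rightarrow> complex"
  assumes "rdecay c"
  shows "(rser c has_derivative (\<lambda>h. \<Sum>i\<in>UNIV. h $ i * rser (dcoef i c) x)) (at x)"
proof -
  define K where "K = (2 * pi)\<^sup>2 * (\<Sum>\<^sub>\<infinity>m\<in>int_lattice. (1 + m \<bullet> m) * cmod (c m))"
  have s1: "(\<lambda>m. (1 + m \<bullet> m) * cmod (c m)) summable_on int_lattice"
    using assms unfolding rdecay_def by (auto dest: spec[of _ 1])
  have est: "\<bar>rser c y - rser c x - (\<Sum>i\<in>UNIV. (y - x) $ i * rser (dcoef i c) x)\<bar> \<le> K * (norm (y - x))\<^sup>2" for y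
  proof -
    let ?h = "y - x"
    have hs: "((\<lambda>m. Re (c m * mode m y) - Re (c m * mode m x) - (\<Sum>i\<in>UNIV. ?h $ i * Re (dcoef i c m * mode m x)))
        has_sum (rser c y - rser c x - (\<Sum>i\<in>UNIV. ?h $ i * rser (dcoef i c) x))) int_lattice"
      by (intro has_sum_diff_real has_sum_finite_sum has_sum_cmult_right rser_has_sum rdecay_summable rdecay_dcoef assms) auto
    have K: "((\<lambda>m. (2 * pi)\<^sup>2 * ((1 + m \<bullet> m) * cmod (c m)) * (norm ?h)\<^sup>2) has_sum K * (norm ?h)\<^sup>2) int_lattice"
      unfolding K_def by (intro has_sum_cmult_left has_sum_cmult_right has_sum_infsum s1)
    have "norm (Re (c m * mode m y) - Re (c m * mode m x) - (\<Sum>i\<in>UNIV. ?h $ i * Re (dcoef i c m * mode m x)))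
       \<le> (2 * pi)\<^sup>2 * ((1 + m \<bullet> m) * cmod (c m)) * (norm ?h)\<^sup>2" for m
    proof -
      define t where "t = 2 * pi * (m \<bullet> ?h)"
      have "(\<Sum>i\<in>UNIV. ?h $ i * Re (dcoef i c m * mode m x)) = Re ((\<Sum>i\<in>UNIV. of_real (?h $ i) * (2 * pi * \<i> * of_real (m $ i))) * (c m * mode m x))"
        unfolding sum_distrib_right Re_sum dcoef_def
        by (intro sum.cong refl) (simp add: algebra_simps)
      also have "(\<Sum>i\<in>UNIV. of_real (?h $ i) * (2 * pi * \<i> * of_real (m $ i))) = \<i> * of_real t"
        unfolding t_def inner_vec_def by (simp add: sum_distrib_left mult_ac del: vector_minus_component)
      finally have 1: "(\<Sum>i\<in>UNIV. ?h $ i * Re (dcoef i c m * mode m x)) = Re (\<i> * of_real t * (c m * mode m x))" .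
      have 2: "mode m y = mode m x * cis t"
        using mode_add_right[of m x ?h] by (simp add: t_def mode_def)
      have "Re (c m * mode m y) - Re (c m * mode m x) - (\<Sum>i\<in>UNIV. ?h $ i * Re (dcoef i c m * mode m x))
        = Re (c m * mode m x * (cis t - 1 - \<i> * of_real t))"
        unfolding 1 2 by (simp add: algebra_simps)
      then have "\<bar>Re (c m * mode m y) - Re (c m * mode m x) - (\<Sum>i\<in>UNIV. ?h $ i * Re (dcoef i c m * mode m x))\<bar>
        \<le> cmod (c m * mode m x * (cis t - 1 - \<i> * of_real t))"
        using abs_Re_le_cmod by metis
      also have "\<dots> \<le> cmod (c m) * t\<^sup>2" by (simp add: norm_mult mult_left_mono cmod_cis_taylor)
      also have "\<dots> \<le> cmod (c m) * ((2 * pi)\<^sup>2 * ((1 + m \<bullet> m) * (norm ?h)\<^sup>2))"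
      proof (rule mult_left_mono)
        have "\<bar>m \<bullet> ?h\<bar> \<le> norm m * norm ?h" by (rule Cauchy_Schwarz_ineq2)
        then have "(m \<bullet> ?h)\<^sup>2 \<le> (norm m * norm ?h)\<^sup>2" by (rule abs_le_square_iff[THEN iffD1, OF order_trans]) simp
        also have "\<dots> \<le> (1 + m \<bullet> m) * (norm ?h)\<^sup>2"
          by (simp add: power_mult_distrib dot_square_norm[symmetric] mult_right_mono)
        finally show "t\<^sup>2 \<le> (2 * pi)\<^sup>2 * ((1 + m \<bullet> m) * (norm ?h)\<^sup>2)"
          unfolding t_def power_mult_distrib by (intro mult_left_mono) auto
      qed simp
      finally show ?thesis by (simp add: mult_ac)
    qed
    from norm_infsum_le[OF hs K this] show ?thesis by simp
  qed
  show ?thesis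
  proof (rule has_derivativeI_sandwich[where e=1 and H="\<lambda>y. K * norm (y - x)"])
    show "bounded_linear (\<lambda>h. \<Sum>i\<in>UNIV. h $ i * rser (dcoef i c) x)"
      by (intro bounded_linear_sum bounded_linear_mult_left[THEN bounded_linear_compose] bounded_linear_vec_nth) 
    show "norm (rser c y - rser c x - (\<Sum>i\<in>UNIV. (y - x) $ i * rser (dcoef i c) x)) / norm (y - x) \<le> K * norm (y - x)"
      if "y \<noteq> x" for y
      using est[of y] that by (simp add: divide_le_eq power2_eq_square mult_ac)
    have "((\<lambda>y. K * norm (y - x)) \<longlongrightarrow> K * norm (x - x)) (at x)" by (intro tendsto_intros)
    then show "((\<lambda>y. K * norm (y - x)) \<longlongrightarrow> 0) (at x)" by simp
  qed simp
qed

lemma rser_pderivative: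
  assumes "rdecay (c :: real ^ 'd::finite \<Rightarrow> complex)"
  shows "pderivative i (rser c) = rser (dcoef i c)"
proof
  fix x
  have "frechet_derivative (rser c) (at x) = (\<lambda>h. \<Sum>i\<in>UNIV. h $ i * rser (dcoef i c) x)"
    by (rule frechet_derivative_at[OF rser_has_derivative[OF assms], symmetric])
  then show "pderivative i (rser c) x = rser (dcoef i c) x"
    by (simp add: pderivative_def axis_def if_distrib[of "\<lambda>a. a * _"] cong: if_cong)
qed

lemma rser_foldr_pderivative:
  assumes "rdecay (c :: real ^ 'd::finite \<Rightarrow> complex)"
  shows "rdecay (foldr dcoef is c) \<and> foldr pderivative is (rser c) = rser (foldr dcoef is c)"
  by (induction "is") (use assms in \<open>auto simp: rdecay_dcoef rser_pderivative\<close>)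

lemma rser_test_fun:
  assumes "rdecay (c :: real ^ 'd::finite \<Rightarrow> complex)" shows "rser c \<in> test_funs"
proof -
  have "foldr pderivative is (rser c) differentiable_on UNIV" for "is"
  proof -
    have "foldr pderivative is (rser c) = rser (foldr dcoef is c)" "rdecay (foldr dcoef is c)"
      using rser_foldr_pderivative[OF assms] by auto
    then show ?thesis
      using rser_has_derivative[of "foldr dcoef is c"] unfolding differentiable_on_def differentiable_def by auto
  qed
  then show ?thesis by (simp add: test_funs_def smooth_def periodic_iff rser_periodic)
qed

text \<open>The eigenvalue of minus the Laplacian on \<open>mode m\<close>; its square is the
  eigenvalue of the biharmonic operator.\<close>

definition lam :: "real ^ 'd \<Rightarrow> real" where "lam m = (2 * pi)\<^sup>2 * (m \<bullet> m)"

lemma lam_nonneg [simp]: "0 \<le> lam m" by (simp add: lam_def)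

lemma lam_minus [simp]: "lam (- m) = lam m" by (simp add: lam_def)

lemma rdecay_lam:
  assumes "rdecay (c :: real ^ 'd::finite \<Rightarrow> complex)" shows "rdecay (\<lambda>m. - of_real (lam m) * c m)"
proof (rule rdecay_mult[OF assms, of _ "(2 * pi)\<^sup>2" 1])
  fix m :: "real ^ 'd"
  show "cmod (- of_real (lam m) * c m) \<le> (2 * pi)\<^sup>2 * (1 + m \<bullet> m) ^ 1 * cmod (c m)"
    unfolding norm_mult norm_minus_cancel norm_of_real by (intro mult_right_mono) (auto simp: lam_def)
qed

lemma rser_laplacian:
  assumes "rdecay (c :: real ^ 'd::finite \<Rightarrow> complex)"
  shows "laplacian (rser c) = rser (\<lambda>m. - of_real (lam m) * c m)"
proof
  fix x
  have "laplacian (rser c) x = (\<Sum>i\<in>UNIV. rser (dcoef i (dcoef i c)) x)"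
    unfolding laplacian_def by (simp add: rser_pderivative rdecay_dcoef assms)
  moreover have "((\<lambda>m. \<Sum>i\<in>UNIV. Re (dcoef i (dcoef i c) m * mode m x)) has_sum (\<Sum>i\<in>UNIV. rser (dcoef i (dcoef i c)) x)) int_lattice"
    by (rule has_sum_finite_sum[OF finite]) (intro rser_has_sum rdecay_summable rdecay_dcoef assms)
  moreover have "(\<Sum>i\<in>UNIV. Re (dcoef i (dcoef i c) m * mode m x)) = Re ((- of_real (lam m) * c m) * mode m x)" for m
  proof -
    have "(\<Sum>i\<in>UNIV. Re (dcoef i (dcoef i c) m * mode m x)) =
        Re (of_real (\<Sum>i\<in>UNIV. - ((2 * pi)\<^sup>2 * (m $ i * m $ i))) * (c m * mode m x))"
      unfolding of_real_sum sum_distrib_right Re_sum dcoef_def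
      by (intro sum.cong refl arg_cong[where f=Re]) (simp add: power2_eq_square mult_ac)
    also have "(\<Sum>i\<in>UNIV. - ((2 * pi)\<^sup>2 * (m $ i * m $ i))) = - lam m"
      unfolding lam_def inner_vec_def by (simp add: sum_negf sum_distrib_left)
    finally show ?thesis by (simp add: mult_ac)
  qed
  ultimately show "laplacian (rser c) x = rser (\<lambda>m. - of_real (lam m) * c m) x"
    unfolding rser_def by (simp add: infsumI)
qed

section \<open>Decay of the Fourier coefficients of smooth functions\<close>

lemma pderivative_periodic:
  fixes f :: "real ^ 'd::finite \<Rightarrow> real"
  assumes d: "f differentiable_on UNIV" and p: "torus_periodic f"
  shows "torus_periodic (pderivative i f)"
  unfolding torus_periodic_def
proof (intro allI ballI)
  fix x m :: "real ^ 'd" assume m: "m \<in> int_lattice"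
  have "(f has_derivative frechet_derivative f (at (x + m))) (at (x + m))"
    using d by (simp add: differentiable_on_def frechet_derivative_works)
  moreover have "((\<lambda>y. y + m) has_derivative (\<lambda>h. h)) (at x)" by (auto intro!: derivative_eq_intros)
  ultimately have "((\<lambda>y. f (y + m)) has_derivative (\<lambda>h. frechet_derivative f (at (x + m)) h)) (at x)"
    by (rule has_derivative_compose[rotated])
  then have "(f has_derivative frechet_derivative f (at (x + m))) (at x)"
    using torus_periodicD[OF p m] by simp
  then have "frechet_derivative f (at (x + m)) = frechet_derivative f (at x)" by (rule frechet_derivative_at)
  then show "pderivative i f (x + m) = pderivative i f x" by (simp add: pderivative_def)
qed

lemma pderivative_line:
  fixes f :: "real ^ 'd::finite \<Rightarrow> real"
  assumes d: "f differentiable_on UNIV"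
  shows "((\<lambda>t. f (x + t *\<^sub>R axis i 1)) has_real_derivative pderivative i f (x + t *\<^sub>R axis i 1)) (at t)"
proof -
  let ?y = "x + t *\<^sub>R axis i 1" and ?D = "frechet_derivative f (at (x + t *\<^sub>R axis i 1))"
  have D: "(f has_derivative ?D) (at ?y)"
    using d by (simp add: differentiable_on_def frechet_derivative_works)
  have "((\<lambda>s. x + s *\<^sub>R axis i 1) has_derivative (\<lambda>h. h *\<^sub>R axis i (1::real))) (at t)"
    by (auto intro!: derivative_eq_intros)
  from has_derivative_compose[OF this D]
  have "((\<lambda>s. f (x + s *\<^sub>R axis i 1)) has_derivative (\<lambda>h. ?D (h *\<^sub>R axis i 1))) (at t)" .
  moreover have "?D (h *\<^sub>R axis i 1) = pderivative i f ?y * h" for h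
    using linear_scale[OF has_derivative_linear[OF D], of h "axis i 1"] by (simp add: pderivative_def)
  ultimately show ?thesis by (simp add: has_field_derivative_def)
qed

text \<open>Takes the place of integration by parts on the cube: the coefficients of a difference
  quotient are explicit because a translation multiplies them by a phase, and the mean value theorem
  supplies the constant bound for dominated convergence.\<close>

lemma fourier_pderivative:
  fixes f :: "real ^ 'd::finite \<Rightarrow> real"
  assumes d: "f differentiable_on UNIV" and p: "torus_periodic f"
    and c: "continuous_on UNIV (pderivative i f)" and m: "m \<in> int_lattice"
  shows "fourier (pderivative i f) m = 2 * pi * \<i> * of_real (m $ i) * fourier f m"
proof -
  let ?e = "axis i 1 :: real ^ 'd" and ?h = "\<lambda>n. 1 / real (Suc n)"
  let ?q = "\<lambda>n x. (f (x + ?h n *\<^sub>R ?e) - f x) / ?h n"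
  have cf: "continuous_on UNIV f" using d by (rule differentiable_imp_continuous_on)
  obtain B where B: "\<And>x. \<bar>pderivative i f x\<bar> \<le> B"
    using continuous_torus_bounded[OF c pderivative_periodic[OF d p]] by auto
  have cs: "continuous_on UNIV (\<lambda>x. f (x + a))" for a
    by (intro continuous_on_compose2[OF cf] continuous_intros) auto
  have cq: "continuous_on UNIV (?q n)" for n
    by (intro continuous_intros cs cf) auto
  have "(\<lambda>n. fourier (?q n) m) \<longlonglongrightarrow> fourier (pderivative i f) m"
    unfolding fourier_def
  proof (rule integral_dominated_convergence[where w="\<lambda>_. B"])
    show "(\<lambda>x. of_real (pderivative i f x) * cnj (mode m x)) \<in> borel_measurable torus"
      by (intro torus_measurable_borel borel_measurable_continuous_onI continuous_of_real_mult_mode c)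
    show "(\<lambda>x. of_real (?q n x) * cnj (mode m x)) \<in> borel_measurable torus" for n
      by (intro torus_measurable_borel borel_measurable_continuous_onI continuous_of_real_mult_mode cq)
    show "AE x in torus. (\<lambda>n. of_real (?q n x) * cnj (mode m x)) \<longlonglongrightarrow> of_real (pderivative i f x) * cnj (mode m x)"
    proof (intro AE_I2 tendsto_mult tendsto_of_real tendsto_const)
      fix x
      have "((\<lambda>t. (f (x + t *\<^sub>R ?e) - f x) / t) \<longlongrightarrow> pderivative i f x) (at 0)"
        using pderivative_line[OF d, of x i 0] by (simp add: has_field_derivative_iff)
      moreover have "filterlim ?h (at 0) sequentially"
        unfolding filterlim_at using LIMSEQ_inverse_real_of_nat by (auto simp: inverse_eq_divide)
      ultimately show "(\<lambda>n. ?q n x) \<longlonglongrightarrow> pderivative i f x"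
        by (rule filterlim_compose)
    qed
    show "AE x in torus. cmod (of_real (?q n x) * cnj (mode m x)) \<le> B" for n
    proof (intro AE_I2)
      fix x
      obtain z where "f (x + ?h n *\<^sub>R ?e) - f (x + 0 *\<^sub>R ?e) = (?h n - 0) * pderivative i f (x + z *\<^sub>R ?e)"
        using MVT2[of 0 "?h n" "\<lambda>t. f (x + t *\<^sub>R ?e)" "\<lambda>t. pderivative i f (x + t *\<^sub>R ?e)"] pderivative_line[OF d, of x i] by auto
      then have "?q n x = pderivative i f (x + z *\<^sub>R ?e)" by (simp add: field_simps)
      then show "cmod (of_real (?q n x) * cnj (mode m x)) \<le> B" using B by (simp only: norm_mult norm_of_real) simp
    qed
  qed simp
  moreover have "(\<lambda>n. fourier (?q n) m) \<longlonglongrightarrow> 2 * pi * \<i> * of_real (m $ i) * fourier f m"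
  proof -
    have "fourier (?q n) m = (cis (2 * pi * m $ i * ?h n) - 1) / of_real (?h n) * fourier f m" for n
    proof -
      have "fourier (?q n) m = of_real (1 / ?h n) * fourier (\<lambda>x. f (x + ?h n *\<^sub>R ?e) - f x) m"
        unfolding fourier_cmult[symmetric] by (simp add: mult.commute)
      also have "fourier (\<lambda>x. f (x + ?h n *\<^sub>R ?e) - f x) m = (mode m (?h n *\<^sub>R ?e) - 1) * fourier f m"
        by (subst fourier_diff[OF cs cf]) (simp add: fourier_shift[OF cf p m] left_diff_distrib)
      also have "mode m (?h n *\<^sub>R ?e) = cis (2 * pi * m $ i * ?h n)"
        by (simp add: mode_def inner_axis)
      finally show ?thesis by (simp add: field_simps)
    qed
    moreover have "(\<lambda>n. (cis (2 * pi * m $ i * ?h n) - 1) / of_real (?h n)) \<longlonglongrightarrow> \<i> * of_real (2 * pi * m $ i)"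
    proof (rule LIM_zero_cancel, rule Lim_null_comparison)
      let ?a = "2 * pi * m $ i"
      show "\<forall>\<^sub>F n in sequentially. norm ((cis (2 * pi * m $ i * ?h n) - 1) / of_real (?h n) - \<i> * of_real (2 * pi * m $ i)) \<le> ?a\<^sup>2 * ?h n"
      proof (intro always_eventually allI)
        fix n
        have "(cis (?a * ?h n) - 1) / of_real (?h n) - \<i> * of_real ?a = (cis (?a * ?h n) - 1 - \<i> * of_real (?a * ?h n)) / of_real (?h n)"
          by (simp add: field_simps del: of_nat_Suc)
        also have "norm \<dots> \<le> (?a * ?h n)\<^sup>2 / ?h n"
          unfolding norm_divide norm_of_real using cmod_cis_taylor[of "?a * ?h n"]
          by (simp add: divide_right_mono del: of_nat_Suc)
        also have "\<dots> = ?a\<^sup>2 * ?h n" by (simp add: power2_eq_square del: of_nat_Suc)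
        finally show "norm ((cis (2 * pi * m $ i * ?h n) - 1) / of_real (?h n) - \<i> * of_real (2 * pi * m $ i)) \<le> ?a\<^sup>2 * ?h n"
          .
      qed
      show "(\<lambda>n. ?a\<^sup>2 * ?h n) \<longlonglongrightarrow> 0"
        using tendsto_mult_right_zero[OF LIMSEQ_inverse_real_of_nat, of "?a\<^sup>2"] by (simp add: inverse_eq_divide)
    qed
    then have "(\<lambda>n. (cis (2 * pi * m $ i * ?h n) - 1) / of_real (?h n) * fourier f m) \<longlonglongrightarrow> \<i> * of_real (2 * pi * m $ i) * fourier f m"
      by (intro tendsto_intros)
    ultimately show ?thesis by (simp add: mult_ac)
  qed
  ultimately show ?thesis by (rule LIMSEQ_unique)
qed

lemma test_fun_deriv:
  assumes "\<phi> \<in> (test_funs :: (real ^ 'd::finite \<Rightarrow> real) set)"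
  shows "foldr pderivative is \<phi> differentiable_on UNIV" "continuous_on UNIV (foldr pderivative is \<phi>)"
    "torus_periodic (foldr pderivative is \<phi>)"
proof -
  show d: "foldr pderivative is \<phi> differentiable_on UNIV" for "is"
    using assms by (simp add: test_funs_def smooth_def)
  then show "continuous_on UNIV (foldr pderivative is \<phi>)" by (rule differentiable_imp_continuous_on)
  show "torus_periodic (foldr pderivative is \<phi>)"
  proof (induction "is")
    case Nil then show ?case using assms by (simp add: test_funs_def periodic_iff)
  next
    case (Cons a "is") then show ?case using pderivative_periodic[OF d[of "is"]] by simp
  qed
qed

lemmas test_fun_continuous = test_fun_deriv(2)[of _ "[]", simplified]
lemmas test_fun_periodic = test_fun_deriv(3)[of _ "[]", simplified]

text \<open>The derivative of order \<open>2 * k\<close> along one axis bounds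
  \<open>(m $ i) ^ (2 * k)\<close> times the coefficient, for each axis; the function itself bounds
  the coefficient.\<close>

lemma fourier_test_fun_rdecay:
  fixes \<phi> :: "real ^ 'd::finite \<Rightarrow> real"
  assumes \<phi>: "\<phi> \<in> test_funs"
  shows "rdecay (fourier \<phi>)"
proof (rule rdecay_bounded)
  fix k :: nat
  let ?n = "2 * k" and ?D = "CARD('d)"
  have f: "fourier (foldr pderivative (replicate n i) \<phi>) m = (2 * pi * \<i> * of_real (m $ i)) ^ n * fourier \<phi> m"
    if m: "m \<in> int_lattice" for m i n
  proof (induction n)
    case (Suc n)
    show ?case using Suc fourier_pderivative[OF test_fun_deriv(1)[OF \<phi>, of "replicate n i"] test_fun_deriv(3)[OF \<phi>] _ m, of i]
        test_fun_deriv(2)[OF \<phi>, of "replicate (Suc n) i"] by (simp add: mult.assoc)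
  qed simp
  have "\<exists>B. \<forall>x. \<bar>foldr pderivative (replicate ?n i) \<phi> x\<bar> \<le> B" for i
    using continuous_torus_bounded[OF test_fun_deriv(2,3)[OF \<phi>, of "replicate ?n i"]] by simp
  then obtain B where B: "\<And>i x. \<bar>foldr pderivative (replicate ?n i) \<phi> x\<bar> \<le> B i" by metis
  obtain B0 where B0: "\<And>x. \<bar>\<phi> x\<bar> \<le> B0"
    using continuous_torus_bounded[OF test_fun_continuous[OF \<phi>] test_fun_periodic[OF \<phi>]] by auto
  have B0': "cmod (fourier \<phi> m) \<le> B0" for m by (rule fourier_bound[OF test_fun_continuous[OF \<phi>] B0])
  have Bn: "B i \<ge> 0" for i using B[of i undefined] by linarith
  have c: "(m $ i)\<^sup>2 ^ k * cmod (fourier \<phi> m) \<le> B i" if m: "m \<in> int_lattice" for m i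
  proof -
    have "(m $ i)\<^sup>2 ^ k \<le> (2 * pi * \<bar>m $ i\<bar>) ^ ?n"
    proof -
      have "(m $ i)\<^sup>2 ^ k = \<bar>m $ i\<bar> ^ ?n" by (simp add: power_mult)
      also have "\<dots> \<le> (2 * pi * \<bar>m $ i\<bar>) ^ ?n"
        using mult_right_mono[of 1 "2 * pi" "\<bar>m $ i\<bar>"] pi_ge_two by (intro power_mono) auto
      finally show ?thesis .
    qed
    then have "(m $ i)\<^sup>2 ^ k * cmod (fourier \<phi> m) \<le> (2 * pi * \<bar>m $ i\<bar>) ^ ?n * cmod (fourier \<phi> m)"
      by (rule mult_right_mono) simp
    also have "\<dots> = cmod (fourier (foldr pderivative (replicate ?n i) \<phi>) m)"
      unfolding f[OF m] by (simp add: norm_mult norm_power)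
    also have "\<dots> \<le> B i" by (rule fourier_bound[OF test_fun_deriv(2)[OF \<phi>] B])
    finally show ?thesis .
  qed
  have "(1 + m \<bullet> m) ^ k * cmod (fourier \<phi> m) \<le> (1 + ?D) ^ k * (B0 + (\<Sum>i\<in>UNIV. B i))" if m: "m \<in> int_lattice" for m :: "real ^ 'd"
  proof -
    \<comment> \<open>The largest coordinate carries \<open>m \<bullet> m\<close> up to the factor
      \<open>d\<close>, so for each frequency a pure derivative along a single axis
      suffices.\<close>
    have "\<exists>j. \<forall>i. (m $ i)\<^sup>2 \<le> (m $ j)\<^sup>2"
    proof -
      have "Max (range (\<lambda>i. (m $ i)\<^sup>2)) \<in> range (\<lambda>i. (m $ i)\<^sup>2)" by (intro Max_in) auto
      then obtain j where "Max (range (\<lambda>i. (m $ i)\<^sup>2)) = (m $ j)\<^sup>2" unfolding image_iff by blast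
      then show ?thesis by (metis Max_ge finite_imageI finite rangeI)
    qed
    then obtain j where j: "\<And>i. (m $ i)\<^sup>2 \<le> (m $ j)\<^sup>2" by blast
    have "m \<bullet> m \<le> (\<Sum>i\<in>(UNIV :: 'd set). (m $ j)\<^sup>2)"
      unfolding inner_vec_def using j by (intro sum_mono) (simp add: power2_eq_square)
    then have mm: "m \<bullet> m \<le> ?D * (m $ j)\<^sup>2" by simp
    have "(1 + m \<bullet> m) ^ k \<le> ((1 + ?D) * max 1 ((m $ j)\<^sup>2)) ^ k"
    proof (rule power_mono)
      have "real ?D * (m $ j)\<^sup>2 \<le> real ?D * max 1 ((m $ j)\<^sup>2)" by (intro mult_left_mono) auto
      then show "1 + m \<bullet> m \<le> (1 + ?D) * max 1 ((m $ j)\<^sup>2)"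
        using mm max.cobounded1[of 1 "(m $ j)\<^sup>2"] unfolding of_nat_add of_nat_1 distrib_right mult_1_left by linarith
    qed simp
    then have "(1 + m \<bullet> m) ^ k * cmod (fourier \<phi> m) \<le> (1 + ?D) ^ k * (max 1 ((m $ j)\<^sup>2) ^ k * cmod (fourier \<phi> m))"
      unfolding power_mult_distrib of_nat_power mult.assoc[symmetric] by (rule mult_right_mono) simp
    also have "max 1 ((m $ j)\<^sup>2) ^ k * cmod (fourier \<phi> m) \<le> B0 + (\<Sum>i\<in>UNIV. B i)"
    proof -
      have "B j \<le> (\<Sum>i\<in>UNIV. B i)" by (rule member_le_sum) (auto simp: Bn)
      moreover have "B0 \<ge> 0" using B0[of undefined] by linarith
      moreover have "(\<Sum>i\<in>UNIV. B i) \<ge> 0" by (intro sum_nonneg Bn)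
      ultimately show ?thesis using c[OF m, of j] B0'[of m] by (auto simp: max_def)
    qed
    finally show ?thesis by (simp add: mult_left_mono)
  qed
  then show "\<exists>K. \<forall>m\<in>int_lattice. (1 + m \<bullet> m) ^ k * cmod (fourier \<phi> m) \<le> K" by blast
qed

lemma test_fun_rser: "\<phi> \<in> test_funs \<Longrightarrow> rser (fourier \<phi>) = (\<phi> :: real ^ 'd::finite \<Rightarrow> real)"
  by (intro rser_fourier test_fun_continuous test_fun_periodic rdecay_summable fourier_test_fun_rdecay)

section \<open>Convergence of Fourier series in the topology of test functions\<close>

lemma test_fun_diff_bdd:
  assumes "\<phi> \<in> (test_funs :: (real ^ 'd::finite \<Rightarrow> real) set)" "\<psi> \<in> test_funs"
  shows "bdd_above (range (\<lambda>x. \<bar>foldr pderivative is \<psi> x - foldr pderivative is \<phi> x\<bar>))"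
proof -
  have "\<exists>B. \<forall>x. norm (foldr pderivative is \<psi> x - foldr pderivative is \<phi> x) \<le> B"
    using test_fun_deriv[OF assms(1)] test_fun_deriv[OF assms(2)]
    by (intro continuous_torus_bounded continuous_intros) (auto simp: torus_periodic_def)
  then obtain B where "\<And>x. \<bar>foldr pderivative is \<psi> x - foldr pderivative is \<phi> x\<bar> \<le> B" by auto
  then show ?thesis by (rule bdd_aboveI2)
qed

abbreviation test_ball :: "'d list \<Rightarrow> (real ^ 'd \<Rightarrow> real) \<Rightarrow> real \<Rightarrow> (real ^ 'd \<Rightarrow> real) set" where
  "test_ball is \<phi> \<epsilon> \<equiv> {\<psi> \<in> test_funs. (SUP x. \<bar>foldr pderivative is \<psi> x - foldr pderivative is \<phi> x\<bar>) < \<epsilon>}"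

lemma openin_test_ball: "\<phi> \<in> test_funs \<Longrightarrow> \<epsilon> > 0 \<Longrightarrow> openin test_topology (test_ball is \<phi> \<epsilon>)"
  unfolding test_topology_def by (rule topology_generated_by_Basis) blast

lemma Union_test_balls:
  "\<Union> {test_ball is \<phi> \<epsilon> |is \<phi> \<epsilon>. \<phi> \<in> test_funs \<and> 0 < \<epsilon>} = (test_funs :: (real ^ 'd::finite \<Rightarrow> real) set)"
proof -
  have "\<phi> \<in> test_ball [] \<phi> 1" if "\<phi> \<in> (test_funs :: (real ^ 'd \<Rightarrow> real) set)" for \<phi>
    using that by simp
  then have "\<phi> \<in> \<Union> {test_ball is \<phi> \<epsilon> |is \<phi> \<epsilon>. \<phi> \<in> test_funs \<and> 0 < \<epsilon>}"
    if "\<phi> \<in> (test_funs :: (real ^ 'd \<Rightarrow> real) set)" for \<phi>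
    using that by (intro UnionI[of "test_ball [] \<phi> 1"] CollectI exI[of _ "[]"] exI[of _ \<phi>] exI[of _ 1]) auto
  moreover have "\<Union> {test_ball is \<phi> \<epsilon> |is \<phi> \<epsilon>. \<phi> \<in> test_funs \<and> 0 < \<epsilon>} \<subseteq> (test_funs :: (real ^ 'd \<Rightarrow> real) set)"
    by auto
  ultimately show ?thesis by (intro equalityI subsetI) auto
qed

lemma topspace_test_topology: "topspace test_topology = (test_funs :: (real ^ 'd::finite \<Rightarrow> real) set)"
  unfolding test_topology_def topology_generated_by_topspace by (rule Union_test_balls)

text \<open>Members of the subbase suffice: eventual membership is stable under finite intersections
  and arbitrary unions.\<close>

lemma limitin_generated:
  assumes "l \<in> \<Union>\<S>" "\<And>U. U \<in> \<S> \<Longrightarrow> l \<in> U \<Longrightarrow> \<forall>\<^sub>F x in F. f x \<in> U"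
  shows "limitin (topology_generated_by \<S>) f l F"
proof -
  have "l \<in> U \<longrightarrow> (\<forall>\<^sub>F x in F. f x \<in> U)" if "generate_topology_on \<S> U" for U
    using that
  proof (induction rule: generate_topology_on.induct)
    case (Int a b) then show ?case by (auto intro: eventually_elim2)
  next
    case (UN K)
    show ?case
    proof
      assume "l \<in> \<Union>K"
      then obtain X where X: "X \<in> K" "l \<in> X" by blast
      then have "\<forall>\<^sub>F x in F. f x \<in> X" using UN by blast
      then show "\<forall>\<^sub>F x in F. f x \<in> \<Union>K" by eventually_elim (use X in auto)
    qed
  qed (use assms(2) in auto)
  then show ?thesis using assms(1) by (auto simp: limitin_def openin_topology_generated_by_iff)
qed

text \<open>A derivative of a partial sum is the partial sum with differentiated coefficients, which
  converges uniformly. The subbasic balls are centred at arbitrary \<open>\<phi>\<close>, not at the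
  limit, so what has to be used up is the gap \<open>\<epsilon> - D\<close> that the limit leaves,
  and half of it is spent.\<close>

lemma rpart_limitin:
  assumes c: "rdecay (c :: real ^ 'd::finite \<Rightarrow> complex)"
  shows "limitin test_topology (\<lambda>F. rpart F c) (rser c) (finite_subsets_at_top int_lattice)"
  unfolding test_topology_def
proof (rule limitin_generated)
  show "rser c \<in> \<Union> {test_ball is \<phi> \<epsilon> |is \<phi> \<epsilon>. \<phi> \<in> test_funs \<and> 0 < \<epsilon>}"
    unfolding Union_test_balls by (rule rser_test_fun[OF c])
  fix U assume U: "U \<in> {test_ball is \<phi> \<epsilon> |is \<phi> \<epsilon>. \<phi> \<in> test_funs \<and> 0 < \<epsilon>}" "rser c \<in> U"
  then obtain "is" \<phi> \<epsilon> where \<phi>: "\<phi> \<in> test_funs" and U_eq: "U = test_ball is \<phi> \<epsilon>" by blast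
  let ?d = "foldr pderivative is"
  define D where "D = (SUP x. \<bar>?d (rser c) x - ?d \<phi> x\<bar>)"
  have D: "D < \<epsilon>" using U(2) unfolding U_eq D_def by simp
  have Dle: "\<bar>?d (rser c) x - ?d \<phi> x\<bar> \<le> D" for x
    unfolding D_def by (rule cSUP_upper[OF UNIV_I test_fun_diff_bdd[OF \<phi> rser_test_fun[OF c]]])
  have "\<forall>\<^sub>F F in finite_subsets_at_top int_lattice. \<forall>x\<in>UNIV. dist (rpart F (foldr dcoef is c) x) (rser (foldr dcoef is c) x) < (\<epsilon> - D) / 2"
    using D rser_foldr_pderivative[OF c, of "is"] by (intro uniform_limitD rser_uniform_limit rdecay_summable) auto
  moreover have "\<forall>\<^sub>F F in finite_subsets_at_top int_lattice. finite F \<and> F \<subseteq> (int_lattice :: (real ^ 'd) set)"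
    by (simp add: eventually_finite_subsets_at_top_weakI)
  ultimately show "\<forall>\<^sub>F F in finite_subsets_at_top int_lattice. rpart F c \<in> U"
  proof eventually_elim
    case (elim F)
    let ?c = "\<lambda>m. if m \<in> F then c m else 0"
    have eq: "rpart F c = rser ?c" using elim by (intro rpart_eq_rser) auto
    have rd: "rdecay ?c" using elim by (intro rdecay_finite) auto
    have "foldr dcoef is ?c = (\<lambda>m. if m \<in> F then foldr dcoef is c m else 0)"
    proof (induction "is")
      case (Cons a "is")
      then show ?case by (simp add: dcoef_def[of a] fun_eq_iff)
    qed (simp add: fun_eq_iff)
    then have deq: "?d (rser ?c) = rpart F (foldr dcoef is c)"
      using rser_foldr_pderivative[OF rd, of "is"] elim by (subst rpart_eq_rser) auto
    have "\<bar>?d (rser ?c) x - ?d \<phi> x\<bar> \<le> (\<epsilon> - D) / 2 + D" for x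
    proof -
      have "\<bar>?d (rser ?c) x - ?d (rser c) x\<bar> \<le> (\<epsilon> - D) / 2"
        using elim rser_foldr_pderivative[OF c, of "is"] unfolding deq by (auto simp: dist_real_def less_imp_le)
      then show ?thesis using Dle[of x] by linarith
    qed
    then have "(SUP x. \<bar>?d (rser ?c) x - ?d \<phi> x\<bar>) \<le> (\<epsilon> - D) / 2 + D" by (intro cSUP_least) auto
    also have "\<dots> < \<epsilon>" using D by (simp add: field_simps)
    finally show ?case unfolding U_eq eq using rser_test_fun[OF rd] by simp
  qed
qed

section \<open>Fourier coefficients of distributions\<close>

text \<open>The value on the conjugate mode, assembled from real test functions because functionals
  act only on these; hence the minus sign at the sine.\<close>

definition fcoef :: "'d::finite functional \<Rightarrow> real ^ 'd \<Rightarrow> complex" where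
  "fcoef f m = Complex (f (\<lambda>x. cos (2 * pi * (m \<bullet> x)))) (- f (\<lambda>x. sin (2 * pi * (m \<bullet> x))))"

lemma distribution_linear:
  assumes "f \<in> distributions" "\<phi> \<in> test_funs" "\<psi> \<in> test_funs"
  shows "f (\<lambda>x. a * \<phi> x + b * \<psi> x) = a * f \<phi> + b * f \<psi>"
  using assms unfolding distributions_def by blast

lemma Re_mode_test_fun: "m \<in> int_lattice \<Longrightarrow> (\<lambda>x. Re (c * mode m x)) \<in> (test_funs :: (real ^ 'd::finite \<Rightarrow> real) set)"
  using rser_test_fun[OF rdecay_finite[of "{m}" "\<lambda>_. c"]] rpart_eq_rser[of "{m}" "\<lambda>_. c"]
  by (simp add: rpart_def[abs_def])

lemma distribution_Re_mode:
  assumes f: "f \<in> distributions" and m: "m \<in> int_lattice"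
  shows "f (\<lambda>x. Re (c * mode m x)) = Re (c * cnj (fcoef f m))"
proof -
  have cs: "(\<lambda>x. cos (2 * pi * (m \<bullet> x))) \<in> test_funs" "(\<lambda>x. sin (2 * pi * (m \<bullet> x))) \<in> test_funs"
    using Re_mode_test_fun[OF m, of 1] Re_mode_test_fun[OF m, of "-\<i>"] by (simp_all add: mode_def)
  have "(\<lambda>x. Re (c * mode m x)) = (\<lambda>x. Re c * cos (2 * pi * (m \<bullet> x)) + (- Im c) * sin (2 * pi * (m \<bullet> x)))"
    by (simp add: mode_def)
  then have "f (\<lambda>x. Re (c * mode m x)) = Re c * f (\<lambda>x. cos (2 * pi * (m \<bullet> x))) + (- Im c) * f (\<lambda>x. sin (2 * pi * (m \<bullet> x)))"
    using distribution_linear[OF f cs, of "Re c" "- Im c"] by metis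
  then show ?thesis by (simp add: fcoef_def)
qed

lemma distribution_rpart:
  assumes f: "f \<in> distributions" and F: "finite F" "F \<subseteq> int_lattice"
  shows "f (rpart F c) = (\<Sum>m\<in>F. Re (c m * cnj (fcoef f m)))"
  using F
proof (induction F rule: finite_induct)
  case empty
  have "f (\<lambda>x. 0 * Re (0 * mode 0 x) + 0 * Re (0 * mode 0 x)) = 0"
    by (subst distribution_linear[OF f Re_mode_test_fun Re_mode_test_fun]) auto
  then show ?case by (simp add: rpart_def[abs_def])
next
  case (insert m F)
  have "rpart (insert m F) c = (\<lambda>x. 1 * Re (c m * mode m x) + 1 * rpart F c x)"
    using insert by (auto simp: rpart_def)
  moreover have "rpart F c \<in> test_funs"
    using insert by (subst rpart_eq_rser) (auto intro!: rser_test_fun rdecay_finite)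
  ultimately have "f (rpart (insert m F) c) = f (\<lambda>x. Re (c m * mode m x)) + f (rpart F c)"
    using distribution_linear[OF f Re_mode_test_fun[of m "c m"], of "rpart F c" 1 1] insert by simp
  then show ?case using insert distribution_Re_mode[OF f, of m "c m"] by (simp del: times_complex.sel)
qed

text \<open>Continuity on test functions passes from finite partial sums to the whole series. Since
  every test function is such a series, a distribution is determined by its coefficients.\<close>

lemma distribution_rser:
  assumes f: "f \<in> distributions" and c: "rdecay c"
  shows "((\<lambda>m. Re (c m * cnj (fcoef f m))) has_sum f (rser c)) int_lattice"
proof -
  have "continuous_map test_topology euclideanreal f" using f by (simp add: distributions_def)
  from continuous_map_limit[OF this rpart_limitin[OF c]]
  have "((\<lambda>F. f (rpart F c)) \<longlongrightarrow> f (rser c)) (finite_subsets_at_top int_lattice)" by (simp add: o_def)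
  moreover have "\<forall>\<^sub>F F in finite_subsets_at_top int_lattice. f (rpart F c) = (\<Sum>m\<in>F. Re (c m * cnj (fcoef f m)))"
    using distribution_rpart[OF f] by (intro eventually_finite_subsets_at_top_weakI)
  ultimately show ?thesis unfolding has_sum_def by (simp add: tendsto_cong)
qed

lemma distribution_has_sum:
  assumes f: "f \<in> distributions" and \<phi>: "\<phi> \<in> test_funs"
  shows "((\<lambda>m. Re (fourier \<phi> m * cnj (fcoef f m))) has_sum f \<phi>) int_lattice"
  using distribution_rser[OF f fourier_test_fun_rdecay[OF \<phi>]] by (simp add: test_fun_rser[OF \<phi>])

lemma distribution_eqI:
  assumes f: "f \<in> distributions" and g: "g \<in> distributions"
    and eq: "\<And>m. m \<in> int_lattice \<Longrightarrow> fcoef f m = fcoef g m"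
  shows "f = g"
proof
  fix \<phi>
  show "f \<phi> = g \<phi>"
  proof (cases "\<phi> \<in> test_funs")
    case True
    have "((\<lambda>m. Re (fourier \<phi> m * cnj (fcoef f m))) has_sum g \<phi>) int_lattice"
      using distribution_has_sum[OF g True] by (rule has_sum_cong[THEN iffD1, rotated]) (simp add: eq)
    with distribution_has_sum[OF f True] show ?thesis by (rule has_sum_unique)
  next
    case False then show ?thesis using f g by (simp add: distributions_def)
  qed
qed

text \<open>Continuity only involves the supremum seminorm, the one with the empty list of
  derivatives. Linearity is an issue because \<open>dist_of\<close> vanishes off the test functions,
  so that combinations must be known to be test functions.\<close>

lemma dist_of_distribution:
  fixes u :: "real ^ 'd::finite \<Rightarrow> real"
  assumes u: "continuous_on UNIV u" "torus_periodic u"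
  shows "dist_of u \<in> distributions"
proof -
  obtain B where B: "\<And>x. \<bar>u x\<bar> \<le> B" using continuous_torus_bounded[OF u] by auto
  have B0: "B \<ge> 0" using B[of undefined] by linarith
  have i: "integrable torus (\<lambda>x. u x * \<phi> x)" if "\<phi> \<in> test_funs" for \<phi>
    by (intro integrable_torus_continuous continuous_intros u test_fun_continuous that)
  have lin: "dist_of u (\<lambda>x. a * \<phi> x + b * \<psi> x) = a * dist_of u \<phi> + b * dist_of u \<psi>"
    if t: "\<phi> \<in> test_funs" "\<psi> \<in> test_funs" for \<phi> \<psi> a b
  proof -
    \<comment> \<open>A combination is recognised as a test function from its coefficients: they
      decay rapidly, and it equals the series that they define.\<close>
    have s: "rdecay (\<lambda>m. of_real a * fourier \<phi> m + of_real b * fourier \<psi> m)"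
      unfolding rdecay_def
    proof
      fix k
      have "(\<lambda>m. \<bar>a\<bar> * ((1 + m \<bullet> m) ^ k * cmod (fourier \<phi> m)) + \<bar>b\<bar> * ((1 + m \<bullet> m) ^ k * cmod (fourier \<psi> m))) summable_on int_lattice"
        using t fourier_test_fun_rdecay unfolding rdecay_def by (intro summable_on_add summable_on_cmult_right) auto
      then show "(\<lambda>m. (1 + m \<bullet> m) ^ k * cmod (of_real a * fourier \<phi> m + of_real b * fourier \<psi> m)) summable_on int_lattice"
      proof (rule summable_on_comparison_test)
        fix m :: "real ^ 'd"
        have "cmod (of_real a * fourier \<phi> m + of_real b * fourier \<psi> m) \<le> \<bar>a\<bar> * cmod (fourier \<phi> m) + \<bar>b\<bar> * cmod (fourier \<psi> m)"
          by (rule norm_triangle_le) (simp add: norm_mult)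
        from mult_left_mono[OF this, of "(1 + m \<bullet> m) ^ k"]
        show "(1 + m \<bullet> m) ^ k * cmod (of_real a * fourier \<phi> m + of_real b * fourier \<psi> m) \<le>
          \<bar>a\<bar> * ((1 + m \<bullet> m) ^ k * cmod (fourier \<phi> m)) + \<bar>b\<bar> * ((1 + m \<bullet> m) ^ k * cmod (fourier \<psi> m))"
          by (simp add: algebra_simps)
      qed auto
    qed
    have c: "continuous_on UNIV (\<lambda>x. a * \<phi> x + b * \<psi> x)" by (intro continuous_intros test_fun_continuous t)
    have eq: "fourier (\<lambda>x. a * \<phi> x + b * \<psi> x) = (\<lambda>m. of_real a * fourier \<phi> m + of_real b * fourier \<psi> m)"
    proof
      fix m
      have "fourier (\<lambda>x. a * \<phi> x + b * \<psi> x) m = fourier (\<lambda>x. a * \<phi> x) m + fourier (\<lambda>x. b * \<psi> x) m"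
        using test_fun_continuous[OF t(1)] test_fun_continuous[OF t(2)] by (intro fourier_add continuous_intros)
      then show "fourier (\<lambda>x. a * \<phi> x + b * \<psi> x) m = of_real a * fourier \<phi> m + of_real b * fourier \<psi> m"
        by (simp add: fourier_cmult)
    qed
    have "(\<lambda>x. a * \<phi> x + b * \<psi> x) = rser (fourier (\<lambda>x. a * \<phi> x + b * \<psi> x))"
      using torus_periodicD[OF test_fun_periodic[OF t(1)]] torus_periodicD[OF test_fun_periodic[OF t(2)]]
      by (intro rser_fourier[symmetric] c) (simp_all add: eq torus_periodic_def rdecay_summable[OF s])
    also note eq
    finally have "(\<lambda>x. a * \<phi> x + b * \<psi> x) \<in> test_funs" using rser_test_fun[OF s] by simp
    then show ?thesis using t i
      by (simp add: dist_of_def ring_distribs mult.left_commute[of _ a] mult.left_commute[of _ b])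
  qed
  have "continuous_map test_topology euclideanreal (dist_of u)"
    unfolding continuous_map_def
  proof (intro conjI allI impI)
    fix V :: "real set" assume "openin euclideanreal V"
    then have V: "open V" by simp
    show "openin test_topology {\<phi> \<in> topspace test_topology. dist_of u \<phi> \<in> V}"
      unfolding openin_subopen[of _ "{\<phi> \<in> topspace test_topology. dist_of u \<phi> \<in> V}"]
    proof
      fix \<phi> assume "\<phi> \<in> {\<phi> \<in> topspace test_topology. dist_of u \<phi> \<in> V}"
      then have \<phi>: "\<phi> \<in> test_funs" "dist_of u \<phi> \<in> V" by (auto simp: topspace_test_topology)
      obtain e where e: "e > 0" "\<And>y. dist y (dist_of u \<phi>) < e \<Longrightarrow> y \<in> V"
        using V \<phi>(2) unfolding open_dist by blast
      define d where "d = e / (B + 1)"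
      have d: "d > 0" using e B0 by (simp add: d_def)
      have "dist_of u \<psi> \<in> V" if \<psi>: "\<psi> \<in> test_ball [] \<phi> d" for \<psi>
      proof (rule e(2))
        have \<psi>': "\<psi> \<in> test_funs" "(SUP x. \<bar>\<psi> x - \<phi> x\<bar>) < d" using \<psi> by auto
        have le: "\<bar>\<psi> x - \<phi> x\<bar> \<le> d" for x
        proof -
          have "\<bar>\<psi> x - \<phi> x\<bar> \<le> (SUP x. \<bar>\<psi> x - \<phi> x\<bar>)"
            using test_fun_diff_bdd[OF \<phi>(1) \<psi>'(1), of "[]"] by (intro cSUP_upper) auto
          then show ?thesis using \<psi>' by linarith
        qed
        have "dist (dist_of u \<psi>) (dist_of u \<phi>) = norm (LINT x|torus. u x * (\<psi> x - \<phi> x))"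
          using \<phi> \<psi>' i by (simp add: dist_of_def dist_norm right_diff_distrib)
        also have "\<dots> \<le> B * d"
          using B le B0 test_fun_continuous[OF \<phi>(1)] test_fun_continuous[OF \<psi>'(1)]
          by (intro norm_torus_integral_le continuous_intros u) (auto simp: abs_mult intro!: mult_mono)
        also have "\<dots> < e" using e B0 by (simp add: d_def field_simps)
        finally show "dist (dist_of u \<psi>) (dist_of u \<phi>) < e" .
      qed
      then show "\<exists>T. openin test_topology T \<and> \<phi> \<in> T \<and> T \<subseteq> {\<phi> \<in> topspace test_topology. dist_of u \<phi> \<in> V}"
        using openin_test_ball[OF \<phi>(1) d, of "[]"] \<phi> d
        by (intro exI[of _ "test_ball [] \<phi> d"]) (auto simp: topspace_test_topology)
    qed
  qed auto
  then show ?thesis using lin by (simp add: distributions_def dist_of_def)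
qed

lemma cos_sin_test_fun:
  assumes "m \<in> int_lattice"
  shows "(\<lambda>x. cos (2 * pi * (m \<bullet> x))) \<in> (test_funs :: (real ^ 'd::finite \<Rightarrow> real) set)"
    "(\<lambda>x. sin (2 * pi * (m \<bullet> x))) \<in> (test_funs :: (real ^ 'd::finite \<Rightarrow> real) set)"
  using Re_mode_test_fun[OF assms, of 1] Re_mode_test_fun[OF assms, of "-\<i>"] by (simp_all add: mode_def)

lemma fcoef_dist_of:
  fixes u :: "real ^ 'd::finite \<Rightarrow> real"
  assumes u: "continuous_on UNIV u" and m: "m \<in> int_lattice"
  shows "fcoef (dist_of u) m = fourier u m"
proof -
  have i: "integrable torus (\<lambda>x. of_real (u x) * cnj (mode m x))"
    by (intro integrable_torus_continuous continuous_of_real_mult_mode u)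
  have "Re (fourier u m) = (LINT x|torus. u x * cos (2 * pi * (m \<bullet> x)))"
    unfolding fourier_def by (subst integral_Re[OF i, symmetric]) (simp add: mode_def)
  moreover have "Im (fourier u m) = (LINT x|torus. - (u x * sin (2 * pi * (m \<bullet> x))))"
    unfolding fourier_def by (subst integral_Im[OF i, symmetric]) (simp add: mode_def)
  ultimately show ?thesis
    using m by (simp add: fcoef_def dist_of_def complex_eq_iff cos_sin_test_fun)
qed

lemma fcoef_minus:
  assumes f: "f \<in> distributions" and m: "m \<in> int_lattice"
  shows "fcoef f (- m) = cnj (fcoef f m)"
proof -
  have "f (\<lambda>x. - 1 * sin (2 * pi * (m \<bullet> x)) + 0 * sin (2 * pi * (m \<bullet> x))) = - 1 * f (\<lambda>x. sin (2 * pi * (m \<bullet> x))) + 0 * f (\<lambda>x. sin (2 * pi * (m \<bullet> x)))"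
    by (rule distribution_linear[OF f cos_sin_test_fun(2)[OF m] cos_sin_test_fun(2)[OF m]])
  then show ?thesis by (simp add: fcoef_def complex_eq_iff)
qed

lemma distribution_diff:
  assumes f: "f \<in> distributions" and g: "g \<in> distributions"
  shows "(\<lambda>\<phi>. f \<phi> - g \<phi>) \<in> distributions"
  using f g unfolding distributions_def
  by (auto intro!: continuous_intros simp: algebra_simps)

lemma fcoef_diff: "fcoef (\<lambda>\<phi>. f \<phi> - g \<phi>) m = fcoef f m - fcoef g m"
  by (simp add: fcoef_def complex_eq_iff)

lemma fun_of_dist_of:
  fixes u :: "real ^ 'd::finite \<Rightarrow> real"
  assumes u: "continuous_on UNIV u" "torus_periodic u"
  shows "fun_of (dist_of u) = u"
  unfolding fun_of_def
proof (rule the_equality)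
  show "continuous_on UNIV u \<and> periodic u \<and> dist_of u = dist_of u" using u by (simp add: periodic_iff)
  fix v assume v: "continuous_on UNIV v \<and> periodic v \<and> dist_of u = dist_of v"
  then show "v = u"
    by (intro fourier_eq_imp_eq u) (auto simp: periodic_iff fcoef_dist_of[symmetric] u)
qed

text \<open>For a continuous periodic function an almost sure bound holds everywhere, so the
  essential supremum is the supremum.\<close>

lemma Linf_norm_continuous:
  fixes u :: "real ^ 'd::finite \<Rightarrow> real"
  assumes u: "continuous_on UNIV u" "torus_periodic u"
  shows "Linf_norm u = ennreal (SUP x. \<bar>u x\<bar>)"
proof (rule antisym)
  obtain B where B: "\<And>x. \<bar>u x\<bar> \<le> B" using continuous_torus_bounded[OF u] by auto
  have bdd: "bdd_above (range (\<lambda>x. \<bar>u x\<bar>))" using B by (rule bdd_aboveI2)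
  have meas: "(\<lambda>x. ennreal \<bar>u x\<bar>) \<in> borel_measurable torus"
  proof -
    have "continuous_on UNIV (\<lambda>x. \<bar>u x\<bar>)" by (intro continuous_intros u)
    from torus_measurable_borel[OF borel_measurable_continuous_onI[OF this]] show ?thesis
      by (rule measurable_compose) (rule measurable_ennreal)
  qed
  show "Linf_norm u \<le> ennreal (SUP x. \<bar>u x\<bar>)"
    unfolding Linf_norm_def by (rule esssup_I, rule meas, intro AE_I2 ennreal_leI cSUP_upper bdd) auto
  show "ennreal (SUP x. \<bar>u x\<bar>) \<le> Linf_norm u"
  proof (cases "Linf_norm u")
    case (real e)
    have "AE x in torus. ennreal \<bar>u x\<bar> \<le> ennreal e"
      using esssup_AE[of "\<lambda>x. ennreal \<bar>u x\<bar>" torus] real unfolding Linf_norm_def by simp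
    then have ae: "AE x in torus. \<bar>u x\<bar> \<le> e" by eventually_elim (use real in simp)
    have "\<bar>u x\<bar> \<le> e" if "x \<in> unit_cube" for x
      by (rule AE_torus_le_continuous[OF _ ae that]) (intro continuous_intros u)
    then have "\<bar>u x\<bar> \<le> e" for x using torus_periodic_unit_cube[OF u(2), of "\<lambda>y. \<bar>y\<bar> \<le> e"] by blast
    then show ?thesis unfolding real by (intro ennreal_leI cSUP_least) auto
  qed simp
qed

section \<open>Littlewood-Paley blocks and the Besov metric\<close>

locale littlewood_paley =
  fixes \<rho> :: "int \<Rightarrow> real ^ 'd::finite \<Rightarrow> real"
  assumes partition: "dyadic_partition \<rho>"
begin

text \<open>The index is shifted by one: \<open>bump n\<close> belongs to the level \<open>n - 1\<close>.\<close>

definition bump :: "nat \<Rightarrow> real ^ 'd \<Rightarrow> real" where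
  "bump n = \<rho> (int n - 1)"

lemma bump_Suc: "bump (Suc q) x = \<rho> 0 ((1 / 2 ^ q) *\<^sub>R x)"
proof (cases "q = 0")
  case False
  then have "\<rho> (int q) = (\<lambda>x. \<rho> 0 ((1 / 2 ^ q) *\<^sub>R x))" using partition unfolding dyadic_partition_def by auto
  then show ?thesis by (simp add: bump_def)
qed (simp add: bump_def)

lemma rho_facts:
  shows "0 \<le> \<rho> (-1) x" "0 \<le> \<rho> 0 x" "\<rho> (-1) x \<noteq> 0 \<Longrightarrow> norm x \<le> 4/3" "\<rho> 0 x \<noteq> 0 \<Longrightarrow> 3/4 \<le> norm x \<and> norm x \<le> 8/3"
    "norm x = norm y \<Longrightarrow> \<rho> (-1) x = \<rho> (-1) y" "norm x = norm y \<Longrightarrow> \<rho> 0 x = \<rho> 0 y"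
    "\<rho> (-1) x + (\<Sum>q::nat. \<rho> 0 ((1 / 2 ^ q) *\<^sub>R x)) = 1"
proof -
  have p: "\<forall>j\<in>{-1, 0}. smooth (\<rho> j) \<and> (\<forall>x. 0 \<le> \<rho> j x) \<and> (\<forall>x y. norm x = norm y \<longrightarrow> \<rho> j x = \<rho> j y)"
    "closure {y. \<rho> (-1) y \<noteq> 0} \<subseteq> {y. norm y \<le> 4/3}"
    "closure {y. \<rho> 0 y \<noteq> 0} \<subseteq> {y. 3/4 \<le> norm y \<and> norm y \<le> 8/3}"
    "\<forall>x. \<rho> (-1) x + (\<Sum>q::nat. \<rho> 0 ((1 / 2 ^ q) *\<^sub>R x)) = 1"
    using partition unfolding dyadic_partition_def by blast+
  have m: "(\<forall>x. 0 \<le> \<rho> j x) \<and> (\<forall>x y. norm x = norm y \<longrightarrow> \<rho> j x = \<rho> j y)" if "j \<in> {-1, 0}" for j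
    using conjunct2[OF bspec[OF p(1) that]] .
  have m1: "(\<forall>x. 0 \<le> \<rho> (-1) x) \<and> (\<forall>x y. norm x = norm y \<longrightarrow> \<rho> (-1) x = \<rho> (-1) y)"
    and m0: "(\<forall>x. 0 \<le> \<rho> 0 x) \<and> (\<forall>x y. norm x = norm y \<longrightarrow> \<rho> 0 x = \<rho> 0 y)"
    by (rule m, simp)+
  show "0 \<le> \<rho> (-1) x" by (rule conjunct1[OF m1, THEN spec])
  show "0 \<le> \<rho> 0 x" by (rule conjunct1[OF m0, THEN spec])
  show "norm x = norm y \<Longrightarrow> \<rho> (-1) x = \<rho> (-1) y"
    by (rule conjunct2[OF m1, THEN spec, THEN spec, THEN mp])
  show "norm x = norm y \<Longrightarrow> \<rho> 0 x = \<rho> 0 y"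
    by (rule conjunct2[OF m0, THEN spec, THEN spec, THEN mp])
  show "\<rho> (-1) x + (\<Sum>q::nat. \<rho> 0 ((1 / 2 ^ q) *\<^sub>R x)) = 1"
    by (rule spec[OF p(4)])
  show "\<rho> (-1) x \<noteq> 0 \<Longrightarrow> norm x \<le> 4/3"
    using subsetD[OF p(2) subsetD[OF closure_subset, of x]] by simp
  show "\<rho> 0 x \<noteq> 0 \<Longrightarrow> 3/4 \<le> norm x \<and> norm x \<le> 8/3"
    using subsetD[OF p(3) subsetD[OF closure_subset, of x]] by simp
qed

lemma bump_nonneg: "0 \<le> bump n x"
  by (cases n) (simp_all add: bump_Suc rho_facts(1,2), simp add: bump_def rho_facts(1))

lemma bump_minus: "bump n (- x) = bump n x"
proof (cases n)
  case 0 then show ?thesis using rho_facts(5)[of "-x" x] by (simp add: bump_def)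
next
  case (Suc q) then show ?thesis using rho_facts(6)[of "(1 / 2 ^ q) *\<^sub>R (-x)" "(1 / 2 ^ q) *\<^sub>R x"] by (simp add: bump_Suc)
qed

text \<open>These are the radii \<open>3/4\<close> and \<open>8/3\<close> scaled by
  \<open>2 ^ (n - 1)\<close>, as the index is one above the level. For \<open>n = 0\<close> the ball
  of radius \<open>4/3\<close> fits the same upper bound.\<close>

lemma bump_support:
  assumes "bump n x \<noteq> 0" shows "norm x \<le> 4/3 * 2 ^ n" and "n > 0 \<Longrightarrow> 3/8 * 2 ^ n \<le> norm x"
proof -
  have "norm x \<le> 4/3 * 2 ^ n \<and> (n > 0 \<longrightarrow> 3/8 * 2 ^ n \<le> norm x)"
  proof (cases n)
    case 0 then show ?thesis using assms rho_facts(3)[of x] by (simp add: bump_def)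
  next
    case (Suc q)
    then have "3/4 \<le> norm x / 2 ^ q \<and> norm x / 2 ^ q \<le> 8/3" using assms rho_facts(4)[of "(1 / 2 ^ q) *\<^sub>R x"] by (simp add: bump_Suc)
    then show ?thesis using Suc by (simp add: field_simps)
  qed
  then show "norm x \<le> 4/3 * 2 ^ n" "n > 0 \<Longrightarrow> 3/8 * 2 ^ n \<le> norm x" by auto
qed

text \<open>Extends the lower bound to \<open>n = 0\<close>, where it holds because a non-zero
  lattice point has norm at least \<open>1\<close>.\<close>

lemma bump_support_lattice:
  assumes "bump n m \<noteq> 0" "m \<in> int_lattice" "m \<noteq> 0" shows "3/8 * 2 ^ n \<le> norm m"
  using bump_support(2)[OF assms(1)] int_lattice_norm_ge_1[OF assms(2,3)] by (cases n) auto

text \<open>The partition condition is an equation for \<open>suminf\<close>, which carries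
  information only once the series is known to converge. It does, as only finitely many annuli meet
  a given point.\<close>

lemma bump_sums: "(\<lambda>n. bump n x) sums 1"
proof -
  obtain N :: nat where N: "norm x / (3/4) < 2 ^ N" using real_arch_pow[of 2 "norm x / (3/4)"] by auto
  have "summable (\<lambda>q. bump (Suc q) x)"
  proof (rule summable_finite[of "{..N}"])
    fix q assume "q \<notin> {..N}"
    then have "(2::real) ^ N \<le> 2 ^ q" by (intro power_increasing) auto
    moreover have "norm x < 3/4 * 2 ^ N" using N by (simp add: field_simps)
    ultimately have "norm x < 3/4 * 2 ^ q" by linarith
    then have "norm ((1 / 2 ^ q) *\<^sub>R x) < 3/4" by (simp add: field_simps)
    then show "bump (Suc q) x = 0" using rho_facts(4)[of "(1 / 2 ^ q) *\<^sub>R x"] unfolding bump_Suc by force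
  qed simp
  then have "(\<lambda>q. bump (Suc q) x) sums (\<Sum>q. bump (Suc q) x)" by (rule summable_sums)
  then have "(\<lambda>n. bump n x) sums ((\<Sum>q. bump (Suc q) x) + bump 0 x)" by (rule sums_Suc)
  moreover have "(\<Sum>q. bump (Suc q) x) + bump 0 x = 1"
    using rho_facts(7)[of x] by (simp add: bump_Suc) (simp add: bump_def)
  ultimately show ?thesis by simp
qed

lemma bump_le_1: "bump n x \<le> 1"
  using sum_le_suminf[OF sums_summable[OF bump_sums[of x]], of "{n}"] sums_unique[OF bump_sums[of x]] bump_nonneg by simp

definition freqs :: "nat \<Rightarrow> (real ^ 'd) set" where
  "freqs n = {m \<in> int_lattice. norm m \<le> 4/3 * 2 ^ n}"

lemma finite_freqs [simp]: "finite (freqs n)" unfolding freqs_def by (rule finite_lattice_ball)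

lemma freqs_sub: "freqs n \<subseteq> int_lattice" by (auto simp: freqs_def)

lemma bump_freqs: "m \<in> int_lattice \<Longrightarrow> m \<notin> freqs n \<Longrightarrow> bump n m = 0"
  using bump_support(1) by (auto simp: freqs_def)

lemma freqs_minus: "- m \<in> freqs n \<longleftrightarrow> m \<in> freqs n"
  by (simp add: freqs_def)

text \<open>Acts on coefficient functions rather than on distributions, so that the same estimates
  serve for distributions, for continuous functions and for the coefficients of the Duhamel
  term.\<close>

definition block :: "nat \<Rightarrow> (real ^ 'd \<Rightarrow> complex) \<Rightarrow> real ^ 'd \<Rightarrow> real" where
  "block n c = rpart (freqs n) (\<lambda>m. of_real (bump n m) * c m)"

lemma block_eq: "block n c x = (\<Sum>m\<in>freqs n. bump n m * Re (c m * mode m x))"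
  unfolding block_def rpart_def by (intro sum.cong refl) (simp add: algebra_simps)

lemma continuous_block: "continuous_on S (block n c)"
  unfolding block_def by (rule continuous_rpart)

lemma block_periodic: "torus_periodic (block n c)"
  unfolding block_def by (rule rpart_periodic[OF freqs_sub])

definition bsup :: "nat \<Rightarrow> (real ^ 'd \<Rightarrow> complex) \<Rightarrow> real" where
  "bsup n c = (SUP x. \<bar>block n c x\<bar>)"

lemma block_le_sum: "\<bar>block n c x\<bar> \<le> (\<Sum>m\<in>freqs n. bump n m * cmod (c m))"
  unfolding block_eq
  by (rule order_trans[OF sum_abs], rule sum_mono) (simp add: abs_mult bump_nonneg mult_left_mono abs_Re_mode_le del: times_complex.sel)

lemma bsup_bdd: "bdd_above (range (\<lambda>x. \<bar>block n c x\<bar>))"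
  by (rule bdd_aboveI2[OF block_le_sum])

lemma block_le_bsup: "\<bar>block n c x\<bar> \<le> bsup n c"
  unfolding bsup_def by (rule cSUP_upper[OF UNIV_I bsup_bdd])

lemma bsup_le: "(\<And>x. \<bar>block n c x\<bar> \<le> B) \<Longrightarrow> bsup n c \<le> B"
  unfolding bsup_def by (rule cSUP_least) auto

lemma bsup_nonneg [simp]: "0 \<le> bsup n c"
  using block_le_bsup[of n c 0] by linarith

lemma bsup_le_sum: "bsup n c \<le> (\<Sum>m\<in>freqs n. bump n m * cmod (c m))"
  by (rule bsup_le[OF block_le_sum])

lemma bsup_cong:
  assumes "\<And>m. m \<in> int_lattice \<Longrightarrow> c m = d m" shows "bsup n c = bsup n d"
proof -
  have "block n c x = block n d x" for x
    unfolding block_eq by (intro sum.cong refl) (simp add: assms[OF subsetD[OF freqs_sub]])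
  then show ?thesis by (simp add: bsup_def)
qed

lemma bsup_add: "bsup n (\<lambda>m. c m + d m) \<le> bsup n c + bsup n d"
proof (rule bsup_le)
  fix x
  have "block n (\<lambda>m. c m + d m) x = block n c x + block n d x"
    unfolding block_eq sum.distrib[symmetric] by (intro sum.cong refl) (simp add: algebra_simps)
  then show "\<bar>block n (\<lambda>m. c m + d m) x\<bar> \<le> bsup n c + bsup n d"
    using block_le_bsup[of n c x] block_le_bsup[of n d x] by linarith
qed

lemma bsup_uminus: "bsup n (\<lambda>m. - c m) = bsup n c"
proof -
  have "block n (\<lambda>m. - c m) x = - block n c x" for x
    unfolding block_eq sum_negf[symmetric] by (intro sum.cong refl) (simp add: algebra_simps)
  then show ?thesis unfolding bsup_def by simp
qed

lemma bsup_diff: "bsup n (\<lambda>m. c m - d m) \<le> bsup n c + bsup n d"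
  using bsup_add[of n c "\<lambda>m. - d m"] by (simp add: bsup_uminus)

text \<open>As a function of \<open>y\<close> the kernel at \<open>y - x\<close> is a finite real
  trigonometric sum with coefficients \<open>bump n m * cnj (mode m x)\<close>; a distribution acts
  on it term by term.\<close>

lemma LP_block_eq:
  assumes f: "f \<in> distributions"
  shows "LP_block \<rho> (int n - 1) f = block n (fcoef f)"
proof
  fix x
  have K: "LP_kernel \<rho> (int n - 1) (y - x) = rpart (freqs n) (\<lambda>m. of_real (bump n m) * cnj (mode m x)) y" for y
  proof -
    have "LP_kernel \<rho> (int n - 1) (y - x) = (\<Sum>\<^sub>\<infinity>m\<in>freqs n. bump n m * cos (2 * pi * ((y - x) \<bullet> m)))"
      unfolding LP_kernel_def bump_def[symmetric] by (rule infsum_cong_neutral) (use bump_freqs freqs_sub in auto)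
    also have "\<dots> = (\<Sum>m\<in>freqs n. bump n m * cos (2 * pi * ((y - x) \<bullet> m)))" by simp
    also have "\<dots> = rpart (freqs n) (\<lambda>m. of_real (bump n m) * cnj (mode m x)) y"
      unfolding rpart_def
    proof (rule sum.cong[OF refl])
      fix m
      have eq: "of_real (bump n m) * cnj (mode m x) * mode m y = of_real (bump n m) * mode m (y - x)"
        by (simp add: mode_diff_right)
      show "bump n m * cos (2 * pi * ((y - x) \<bullet> m)) = Re (of_real (bump n m) * cnj (mode m x) * mode m y)"
        unfolding eq by (simp add: mode_def inner_commute)
    qed
    finally show ?thesis .
  qed
  have "LP_block \<rho> (int n - 1) f x = f (rpart (freqs n) (\<lambda>m. of_real (bump n m) * cnj (mode m x)))"
    unfolding LP_block_def convolve_def K by simp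
  also have "\<dots> = (\<Sum>m\<in>freqs n. Re (of_real (bump n m) * cnj (mode m x) * cnj (fcoef f m)))"
    by (rule distribution_rpart[OF f finite_freqs freqs_sub])
  also have "\<dots> = block n (fcoef f) x"
    unfolding block_eq by (intro sum.cong refl) (simp add: algebra_simps)
  finally show "LP_block \<rho> (int n - 1) f x = block n (fcoef f) x" .
qed

lemma Linf_LP_block: "f \<in> distributions \<Longrightarrow> Linf_norm (LP_block \<rho> (int n - 1) f) = ennreal (bsup n (fcoef f))"
  unfolding LP_block_eq bsup_def by (rule Linf_norm_continuous[OF continuous_block block_periodic])

text \<open>The symmetry of \<open>c\<close> together with the evenness of \<open>bump\<close> makes
  the real parts in \<open>rpart\<close> harmless.\<close>

lemma fourier_block:
  assumes h: "\<And>m. m \<in> int_lattice \<Longrightarrow> c (- m) = cnj (c m)" and m: "m \<in> int_lattice"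
  shows "fourier (block n c) m = of_real (bump n m) * c m"
  unfolding block_def using fourier_rpart[OF finite_freqs freqs_sub m, of n] h[OF m] bump_freqs[OF m, of n]
  by (auto simp: freqs_minus bump_minus)

end

section \<open>The Besov space of a positive exponent and its metric\<close>

locale besov = littlewood_paley \<rho> for \<rho> :: "int \<Rightarrow> real ^ 'd::finite \<Rightarrow> real" +
  fixes \<alpha> :: real
  assumes alpha_pos: "0 < \<alpha>"
begin

text \<open>The factor \<open>2 powr (\<alpha> * j)\<close> of the norm at the level
  \<open>j = n - 1\<close>.\<close>

definition wt :: "nat \<Rightarrow> real" where "wt n = 2 powr (\<alpha> * (real n - 1))"

lemma wt_pos [simp]: "0 < wt n" "0 \<le> wt n" by (simp_all add: wt_def)

lemma besov_norm_eq:
  assumes "f \<in> distributions"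
  shows "besov_norm \<rho> \<alpha> f = (SUP n. ennreal (wt n * bsup n (fcoef f)))"
proof -
  have "j \<in> range (\<lambda>n. int n - 1)" if "j \<ge> -1" for j
    using that by (intro image_eqI[of _ _ "nat (j + 1)"]) auto
  then have "{-1..} = range (\<lambda>n. int n - 1)" by auto
  then show ?thesis
    unfolding besov_norm_def by (simp add: image_comp o_def Linf_LP_block[OF assms] wt_def ennreal_mult)
qed

lemma besov_norm_le_iff:
  assumes "f \<in> distributions" "K \<ge> 0"
  shows "besov_norm \<rho> \<alpha> f \<le> ennreal K \<longleftrightarrow> (\<forall>n. wt n * bsup n (fcoef f) \<le> K)"
  unfolding besov_norm_eq[OF assms(1)] SUP_le_iff using assms(2) by simp

lemma besov_space_iff:
  "f \<in> besov_space \<rho> \<alpha> \<longleftrightarrow> f \<in> distributions \<and> (\<lambda>n. wt n * bsup n (fcoef f)) \<longlonglongrightarrow> 0"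
proof -
  have "(\<lambda>n. ennreal (2 powr (\<alpha> * real n)) * Linf_norm (LP_block \<rho> (int n) f)) \<longlonglongrightarrow> 0 \<longleftrightarrow> (\<lambda>n. wt n * bsup n (fcoef f)) \<longlonglongrightarrow> 0"
    if f: "f \<in> distributions"
  proof -
    have "(\<lambda>n. ennreal (2 powr (\<alpha> * real n)) * Linf_norm (LP_block \<rho> (int n) f)) = (\<lambda>n. ennreal (wt (Suc n) * bsup (Suc n) (fcoef f)))"
      using Linf_LP_block[OF f, of "Suc _"] by (simp add: wt_def ennreal_mult)
    then have "(\<lambda>n. ennreal (2 powr (\<alpha> * real n)) * Linf_norm (LP_block \<rho> (int n) f)) \<longlonglongrightarrow> 0 \<longleftrightarrow>
       (\<lambda>n. ennreal (wt (Suc n) * bsup (Suc n) (fcoef f))) \<longlonglongrightarrow> ennreal 0" by simp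
    also have "\<dots> \<longleftrightarrow> (\<lambda>n. wt (Suc n) * bsup (Suc n) (fcoef f)) \<longlonglongrightarrow> 0" by (subst tendsto_ennreal_iff) auto
    also have "\<dots> \<longleftrightarrow> (\<lambda>n. wt n * bsup n (fcoef f)) \<longlonglongrightarrow> 0" by (rule filterlim_sequentially_Suc)
    finally show ?thesis .
  qed
  then show ?thesis by (auto simp: besov_space_def)
qed

lemma besov_distribution: "f \<in> besov_space \<rho> \<alpha> \<Longrightarrow> f \<in> distributions"
  by (simp add: besov_space_def)

lemma besov_bounded:
  assumes "f \<in> besov_space \<rho> \<alpha>"
  shows "\<exists>K\<ge>0. \<forall>n. wt n * bsup n (fcoef f) \<le> K"
proof -
  have "Bseq (\<lambda>n. wt n * bsup n (fcoef f))"
    using assms unfolding besov_space_iff by (intro convergent_imp_Bseq) (auto simp: convergent_def)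
  then obtain K where "K > 0" "\<forall>n. norm (wt n * bsup n (fcoef f)) \<le> K" by (auto elim: BseqE)
  then show ?thesis by (intro exI[of _ K]) (auto simp: abs_mult intro: order_trans[OF abs_ge_self])
qed

definition bdist :: "'d functional \<Rightarrow> 'd functional \<Rightarrow> real" where
  "bdist f g = enn2real (besov_norm \<rho> \<alpha> (\<lambda>\<phi>. f \<phi> - g \<phi>))"

text \<open>\<open>enn2real\<close> sends infinity to \<open>0\<close>, so a bound on
  \<open>bdist\<close> means something only because the norm of the difference is finite; both norms
  are, as convergent sequences are bounded.\<close>

lemma bdist_le_iff:
  assumes f: "f \<in> besov_space \<rho> \<alpha>" and g: "g \<in> besov_space \<rho> \<alpha>" and K: "K \<ge> 0"
  shows "bdist f g \<le> K \<longleftrightarrow> (\<forall>n. wt n * bsup n (\<lambda>m. fcoef f m - fcoef g m) \<le> K)"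
proof -
  have d: "(\<lambda>\<phi>. f \<phi> - g \<phi>) \<in> distributions" by (intro distribution_diff besov_distribution f g)
  obtain A B where A: "\<forall>n. wt n * bsup n (fcoef f) \<le> A" "A \<ge> 0" and B: "\<forall>n. wt n * bsup n (fcoef g) \<le> B" "B \<ge> 0"
    using besov_bounded[OF f] besov_bounded[OF g] by blast
  have fc: "fcoef (\<lambda>\<phi>. f \<phi> - g \<phi>) = (\<lambda>m. fcoef f m - fcoef g m)" by (rule ext) (rule fcoef_diff)
  have "wt n * bsup n (\<lambda>m. fcoef f m - fcoef g m) \<le> A + B" for n
  proof -
    have "wt n * bsup n (\<lambda>m. fcoef f m - fcoef g m) \<le> wt n * (bsup n (fcoef f) + bsup n (fcoef g))"
      by (intro mult_left_mono bsup_diff) auto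
    also have "\<dots> \<le> A + B" unfolding distrib_left using A B by (intro add_mono) auto
    finally show ?thesis .
  qed
  then have "besov_norm \<rho> \<alpha> (\<lambda>\<phi>. f \<phi> - g \<phi>) \<le> ennreal (A + B)"
    using A B by (subst besov_norm_le_iff[OF d]) (auto simp: fc)
  then have fin: "besov_norm \<rho> \<alpha> (\<lambda>\<phi>. f \<phi> - g \<phi>) < \<infinity>" by (rule le_less_trans) simp
  have "bdist f g \<le> K \<longleftrightarrow> besov_norm \<rho> \<alpha> (\<lambda>\<phi>. f \<phi> - g \<phi>) \<le> ennreal K"
    unfolding bdist_def using fin K by (metis ennreal_enn2real ennreal_le_iff infinity_ennreal_def)
  also have "\<dots> \<longleftrightarrow> (\<forall>n. wt n * bsup n (\<lambda>m. fcoef f m - fcoef g m) \<le> K)"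
    by (subst besov_norm_le_iff[OF d K]) (simp add: fc)
  finally show ?thesis .
qed

lemma bdist_nonneg [simp]: "0 \<le> bdist f g" by (simp add: bdist_def)

lemma bsup_le_bdist:
  assumes f: "f \<in> besov_space \<rho> \<alpha>" and g: "g \<in> besov_space \<rho> \<alpha>"
  shows "wt n * bsup n (\<lambda>m. fcoef f m - fcoef g m) \<le> bdist f g"
  using bdist_le_iff[OF assms bdist_nonneg[of f g]] by simp

text \<open>If all blocks vanish then so do all products \<open>bump n m * c m\<close>; but the
  bumps at \<open>m\<close> sum to \<open>1\<close> and cannot all be zero.\<close>

lemma bsup_zero_imp:
  assumes h: "\<And>m. m \<in> int_lattice \<Longrightarrow> c (- m) = cnj (c m)" and z: "\<And>n. bsup n c \<le> 0" and m: "m \<in> int_lattice"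
  shows "c m = 0"
proof -
  have b: "bump n m * cmod (c m) = 0" for n
  proof -
    have "\<bar>block n c x\<bar> \<le> 0" for x using block_le_bsup[of n c x] z[of n] by linarith
    then have "cmod (fourier (block n c) m) \<le> 0" by (intro fourier_bound continuous_block)
    then have "bump n m * cmod (c m) \<le> 0"
      using fourier_block[of c m n, OF h m] bump_nonneg[of n m] by (simp add: norm_mult)
    moreover have "0 \<le> bump n m * cmod (c m)" by (intro mult_nonneg_nonneg bump_nonneg norm_ge_zero)
    ultimately show ?thesis by (rule antisym)
  qed
  show ?thesis
  proof (rule ccontr)
    assume "c m \<noteq> 0"
    then have "\<And>n. bump n m = 0" using b by simp
    then have "(\<lambda>n. 0) sums (1::real)" using bump_sums[of m] by simp
    from sums_unique2[OF this sums_zero] show False by simp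
  qed
qed

lemma Metric_space_besov: "Metric_space (besov_space \<rho> \<alpha>) bdist"
proof
  show "0 \<le> bdist f g" for f g by simp
  show "bdist f g = bdist g f" for f g
  proof -
    have "LP_block \<rho> j (\<lambda>\<phi>. f \<phi> - g \<phi>) x = - LP_block \<rho> j (\<lambda>\<phi>. g \<phi> - f \<phi>) x" for j x
      by (simp add: LP_block_def convolve_def)
    then show ?thesis unfolding bdist_def besov_norm_def Linf_norm_def by (simp add: abs_minus_commute abs_minus_cancel)
  qed
  fix f g assume f: "f \<in> besov_space \<rho> \<alpha>" and g: "g \<in> besov_space \<rho> \<alpha>"
  show "bdist f g = 0 \<longleftrightarrow> f = g"
  proof
    assume "bdist f g = 0"
    then have "wt n * bsup n (\<lambda>m. fcoef f m - fcoef g m) \<le> 0" for n using bsup_le_bdist[OF f g, of n] by simp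
    then have "bsup n (\<lambda>m. fcoef f m - fcoef g m) \<le> 0" for n
      using mult_le_cancel_left_pos[OF wt_pos(1), of n "bsup n (\<lambda>m. fcoef f m - fcoef g m)" 0] by simp
    then have "fcoef f m - fcoef g m = 0" if "m \<in> int_lattice" for m
      using fcoef_minus[OF besov_distribution] f g that by (intro bsup_zero_imp[where c="\<lambda>m. fcoef f m - fcoef g m"]) auto
    then show "f = g" by (intro distribution_eqI besov_distribution f g) auto
  next
    assume "f = g"
    have "bsup n (\<lambda>m. 0) = 0" for n using bsup_le_sum[of n "\<lambda>m. 0"] by (intro antisym) auto
    then have "bdist f g \<le> 0" unfolding \<open>f = g\<close> by (subst bdist_le_iff[OF g g]) auto
    then show "bdist f g = 0" using bdist_nonneg[of f g] by linarith
  qed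
  fix h assume h: "h \<in> besov_space \<rho> \<alpha>"
  show "bdist f h \<le> bdist f g + bdist g h"
  proof (subst bdist_le_iff[OF f h], simp, intro allI)
    fix n
    have "bsup n (\<lambda>m. fcoef f m - fcoef h m) \<le> bsup n (\<lambda>m. fcoef f m - fcoef g m) + bsup n (\<lambda>m. fcoef g m - fcoef h m)"
      using bsup_add[of n "\<lambda>m. fcoef f m - fcoef g m" "\<lambda>m. fcoef g m - fcoef h m"] by simp
    then have "wt n * bsup n (\<lambda>m. fcoef f m - fcoef h m) \<le> wt n * (bsup n (\<lambda>m. fcoef f m - fcoef g m) + bsup n (\<lambda>m. fcoef g m - fcoef h m))"
      by (intro mult_left_mono) auto
    then show "wt n * bsup n (\<lambda>m. fcoef f m - fcoef h m) \<le> bdist f g + bdist g h"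
      using bsup_le_bdist[OF f g, of n] bsup_le_bdist[OF g h, of n] by (simp add: distrib_left)
  qed
qed

sublocale B: Metric_space "besov_space \<rho> \<alpha>" bdist by (rule Metric_space_besov)

lemma besov_topology_eq: "besov_topology \<rho> \<alpha> = B.mtopology"
  unfolding besov_topology_def bdist_def[abs_def] ..

lemma topspace_besov: "topspace (besov_topology \<rho> \<alpha>) = besov_space \<rho> \<alpha>"
  unfolding besov_topology_eq by simp

text \<open>Continuity in epsilon-delta form with a weak inequality, which by
  \<open>bdist_le_iff\<close> can be checked block by block.\<close>

definition bcont :: "real set \<Rightarrow> (real \<Rightarrow> 'd functional) \<Rightarrow> bool" where
  "bcont S h \<longleftrightarrow> (\<forall>t\<in>S. h t \<in> besov_space \<rho> \<alpha>) \<and>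
     (\<forall>t\<in>S. \<forall>\<epsilon>>0. \<exists>\<delta>>0. \<forall>s\<in>S. \<bar>s - t\<bar> < \<delta> \<longrightarrow> bdist (h s) (h t) \<le> \<epsilon>)"

lemma continuous_map_besov_iff: "continuous_map (top_of_set S) (besov_topology \<rho> \<alpha>) h \<longleftrightarrow> bcont S h"
proof
  assume c: "continuous_map (top_of_set S) (besov_topology \<rho> \<alpha>) h"
  show "bcont S h" unfolding bcont_def
  proof (intro conjI ballI allI impI)
    show "h t \<in> besov_space \<rho> \<alpha>" if "t \<in> S" for t
      using continuous_map_image_subset_topspace[OF c] that by (auto simp: topspace_besov)
    fix t and \<epsilon> :: real assume t: "t \<in> S" "\<epsilon> > 0"
    have "\<forall>x\<in>topspace (top_of_set S). \<forall>\<epsilon>>0. \<exists>U. openin (top_of_set S) U \<and> x \<in> U \<and> (\<forall>y\<in>U. h y \<in> B.mball (h x) \<epsilon>)"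
      using c unfolding besov_topology_eq B.continuous_map_to_metric .
    with t have "\<exists>U. openin (top_of_set S) U \<and> t \<in> U \<and> (\<forall>y\<in>U. h y \<in> B.mball (h t) \<epsilon>)" by simp
    then obtain U where U: "openin (top_of_set S) U" "t \<in> U" "\<forall>y\<in>U. h y \<in> B.mball (h t) \<epsilon>" by blast
    then obtain \<delta> where "\<delta> > 0" "\<And>s. s \<in> S \<Longrightarrow> dist s t < \<delta> \<Longrightarrow> s \<in> U"
      using U(1,2) unfolding openin_euclidean_subtopology_iff by meson
    then show "\<exists>\<delta>>0. \<forall>s\<in>S. \<bar>s - t\<bar> < \<delta> \<longrightarrow> bdist (h s) (h t) \<le> \<epsilon>"
      using U(3) by (intro exI[of _ \<delta>]) (auto simp: dist_real_def B.in_mball B.commute intro: less_imp_le)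
  qed
next
  assume b: "bcont S h"
  show "continuous_map (top_of_set S) (besov_topology \<rho> \<alpha>) h"
    unfolding besov_topology_eq B.continuous_map_to_metric
  proof (intro ballI allI impI)
    fix t and \<epsilon> :: real assume t: "t \<in> topspace (top_of_set S)" "\<epsilon> > 0"
    then have tS: "t \<in> S" by simp
    obtain \<delta> where \<delta>: "\<delta> > 0" "\<And>s. s \<in> S \<Longrightarrow> \<bar>s - t\<bar> < \<delta> \<Longrightarrow> bdist (h s) (h t) \<le> \<epsilon> / 2"
      using b tS t(2) unfolding bcont_def by (meson half_gt_zero)
    show "\<exists>U. openin (top_of_set S) U \<and> t \<in> U \<and> (\<forall>y\<in>U. h y \<in> B.mball (h t) \<epsilon>)"
    proof (intro exI[of _ "S \<inter> ball t \<delta>"] conjI ballI)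
      show "openin (top_of_set S) (S \<inter> ball t \<delta>)" by (intro openin_open_Int) simp
      show "t \<in> S \<inter> ball t \<delta>" using tS \<delta> by simp
      fix y assume y: "y \<in> S \<inter> ball t \<delta>"
      then have "bdist (h y) (h t) \<le> \<epsilon> / 2" by (intro \<delta>(2)) (auto simp: dist_real_def)
      then show "h y \<in> B.mball (h t) \<epsilon>"
        using b tS y t(2) by (auto simp: bcont_def B.in_mball B.commute[of "h t"])
    qed
  qed
qed

section \<open>Elements of the Besov space as continuous functions\<close>

text \<open>A geometric series of ratio \<open>2 powr (- \<alpha>)\<close>: positivity of \<alpha>
  is what makes the elements of the space continuous functions.\<close>

lemma summable_inverse_wt: "summable (\<lambda>n. 1 / wt n)"
proof -
  have e: "1 / wt n = 2 powr \<alpha> * (2 powr (- \<alpha>)) ^ n" for n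
    unfolding wt_def by (simp add: powr_realpow[symmetric] powr_powr powr_minus_divide[symmetric] powr_add[symmetric] algebra_simps)
  have "(2::real) powr (- \<alpha>) < 2 powr 0" using alpha_pos by (intro powr_less_mono) auto
  then show ?thesis unfolding e by (intro summable_mult summable_geometric) auto
qed

text \<open>The constant of the embedding into bounded functions.\<close>

definition Csup :: real where "Csup = (\<Sum>n. 1 / wt n)"

lemma Csup_nonneg: "0 \<le> Csup"
  unfolding Csup_def by (intro suminf_nonneg summable_inverse_wt) (simp add: less_imp_le)

text \<open>A sum over blocks rather than over modes: the Fourier coefficients of an element of the
  space need not be absolutely summable, while the block suprema are.\<close>

definition synth :: "(real ^ 'd \<Rightarrow> complex) \<Rightarrow> real ^ 'd \<Rightarrow> real" where
  "synth c x = (\<Sum>n. block n c x)"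

text \<open>The blocks are dominated by \<open>K / wt n\<close>, so the series converges uniformly;
  its coefficient at \<open>m\<close> is \<open>c m\<close> times the sum of the bumps, which is
  \<open>1\<close>.\<close>

lemma synth:
  assumes h: "\<And>m. m \<in> int_lattice \<Longrightarrow> c (- m) = cnj (c m)" and K: "\<And>n. wt n * bsup n c \<le> K"
  shows "continuous_on UNIV (synth c) \<and> torus_periodic (synth c) \<and> (\<forall>m\<in>int_lattice. fourier (synth c) m = c m)
    \<and> (\<forall>x. \<bar>synth c x\<bar> \<le> Csup * K) \<and> (\<forall>x. (\<lambda>n. block n c x) sums synth c x)"
proof -
  have le: "\<bar>block n c x\<bar> \<le> K / wt n" for n x
  proof -
    have "bsup n c \<le> K / wt n" using K[of n] by (simp add: pos_le_divide_eq mult.commute)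
    then show ?thesis using block_le_bsup[of n c x] by linarith
  qed
  have sm: "summable (\<lambda>n. K / wt n)" using summable_mult[OF summable_inverse_wt, of K] by simp
  define u where us: "u = synth c"
  have u_def: "u x = (\<Sum>n. block n c x)" for x by (simp add: us synth_def)
  have ul: "uniform_limit UNIV (\<lambda>N x. \<Sum>n<N. block n c x) u sequentially"
    unfolding u_def by (rule Weierstrass_m_test[OF _ sm]) (simp add: le)
  have cN: "continuous_on UNIV (\<lambda>x. \<Sum>n<N. block n c x)" for N by (intro continuous_intros continuous_block)
  have cu: "continuous_on UNIV u"
    by (rule uniform_limit_theorem[OF always_eventually[OF allI[OF cN]] ul]) simp
  have pu: "torus_periodic u" using block_periodic unfolding torus_periodic_def u_def by simp
  have f: "fourier u m = c m" if m: "m \<in> int_lattice" for m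
  proof -
    have "(\<lambda>N. fourier (\<lambda>x. \<Sum>n<N. block n c x) m) \<longlonglongrightarrow> fourier u m"
      by (rule fourier_uniform_limit[OF ul cN cu])
    moreover have "fourier (\<lambda>x. \<Sum>n<N. block n c x) m = of_real (\<Sum>n<N. bump n m) * c m" for N
    proof (induction N)
      case 0 then show ?case by (simp add: fourier_def)
    next
      case (Suc N)
      have "fourier (\<lambda>x. \<Sum>n<Suc N. block n c x) m = fourier (\<lambda>x. (\<Sum>n<N. block n c x) + block N c x) m" by simp
      also have "\<dots> = fourier (\<lambda>x. \<Sum>n<N. block n c x) m + fourier (block N c) m"
        by (rule fourier_add[OF cN continuous_block])
      finally show ?case using Suc fourier_block[of c m N, OF h m] by (simp add: ring_distribs)
    qed
    moreover have "(\<lambda>N. of_real (\<Sum>n<N. bump n m) * c m) \<longlonglongrightarrow> of_real 1 * c m"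
      using bump_sums[of m] unfolding sums_def by (intro tendsto_intros)
    ultimately show ?thesis using LIMSEQ_unique by fastforce
  qed
  have "\<bar>u x\<bar> \<le> Csup * K" for x
  proof -
    have "norm (u x) \<le> (\<Sum>n. K / wt n)" unfolding u_def
      by (rule norm_suminf_le[OF _ sm]) (simp add: le)
    also have "\<dots> = Csup * K" unfolding Csup_def using suminf_mult2[OF summable_inverse_wt, of K] by simp
    finally show ?thesis by simp
  qed
  moreover have "(\<lambda>n. block n c x) sums u x" for x
    unfolding u_def by (intro summable_sums summable_comparison_test'[OF sm]) (simp add: le)
  ultimately show ?thesis using cu pu f unfolding us by blast
qed

lemma besov_function:
  assumes "\<And>m. m \<in> int_lattice \<Longrightarrow> c (- m) = cnj (c m)" and "\<And>n. wt n * bsup n c \<le> K"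
  shows "\<exists>u. continuous_on UNIV u \<and> torus_periodic u \<and> (\<forall>m\<in>int_lattice. fourier u m = c m) \<and> (\<forall>x. \<bar>u x\<bar> \<le> Csup * K)"
  using synth[OF assms] by blast

lemma besov_fun_of:
  assumes f: "f \<in> besov_space \<rho> \<alpha>"
  shows "continuous_on UNIV (fun_of f)" "torus_periodic (fun_of f)" "dist_of (fun_of f) = f"
    "\<And>m. m \<in> int_lattice \<Longrightarrow> fourier (fun_of f) m = fcoef f m"
    "(\<And>n. wt n * bsup n (fcoef f) \<le> K) \<Longrightarrow> \<bar>fun_of f x\<bar> \<le> Csup * K"
proof -
  have fd: "f \<in> distributions" using f by (rule besov_distribution)
  have ex: "continuous_on UNIV (fun_of f) \<and> torus_periodic (fun_of f) \<and> dist_of (fun_of f) = f \<and>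
    (\<forall>m\<in>int_lattice. fourier (fun_of f) m = fcoef f m) \<and> (\<forall>x. \<bar>fun_of f x\<bar> \<le> Csup * K)"
    if K: "\<And>n. wt n * bsup n (fcoef f) \<le> K" for K
  proof -
    obtain u where u: "continuous_on UNIV u" "torus_periodic u" "\<And>m. m \<in> int_lattice \<Longrightarrow> fourier u m = fcoef f m" "\<And>x. \<bar>u x\<bar> \<le> Csup * K"
      using besov_function[OF fcoef_minus[OF fd] K] by blast
    have "dist_of u = f"
      by (rule distribution_eqI[OF dist_of_distribution[OF u(1,2)] fd]) (simp add: fcoef_dist_of u)
    moreover have "fun_of f = u" using fun_of_dist_of[OF u(1,2)] \<open>dist_of u = f\<close> by simp
    ultimately show ?thesis using u by auto
  qed
  obtain K' where "\<And>n. wt n * bsup n (fcoef f) \<le> K'" using besov_bounded[OF f] by blast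
  from ex[OF this] show "continuous_on UNIV (fun_of f)" "torus_periodic (fun_of f)" "dist_of (fun_of f) = f"
    "\<And>m. m \<in> int_lattice \<Longrightarrow> fourier (fun_of f) m = fcoef f m" by auto
  show "(\<And>n. wt n * bsup n (fcoef f) \<le> K) \<Longrightarrow> \<bar>fun_of f x\<bar> \<le> Csup * K" using ex[of K] by blast
qed

lemma dist_of_besov_iff:
  assumes u: "continuous_on UNIV u" "torus_periodic u"
  shows "dist_of u \<in> besov_space \<rho> \<alpha> \<longleftrightarrow> (\<lambda>n. wt n * bsup n (fourier u)) \<longlonglongrightarrow> 0"
proof -
  have "bsup n (fcoef (dist_of u)) = bsup n (fourier u)" for n by (rule bsup_cong) (simp add: fcoef_dist_of u)
  then show ?thesis by (simp add: besov_space_iff dist_of_distribution u)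
qed

lemma fun_of_diff_le:
  assumes f: "f \<in> besov_space \<rho> \<alpha>" and g: "g \<in> besov_space \<rho> \<alpha>"
  shows "\<bar>fun_of f x - fun_of g x\<bar> \<le> Csup * bdist f g"
proof -
  note F = besov_fun_of[OF f] and G = besov_fun_of[OF g]
  have "\<exists>u. continuous_on UNIV u \<and> torus_periodic u \<and> (\<forall>m\<in>int_lattice. fourier u m = fcoef f m - fcoef g m) \<and> (\<forall>x. \<bar>u x\<bar> \<le> Csup * bdist f g)"
    using fcoef_minus[OF besov_distribution[OF f]] fcoef_minus[OF besov_distribution[OF g]]
    by (intro besov_function bsup_le_bdist[OF f g]) simp
  then obtain u where u: "continuous_on UNIV u" "torus_periodic u" "\<And>m. m \<in> int_lattice \<Longrightarrow> fourier u m = fcoef f m - fcoef g m"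
    "\<And>x. \<bar>u x\<bar> \<le> Csup * bdist f g" by blast
  have "u = (\<lambda>x. fun_of f x - fun_of g x)"
    by (rule fourier_eq_imp_eq)
       (use u F G in \<open>auto intro!: continuous_intros simp: fourier_diff torus_periodic_def\<close>)
  then show ?thesis using u(4)[of x] by simp
qed

end

section \<open>Boundedness of the biharmonic semigroup\<close>

text \<open>Up to \<open>pi / 6\<close> the cosine is at least \<open>1/2\<close>, so the difference
  increases; beyond it the sine is at least \<open>1/2\<close>, while \<open>x / 4\<close> is at
  most \<open>pi / 8 < 1/2\<close>.\<close>

lemma sin_ge_quarter: 
  assumes "0 \<le> x" "x \<le> pi / 2" shows "x / 4 \<le> sin x"
proof (cases "x \<le> pi / 6")
  case True
  have "sin 0 - 0 / 4 \<le> sin x - x / 4"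
  proof (rule DERIV_nonneg_imp_nondecreasing[OF assms(1)])
    fix y assume y: "0 \<le> y" "y \<le> x"
    have "cos (pi / 3) \<le> cos y" using y True pi_gt_zero by (intro cos_monotone_0_pi_le) auto
    then have "cos y - 1 / 4 \<ge> 0" by (simp add: cos_60)
    moreover have "((\<lambda>y. sin y - y / 4) has_real_derivative cos y - 1 / 4) (at y)"
      by (auto intro!: derivative_eq_intros)
    ultimately show "\<exists>d. ((\<lambda>y. sin y - y / 4) has_real_derivative d) (at y) \<and> 0 \<le> d" by blast
  qed
  then show ?thesis by simp
next
  case False
  have "sin (pi / 6) \<le> sin x" using False assms pi_gt_zero by (intro sin_monotone_2pi_le) auto
  then show ?thesis using assms pi_less_4 by (simp add: sin_30)
qed

text \<open>The periodic substitute for \<open>y ^ 2\<close>: it vanishes quadratically exactly at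
  the integers, and it only has the frequencies \<open>0\<close>, \<open>1\<close> and
  \<open>- 1\<close>, so that multiplication by it is a second difference of Fourier
  coefficients.\<close>

definition sin2 :: "real \<Rightarrow> real" where "sin2 y = (sin (pi * y))\<^sup>2"

lemma sin2_ge:
  assumes "0 \<le> y" "y \<le> 1/2" shows "y\<^sup>2 / 4 \<le> sin2 y"
proof -
  have "pi * y / 4 \<le> sin (pi * y)"
    using sin_ge_quarter[of "pi * y"] assms mult_left_mono[of y "1/2" pi] by simp
  moreover have "y / 2 \<le> pi * y / 4" using mult_right_mono[OF pi_ge_two assms(1)] by simp
  ultimately have "y / 2 \<le> sin (pi * y)" by linarith
  then have "(y / 2)\<^sup>2 \<le> (sin (pi * y))\<^sup>2" using assms by (intro power_mono) auto
  then show ?thesis by (simp add: sin2_def power2_eq_square)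
qed

lemma sin2_reflect: "sin2 (1 - y) = sin2 y"
proof -
  have "sin (pi * (1 - y)) = sin (pi * y)" using sin_pi_minus[of "pi * y"] by (simp add: right_diff_distrib)
  then show ?thesis by (simp add: sin2_def)
qed

text \<open>The exponent \<open>2/3\<close> is chosen for dimension three: three such factors make
  up the power \<open>2\<close> of the squared weight, and each still decays like the power
  \<open>4/3\<close> of the distance to the nearest zero, which is integrable. The two summands
  belong to the zeros \<open>0\<close> and \<open>1\<close>.\<close>

lemma sin2_weight_bound:
  assumes N: "N \<ge> 1" and y: "0 \<le> y" "y \<le> 1"
  shows "(1 + N\<^sup>2 * sin2 y) powr (- (2/3)) \<le> 2 * (1 + N * y / 2) powr (- (4/3)) + 2 * (1 + N * (1 - y) / 2) powr (- (4/3))"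
proof -
  have half: "(1 + N\<^sup>2 * sin2 y) powr (- (2/3)) \<le> 2 * (1 + N * y / 2) powr (- (4/3))" if y: "0 \<le> y" "y \<le> 1/2" for y
  proof -
    have 1: "(1 + N * y / 2)\<^sup>2 / 2 \<le> 1 + N\<^sup>2 * sin2 y"
    proof -
      have "0 \<le> (1 - N * y / 2)\<^sup>2" by simp
      then have "(1 + N * y / 2)\<^sup>2 / 2 \<le> 1 + N\<^sup>2 * (y\<^sup>2 / 4)" by (simp add: power2_eq_square algebra_simps)
      also have "\<dots> \<le> 1 + N\<^sup>2 * sin2 y" using sin2_ge[OF y] by (intro add_left_mono mult_left_mono) auto
      finally show ?thesis .
    qed
    have p: "1 + N * y / 2 > 0" using N y by (intro add_pos_nonneg) auto
    have "(1 + N\<^sup>2 * sin2 y) powr (- (2/3)) \<le> ((1 + N * y / 2)\<^sup>2 / 2) powr (- (2/3))"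
      using p by (intro powr_mono2' 1) auto
    also have "\<dots> = (1 + N * y / 2) powr (- (4/3)) * 2 powr (2/3)"
    proof -
      have "((1 + N * y / 2)\<^sup>2) powr (- (2/3)) = ((1 + N * y / 2) powr 2) powr (- (2/3))" using p by simp
      also have "\<dots> = (1 + N * y / 2) powr (- (4/3))" unfolding powr_powr by simp
      finally have "((1 + N * y / 2)\<^sup>2) powr (- (2/3)) = (1 + N * y / 2) powr (- (4/3))" .
      moreover have "(Z / 2) powr (- (2/3)) = Z powr (- (2/3)) * 2 powr (2/3)" for Z :: real
        unfolding powr_divide by (subst powr_minus[of 2]) (simp only: divide_inverse inverse_inverse_eq)
      ultimately show ?thesis by simp
    qed
    also have "\<dots> \<le> (1 + N * y / 2) powr (- (4/3)) * 2"
      using powr_mono[of "2/3" 1 "2::real"] by (intro mult_left_mono) auto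
    finally show ?thesis by simp
  qed
  show ?thesis
  proof (cases "y \<le> 1/2")
    case True
    then show ?thesis using half[of y] y by (intro order_trans[OF half[of y]]) auto
  next
    case False
    then show ?thesis using half[of "1 - y"] y by (intro order_trans[OF half[of "1 - y", unfolded sin2_reflect]]) auto
  qed
qed

text \<open>Both summands have explicit primitives with exponent \<open>- 1/3\<close> and contribute
  at most \<open>12 / N\<close> each.\<close>

lemma sin2_weight_integral:
  assumes N: "N \<ge> 1"
  shows "(\<integral>\<^sup>+y. ennreal (2 * (1 + N * y / 2) powr (- (4/3)) + 2 * (1 + N * (1 - y) / 2) powr (- (4/3))) * indicator {0..1} y \<partial>lborel)
    \<le> ennreal (24 / N)"
proof -
  let ?H = "\<lambda>y. - (12 / N) * (1 + N * y / 2) powr (- (1/3)) + (12 / N) * (1 + N * (1 - y) / 2) powr (- (1/3))"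
  let ?h = "\<lambda>y. 2 * (1 + N * y / 2) powr (- (4/3)) + 2 * (1 + N * (1 - y) / 2) powr (- (4/3))"
  have "(\<integral>\<^sup>+y. ennreal (?h y) * indicator {0..1} y \<partial>lborel) = ennreal (?H 1 - ?H 0)"
  proof (rule nn_integral_FTC_Icc)
    fix y :: real assume y: "y \<in> {0..1}"
    have p: "1 + N * y / 2 > 0" "1 + N * (1 - y) / 2 > 0" using N y by (auto intro!: add_pos_nonneg)
    have d1: "((\<lambda>y. (1 + N * y / 2) powr (- (1/3))) has_real_derivative - (1/3) * (1 + N * y / 2) powr (- (1/3) - 1) * (N / 2)) (at y)"
      using DERIV_fun_powr[of "\<lambda>y. 1 + N * y / 2" "N / 2" y "- (1/3)"] p(1) by (auto intro!: derivative_eq_intros)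
    have d2: "((\<lambda>y. (1 + N * (1 - y) / 2) powr (- (1/3))) has_real_derivative - (1/3) * (1 + N * (1 - y) / 2) powr (- (1/3) - 1) * (- N / 2)) (at y)"
      using DERIV_fun_powr[of "\<lambda>y. 1 + N * (1 - y) / 2" "- N / 2" y "- (1/3)"] p(2) by (auto intro!: derivative_eq_intros)
    have "(?H has_real_derivative - (12 / N) * (- (1/3) * (1 + N * y / 2) powr (- (1/3) - 1) * (N / 2)) +
        (12 / N) * (- (1/3) * (1 + N * (1 - y) / 2) powr (- (1/3) - 1) * (- N / 2))) (at y)"
      by (intro DERIV_add DERIV_cmult d1 d2)
    then show "(?H has_real_derivative ?h y) (at y)" using N by simp
  qed auto
  also have "?H 1 - ?H 0 \<le> 24 / N"
  proof -
    have "?H 1 - ?H 0 = (24 / N) * (1 - (1 + N / 2) powr (- (1/3)))" by (simp add: algebra_simps)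
    also have "\<dots> \<le> (24 / N) * 1" using N by (intro mult_left_mono) auto
    finally show ?thesis by simp
  qed
  finally show ?thesis by (simp add: ennreal_leI)
qed

definition sin2sum :: "real ^ 'd \<Rightarrow> real" where "sin2sum x = (\<Sum>i\<in>UNIV. sin2 (x $ i))"

lemma sin2_nonneg [simp]: "0 \<le> sin2 y" by (simp add: sin2_def)

lemma sin2sum_nonneg [simp]: "0 \<le> sin2sum (x :: real ^ 'd::finite)" by (simp add: sin2sum_def sum_nonneg)

lemma continuous_sin2sum: "continuous_on S (sin2sum :: real ^ 'd::finite \<Rightarrow> real)"
  unfolding sin2sum_def sin2_def by (intro continuous_intros)

lemma sin2sum_pos: "1 + N\<^sup>2 * sin2sum (x :: real ^ 'd::finite) > 0"
  by (intro add_pos_nonneg) auto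

text \<open>The weight is split into a product of one-dimensional weights, whose integral factors by
  Tonelli's theorem.\<close>

lemma sin2sum_integral:
  assumes N: "N \<ge> 1" and d: "CARD('d::finite) \<le> 3"
  shows "(LINT x|torus. (1 / (1 + N\<^sup>2 * sin2sum (x :: real ^ 'd)))\<^sup>2) \<le> (24 / N) ^ CARD('d)"
proof -
  let ?w = "\<lambda>x :: real ^ 'd. (1 / (1 + N\<^sup>2 * sin2sum x))\<^sup>2"
  let ?h = "\<lambda>y. 2 * (1 + N * y / 2) powr (- (4/3)) + 2 * (1 + N * (1 - y) / 2) powr (- (4/3))"
  let ?g = "\<lambda>y. ennreal (?h y) * indicator {0..1} y"
  have c: "continuous_on UNIV ?w"
    by (intro continuous_intros continuous_sin2sum ballI less_imp_neq[OF sin2sum_pos, THEN not_sym])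
  have le: "?w x \<le> (\<Prod>i\<in>UNIV. ?h (x $ i))" if x: "x \<in> unit_cube" for x :: "real ^ 'd"
  proof -
    let ?A = "1 + N\<^sup>2 * sin2sum x"
    have A1: "?A \<ge> 1" by simp
    have "?w x = ?A powr (- 2)" using A1 by (simp add: powr_minus_divide powr_realpow[of _ 2, simplified] power_one_over)
    \<comment> \<open>The dimension enters here: the base is at least \<open>1\<close>, and
      \<open>2/3 * d \<le> 2\<close>.\<close>
    also have "\<dots> \<le> ?A powr (- (2/3) * real CARD('d))"
      using d A1 by (intro powr_mono) auto
    also have "\<dots> = (\<Prod>i\<in>(UNIV :: 'd set). ?A powr (- (2/3)))"
      unfolding prod_constant powr_powr[symmetric] by (rule powr_realpow) (use sin2sum_pos[of N x] in simp)
    also have "\<dots> \<le> (\<Prod>i\<in>UNIV. ?h (x $ i))"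
    proof (intro prod_mono conjI)
      fix i
      have "sin2 (x $ i) \<le> sin2sum x" unfolding sin2sum_def by (rule member_le_sum) auto
      then have "1 + N\<^sup>2 * sin2 (x $ i) \<le> ?A" by (intro add_left_mono mult_left_mono) auto
      then have "?A powr (- (2/3)) \<le> (1 + N\<^sup>2 * sin2 (x $ i)) powr (- (2/3))"
        by (intro powr_mono2') (auto intro!: add_pos_nonneg)
      also have "\<dots> \<le> ?h (x $ i)"
        using x by (intro sin2_weight_bound N) (auto simp: unit_cube_def less_imp_le)
      finally show "?A powr (- (2/3)) \<le> ?h (x $ i)" .
    qed simp
    finally show ?thesis .
  qed
  have "ennreal (LINT x|torus. ?w x) = (\<integral>\<^sup>+x. ennreal (?w x) \<partial>torus)"
    by (rule nn_integral_eq_integral[symmetric]) (auto intro: integrable_torus_continuous c)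
  also have "\<dots> = (\<integral>\<^sup>+x. ennreal (?w x) * indicator unit_cube x \<partial>lborel)"
    unfolding torus_def by (rule nn_integral_restrict_space) simp
  also have "\<dots> \<le> (\<integral>\<^sup>+x. (\<Prod>b\<in>(Basis :: (real ^ 'd) set). ?g (x \<bullet> b)) \<partial>lborel)"
  proof (rule nn_integral_mono)
    fix x :: "real ^ 'd"
    show "ennreal (?w x) * indicator unit_cube x \<le> (\<Prod>b\<in>(Basis :: (real ^ 'd) set). ?g (x \<bullet> b))"
    proof (cases "x \<in> unit_cube")
      case True
      have inj: "inj_on (\<lambda>i. axis i (1::real)) (UNIV :: 'd set)" by (auto simp: inj_on_def axis_eq_axis)
      have B: "Basis = (\<lambda>i. axis i (1::real)) ` (UNIV :: 'd set)" by (auto simp: Basis_vec_def)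
      have "(\<Prod>b\<in>(Basis :: (real ^ 'd) set). ?g (x \<bullet> b)) = (\<Prod>i\<in>UNIV. ?g (x $ i))"
        unfolding B by (subst prod.reindex[OF inj]) (simp add: inner_axis)
      also have "\<dots> = (\<Prod>i\<in>UNIV. ennreal (?h (x $ i)))"
        using True by (intro prod.cong refl) (auto simp: unit_cube_def less_imp_le indicator_def)
      also have "\<dots> = ennreal (\<Prod>i\<in>UNIV. ?h (x $ i))" by (intro prod_ennreal) auto
      finally show ?thesis using le[OF True] True by (simp add: ennreal_leI)
    qed simp
  qed
  also have "\<dots> = (\<Prod>b\<in>(Basis :: (real ^ 'd) set). (\<integral>\<^sup>+y. ?g y \<partial>lborel))"
    by (rule nn_integral_lborel_prod) auto
  also have "\<dots> \<le> ennreal ((24 / N) ^ CARD('d))"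
  proof -
    obtain r where r: "0 \<le> r" "(\<integral>\<^sup>+y. ?g y \<partial>lborel) = ennreal r"
      using sin2_weight_integral[OF N] by (cases "\<integral>\<^sup>+y. ?g y \<partial>lborel") (auto simp: top_unique)
    then have "r \<le> 24 / N" using sin2_weight_integral[OF N] N by (simp add: ennreal_le_iff)
    then have "ennreal (r ^ CARD('d)) \<le> ennreal ((24 / N) ^ CARD('d))" using r by (intro ennreal_leI power_mono)
    then show ?thesis unfolding r(2) using r(1) by (simp add: ennreal_power)
  qed
  finally show ?thesis using N by (subst (asm) ennreal_le_iff) auto
qed

section \<open>Decay and second differences of the symbol of the semigroup\<close>

text \<open>\<open>(1 + y) ^ 6 \<le> 8 * (1 + y ^ 2) ^ 3\<close>, and the cubic term of the
  exponential series bounds the cube by \<open>6 * exp (1 + y ^ 2)\<close>;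
  \<open>48 = 8 * 6\<close>.\<close>

lemma gaussian_decay:
  fixes y :: real assumes "y \<ge> 0"
  shows "(1 + y) ^ 6 * exp (- y\<^sup>2) \<le> 48 * exp 1"
proof -
  have "0 \<le> (1 - y)\<^sup>2" by simp
  then have "(1 + y)\<^sup>2 \<le> 2 * (1 + y\<^sup>2)" by (simp add: power2_eq_square algebra_simps)
  then have "((1 + y)\<^sup>2) ^ 3 \<le> (2 * (1 + y\<^sup>2)) ^ 3" by (rule power_mono) simp
  then have 1: "(1 + y) ^ 6 \<le> 8 * (1 + y\<^sup>2) ^ 3" 
    unfolding power_mult_distrib power_mult[symmetric] by simp
  have "(1 + y\<^sup>2) ^ 3 / fact 3 \<le> exp (1 + y\<^sup>2)"
  proof -
    have "(1 + y\<^sup>2) ^ 3 /\<^sub>R fact 3 \<le> (\<Sum>n. (1 + y\<^sup>2) ^ n /\<^sub>R fact n)"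
      using sum_le_suminf[OF summable_exp_generic[of "1 + y\<^sup>2"], of "{3}"] by simp
    then show ?thesis using exp_converges[of "1 + y\<^sup>2"] by (simp add: sums_iff divide_inverse_commute)
  qed
  then have "(1 + y\<^sup>2) ^ 3 \<le> 6 * (exp 1 * exp (y\<^sup>2))" by (simp add: fact_numeral exp_add field_simps)
  then have "(1 + y) ^ 6 \<le> 48 * exp 1 * exp (y\<^sup>2)" using 1 by simp
  then have "(1 + y) ^ 6 * exp (- y\<^sup>2) \<le> 48 * exp 1 * exp (y\<^sup>2) * exp (- y\<^sup>2)" by (rule mult_right_mono) simp
  also have "\<dots> = 48 * exp 1" by (simp add: exp_minus field_simps)
  finally show ?thesis .
qed

text \<open>The mean value theorem on \<open>[0, 1]\<close>, on \<open>[- 1, 0]\<close> and then for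
  the derivative between the two intermediate points, which are at most \<open>2\<close>
  apart.\<close>

lemma second_difference_bound:
  fixes f :: "real \<Rightarrow> real"
  assumes f': "\<And>x. (f has_real_derivative f' x) (at x)" and f'': "\<And>x. (f' has_real_derivative f'' x) (at x)"
    and B: "\<And>x. \<bar>x\<bar> \<le> 1 \<Longrightarrow> \<bar>f'' x\<bar> \<le> B"
  shows "\<bar>2 * f 0 - f 1 - f (-1)\<bar> \<le> 2 * B"
proof -
  obtain a where a: "0 < a" "a < 1" "f 1 - f 0 = (1 - 0) * f' a" using MVT2[of 0 1 f f'] f' by auto
  obtain b where b: "-1 < b" "b < 0" "f 0 - f (-1) = (0 - (-1)) * f' b" using MVT2[of "-1" 0 f f'] f' by auto
  obtain c where c: "b < c" "c < a" "f' a - f' b = (a - b) * f'' c" using MVT2[of b a f' f''] f'' a b by auto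
  have "\<bar>2 * f 0 - f 1 - f (-1)\<bar> = \<bar>a - b\<bar> * \<bar>f'' c\<bar>" using a(3) b(3) c(3) by (simp add: abs_mult[symmetric])
  also have "\<dots> \<le> 2 * B" using a b c by (intro mult_mono B) auto
  finally show ?thesis .
qed

definition semi :: "real \<Rightarrow> real ^ 'd \<Rightarrow> real" where
  "semi t m = exp (- t * (lam m)\<^sup>2)"

lemma semi_pos [simp]: "0 < semi t m" "0 \<le> semi t m" by (simp_all add: semi_def)

lemma semi_minus [simp]: "semi t (- m) = semi t m" by (simp add: semi_def)

text \<open>The scale-invariant variable is \<open>sqrt t * (m \<bullet> m)\<close>. Of the six
  powers, \<open>semi_second_difference\<close> spends four on the polynomial factors of the second
  derivative and keeps two as decay.\<close>

lemma semi_decay: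
  fixes m :: "real ^ 'd::finite"
  assumes t: "0 \<le> t"
  shows "(1 + sqrt t * (m \<bullet> m)) ^ 6 * semi t m \<le> 48 * exp 1"
proof -
  let ?y = "sqrt t * (m \<bullet> m)"
  have y: "?y \<ge> 0" using t by simp
  have "t * (m \<bullet> m)\<^sup>2 \<le> t * (lam m)\<^sup>2"
  proof (intro mult_left_mono power_mono t)
    have "1 * (m \<bullet> m) \<le> (2 * pi)\<^sup>2 * (m \<bullet> m)"
      using pi_ge_two by (intro mult_right_mono one_le_power) auto
    then show "m \<bullet> m \<le> lam m" by (simp add: lam_def)
  qed simp
  then have "?y\<^sup>2 \<le> t * (lam m)\<^sup>2" using t by (simp add: power_mult_distrib)
  then have "semi t m \<le> exp (- ?y\<^sup>2)" by (simp add: semi_def)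
  then have "(1 + ?y) ^ 6 * semi t m \<le> (1 + ?y) ^ 6 * exp (- ?y\<^sup>2)" using y by (intro mult_left_mono) auto
  also have "\<dots> \<le> 48 * exp 1" by (rule gaussian_decay[OF y])
  finally show ?thesis .
qed

text \<open>Along the axis the symbol is \<open>exp (- t \<kappa> (q x) ^ 2)\<close> with a
  quadratic polynomial \<open>q\<close>. Its second derivative is of the order
  \<open>t q + t ^ 2 q ^ 3\<close> times the symbol, which is \<open>sqrt t\<close> times a
  polynomial in \<open>z = sqrt t * q\<close>. The factor \<open>sqrt t\<close> later cancels the
  \<open>N ^ 2 = 1 / sqrt t\<close> of the weight.\<close>

lemma semi_second_difference:
  fixes m :: "real ^ 'd::finite"
  assumes t: "0 < t" "t \<le> 1"
  shows "\<bar>2 * semi t m - semi t (m + axis i 1) - semi t (m - axis i 1)\<bar> * (1 + sqrt t * (m \<bullet> m))\<^sup>2 \<le>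
    2 * (9 * (28 * ((2 * pi) ^ 4 + 1)\<^sup>2 * (48 * exp 1))) * sqrt t"
proof -
  define \<kappa> where "\<kappa> = (2 * pi) ^ 4"
  have \<kappa>: "\<kappa> \<ge> 0" by (simp add: \<kappa>_def)
  define q where "q x = (m + x *\<^sub>R axis i 1) \<bullet> (m + x *\<^sub>R axis i 1)" for x
  define f where "f x = semi t (m + x *\<^sub>R axis i 1)" for x
  define l where "l x = m $ i + x" for x
  have q_eq: "q x = m \<bullet> m + 2 * x * m $ i + x\<^sup>2" for x
    by (simp add: q_def inner_add_left inner_add_right inner_axis inner_axis' power2_eq_square algebra_simps)
  have f_eq: "f x = exp (- (t * \<kappa>) * (q x)\<^sup>2)" for x
    by (simp add: f_def semi_def lam_def q_def \<kappa>_def power_mult_distrib algebra_simps power2_eq_square power4_eq_xxxx)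
  have q0: "q x \<ge> 0" for x by (simp add: q_def)
  have lq: "(l x)\<^sup>2 \<le> q x" for x
    using component_sq_le_inner[of "m + x *\<^sub>R axis i 1" i] by (simp add: l_def q_def)
  have dq: "(q has_real_derivative 2 * l x) (at x)" for x
    unfolding q_eq[abs_def] l_def by (auto intro!: derivative_eq_intros simp: algebra_simps)
  have dl: "(l has_real_derivative 1) (at x)" for x
    unfolding l_def[abs_def] by (auto intro!: derivative_eq_intros)
  define f' where "f' x = - (4 * (t * \<kappa>)) * (q x * l x) * f x" for x
  define f'' where "f'' x = - (4 * (t * \<kappa>)) * (2 * l x * l x + q x) * f x + (4 * (t * \<kappa>) * (q x * l x))\<^sup>2 * f x" for x
  have d1: "(f has_real_derivative f' x) (at x)" for x
  proof -
    have "(f has_real_derivative exp (- (t * \<kappa>) * (q x)\<^sup>2) * (- (t * \<kappa>) * (2 * q x * (2 * l x)))) (at x)"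
      unfolding f_eq[abs_def] by (auto intro!: derivative_eq_intros dq)
    then show ?thesis unfolding f'_def f_eq by (simp add: algebra_simps)
  qed
  have d2: "(f' has_real_derivative f'' x) (at x)" for x
  proof -
    have "(f' has_real_derivative - (4 * (t * \<kappa>)) * (2 * l x * l x + q x) * f x + (- (4 * (t * \<kappa>)) * (q x * l x)) * f' x) (at x)"
      unfolding f'_def[abs_def] by (auto intro!: derivative_eq_intros dq dl d1[unfolded f'_def] simp: algebra_simps)
    then show ?thesis unfolding f''_def f'_def by (simp add: algebra_simps power2_eq_square)
  qed
  define B where "B = 9 * (28 * (\<kappa> + 1)\<^sup>2 * (48 * exp 1)) * sqrt t / (1 + sqrt t * (m \<bullet> m))\<^sup>2"
  have zp: "1 + sqrt t * (m \<bullet> m) > 0" using t by (intro add_pos_nonneg) auto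
  have B: "\<bar>f'' x\<bar> \<le> B" if x: "\<bar>x\<bar> \<le> 1" for x
  proof -
    define z where "z = sqrt t * q x"
    have z: "z \<ge> 0" using t q0 by (simp add: z_def)
    have tz: "t = sqrt t * sqrt t" using t by simp
    have fx: "f x \<ge> 0" by (simp add: f_eq)
    have "\<bar>f'' x\<bar> \<le> (4 * (t * \<kappa>)) * (3 * q x) * f x + (4 * (t * \<kappa>))\<^sup>2 * (q x ^ 3) * f x"
    proof -
      have "\<bar>f'' x\<bar> \<le> \<bar>- (4 * (t * \<kappa>)) * (2 * l x * l x + q x) * f x\<bar> + \<bar>(4 * (t * \<kappa>) * (q x * l x))\<^sup>2 * f x\<bar>"
        unfolding f''_def by (rule abs_triangle_ineq)
      also have "\<bar>- (4 * (t * \<kappa>)) * (2 * l x * l x + q x) * f x\<bar> = (4 * (t * \<kappa>)) * (2 * (l x)\<^sup>2 + q x) * f x"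
        using t \<kappa> q0[of x] fx by (simp add: abs_mult power2_eq_square)
      also have "\<dots> \<le> (4 * (t * \<kappa>)) * (3 * q x) * f x"
        using lq[of x] t \<kappa> fx by (intro mult_right_mono mult_left_mono) auto
      also have "\<bar>(4 * (t * \<kappa>) * (q x * l x))\<^sup>2 * f x\<bar> = (4 * (t * \<kappa>))\<^sup>2 * ((q x)\<^sup>2 * (l x)\<^sup>2) * f x"
        using fx by (simp add: abs_mult power_mult_distrib)
      also have "\<dots> \<le> (4 * (t * \<kappa>))\<^sup>2 * ((q x)\<^sup>2 * q x) * f x"
        using lq[of x] fx by (intro mult_right_mono mult_left_mono) auto
      finally show ?thesis by (simp add: power3_eq_cube power2_eq_square mult_ac)
    qed
    also have "\<dots> = sqrt t * ((12 * \<kappa> * z + 16 * \<kappa>\<^sup>2 * z ^ 3) * f x)"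
    proof -
      have e1: "t * q x = sqrt t * z" unfolding z_def using tz by (simp add: mult.assoc[symmetric])
      have e2: "t\<^sup>2 * q x ^ 3 = sqrt t * z ^ 3"
      proof -
        have "sqrt t * z ^ 3 = (sqrt t * sqrt t) * (sqrt t * sqrt t) * q x ^ 3" unfolding z_def by (simp add: power3_eq_cube mult_ac)
        then show ?thesis using tz by (simp add: power2_eq_square)
      qed
      have "(4 * (t * \<kappa>)) * (3 * q x) * f x + (4 * (t * \<kappa>))\<^sup>2 * (q x ^ 3) * f x = (12 * \<kappa> * (t * q x) + 16 * \<kappa>\<^sup>2 * (t\<^sup>2 * q x ^ 3)) * f x"
        by (simp add: algebra_simps power_mult_distrib)
      then show ?thesis unfolding e1 e2 by (simp add: algebra_simps)
    qed
    \<comment> \<open>A common majorant for both terms: \<open>28 = 12 + 16\<close>, and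
      \<open>(\<kappa> + 1) ^ 2\<close> dominates \<kappa> as well as its square.\<close>
    also have "\<dots> \<le> sqrt t * (28 * (\<kappa> + 1)\<^sup>2 * (1 + z) ^ 4 * f x)"
    proof (intro mult_left_mono mult_right_mono)
      have k: "\<kappa> \<le> (\<kappa> + 1)\<^sup>2" "\<kappa>\<^sup>2 \<le> (\<kappa> + 1)\<^sup>2" using \<kappa> by (auto simp: power2_eq_square algebra_simps)
      have "z \<le> (1 + z) ^ 4" using z power_increasing[of 1 4 "1 + z"] by simp
      moreover have "z ^ 3 \<le> (1 + z) ^ 4"
        using z power_mono[of z "1 + z" 3] power_increasing[of 3 4 "1 + z"] by linarith
      ultimately have "\<kappa> * z \<le> (\<kappa> + 1)\<^sup>2 * (1 + z) ^ 4" "\<kappa>\<^sup>2 * z ^ 3 \<le> (\<kappa> + 1)\<^sup>2 * (1 + z) ^ 4"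
        using k z \<kappa> by (auto intro!: mult_mono)
      then show "12 * \<kappa> * z + 16 * \<kappa>\<^sup>2 * z ^ 3 \<le> 28 * (\<kappa> + 1)\<^sup>2 * (1 + z) ^ 4" by simp
    qed (use fx t in auto)
    also have "\<dots> \<le> sqrt t * (28 * (\<kappa> + 1)\<^sup>2 * (48 * exp 1 / (1 + z)\<^sup>2))"
    proof -
      have "(1 + z) ^ 6 * f x \<le> 48 * exp 1"
        using semi_decay[of t "m + x *\<^sub>R axis i 1"] t unfolding f_def z_def q_def by simp
      moreover have p6: "(1 + z) ^ 6 = (1 + z) ^ 4 * (1 + z)\<^sup>2" by (simp add: power_add[symmetric])
      have "(1 + z) ^ 6 * f x = ((1 + z) ^ 4 * f x) * (1 + z)\<^sup>2" unfolding p6 by (simp only: mult_ac)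
      moreover have "(1 + z)\<^sup>2 > 0" using z by simp
      ultimately have "(1 + z) ^ 4 * f x \<le> 48 * exp 1 / (1 + z)\<^sup>2" by (simp only: pos_le_divide_eq)
      then have "sqrt t * (28 * (\<kappa> + 1)\<^sup>2 * ((1 + z) ^ 4 * f x)) \<le> sqrt t * (28 * (\<kappa> + 1)\<^sup>2 * (48 * exp 1 / (1 + z)\<^sup>2))"
        using t by (intro mult_left_mono) auto
      then show ?thesis by (simp add: mult.assoc)
    qed
    \<comment> \<open>Back from the intermediate point to the centre: as \<open>t \<le> 1\<close>
      and \<open>\<bar>x\<bar> \<le> 1\<close>, the quantity
      \<open>1 + sqrt t * (m \<bullet> m)\<close> is at most \<open>3 * (1 + z)\<close>, and the
      square of \<open>3\<close> is the \<open>9\<close>.\<close>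
    also have "\<dots> \<le> sqrt t * (28 * (\<kappa> + 1)\<^sup>2 * (9 * (48 * exp 1) / (1 + sqrt t * (m \<bullet> m))\<^sup>2))"
    proof (intro mult_left_mono)
      have "m \<bullet> m \<le> 2 * q x + 2"
      proof -
        have "q x = m \<bullet> m + 2 * x * m $ i + x\<^sup>2" by (rule q_eq)
        moreover have "- (4 * x * m $ i) \<le> (m $ i)\<^sup>2 + 4 * x\<^sup>2"
          using zero_le_power2[of "m $ i + 2 * x"] by (simp add: power2_eq_square algebra_simps)
        moreover have "x\<^sup>2 \<le> 1" using x by (simp add: abs_square_le_1)
        moreover have "(m $ i)\<^sup>2 \<le> m \<bullet> m" by (rule component_sq_le_inner)
        ultimately show ?thesis by linarith
      qed
      then have "sqrt t * (m \<bullet> m) \<le> sqrt t * (2 * q x + 2)" using t by (intro mult_left_mono) auto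
      also have "\<dots> = 2 * z + 2 * sqrt t" by (simp add: z_def algebra_simps)
      finally have "sqrt t * (m \<bullet> m) \<le> 2 * z + 2 * sqrt t" .
      moreover have "sqrt t \<le> 1" using t by simp
      moreover have "1 + P \<le> 3 * (1 + z)" if "P \<le> 2 * z + 2 * s" "s \<le> 1" for P s :: real
        using that z by argo
      ultimately have "1 + sqrt t * (m \<bullet> m) \<le> 3 * (1 + z)" by blast
      then have "(1 + sqrt t * (m \<bullet> m))\<^sup>2 \<le> (3 * (1 + z))\<^sup>2" using zp by (intro power_mono) auto
      then have "(1 + sqrt t * (m \<bullet> m))\<^sup>2 \<le> 9 * (1 + z)\<^sup>2" unfolding power_mult_distrib[of 3] by simp
      then have le: "(48 * exp 1) * (1 + sqrt t * (m \<bullet> m))\<^sup>2 \<le> 9 * (48 * exp 1) * (1 + z)\<^sup>2" by simp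
      show "48 * exp 1 / (1 + z)\<^sup>2 \<le> 9 * (48 * exp 1) / (1 + sqrt t * (m \<bullet> m))\<^sup>2"
      proof -
        have p: "(1 + z)\<^sup>2 > 0" "(1 + sqrt t * (m \<bullet> m))\<^sup>2 > 0" using zp z by simp_all
        have "48 * exp 1 = (48 * exp 1) * (1 + sqrt t * (m \<bullet> m))\<^sup>2 / (1 + sqrt t * (m \<bullet> m))\<^sup>2" using p(2) by simp
        also have "\<dots> \<le> 9 * (48 * exp 1) * (1 + z)\<^sup>2 / (1 + sqrt t * (m \<bullet> m))\<^sup>2" using le p(2) by (intro divide_right_mono) auto
        finally have "48 * exp 1 \<le> 9 * (48 * exp 1) / (1 + sqrt t * (m \<bullet> m))\<^sup>2 * (1 + z)\<^sup>2" by (simp add: mult.commute)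
        then show ?thesis using p(1) by (subst pos_divide_le_eq)
      qed
    qed (use t in auto)
    also have "\<dots> = B" by (simp add: B_def)
    finally show ?thesis .
  qed
  have "\<bar>2 * f 0 - f 1 - f (- 1)\<bar> \<le> 2 * B" by (rule second_difference_bound[OF d1 d2 B])
  then have "\<bar>2 * semi t m - semi t (m + axis i 1) - semi t (m - axis i 1)\<bar> \<le> 2 * B" by (simp add: f_def)
  then have "\<bar>2 * semi t m - semi t (m + axis i 1) - semi t (m - axis i 1)\<bar> * (1 + sqrt t * (m \<bullet> m))\<^sup>2 \<le> 2 * B * (1 + sqrt t * (m \<bullet> m))\<^sup>2"
    by (rule mult_right_mono) simp
  also have "\<dots> = 2 * (9 * (28 * (\<kappa> + 1)\<^sup>2 * (48 * exp 1))) * sqrt t"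
    using zp unfolding B_def by (simp add: field_simps)
  finally show ?thesis unfolding \<kappa>_def .
qed

lemma power_le_fact_exp:
  fixes x :: real assumes "x \<ge> 0" shows "x ^ n \<le> fact n * exp x"
proof -
  have "x ^ n /\<^sub>R fact n \<le> (\<Sum>k. x ^ k /\<^sub>R fact k)"
    using sum_le_suminf[OF summable_exp_generic[of x], of "{n}"] assms by simp
  then have "x ^ n / fact n \<le> exp x" using exp_converges[of x] by (simp add: sums_iff divide_inverse_commute)
  then show ?thesis by (simp add: pos_divide_le_eq mult.commute)
qed

lemma inner_le_lam: "m \<bullet> m \<le> lam (m :: real ^ 'd::finite)"
proof -
  have "1 * (m \<bullet> m) \<le> (2 * pi)\<^sup>2 * (m \<bullet> m)"
    using pi_ge_two by (intro mult_right_mono one_le_power) auto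
  then show ?thesis by (simp add: lam_def)
qed

text \<open>With \<open>y = 1 + m \<bullet> m\<close> the exponent is at least
  \<open>t * (y ^ 2 / 2 - 1)\<close>, and the exponential series beats every power of
  \<open>t / 2 * y ^ 2\<close>.\<close>

lemma semi_rdecay:
  fixes c :: "real ^ 'd::finite \<Rightarrow> complex"
  assumes t: "t > 0" and c: "\<And>m. m \<in> int_lattice \<Longrightarrow> cmod (c m) \<le> K"
  shows "rdecay (\<lambda>m. of_real (semi t m) * c m)"
proof (rule rdecay_bounded)
  fix k
  have "(1 + m \<bullet> m) ^ k * cmod (of_real (semi t m) * c m) \<le> (fact k / (t / 2) ^ k * exp t) * K"
    if m: "m \<in> int_lattice" for m
  proof -
    define y where "y = 1 + m \<bullet> m"
    have y: "y \<ge> 1" by (simp add: y_def)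
    have "0 \<le> (1 - m \<bullet> m)\<^sup>2" by simp
    then have "y\<^sup>2 / 2 - 1 \<le> (m \<bullet> m)\<^sup>2" unfolding y_def by (simp add: power2_eq_square algebra_simps)
    also have "\<dots> \<le> (lam m)\<^sup>2" by (intro power_mono inner_le_lam) simp
    finally have "t * (y\<^sup>2 / 2 - 1) \<le> t * (lam m)\<^sup>2" using t by (intro mult_left_mono) auto
    then have "- t * (lam m)\<^sup>2 \<le> t - t / 2 * y\<^sup>2" by (simp add: algebra_simps)
    then have s: "semi t m \<le> exp t * exp (- (t / 2 * y\<^sup>2))" unfolding semi_def exp_add[symmetric] by simp
    have "(t / 2 * y\<^sup>2) ^ k \<le> fact k * exp (t / 2 * y\<^sup>2)" using t by (intro power_le_fact_exp) auto
    then have "(t / 2) ^ k * (y\<^sup>2) ^ k * exp (- (t / 2 * y\<^sup>2)) \<le> fact k * exp (t / 2 * y\<^sup>2) * exp (- (t / 2 * y\<^sup>2))"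
      unfolding power_mult_distrib by (rule mult_right_mono) simp
    also have "\<dots> = fact k" by (simp add: mult.assoc exp_add[symmetric])
    finally have e: "(y\<^sup>2) ^ k * exp (- (t / 2 * y\<^sup>2)) \<le> fact k / (t / 2) ^ k"
      using t by (subst pos_le_divide_eq) (auto simp: mult_ac)
    have "y ^ k \<le> (y\<^sup>2) ^ k" using y by (intro power_mono) (auto simp: power2_eq_square)
    then have "y ^ k * semi t m \<le> (y\<^sup>2) ^ k * (exp t * exp (- (t / 2 * y\<^sup>2)))"
      using s y by (intro mult_mono) auto
    also have "\<dots> \<le> fact k / (t / 2) ^ k * exp t" using mult_right_mono[OF e, of "exp t"] by (simp add: mult_ac)
    finally have "y ^ k * semi t m \<le> fact k / (t / 2) ^ k * exp t" .
    from mult_mono[OF this c[OF m]] have "y ^ k * semi t m * cmod (c m) \<le> (fact k / (t / 2) ^ k * exp t) * K"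
      using t by simp
    then show ?thesis by (simp add: norm_mult y_def mult.assoc)
  qed
  then show "\<exists>B. \<forall>m\<in>int_lattice. (1 + m \<bullet> m) ^ k * cmod (of_real (semi t m) * c m) \<le> B" by blast
qed

lemma semi_summable: "t > 0 \<Longrightarrow> semi t summable_on (int_lattice :: (real ^ 'd::finite) set)"
  using rdecay_summable[OF semi_rdecay[of t "\<lambda>_. 1" 1]] by simp

lemma semi_mult_summable:
  fixes r :: "real ^ 'd::finite \<Rightarrow> real"
  assumes "t > 0" and "\<And>m. m \<in> int_lattice \<Longrightarrow> \<bar>r m\<bar> \<le> K"
  shows "(\<lambda>m. semi t m * r m) summable_on int_lattice"
proof -
  have "(\<lambda>m. semi t m * K) summable_on (int_lattice :: (real ^ 'd) set)"
    using semi_summable[OF assms(1)] by (rule summable_on_cmult_left)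
  then have "(\<lambda>m. norm (semi t m * r m)) summable_on int_lattice"
    by (rule Infinite_Sum.abs_summable_on_comparison_test') (simp add: abs_mult mult_left_mono assms(2))
  then show ?thesis by (rule Infinite_Sum.abs_summable_summable)
qed

section \<open>Summation by parts against the weight\<close>

text \<open>\<open>4 * sin2 (y $ i)\<close> equals \<open>2\<close> minus the modes of frequency
  \<open>axis i 1\<close> and \<open>- axis i 1\<close> at \<open>y\<close>, and a product with a
  mode shifts the frequency.\<close>

lemma fourier_sin2_mult:
  fixes k :: "real ^ 'd::finite \<Rightarrow> real"
  assumes k: "continuous_on UNIV k"
  shows "fourier (\<lambda>y. sin2 (y $ i) * k y) m = (2 * fourier k m - fourier k (m - axis i 1) - fourier k (m + axis i 1)) / 4"
proof -
  let ?e = "axis i 1 :: real ^ 'd"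
  have e: "complex_of_real (sin2 (y $ i) * k y) * cnj (mode m y) =
     (1/4) * (2 * (of_real (k y) * cnj (mode m y)) - of_real (k y) * cnj (mode (m - ?e) y) - of_real (k y) * cnj (mode (m + ?e) y))" for y
  proof -
    have s: "sin2 (y $ i) = (1 - cos (2 * pi * (y $ i))) / 2"
      using cos_double_sin[of "pi * (y $ i)"] by (simp add: sin2_def mult.assoc)
    have "mode ?e y + cnj (mode ?e y) = of_real (2 * cos (2 * pi * (y $ i)))"
      by (simp add: mode_def inner_axis' complex_eq_iff)
    then have s': "complex_of_real (sin2 (y $ i)) = (2 - mode ?e y - cnj (mode ?e y)) / 4"
      unfolding s by (simp add: field_simps)
    have e1: "cnj (mode (m - ?e) y) = cnj (mode m y) * mode ?e y"
      using mode_add[of m "- ?e" y] by (simp add: mode_minus)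
    have e2: "cnj (mode (m + ?e) y) = cnj (mode m y) * cnj (mode ?e y)"
      by (simp add: mode_add)
    show ?thesis unfolding of_real_mult s' e1 e2 by (simp add: field_simps)
  qed
  have i: "integrable torus (\<lambda>y. complex_of_real (k y) * cnj (mode n y))" for n
    by (intro integrable_torus_continuous continuous_of_real_mult_mode k)
  show ?thesis unfolding fourier_def e using i by simp
qed

lemma fourier_sum:
  assumes "finite A" "\<And>i. i \<in> A \<Longrightarrow> continuous_on UNIV (f i)"
  shows "fourier (\<lambda>x. \<Sum>i\<in>A. f i x) m = (\<Sum>i\<in>A. fourier (f i) m)"
  using assms
proof (induction A rule: finite_induct)
  case empty then show ?case by (simp add: fourier_def)
next
  case (insert a A)
  have "fourier (\<lambda>x. f a x + (\<Sum>i\<in>A. f i x)) m = fourier (f a) m + fourier (\<lambda>x. \<Sum>i\<in>A. f i x) m"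
    using insert by (intro fourier_add continuous_on_sum) auto
  then show ?case using insert by simp
qed

lemma lattice_weight_ge:
  assumes "N > 0" shows "(1 / (1 + (m \<bullet> m) / N\<^sup>2)) ^ CARD('d) \<le> lattice_weight N (m :: real ^ 'd::finite)"
proof -
  have "(1 / (1 + (m \<bullet> m) / N\<^sup>2)) ^ CARD('d) = (\<Prod>i\<in>(UNIV :: 'd set). 1 / (1 + (m \<bullet> m) / N\<^sup>2))" by simp
  also have "\<dots> \<le> lattice_weight N m" unfolding lattice_weight_def
    by (intro prod_mono conjI divide_left_mono add_left_mono)
       (use assms in \<open>auto simp: power_divide component_sq_le_inner divide_right_mono add_pos_nonneg intro!: mult_pos_pos\<close>)
  finally show ?thesis .
qed

text \<open>The coefficients of the heat kernel times the weight \<open>1 + N ^ 2 * sin2sum\<close>,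
  where \<open>N ^ 2 = 1 / sqrt t\<close>.\<close>

definition dual_coef :: "real \<Rightarrow> real ^ 'd \<Rightarrow> real" where
  "dual_coef t m = semi t m + (1 / sqrt t / 4) * (\<Sum>i\<in>UNIV. 2 * semi t m - semi t (m + axis i 1) - semi t (m - axis i 1))"

text \<open>With \<open>z = 1 + sqrt t * (m \<bullet> m)\<close> the coefficient is at most
  \<open>C / z ^ 2\<close>. Its square is at most a multiple of \<open>z ^ (- d)\<close>, as
  \<open>d < 4\<close>, hence of \<open>lattice_weight N m\<close> for
  \<open>N = t powr (- 1/4)\<close>, and the sum of that weight is of order
  \<open>N ^ d\<close>.\<close>

lemma dual_coef_l2:
  assumes d: "CARD('d::finite) \<le> 3"
  shows "\<exists>C\<ge>0. \<forall>t F. 0 < t \<and> t \<le> 1 \<and> finite F \<and> F \<subseteq> (int_lattice :: (real ^ 'd) set) \<longrightarrow>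
    (\<Sum>m\<in>F. (dual_coef t m)\<^sup>2) \<le> C * (1 / sqrt (sqrt t)) ^ CARD('d)"
proof -
  define K where "K = 2 * (9 * (28 * ((2 * pi) ^ 4 + 1)\<^sup>2 * (48 * exp 1)) :: real)"
  define C where "C = 48 * exp 1 + real CARD('d) * K / 4"
  have K: "K \<ge> 0" by (simp add: K_def)
  have C: "C \<ge> 0" unfolding C_def using K by simp
  have "(\<Sum>m\<in>F. (dual_coef t m)\<^sup>2) \<le> C\<^sup>2 * 5 ^ CARD('d) * (1 / sqrt (sqrt t)) ^ CARD('d)"
    if t: "0 < t" "t \<le> 1" and F: "finite F" "F \<subseteq> (int_lattice :: (real ^ 'd) set)" for t F
  proof -
    define N where "N = 1 / sqrt (sqrt t)"
    have N1: "N \<ge> 1" unfolding N_def using t by simp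
    have N2: "1 / N\<^sup>2 = sqrt t" unfolding N_def using t by (simp add: power_divide)
    have "(dual_coef t m)\<^sup>2 \<le> C\<^sup>2 * lattice_weight N m" if m: "m \<in> F" for m :: "real ^ 'd"
    proof -
      define z where "z = 1 + sqrt t * (m \<bullet> m)"
      have z: "z \<ge> 1" unfolding z_def using t by simp
      have "\<bar>dual_coef t m\<bar> * z\<^sup>2 \<le> C"
      proof -
        have "\<bar>dual_coef t m\<bar> \<le> semi t m + (1 / sqrt t / 4) * (\<Sum>i\<in>UNIV. \<bar>2 * semi t m - semi t (m + axis i 1) - semi t (m - axis i 1)\<bar>)"
          unfolding dual_coef_def using t
          by (intro order_trans[OF abs_triangle_ineq] add_mono) (auto simp: abs_mult intro!: mult_left_mono divide_right_mono)
        then have "\<bar>dual_coef t m\<bar> * z\<^sup>2 \<le> (semi t m + (1 / sqrt t / 4) * (\<Sum>i\<in>UNIV. \<bar>2 * semi t m - semi t (m + axis i 1) - semi t (m - axis i 1)\<bar>)) * z\<^sup>2"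
          by (rule mult_right_mono) simp
        also have "\<dots> = semi t m * z\<^sup>2 + (1 / sqrt t / 4) * (\<Sum>i\<in>UNIV. \<bar>2 * semi t m - semi t (m + axis i 1) - semi t (m - axis i 1)\<bar> * z\<^sup>2)"
          by (simp only: distrib_right sum_distrib_right mult.assoc)
        also have "\<dots> \<le> 48 * exp 1 + (1 / sqrt t / 4) * (\<Sum>i\<in>(UNIV :: 'd set). K * sqrt t)"
        proof (intro add_mono mult_left_mono sum_mono)
          have "semi t m * z\<^sup>2 \<le> semi t m * z ^ 6" using z by (intro mult_left_mono power_increasing) auto
          also have "\<dots> \<le> 48 * exp 1" using semi_decay[of t m] t by (simp add: z_def mult.commute)
          finally show "semi t m * z\<^sup>2 \<le> 48 * exp 1" .
          show "\<bar>2 * semi t m - semi t (m + axis i 1) - semi t (m - axis i 1)\<bar> * z\<^sup>2 \<le> K * sqrt t" for i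
            unfolding K_def z_def by (rule semi_second_difference[OF t])
        qed (use t in auto)
        also have "\<dots> = C" unfolding C_def using t by simp
        finally show ?thesis .
      qed
      then have "\<bar>dual_coef t m\<bar> \<le> C / z\<^sup>2" using z by (subst pos_le_divide_eq) auto
      then have "\<bar>dual_coef t m\<bar>\<^sup>2 \<le> (C / z\<^sup>2)\<^sup>2" by (rule power_mono) simp
      then have "(dual_coef t m)\<^sup>2 \<le> C\<^sup>2 * (1 / z) ^ 4" by (simp add: power_divide power_mult[symmetric])
      also have "\<dots> \<le> C\<^sup>2 * (1 / z) ^ CARD('d)"
        using z d by (intro mult_left_mono power_decreasing) auto
      also have "\<dots> \<le> C\<^sup>2 * lattice_weight N m"
        using lattice_weight_ge[of N m] N1 N2 unfolding z_def by (intro mult_left_mono) (auto simp: divide_inverse mult.commute)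
      finally show ?thesis .
    qed
    then have "(\<Sum>m\<in>F. (dual_coef t m)\<^sup>2) \<le> C\<^sup>2 * (\<Sum>m\<in>F. lattice_weight N m)"
      unfolding sum_distrib_left by (rule sum_mono)
    also have "\<dots> \<le> C\<^sup>2 * (5 * N) ^ CARD('d)" by (intro mult_left_mono sum_lattice_weight_le N1 F) simp
    finally show ?thesis by (simp add: N_def power_mult_distrib power_divide)
  qed
  then show ?thesis by (intro exI[of _ "C\<^sup>2 * 5 ^ CARD('d)"]) auto
qed

lemma has_sum_abs_le:
  fixes f :: "'a \<Rightarrow> real"
  assumes "(f has_sum V) A" "\<And>F. finite F \<Longrightarrow> F \<subseteq> A \<Longrightarrow> \<bar>sum f F\<bar> \<le> L"
  shows "\<bar>V\<bar> \<le> L"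
proof (rule tendsto_upperbound)
  show "((\<lambda>F. \<bar>sum f F\<bar>) \<longlongrightarrow> \<bar>V\<bar>) (finite_subsets_at_top A)"
    using assms(1) unfolding has_sum_def by (rule tendsto_rabs)
  show "\<forall>\<^sub>F F in finite_subsets_at_top A. \<bar>sum f F\<bar> \<le> L"
    by (intro eventually_finite_subsets_at_top_weakI assms(2))
qed simp

lemma lattice_shift_has_sum:
  fixes f :: "real ^ 'd::finite \<Rightarrow> real"
  assumes e: "e \<in> int_lattice"
  shows "((\<lambda>m. f (m + e)) has_sum S) int_lattice \<longleftrightarrow> (f has_sum S) int_lattice"
proof (rule has_sum_reindex_bij_betw)
  show "bij_betw (\<lambda>m. m + e) int_lattice int_lattice"
    by (rule bij_betw_byWitness[where f'="\<lambda>m. m - e"]) (use e in auto)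
qed

text \<open>
  With \<open>N = t powr (-1/4)\<close>, the weight \<open>W = 1 + N\<^sup>2 sin2sum\<close> and \<open>k = h / W\<close>, multiplication by \<open>W\<close> is
  a second difference on the Fourier side. Summation by parts moves it to the kernel, and the Cauchy-Schwarz
  inequality pairs \<open>dual_coef\<close> with the \<open>L\<^sup>2\<close> norm of \<open>k\<close>.
\<close>

lemma semigroup_sup_bound_small:
  assumes d: "CARD('d::finite) \<le> 3"
  shows "\<exists>C\<ge>0. \<forall>t (h :: real ^ 'd \<Rightarrow> real) B x. 0 < t \<and> t \<le> 1 \<and> continuous_on UNIV h \<and> torus_periodic h \<and> (\<forall>x. \<bar>h x\<bar> \<le> B)
     \<longrightarrow> \<bar>rser (\<lambda>m. of_real (semi t m) * fourier h m) x\<bar> \<le> C * B"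
proof -
  obtain C where C: "C \<ge> 0" and C2: "\<And>t F. 0 < t \<Longrightarrow> t \<le> 1 \<Longrightarrow> finite F \<Longrightarrow> F \<subseteq> (int_lattice :: (real ^ 'd) set) \<Longrightarrow>
    (\<Sum>m\<in>F. (dual_coef t m)\<^sup>2) \<le> C * (1 / sqrt (sqrt t)) ^ CARD('d)"
    using dual_coef_l2[OF d] by blast
  have "\<bar>rser (\<lambda>m. of_real (semi t m) * fourier h m) x\<bar> \<le> sqrt (C * 24 ^ CARD('d)) * B"
    if t: "0 < t" "t \<le> 1" and h: "continuous_on UNIV h" "torus_periodic h" and B: "\<And>x. \<bar>h x\<bar> \<le> B"
    for t B x and h :: "real ^ 'd \<Rightarrow> real"
  proof -
    define N where "N = 1 / sqrt (sqrt t)"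
    have N1: "N \<ge> 1" unfolding N_def using t by simp
    have N2: "N\<^sup>2 = 1 / sqrt t" unfolding N_def using t by (simp add: power_divide)
    have B0: "B \<ge> 0" using B[of 0] by linarith
    define W where "W y = 1 + N\<^sup>2 * sin2sum y" for y :: "real ^ 'd"
    have Wp: "W y > 0" for y unfolding W_def by (rule sin2sum_pos)
    \<comment> \<open>The translation puts the evaluation point at the origin, where the kernel
      concentrates and the weight is smallest. Division by \<open>W\<close> leaves a function whose
      squared \<open>L\<^sup>2\<close> norm is of order \<open>B ^ 2 * N ^ (- d)\<close>.\<close>
    define k where "k y = h (y + x) / W y" for y
    have hx: "continuous_on UNIV (\<lambda>y. h (y + x))"
      by (intro continuous_on_compose2[OF h(1)] continuous_intros) auto
    have cW: "continuous_on UNIV W" unfolding W_def by (intro continuous_intros continuous_sin2sum)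
    have k: "continuous_on UNIV k" unfolding k_def
      by (intro continuous_intros hx cW ballI less_imp_neq[OF Wp, THEN not_sym])
    have cs: "continuous_on UNIV (\<lambda>y. sin2 (y $ i) * k y)" for i
      unfolding sin2_def by (intro continuous_intros k)
    have kB: "\<bar>k y\<bar> \<le> B" for y
    proof -
      have "W y \<ge> 1" by (simp add: W_def)
      then have "\<bar>k y\<bar> \<le> \<bar>h (y + x)\<bar> / 1" unfolding k_def abs_divide by (intro frac_le) auto
      then show ?thesis using B[of "y + x"] by simp
    qed
    \<comment> \<open>The multipliers are real, so only the real parts of the coefficients of
      \<open>k\<close> enter the sum.\<close>
    define r where "r m = Re (fourier k m)" for m
    have rB: "\<bar>r m\<bar> \<le> B" for m
      unfolding r_def using abs_Re_le_cmod[of "fourier k m"] fourier_bound[OF k kB, of m] by linarith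
    have hk: "(\<lambda>y. h (y + x)) = (\<lambda>y. k y + N\<^sup>2 * (\<Sum>i\<in>UNIV. sin2 (y $ i) * k y))"
    proof
      fix y
      have "h (y + x) = k y * W y" using Wp[of y] by (simp add: k_def)
      then show "h (y + x) = k y + N\<^sup>2 * (\<Sum>i\<in>UNIV. sin2 (y $ i) * k y)"
        by (simp add: W_def sin2sum_def sum_distrib_left algebra_simps)
    qed
    have f_eq: "fourier (\<lambda>y. h (y + x)) m = fourier k m + of_real (N\<^sup>2) * (\<Sum>i\<in>UNIV. (2 * fourier k m - fourier k (m - axis i 1) - fourier k (m + axis i 1)) / 4)" for m
    proof -
      have "fourier (\<lambda>y. h (y + x)) m = fourier k m + fourier (\<lambda>y. N\<^sup>2 * (\<Sum>i\<in>UNIV. sin2 (y $ i) * k y)) m"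
        unfolding hk by (intro fourier_add k continuous_intros cs)
      also have "fourier (\<lambda>y. N\<^sup>2 * (\<Sum>i\<in>UNIV. sin2 (y $ i) * k y)) m = of_real (N\<^sup>2) * (\<Sum>i\<in>UNIV. fourier (\<lambda>y. sin2 (y $ i) * k y) m)"
        unfolding fourier_cmult by (subst fourier_sum) (auto intro: cs)
      finally show ?thesis by (simp add: fourier_sin2_mult[OF k])
    qed
    have summand: "Re (of_real (semi t m) * fourier h m * mode m x) =
        semi t m * r m + (1 / sqrt t / 4) * (\<Sum>i\<in>UNIV. 2 * (semi t m * r m) - semi t m * r (m - axis i 1) - semi t m * r (m + axis i 1))"
      if m: "m \<in> int_lattice" for m
    proof -
      have sh: "of_real (semi t m) * fourier h m * mode m x = of_real (semi t m) * fourier (\<lambda>y. h (y + x)) m"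
        by (subst fourier_shift[OF h m]) simp
      have "Re (of_real (semi t m) * fourier h m * mode m x) = semi t m * Re (fourier (\<lambda>y. h (y + x)) m)"
        unfolding sh by simp
      also have "Re (fourier (\<lambda>y. h (y + x)) m) = r m + (1 / sqrt t) * (\<Sum>i\<in>UNIV. (2 * r m - r (m - axis i 1) - r (m + axis i 1)) / 4)"
        unfolding f_eq r_def N2 by (simp add: Re_sum)
      also have "semi t m * \<dots> = semi t m * r m + (1 / sqrt t / 4) * (\<Sum>i\<in>UNIV. semi t m * (2 * r m - r (m - axis i 1) - r (m + axis i 1)))"
        by (simp add: distrib_left sum_distrib_left[symmetric] sum_divide_distrib[symmetric])
      finally show ?thesis by (simp add: right_diff_distrib mult.left_commute)
    qed
    define V where "V = rser (\<lambda>m. of_real (semi t m) * fourier h m) x"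
    have V: "((\<lambda>m. Re (of_real (semi t m) * fourier h m * mode m x)) has_sum V) int_lattice"
      unfolding V_def by (rule rser_has_sum[OF rdecay_summable[OF semi_rdecay[OF t(1) fourier_bound[OF h(1) B]]]])
    have sm: "(\<lambda>m. semi t m * r (m + e)) summable_on int_lattice" for e
      by (rule semi_mult_summable[OF t(1) rB])
    define A where "A e = (\<Sum>\<^sub>\<infinity>m\<in>int_lattice. semi t m * r (m + e))" for e
    have A: "((\<lambda>m. semi t m * r (m + e)) has_sum A e) int_lattice" for e
      unfolding A_def by (rule has_sum_infsum[OF sm])
    have A0: "((\<lambda>m. semi t m * r m) has_sum A 0) int_lattice" using A[of 0] by simp
    have Am: "((\<lambda>m. semi t m * r (m - axis i 1)) has_sum A (- axis i 1)) int_lattice" for i using A[of "- axis i 1"] by simp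
    \<comment> \<open>Re-indexing by a lattice vector moves the shift from \<open>r\<close> to
      \<open>semi\<close> without changing the sum \<open>A e\<close>.\<close>
    have A': "((\<lambda>m. semi t (m - e) * r m) has_sum A e) int_lattice" if "e \<in> int_lattice" for e
      using lattice_shift_has_sum[OF that, of "\<lambda>m. semi t (m - e) * r m" "A e"] A[of e] by simp
    have A'm: "((\<lambda>m. semi t (m + axis i 1) * r m) has_sum A (- axis i 1)) int_lattice" for i
      using A'[of "- axis i 1"] by simp
    define V' where "V' = A 0 + (1 / sqrt t / 4) * (\<Sum>i\<in>UNIV. 2 * A 0 - A (- axis i 1) - A (axis i 1))"
    have "((\<lambda>m. semi t m * r m + (1 / sqrt t / 4) * (\<Sum>i\<in>UNIV. 2 * (semi t m * r m) - semi t m * r (m - axis i 1) - semi t m * r (m + axis i 1))) has_sum V') int_lattice"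
      unfolding V'_def
      by (intro has_sum_add has_sum_cmult_right has_sum_finite_sum has_sum_diff_real A0 A Am) simp
    then have "((\<lambda>m. Re (of_real (semi t m) * fourier h m * mode m x)) has_sum V') int_lattice"
      by (rule has_sum_cong[THEN iffD1, rotated]) (simp only: summand)
    then have VV: "V = V'" using V by (rule has_sum_unique[rotated])
    \<comment> \<open>The same value once more, now with every shift on the symbol; this is the
      summation by parts.\<close>
    have "((\<lambda>m. semi t m * r m + (1 / sqrt t / 4) * (\<Sum>i\<in>UNIV. 2 * (semi t m * r m) - semi t (m + axis i 1) * r m - semi t (m - axis i 1) * r m)) has_sum V') int_lattice"
      unfolding V'_def
      by (intro has_sum_add has_sum_cmult_right has_sum_finite_sum has_sum_diff_real A0 A' A'm) auto
    moreover have "semi t m * r m + (1 / sqrt t / 4) * (\<Sum>i\<in>UNIV. 2 * (semi t m * r m) - semi t (m + axis i 1) * r m - semi t (m - axis i 1) * r m) = dual_coef t m * r m" for m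
      unfolding dual_coef_def distrib_right mult.assoc sum_distrib_right left_diff_distrib by simp
    ultimately have dual: "((\<lambda>m. dual_coef t m * r m) has_sum V) int_lattice" unfolding VV by simp
    have "\<bar>V\<bar> \<le> sqrt (C * 24 ^ CARD('d)) * B"
    proof (rule has_sum_abs_le[OF dual])
      fix F :: "(real ^ 'd) set" assume F: "finite F" "F \<subseteq> int_lattice"
      have "(\<Sum>m\<in>F. (r m)\<^sup>2) \<le> (\<Sum>m\<in>F. (cmod (fourier k m))\<^sup>2)"
        unfolding r_def by (intro sum_mono) (simp add: cmod_power2)
      also have "\<dots> \<le> (LINT y|torus. (k y)\<^sup>2)" by (rule bessel[OF k F])
      also have "\<dots> \<le> (LINT y|torus. B\<^sup>2 * (1 / W y)\<^sup>2)"
      proof (rule integral_mono)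
        show "(k y)\<^sup>2 \<le> B\<^sup>2 * (1 / W y)\<^sup>2" for y
          using power_mono[OF B[of "y + x"], of 2] by (simp add: k_def power_divide divide_right_mono)
      qed (auto intro!: integrable_torus_continuous continuous_intros k cW less_imp_neq[OF Wp, THEN not_sym])
      also have "\<dots> = B\<^sup>2 * (LINT y|torus. (1 / W y)\<^sup>2)" by simp
      also have "\<dots> \<le> B\<^sup>2 * (24 / N) ^ CARD('d)"
        unfolding W_def by (intro mult_left_mono sin2sum_integral N1 d) simp
      finally have rl: "(\<Sum>m\<in>F. (r m)\<^sup>2) \<le> B\<^sup>2 * (24 / N) ^ CARD('d)" .
      have "(\<Sum>m\<in>F. dual_coef t m * r m)\<^sup>2 \<le> (\<Sum>m\<in>F. (dual_coef t m)\<^sup>2) * (\<Sum>m\<in>F. (r m)\<^sup>2)"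
        by (rule Cauchy_Schwarz_ineq_sum)
      also have "\<dots> \<le> (C * N ^ CARD('d)) * (B\<^sup>2 * (24 / N) ^ CARD('d))"
      proof (rule mult_mono[OF _ rl])
        show "(\<Sum>m\<in>F. (dual_coef t m)\<^sup>2) \<le> C * N ^ CARD('d)" using C2[OF t F] by (simp add: N_def)
      qed (use C N1 in \<open>auto intro: sum_nonneg\<close>)
      \<comment> \<open>The powers of \<open>N\<close> cancel, \<open>N ^ d\<close> from
        \<open>dual_coef\<close> against \<open>N ^ (- d)\<close> from the weight, so the bound is
        uniform in \<open>t\<close>.\<close>
      also have "\<dots> = (sqrt (C * 24 ^ CARD('d)) * B)\<^sup>2"
        using N1 C by (simp add: power_mult_distrib power_divide)
      finally have "\<bar>\<Sum>m\<in>F. dual_coef t m * r m\<bar> \<le> \<bar>sqrt (C * 24 ^ CARD('d)) * B\<bar>"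
        by (simp only: abs_le_square_iff)
      then show "\<bar>\<Sum>m\<in>F. dual_coef t m * r m\<bar> \<le> sqrt (C * 24 ^ CARD('d)) * B" using B0 C by (simp add: abs_mult)
    qed
    then show ?thesis unfolding V_def .
  qed
  then show ?thesis using C by (intro exI[of _ "sqrt (C * 24 ^ CARD('d))"]) auto
qed

text \<open>For \<open>t > 1\<close> the symbol is below the one at time \<open>1\<close>, and
  summing moduli is enough. The constant is made at least \<open>1\<close> so that it also covers
  the identity at \<open>t = 0\<close>.\<close>

lemma semigroup_sup_bound:
  assumes d: "CARD('d::finite) \<le> 3"
  shows "\<exists>C\<ge>1. \<forall>t (h :: real ^ 'd \<Rightarrow> real) B x. 0 < t \<and> continuous_on UNIV h \<and> torus_periodic h \<and> (\<forall>x. \<bar>h x\<bar> \<le> B)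
     \<longrightarrow> \<bar>rser (\<lambda>m. of_real (semi t m) * fourier h m) x\<bar> \<le> C * B"
proof -
  obtain C where C: "C \<ge> 0" and small: "\<And>t (h :: real ^ 'd \<Rightarrow> real) B x. 0 < t \<Longrightarrow> t \<le> 1 \<Longrightarrow> continuous_on UNIV h \<Longrightarrow> torus_periodic h \<Longrightarrow> (\<And>x. \<bar>h x\<bar> \<le> B)
     \<Longrightarrow> \<bar>rser (\<lambda>m. of_real (semi t m) * fourier h m) x\<bar> \<le> C * B"
    using semigroup_sup_bound_small[OF d] by blast
  define S where "S = (\<Sum>\<^sub>\<infinity>m\<in>(int_lattice :: (real ^ 'd) set). semi 1 m)"
  have S: "(semi 1 has_sum S) (int_lattice :: (real ^ 'd) set)"
    unfolding S_def by (rule has_sum_infsum[OF semi_summable]) simp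
  have S0: "S \<ge> 0" using S by (rule has_sum_nonneg) simp
  have "\<bar>rser (\<lambda>m. of_real (semi t m) * fourier h m) x\<bar> \<le> (C + S + 1) * B"
    if t: "0 < t" and h: "continuous_on UNIV h" "torus_periodic h" and B: "\<And>x. \<bar>h x\<bar> \<le> B"
    for t B x and h :: "real ^ 'd \<Rightarrow> real"
  proof -
    have B0: "B \<ge> 0" using B[of 0] by linarith
    have "\<bar>rser (\<lambda>m. of_real (semi t m) * fourier h m) x\<bar> \<le> C * B \<or> \<bar>rser (\<lambda>m. of_real (semi t m) * fourier h m) x\<bar> \<le> S * B"
    proof (cases "t \<le> 1")
      case True then show ?thesis using small[OF t True h B] by blast
    next
      case False
      have "norm (rser (\<lambda>m. of_real (semi t m) * fourier h m) x) \<le> S * B"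
      proof (rule norm_infsum_le)
        show "((\<lambda>m. Re (of_real (semi t m) * fourier h m * mode m x)) has_sum rser (\<lambda>m. of_real (semi t m) * fourier h m) x) int_lattice"
          by (rule rser_has_sum[OF rdecay_summable[OF semi_rdecay[OF t fourier_bound[OF h(1) B]]]])
        show "((\<lambda>m :: real ^ 'd. semi 1 m * B) has_sum S * B) int_lattice" by (intro has_sum_cmult_left S)
        fix m :: "real ^ 'd"
        have "norm (Re (of_real (semi t m) * fourier h m * mode m x)) \<le> cmod (of_real (semi t m) * fourier h m)" by (rule norm_Re_mode_le)
        also have "\<dots> = semi t m * cmod (fourier h m)" by (simp add: norm_mult)
        also have "\<dots> \<le> semi 1 m * B"
        proof (intro mult_mono fourier_bound[OF h(1) B])
          show "semi t m \<le> semi 1 m" using False mult_right_mono[of 1 t "(lam m)\<^sup>2"] by (simp add: semi_def)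
        qed auto
        finally show "norm (Re (of_real (semi t m) * fourier h m * mode m x)) \<le> semi 1 m * B" .
      qed
      then show ?thesis by simp
    qed
    moreover have "C * B \<le> (C + S + 1) * B" "S * B \<le> (C + S + 1) * B"
      using B0 C S0 by (auto intro!: mult_right_mono)
    ultimately show ?thesis by linarith
  qed
  then show ?thesis using C S0 by (intro exI[of _ "C + S + 1"]) auto
qed

text \<open>The semigroup acts on coefficients and so commutes with blocks; the supremum bound is
  applied to the block itself, a continuous periodic function with the bound
  \<open>bsup n c\<close>.\<close>

lemma (in littlewood_paley) bsup_semi:
  assumes d: "CARD('d) \<le> 3"
  shows "\<exists>C\<ge>1. \<forall>t\<ge>0. \<forall>n c. (\<forall>m\<in>int_lattice. c (- m) = cnj (c m)) \<longrightarrow> bsup n (\<lambda>m. of_real (semi t m) * c m) \<le> C * bsup n c"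
proof -
  obtain C where C: "C \<ge> 1" and bd: "\<And>t (h :: real ^ 'd \<Rightarrow> real) B x. 0 < t \<Longrightarrow> continuous_on UNIV h \<Longrightarrow> torus_periodic h \<Longrightarrow> (\<And>x. \<bar>h x\<bar> \<le> B)
     \<Longrightarrow> \<bar>rser (\<lambda>m. of_real (semi t m) * fourier h m) x\<bar> \<le> C * B"
    using semigroup_sup_bound[OF d] by blast
  have "bsup n (\<lambda>m. of_real (semi t m) * c m) \<le> C * bsup n c"
    if t: "t \<ge> 0" and h: "\<And>m. m \<in> int_lattice \<Longrightarrow> c (- m) = cnj (c m)" for t n c
  proof (cases "t = 0")
    case True
    have "1 * bsup n c \<le> C * bsup n c" using C by (intro mult_right_mono) auto
    then show ?thesis using True by (simp add: semi_def)
  next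
    case False
    then have t': "t > 0" using t by simp
    have "block n (\<lambda>m. of_real (semi t m) * c m) x = rser (\<lambda>m. of_real (semi t m) * fourier (block n c) m) x" for x
    proof -
      have "rser (\<lambda>m. of_real (semi t m) * fourier (block n c) m) x = (\<Sum>\<^sub>\<infinity>m\<in>freqs n. Re (of_real (bump n m) * (of_real (semi t m) * c m) * mode m x))"
        unfolding rser_def
      proof (rule infsum_cong_neutral)
        fix m assume m: "m \<in> int_lattice - freqs n"
        then show "Re (of_real (semi t m) * fourier (block n c) m * mode m x) = 0"
          using fourier_block[of c m n, OF h] bump_freqs[of m n] by simp
      next
        fix m assume "m \<in> int_lattice \<inter> freqs n"
        then show "Re (of_real (semi t m) * fourier (block n c) m * mode m x) = Re (of_real (bump n m) * (of_real (semi t m) * c m) * mode m x)"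
          using fourier_block[of c m n, OF h] by (simp add: mult_ac)
      qed (use freqs_sub in auto)
      then show ?thesis unfolding block_def rpart_def by simp
    qed
    then show ?thesis
      using bd[OF t' continuous_block block_periodic block_le_bsup[of n c]] by (intro bsup_le) auto
  qed
  then show ?thesis using C by blast
qed

section \<open>The Duhamel term\<close>

abbreviation hermitian :: "(real ^ 'd \<Rightarrow> complex) \<Rightarrow> bool" where
  "hermitian c \<equiv> \<forall>m\<in>int_lattice. c (- m) = cnj (c m)"

context besov
begin

lemma synth_facts:
  assumes h: "hermitian c" and K: "\<And>n. wt n * bsup n c \<le> K"
  shows "continuous_on UNIV (synth c)" "torus_periodic (synth c)" "\<And>m. m \<in> int_lattice \<Longrightarrow> fourier (synth c) m = c m"
    "\<bar>synth c x\<bar> \<le> Csup * K" "(\<lambda>n. block n c x) sums synth c x"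
proof -
  have h': "\<And>m. m \<in> int_lattice \<Longrightarrow> c (- m) = cnj (c m)" using h by blast
  note S = synth[OF h' K]
  show "continuous_on UNIV (synth c)" "torus_periodic (synth c)" "\<And>m. m \<in> int_lattice \<Longrightarrow> fourier (synth c) m = c m"
    "\<bar>synth c x\<bar> \<le> Csup * K" "(\<lambda>n. block n c x) sums synth c x" using S by blast+
qed

lemma synth_eqI:
  assumes h: "hermitian c" and K: "\<And>n. wt n * bsup n c \<le> K"
    and u: "continuous_on UNIV u" "torus_periodic u" "\<And>m. m \<in> int_lattice \<Longrightarrow> fourier u m = c m"
  shows "synth c = u"
  by (rule fourier_eq_imp_eq[OF synth_facts(1,2)[OF h K] u(1,2)]) (simp add: synth_facts(3)[OF h K] u(3))

lemma synth_besov: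
  assumes h: "hermitian c" and z: "(\<lambda>n. wt n * bsup n c) \<longlonglongrightarrow> 0" and K: "\<And>n. wt n * bsup n c \<le> K"
  shows "dist_of (synth c) \<in> besov_space \<rho> \<alpha>"
proof -
  have "bsup n (fourier (synth c)) = bsup n c" for n by (rule bsup_cong) (rule synth_facts(3)[OF h K])
  then show ?thesis using z by (simp add: dist_of_besov_iff[OF synth_facts(1,2)[OF h K]])
qed

text \<open>The tail bound \<open>b\<close> is uniform in \<open>t\<close>, so up to \<epsilon> only
  finitely many blocks matter; these involve finitely many coefficients, each continuous in
  \<open>t\<close>.\<close>

lemma bcont_synth:
  assumes h: "\<And>t. t \<in> S \<Longrightarrow> hermitian (c t)"
    and cc: "\<And>m. m \<in> int_lattice \<Longrightarrow> continuous_on S (\<lambda>t. c t m)"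
    and tail: "\<And>t n. t \<in> S \<Longrightarrow> wt n * bsup n (c t) \<le> b n" and b: "b \<longlonglongrightarrow> 0"
  shows "bcont S (\<lambda>t. dist_of (synth (c t)))"
proof -
  obtain K where K: "\<And>n. b n \<le> K"
    using convergent_imp_Bseq[of b] b unfolding convergent_def Bseq_def by (metis abs_le_D1 real_norm_def)
  have bK: "wt n * bsup n (c t) \<le> K" if "t \<in> S" for t n using tail[OF that, of n] K[of n] by linarith
  have sp: "dist_of (synth (c t)) \<in> besov_space \<rho> \<alpha>" if t: "t \<in> S" for t
  proof (rule synth_besov[OF h[OF t] _ bK[OF t]])
    show "(\<lambda>n. wt n * bsup n (c t)) \<longlonglongrightarrow> 0"
      by (rule tendsto_sandwich[OF _ _ tendsto_const b]) (auto simp: tail[OF t])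
  qed
  have fc: "fcoef (dist_of (synth (c t))) m = c t m" if "t \<in> S" "m \<in> int_lattice" for t m
    using that by (simp add: fcoef_dist_of synth_facts(1,3)[OF h bK])
  show ?thesis unfolding bcont_def
  proof (intro conjI ballI allI impI)
    show "dist_of (synth (c t)) \<in> besov_space \<rho> \<alpha>" if "t \<in> S" for t by (rule sp[OF that])
    fix t and \<epsilon> :: real assume t: "t \<in> S" and e: "\<epsilon> > 0"
    obtain N where N: "\<And>n. n \<ge> N \<Longrightarrow> b n \<le> \<epsilon> / 2"
      using LIMSEQ_D[OF b, of "\<epsilon> / 2"] e by (metis abs_le_D1 diff_zero half_gt_zero less_imp_le real_norm_def)
    define G where "G s = (\<Sum>n<N. wt n * (\<Sum>m\<in>freqs n. bump n m * cmod (c s m - c t m)))" for s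
    have "continuous_on S G" unfolding G_def
      using freqs_sub by (intro continuous_intros cc) auto
    then obtain \<delta> where \<delta>: "\<delta> > 0" "\<And>s. s \<in> S \<Longrightarrow> dist s t < \<delta> \<Longrightarrow> dist (G s) (G t) < \<epsilon>"
      unfolding continuous_on_iff using t e by metis
    have Gt: "G t = 0" by (simp add: G_def)
    show "\<exists>\<delta>>0. \<forall>s\<in>S. \<bar>s - t\<bar> < \<delta> \<longrightarrow> bdist (dist_of (synth (c s))) (dist_of (synth (c t))) \<le> \<epsilon>"
    proof (intro exI[of _ \<delta>] conjI \<delta>(1) ballI impI)
      fix s assume s: "s \<in> S" "\<bar>s - t\<bar> < \<delta>"
      have "wt n * bsup n (\<lambda>m. c s m - c t m) \<le> \<epsilon>" for n
      proof (cases "n < N")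
        case True
        have "wt n * bsup n (\<lambda>m. c s m - c t m) \<le> wt n * (\<Sum>m\<in>freqs n. bump n m * cmod (c s m - c t m))"
          by (intro mult_left_mono bsup_le_sum) simp
        also have "\<dots> \<le> G s" unfolding G_def
          by (rule member_le_sum) (use True in \<open>auto intro!: mult_nonneg_nonneg sum_nonneg bump_nonneg\<close>)
        also have "\<dots> \<le> \<epsilon>" using \<delta>(2)[OF s(1)] s(2) Gt by (simp add: dist_real_def)
        finally show ?thesis .
      next
        case False
        have "wt n * bsup n (\<lambda>m. c s m - c t m) \<le> wt n * (bsup n (c s) + bsup n (c t))"
          by (intro mult_left_mono bsup_diff) simp
        also have "\<dots> \<le> b n + b n" unfolding distrib_left by (intro add_mono tail s t)
        also have "\<dots> \<le> \<epsilon>" using N[of n] False by simp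
        finally show ?thesis .
      qed
      moreover have "bsup n (\<lambda>m. fcoef (dist_of (synth (c s))) m - fcoef (dist_of (synth (c t))) m) = bsup n (\<lambda>m. c s m - c t m)" for n
        by (rule bsup_cong) (simp add: fc s t)
      ultimately show "bdist (dist_of (synth (c s))) (dist_of (synth (c t))) \<le> \<epsilon>"
        using e by (subst bdist_le_iff[OF sp[OF s(1)] sp[OF t]]) auto
    qed
  qed
qed

lemma bcont_add:
  assumes f: "bcont S (\<lambda>t. dist_of (f t))" and g: "bcont S (\<lambda>t. dist_of (g t))"
    and cf: "\<And>t. t \<in> S \<Longrightarrow> continuous_on UNIV (f t) \<and> torus_periodic (f t)"
    and cg: "\<And>t. t \<in> S \<Longrightarrow> continuous_on UNIV (g t) \<and> torus_periodic (g t)"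
  shows "bcont S (\<lambda>t. dist_of (\<lambda>x. f t x + g t x))"
proof -
  have cfg: "continuous_on UNIV (\<lambda>x. f t x + g t x)" "torus_periodic (\<lambda>x. f t x + g t x)" if "t \<in> S" for t
    using cf[OF that] cg[OF that] by (auto intro!: continuous_intros simp: torus_periodic_def)
  have fc: "fcoef (dist_of (\<lambda>x. f t x + g t x)) m = fcoef (dist_of (f t)) m + fcoef (dist_of (g t)) m" if "t \<in> S" "m \<in> int_lattice" for t m
    using that cf cg cfg by (simp add: fcoef_dist_of fourier_add)
  have sf: "dist_of (f t) \<in> besov_space \<rho> \<alpha>" and sg: "dist_of (g t) \<in> besov_space \<rho> \<alpha>" if "t \<in> S" for t
    using f g that by (auto simp: bcont_def)
  have sp: "dist_of (\<lambda>x. f t x + g t x) \<in> besov_space \<rho> \<alpha>" if t: "t \<in> S" for t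
    unfolding besov_space_iff
  proof
    show "dist_of (\<lambda>x. f t x + g t x) \<in> distributions" by (rule dist_of_distribution[OF cfg[OF t]])
    have le: "wt n * bsup n (fcoef (dist_of (\<lambda>x. f t x + g t x))) \<le> wt n * bsup n (fcoef (dist_of (f t))) + wt n * bsup n (fcoef (dist_of (g t)))" for n
    proof -
      have "bsup n (fcoef (dist_of (\<lambda>x. f t x + g t x))) = bsup n (\<lambda>m. fcoef (dist_of (f t)) m + fcoef (dist_of (g t)) m)"
        by (rule bsup_cong) (rule fc[OF t])
      also have "\<dots> \<le> bsup n (fcoef (dist_of (f t))) + bsup n (fcoef (dist_of (g t)))" by (rule bsup_add)
      finally show ?thesis unfolding distrib_left[symmetric] by (rule mult_left_mono) simp
    qed
    have "(\<lambda>n. wt n * bsup n (fcoef (dist_of (f t))) + wt n * bsup n (fcoef (dist_of (g t)))) \<longlonglongrightarrow> 0 + 0"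
      using sf[OF t] sg[OF t] unfolding besov_space_iff by (intro tendsto_add) auto
    then have z: "(\<lambda>n. wt n * bsup n (fcoef (dist_of (f t))) + wt n * bsup n (fcoef (dist_of (g t)))) \<longlonglongrightarrow> 0"
      by simp
    show "(\<lambda>n. wt n * bsup n (fcoef (dist_of (\<lambda>x. f t x + g t x)))) \<longlonglongrightarrow> 0"
    proof (rule tendsto_sandwich[OF _ _ tendsto_const z])
      show "\<forall>\<^sub>F n in sequentially. wt n * bsup n (fcoef (dist_of (\<lambda>x. f t x + g t x))) \<le>
          wt n * bsup n (fcoef (dist_of (f t))) + wt n * bsup n (fcoef (dist_of (g t)))"
        by (intro always_eventually allI le)
    qed simp
  qed
  have dd: "bdist (dist_of (\<lambda>x. f s x + g s x)) (dist_of (\<lambda>x. f t x + g t x)) \<le> bdist (dist_of (f s)) (dist_of (f t)) + bdist (dist_of (g s)) (dist_of (g t))"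
    if s: "s \<in> S" and t: "t \<in> S" for s t
  proof (subst bdist_le_iff[OF sp[OF s] sp[OF t]], simp, intro allI)
    fix n
    have "bsup n (\<lambda>m. fcoef (dist_of (\<lambda>x. f s x + g s x)) m - fcoef (dist_of (\<lambda>x. f t x + g t x)) m) =
      bsup n (\<lambda>m. (fcoef (dist_of (f s)) m - fcoef (dist_of (f t)) m) + (fcoef (dist_of (g s)) m - fcoef (dist_of (g t)) m))"
      by (rule bsup_cong) (simp add: fc s t)
    also have "\<dots> \<le> bsup n (\<lambda>m. fcoef (dist_of (f s)) m - fcoef (dist_of (f t)) m) + bsup n (\<lambda>m. fcoef (dist_of (g s)) m - fcoef (dist_of (g t)) m)"
      by (rule bsup_add)
    finally have "wt n * bsup n (\<lambda>m. fcoef (dist_of (\<lambda>x. f s x + g s x)) m - fcoef (dist_of (\<lambda>x. f t x + g t x)) m) \<le>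
      wt n * (bsup n (\<lambda>m. fcoef (dist_of (f s)) m - fcoef (dist_of (f t)) m) + bsup n (\<lambda>m. fcoef (dist_of (g s)) m - fcoef (dist_of (g t)) m))"
      by (rule mult_left_mono) simp
    then show "wt n * bsup n (\<lambda>m. fcoef (dist_of (\<lambda>x. f s x + g s x)) m - fcoef (dist_of (\<lambda>x. f t x + g t x)) m) \<le>
      bdist (dist_of (f s)) (dist_of (f t)) + bdist (dist_of (g s)) (dist_of (g t))"
      using bsup_le_bdist[OF sf[OF s] sf[OF t], of n] bsup_le_bdist[OF sg[OF s] sg[OF t], of n] by (simp add: distrib_left)
  qed
  show ?thesis unfolding bcont_def
  proof (intro conjI ballI allI impI)
    show "dist_of (\<lambda>x. f t x + g t x) \<in> besov_space \<rho> \<alpha>" if "t \<in> S" for t by (rule sp[OF that])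
    fix t and \<epsilon> :: real assume t: "t \<in> S" and e: "\<epsilon> > 0"
    obtain d1 where d1: "d1 > 0" "\<And>s. s \<in> S \<Longrightarrow> \<bar>s - t\<bar> < d1 \<Longrightarrow> bdist (dist_of (f s)) (dist_of (f t)) \<le> \<epsilon> / 2"
      using f t e unfolding bcont_def by (meson half_gt_zero)
    obtain d2 where d2: "d2 > 0" "\<And>s. s \<in> S \<Longrightarrow> \<bar>s - t\<bar> < d2 \<Longrightarrow> bdist (dist_of (g s)) (dist_of (g t)) \<le> \<epsilon> / 2"
      using g t e unfolding bcont_def by (meson half_gt_zero)
    show "\<exists>\<delta>>0. \<forall>s\<in>S. \<bar>s - t\<bar> < \<delta> \<longrightarrow> bdist (dist_of (\<lambda>x. f s x + g s x)) (dist_of (\<lambda>x. f t x + g t x)) \<le> \<epsilon>"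
    proof (intro exI[of _ "min d1 d2"] conjI ballI impI)
      fix s assume s: "s \<in> S" "\<bar>s - t\<bar> < min d1 d2"
      then show "bdist (dist_of (\<lambda>x. f s x + g s x)) (dist_of (\<lambda>x. f t x + g t x)) \<le> \<epsilon>"
        using dd[OF s(1) t] d1(2)[OF s(1)] d2(2)[OF s(1)] by simp
    qed (use d1 d2 in simp)
  qed
qed

end

section \<open>Paths of continuous functions\<close>

text \<open>Continuity in time with respect to the supremum norm over the torus. This class is
  stable under composition with a Lipschitz function, so the nonlinearity acts on it
  directly.\<close>

definition wpath :: "real set \<Rightarrow> (real \<Rightarrow> real ^ 'd \<Rightarrow> real) \<Rightarrow> bool" where
  "wpath S w \<longleftrightarrow> (\<forall>s\<in>S. continuous_on UNIV (w s) \<and> torus_periodic (w s)) \<and>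
     (\<forall>t\<in>S. \<forall>\<epsilon>>0. \<exists>\<delta>>0. \<forall>s\<in>S. \<bar>s - t\<bar> < \<delta> \<longrightarrow> (\<forall>x. \<bar>w s x - w t x\<bar> \<le> \<epsilon>))"

lemma wpathD:
  assumes "wpath S w" "s \<in> S" shows "continuous_on UNIV (w s)" "torus_periodic (w s)"
  using assms by (auto simp: wpath_def)

lemma wpath_continuity:
  assumes "wpath S w" "t \<in> S" "\<epsilon> > 0"
  obtains \<delta> where "\<delta> > 0" "\<And>s x. s \<in> S \<Longrightarrow> \<bar>s - t\<bar> < \<delta> \<Longrightarrow> \<bar>w s x - w t x\<bar> \<le> \<epsilon>"
  using assms unfolding wpath_def by metis

lemma wpath_subset: "wpath S w \<Longrightarrow> T \<subseteq> S \<Longrightarrow> wpath T w"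
  unfolding wpath_def by (meson subsetD)

lemma wpath_lipschitz:
  assumes w: "wpath S w" and P: "\<And>a b. \<bar>P a - P b\<bar> \<le> L * \<bar>a - b\<bar>" and L: "L > 0"
  shows "wpath S (\<lambda>s x. P (w s x))"
  unfolding wpath_def
proof (intro conjI ballI allI impI)
  have cP: "continuous_on UNIV P"
  proof (rule continuous_onI)
    fix x e :: real assume "e > 0"
    then show "\<exists>d>0. \<forall>x'\<in>UNIV. dist x' x < d \<longrightarrow> dist (P x') (P x) \<le> e"
      using L by (intro exI[of _ "e / L"]) (auto simp: dist_real_def field_simps intro: order_trans[OF P])
  qed
  show "continuous_on UNIV (\<lambda>x. P (w s x))" if "s \<in> S" for s
    by (rule continuous_on_compose2[OF cP wpathD(1)[OF w that]]) simp
  show "torus_periodic (\<lambda>x. P (w s x))" if "s \<in> S" for s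
    using wpathD(2)[OF w that] by (simp add: torus_periodic_def)
  fix t and \<epsilon> :: real assume t: "t \<in> S" and e: "\<epsilon> > 0"
  obtain \<delta> where \<delta>: "\<delta> > 0" "\<And>s x. s \<in> S \<Longrightarrow> \<bar>s - t\<bar> < \<delta> \<Longrightarrow> \<bar>w s x - w t x\<bar> \<le> \<epsilon> / L"
    using wpath_continuity[OF w t, of "\<epsilon> / L"] e L by auto
  have "\<bar>P (w s x) - P (w t x)\<bar> \<le> \<epsilon>" if "s \<in> S" "\<bar>s - t\<bar> < \<delta>" for s x
  proof -
    have "\<bar>P (w s x) - P (w t x)\<bar> \<le> L * \<bar>w s x - w t x\<bar>" by (rule P)
    also have "\<dots> \<le> L * (\<epsilon> / L)" using \<delta>(2)[OF that, of x] L by (intro mult_left_mono) auto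
    finally show ?thesis using L by simp
  qed
  then show "\<exists>\<delta>>0. \<forall>s\<in>S. \<bar>s - t\<bar> < \<delta> \<longrightarrow> (\<forall>x. \<bar>P (w s x) - P (w t x)\<bar> \<le> \<epsilon>)" using \<delta>(1) by blast
qed

lemma wpath_add:
  assumes v: "wpath S v" and w: "wpath S w"
  shows "wpath S (\<lambda>s x. v s x + w s x)"
  unfolding wpath_def
proof (intro conjI ballI allI impI)
  show "continuous_on UNIV (\<lambda>x. v s x + w s x)" "torus_periodic (\<lambda>x. v s x + w s x)" if "s \<in> S" for s
    using wpathD[OF v that] wpathD[OF w that] by (auto intro!: continuous_intros simp: torus_periodic_def)
  fix t and \<epsilon> :: real assume t: "t \<in> S" and e: "\<epsilon> > 0"
  obtain d1 where d1: "d1 > 0" "\<And>s x. s \<in> S \<Longrightarrow> \<bar>s - t\<bar> < d1 \<Longrightarrow> \<bar>v s x - v t x\<bar> \<le> \<epsilon> / 2"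
    using wpath_continuity[OF v t, of "\<epsilon> / 2"] e by auto
  obtain d2 where d2: "d2 > 0" "\<And>s x. s \<in> S \<Longrightarrow> \<bar>s - t\<bar> < d2 \<Longrightarrow> \<bar>w s x - w t x\<bar> \<le> \<epsilon> / 2"
    using wpath_continuity[OF w t, of "\<epsilon> / 2"] e by auto
  show "\<exists>\<delta>>0. \<forall>s\<in>S. \<bar>s - t\<bar> < \<delta> \<longrightarrow> (\<forall>x. \<bar>v s x + w s x - (v t x + w t x)\<bar> \<le> \<epsilon>)"
  proof (intro exI[of _ "min d1 d2"] conjI ballI impI allI)
    fix s x assume s: "s \<in> S" "\<bar>s - t\<bar> < min d1 d2"
    show "\<bar>v s x + w s x - (v t x + w t x)\<bar> \<le> \<epsilon>"
      using d1(2)[OF s(1), of x] d2(2)[OF s(1), of x] s(2) by linarith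
  qed (use d1 d2 in simp)
qed

lemma wpath_diff:
  assumes v: "wpath S v" and w: "wpath S w"
  shows "wpath S (\<lambda>s x. v s x - w s x)"
proof -
  have "wpath S (\<lambda>s x. - w s x)" by (rule wpath_lipschitz[OF w, of uminus 1]) auto
  from wpath_add[OF v this] show ?thesis by simp
qed

lemma wpath_fourier_continuous:
  fixes w :: "real \<Rightarrow> real ^ 'd::finite \<Rightarrow> real"
  assumes w: "wpath S w"
  shows "continuous_on S (\<lambda>s. fourier (w s) m)"
proof (rule continuous_onI)
  fix t and e :: real assume t: "t \<in> S" and e: "e > 0"
  obtain \<delta> where \<delta>: "\<delta> > 0" "\<And>s x. s \<in> S \<Longrightarrow> \<bar>s - t\<bar> < \<delta> \<Longrightarrow> \<bar>w s x - w t x\<bar> \<le> e"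
    using wpath_continuity[OF w t e] by blast
  have "dist (fourier (w s) m) (fourier (w t) m) \<le> e" if s: "s \<in> S" "\<bar>s - t\<bar> < \<delta>" for s
    unfolding dist_norm fourier_diff[OF wpathD(1)[OF w s(1)] wpathD(1)[OF w t], symmetric]
    by (intro fourier_bound continuous_intros wpathD(1)[OF w s(1)] wpathD(1)[OF w t] \<delta>(2)[OF s])
  then show "\<exists>d>0. \<forall>s\<in>S. dist s t < d \<longrightarrow> dist (fourier (w s) m) (fourier (w t) m) \<le> e"
    using \<delta>(1) by (auto simp: dist_real_def)
qed

definition l2sq :: "(real ^ 'd::finite \<Rightarrow> real) \<Rightarrow> real" where
  "l2sq u = (LINT x|torus. (u x)\<^sup>2)"

lemma l2sq_nonneg [simp]: "0 \<le> l2sq u"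
  unfolding l2sq_def by (rule integral_nonneg_AE) simp

lemma l2sq_le:
  assumes "continuous_on UNIV u" "\<And>x. \<bar>u x\<bar> \<le> B" shows "l2sq u \<le> B\<^sup>2"
proof -
  have "norm (LINT x|torus. (u x)\<^sup>2) \<le> B\<^sup>2"
  proof (rule norm_torus_integral_le)
    show "norm ((u x)\<^sup>2) \<le> B\<^sup>2" for x using power_mono[OF assms(2)[of x], of 2] by simp
  qed (intro continuous_intros assms(1))
  then show ?thesis unfolding l2sq_def by simp
qed

lemma l2sq_mono:
  assumes "continuous_on UNIV u" "continuous_on UNIV v" "\<And>x. \<bar>u x\<bar> \<le> L * \<bar>v x\<bar>"
  shows "l2sq u \<le> L\<^sup>2 * l2sq v"
proof -
  have "(LINT x|torus. (u x)\<^sup>2) \<le> (LINT x|torus. L\<^sup>2 * (v x)\<^sup>2)"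
  proof (rule integral_mono)
    show "(u x)\<^sup>2 \<le> L\<^sup>2 * (v x)\<^sup>2" for x
      using power_mono[OF assms(3)[of x], of 2] by (simp add: power_mult_distrib)
  qed (intro integrable_torus_continuous continuous_intros assms)+
  then show ?thesis by (simp add: l2sq_def)
qed

lemma wpath_l2sq_continuous:
  fixes w :: "real \<Rightarrow> real ^ 'd::finite \<Rightarrow> real"
  assumes w: "wpath S w"
  shows "continuous_on S (\<lambda>s. l2sq (w s))"
proof (rule continuous_onI)
  fix t and e :: real assume t: "t \<in> S" and e: "e > 0"
  obtain B where B: "\<And>x. \<bar>w t x\<bar> \<le> B" using continuous_torus_bounded[OF wpathD[OF w t]] by auto
  have B0: "B \<ge> 0" using B[of 0] by linarith
  define \<eta> where "\<eta> = min 1 (e / (2 * B + 1))"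
  have \<eta>: "\<eta> > 0" "\<eta> \<le> 1" "\<eta> \<le> e / (2 * B + 1)"
    using e B0 by (auto simp: \<eta>_def)
  then have \<eta>3: "\<eta> * (2 * B + 1) \<le> e" using B0 by (simp add: pos_le_divide_eq)
  obtain \<delta> where \<delta>: "\<delta> > 0" "\<And>s x. s \<in> S \<Longrightarrow> \<bar>s - t\<bar> < \<delta> \<Longrightarrow> \<bar>w s x - w t x\<bar> \<le> \<eta>"
    using wpath_continuity[OF w t \<eta>(1)] by blast
  have "dist (l2sq (w s)) (l2sq (w t)) \<le> e" if s: "s \<in> S" "\<bar>s - t\<bar> < \<delta>" for s
  proof -
    note cs = wpathD(1)[OF w s(1)] and ct = wpathD(1)[OF w t]
    have "l2sq (w s) - l2sq (w t) = (LINT x|torus. (w s x)\<^sup>2 - (w t x)\<^sup>2)"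
      unfolding l2sq_def by (intro Bochner_Integration.integral_diff[symmetric] integrable_torus_continuous continuous_intros cs ct)
    moreover have "norm (LINT x|torus. (w s x)\<^sup>2 - (w t x)\<^sup>2) \<le> e"
    proof (rule norm_torus_integral_le)
      fix x
      have "\<bar>w s x + w t x\<bar> \<le> 2 * B + 1" using \<delta>(2)[OF s, of x] B[of x] \<eta>(2) by linarith
      then have "\<bar>w s x - w t x\<bar> * \<bar>w s x + w t x\<bar> \<le> \<eta> * (2 * B + 1)" using \<delta>(2)[OF s, of x] \<eta>(1) by (intro mult_mono) auto
      then show "norm ((w s x)\<^sup>2 - (w t x)\<^sup>2) \<le> e"
        using \<eta>3 by (simp add: power2_eq_square square_diff_square_factored abs_mult mult.commute)
    qed (intro continuous_intros cs ct)
    ultimately show ?thesis by (simp add: dist_norm)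
  qed
  then show "\<exists>d>0. \<forall>s\<in>S. dist s t < d \<longrightarrow> dist (l2sq (w s)) (l2sq (w t)) \<le> e"
    using \<delta>(1) by (auto simp: dist_real_def)
qed

section \<open>Energy estimates for the Duhamel coefficients\<close>

text \<open>The coefficients of the integral of \<open>G_(t - s)\<close> applied to the Laplacian of
  \<open>w s\<close>. Each is a scalar integral, so that no function-valued integral is formed;
  \<open>weak_drift\<close> identifies the result with the weak integral of the equation.\<close>

definition duhamel :: "(real \<Rightarrow> real ^ 'd::finite \<Rightarrow> real) \<Rightarrow> real \<Rightarrow> real ^ 'd \<Rightarrow> complex" where
  "duhamel w t m = - of_real (lam m) * integral {0..t} (\<lambda>s. of_real (semi (t - s) m) * fourier (w s) m)"

lemma continuous_semi [continuous_intros]: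
  "continuous_on S f \<Longrightarrow> continuous_on S (\<lambda>s. semi (f s) m)"
  unfolding semi_def by (intro continuous_intros)

lemma duhamel_integrand_continuous:
  assumes "wpath {0..t} w" shows "continuous_on {0..t} (\<lambda>s. complex_of_real (semi (t - s) m) * fourier (w s) m)"
  by (intro continuous_intros wpath_fourier_continuous[OF assms])

lemma duhamel_hermitian: "wpath {0..t} w \<Longrightarrow> hermitian (duhamel w t)"
  unfolding duhamel_def by (simp add: fourier_minus integral_cnj)

lemma duhamel_diff:
  assumes v: "wpath {0..t} v" and w: "wpath {0..t} w"
  shows "duhamel (\<lambda>s x. v s x - w s x) t m = duhamel v t m - duhamel w t m"
proof -
  have "integral {0..t} (\<lambda>s. of_real (semi (t - s) m) * fourier (\<lambda>x. v s x - w s x) m) =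
     integral {0..t} (\<lambda>s. of_real (semi (t - s) m) * fourier (v s) m - of_real (semi (t - s) m) * fourier (w s) m)"
    by (rule Henstock_Kurzweil_Integration.integral_cong)
       (simp add: fourier_diff wpathD[OF v] wpathD[OF w] right_diff_distrib)
  also have "\<dots> = integral {0..t} (\<lambda>s. of_real (semi (t - s) m) * fourier (v s) m) - integral {0..t} (\<lambda>s. of_real (semi (t - s) m) * fourier (w s) m)"
    by (intro Henstock_Kurzweil_Integration.integral_diff integrable_continuous_interval duhamel_integrand_continuous v w)
  finally show ?thesis by (simp add: duhamel_def right_diff_distrib)
qed

lemma integral_exp_decay_le:
  fixes \<mu> :: real assumes "\<mu> > 0" "t \<ge> 0"
  shows "integral {0..t} (\<lambda>s. exp (- (t - s) * \<mu>)) \<le> 1 / \<mu>"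
proof -
  have "((\<lambda>s. exp (- (t - s) * \<mu>)) has_integral exp (- (t - t) * \<mu>) / \<mu> - exp (- (t - 0) * \<mu>) / \<mu>) {0..t}"
    using assms by (intro fundamental_theorem_of_calculus)
      (auto intro!: derivative_eq_intros simp: has_real_derivative_iff_has_vector_derivative[symmetric])
  then have "integral {0..t} (\<lambda>s. exp (- (t - s) * \<mu>)) = 1 / \<mu> - exp (- t * \<mu>) / \<mu>"
    by (simp add: integral_unique)
  then show ?thesis using assms by simp
qed

text \<open>Cauchy-Schwarz in time for the weight \<open>semi (t - s) m\<close>, whose integral is
  at most \<open>1 / (lam m) ^ 2\<close>; this absorbs the square of the factor \<open>lam m\<close>
  exactly.\<close>

lemma duhamel_mode_estimate:
  fixes w :: "real \<Rightarrow> real ^ 'd::finite \<Rightarrow> real"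
  assumes w: "wpath {0..t} w" and t: "t \<ge> 0"
  shows "(cmod (duhamel w t m))\<^sup>2 \<le> integral {0..t} (\<lambda>s. semi (t - s) m * (cmod (fourier (w s) m))\<^sup>2)"
proof (cases "lam m = 0")
  case True
  then show ?thesis unfolding duhamel_def by (simp, intro Henstock_Kurzweil_Integration.integral_nonneg integrable_continuous_interval continuous_intros wpath_fourier_continuous[OF w]) auto
next
  case False
  define \<mu> where "\<mu> = (lam m)\<^sup>2"
  have \<mu>: "\<mu> > 0" using False by (simp add: \<mu>_def)
  let ?a = "\<lambda>s. semi (t - s) m" and ?f = "\<lambda>s. cmod (fourier (w s) m)"
  have cf: "continuous_on {0..t} ?f" by (intro continuous_intros wpath_fourier_continuous[OF w])
  define I where "I = integral {0..t} (\<lambda>s. ?a s * ?f s)"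
  define J where "J = integral {0..t} (\<lambda>s. ?a s * (?f s)\<^sup>2)"
  have "cmod (integral {0..t} (\<lambda>s. of_real (?a s) * fourier (w s) m)) \<le> I"
    unfolding I_def
    by (rule integral_norm_bound_integral)
       (auto intro!: integrable_continuous_interval duhamel_integrand_continuous[OF w] continuous_intros cf simp: norm_mult)
  then have "cmod (duhamel w t m) \<le> lam m * I" unfolding duhamel_def by (simp add: norm_mult mult_left_mono)
  then have "(cmod (duhamel w t m))\<^sup>2 \<le> (lam m * I)\<^sup>2" by (rule power_mono) simp
  also have "\<dots> = \<mu> * I\<^sup>2" by (simp add: \<mu>_def power_mult_distrib)
  also have "\<dots> \<le> J"
  proof -
    \<comment> \<open>The optimal parameter in
      \<open>2 * \<theta> * f \<le> \<theta> ^ 2 + f ^ 2\<close>; integrated against the weight,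
      this gives the Cauchy-Schwarz inequality.\<close>
    define \<theta> where "\<theta> = \<mu> * I"
    have E: "integral {0..t} ?a \<le> 1 / \<mu>"
      using integral_exp_decay_le[OF \<mu> t] by (simp add: semi_def \<mu>_def)
    have "2 * \<theta> * I = integral {0..t} (\<lambda>s. 2 * \<theta> * (?a s * ?f s))" unfolding I_def by simp
    also have "\<dots> \<le> integral {0..t} (\<lambda>s. \<theta>\<^sup>2 * ?a s + ?a s * (?f s)\<^sup>2)"
    proof (rule integral_le)
      fix s
      have "0 \<le> (\<theta> - ?f s)\<^sup>2" by simp
      then have "2 * \<theta> * ?f s \<le> \<theta>\<^sup>2 + (?f s)\<^sup>2" by (simp add: power2_diff)
      from mult_left_mono[OF this, of "?a s"] show "2 * \<theta> * (?a s * ?f s) \<le> \<theta>\<^sup>2 * ?a s + ?a s * (?f s)\<^sup>2"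
        by (simp add: algebra_simps)
    qed (intro integrable_continuous_interval continuous_intros cf)+
    also have "\<dots> = integral {0..t} (\<lambda>s. \<theta>\<^sup>2 * ?a s) + J" unfolding J_def
      by (intro Henstock_Kurzweil_Integration.integral_add integrable_continuous_interval continuous_intros cf)
    also have "integral {0..t} (\<lambda>s. \<theta>\<^sup>2 * ?a s) \<le> \<theta>\<^sup>2 * (1 / \<mu>)"
      using E by (simp add: mult_left_mono del: times_divide_eq_right mult_1_right)
    also have "\<theta>\<^sup>2 * (1 / \<mu>) = \<mu> * I\<^sup>2" using \<mu> by (simp add: \<theta>_def power2_eq_square)
    finally show ?thesis by (simp add: \<theta>_def power2_eq_square algebra_simps)
  qed
  finally show ?thesis unfolding J_def .
qed

text \<open>\<open>R\<close> is a lower bound for the biharmonic eigenvalues of the chosen modes.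
  \<open>R = 0\<close> gives the energy inequality behind Picard iteration; \<open>R\<close> of
  order \<open>2 ^ (4 * n)\<close> gives the gain on the block \<open>n\<close>.\<close>

lemma duhamel_l2_estimate:
  fixes w :: "real \<Rightarrow> real ^ 'd::finite \<Rightarrow> real"
  assumes w: "wpath {0..t} w" and t: "t \<ge> 0" and F: "finite F" "F \<subseteq> int_lattice"
    and R: "\<And>m. m \<in> F \<Longrightarrow> R \<le> (lam m)\<^sup>2"
  shows "(\<Sum>m\<in>F. (cmod (duhamel w t m))\<^sup>2) \<le> integral {0..t} (\<lambda>s. exp (- (t - s) * R) * l2sq (w s))"
proof -
  have cf: "continuous_on {0..t} (\<lambda>s. fourier (w s) m)" for m by (rule wpath_fourier_continuous[OF w])
  have "(\<Sum>m\<in>F. (cmod (duhamel w t m))\<^sup>2) \<le> (\<Sum>m\<in>F. integral {0..t} (\<lambda>s. semi (t - s) m * (cmod (fourier (w s) m))\<^sup>2))"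
    by (intro sum_mono duhamel_mode_estimate[OF w t])
  also have "\<dots> = integral {0..t} (\<lambda>s. \<Sum>m\<in>F. semi (t - s) m * (cmod (fourier (w s) m))\<^sup>2)"
    by (intro Henstock_Kurzweil_Integration.integral_sum[symmetric] F integrable_continuous_interval continuous_intros cf)
  also have "\<dots> \<le> integral {0..t} (\<lambda>s. exp (- (t - s) * R) * l2sq (w s))"
  proof (rule integral_le)
    fix s assume s: "s \<in> {0..t}"
    have "(\<Sum>m\<in>F. semi (t - s) m * (cmod (fourier (w s) m))\<^sup>2) \<le> (\<Sum>m\<in>F. exp (- (t - s) * R) * (cmod (fourier (w s) m))\<^sup>2)"
    proof (intro sum_mono mult_right_mono)
      fix m assume "m \<in> F"
      then have "(t - s) * R \<le> (t - s) * (lam m)\<^sup>2" using s by (intro mult_left_mono R) auto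
      then have "- (t - s) * (lam m)\<^sup>2 \<le> - (t - s) * R" by (simp only: mult_minus_left neg_le_iff_le)
      then show "semi (t - s) m \<le> exp (- (t - s) * R)" unfolding semi_def by (simp only: exp_le_cancel_iff)
    qed simp
    also have "\<dots> \<le> exp (- (t - s) * R) * l2sq (w s)"
      unfolding sum_distrib_left[symmetric] l2sq_def by (intro mult_left_mono bessel wpathD(1)[OF w s] F) simp
    finally show "(\<Sum>m\<in>F. semi (t - s) m * (cmod (fourier (w s) m))\<^sup>2) \<le> exp (- (t - s) * R) * l2sq (w s)" .
  qed (intro integrable_continuous_interval continuous_intros cf wpath_l2sq_continuous[OF w])+
  finally show ?thesis .
qed

lemma duhamel_tail_estimate:
  fixes w :: "real \<Rightarrow> real ^ 'd::finite \<Rightarrow> real"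
  assumes w: "wpath {0..t} w" and t: "t \<ge> 0" and F: "finite F" "F \<subseteq> int_lattice"
    and R: "\<And>m. m \<in> F \<Longrightarrow> R \<le> (lam m)\<^sup>2" "R > 0" and W: "\<And>s. s \<in> {0..t} \<Longrightarrow> l2sq (w s) \<le> W"
  shows "(\<Sum>m\<in>F. (cmod (duhamel w t m))\<^sup>2) \<le> W / R"
proof -
  have W0: "W \<ge> 0" using t by (intro order_trans[OF l2sq_nonneg W[of 0]]) simp
  have "(\<Sum>m\<in>F. (cmod (duhamel w t m))\<^sup>2) \<le> integral {0..t} (\<lambda>s. exp (- (t - s) * R) * l2sq (w s))"
    by (rule duhamel_l2_estimate[OF w t F R(1)])
  also have "\<dots> \<le> integral {0..t} (\<lambda>s. exp (- (t - s) * R) * W)"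
    by (rule integral_le) (auto intro!: integrable_continuous_interval continuous_intros wpath_l2sq_continuous[OF w] mult_left_mono W)
  also have "\<dots> = integral {0..t} (\<lambda>s. exp (- (t - s) * R)) * W" by simp
  also have "\<dots> \<le> 1 / R * W" by (intro mult_right_mono integral_exp_decay_le R t W0)
  finally show ?thesis by simp
qed

text \<open>Once \<open>semi t m\<close> is taken out of the integral, \<open>t\<close> occurs only
  as the endpoint of the integral of a fixed continuous function.\<close>

lemma duhamel_continuous:
  fixes w :: "real \<Rightarrow> real ^ 'd::finite \<Rightarrow> real"
  assumes w: "wpath {0..} w"
  shows "continuous_on {0..} (\<lambda>t. duhamel w t m)"
proof -
  define f where "f s = complex_of_real (exp (s * (lam m)\<^sup>2)) * fourier (w s) m" for s
  have cf: "continuous_on {0..} f" unfolding f_def by (intro continuous_intros wpath_fourier_continuous[OF w])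
  have e: "duhamel w t m = - of_real (lam m) * (of_real (semi t m) * integral {0..t} f)" for t
  proof -
    have sd: "semi (t - s) m = semi t m * exp (s * (lam m)\<^sup>2)" for s
      unfolding semi_def exp_add[symmetric] by (simp add: left_diff_distrib)
    have "integral {0..t} (\<lambda>s. of_real (semi (t - s) m) * fourier (w s) m) = integral {0..t} (\<lambda>s. of_real (semi t m) * f s)"
      by (rule Henstock_Kurzweil_Integration.integral_cong) (simp add: f_def sd mult.assoc)
    then show ?thesis unfolding duhamel_def by simp
  qed
  have ci: "continuous_on {0..T} (\<lambda>t. integral {0..t} f)" for T
    by (intro indefinite_integral_continuous_1 integrable_continuous_interval continuous_on_subset[OF cf]) auto
  have "continuous_on {0..} (\<lambda>t. integral {0..t} f)"
    unfolding continuous_on_eq_continuous_within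
  proof
    fix t :: real assume t: "t \<in> {0..}"
    have "continuous (at t within {0..t+1}) (\<lambda>t. integral {0..t} f)"
      using ci[of "t + 1"] t by (simp add: continuous_on_eq_continuous_within)
    moreover have "at t within {0..t+1} = at t within {0..}"
      by (rule at_within_nhd[of t "{..<t+1}"]) (use t in auto)
    ultimately show "continuous (at t within {0..}) (\<lambda>t. integral {0..t} f)" by (simp add: continuous_within)
  qed
  then show ?thesis unfolding e by (intro continuous_intros)
qed

section \<open>Regularity of the free evolution and of the drift\<close>

locale mild_setting = besov \<rho> \<alpha> for \<rho> :: "int \<Rightarrow> real ^ 'd::finite \<Rightarrow> real" and \<alpha> :: real +
  assumes dim: "CARD('d) \<le> 3" and alpha_lt: "\<alpha> < 2 - real CARD('d) / 2"
begin

text \<open>By \<open>bsup_semi\<close> the weighted blocks of all times are dominated by a multiple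
  of those of \<open>g\<close>, which tend to \<open>0\<close> because \<open>g\<close> lies in the
  space; continuity therefore holds down to \<open>t = 0\<close>.\<close>

lemma bcont_semi:
  assumes g: "g \<in> besov_space \<rho> \<alpha>"
  shows "bcont {0..} (\<lambda>t. dist_of (synth (\<lambda>m. of_real (semi t m) * fcoef g m)))"
    and "\<exists>K. \<forall>t\<ge>0. \<forall>n. wt n * bsup n (\<lambda>m. of_real (semi t m) * fcoef g m) \<le> K"
proof -
  have hg: "hermitian (fcoef g)" using fcoef_minus[OF besov_distribution[OF g]] by blast
  obtain C where C: "C \<ge> 1" and bs: "\<And>t n c. t \<ge> 0 \<Longrightarrow> hermitian c \<Longrightarrow> bsup n (\<lambda>m. of_real (semi t m) * c m) \<le> C * bsup n c"
    using bsup_semi[OF dim] by metis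
  have tail: "wt n * bsup n (\<lambda>m. of_real (semi t m) * fcoef g m) \<le> C * (wt n * bsup n (fcoef g))" if "t \<in> {0..}" for t n
    using mult_left_mono[OF bs[of t "fcoef g" n], of "wt n"] that hg by (simp add: mult.left_commute)
  have z: "(\<lambda>n. C * (wt n * bsup n (fcoef g))) \<longlonglongrightarrow> 0"
    using g unfolding besov_space_iff by (intro tendsto_mult_right_zero) simp
  show "bcont {0..} (\<lambda>t. dist_of (synth (\<lambda>m. of_real (semi t m) * fcoef g m)))"
    by (rule bcont_synth[OF _ _ tail z]) (auto simp: hg intro!: continuous_intros)
  obtain K where K: "\<And>n. wt n * bsup n (fcoef g) \<le> K" using besov_bounded[OF g] by blast
  have "wt n * bsup n (\<lambda>m. of_real (semi t m) * fcoef g m) \<le> C * K" if "t \<ge> 0" for t n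
    by (rule order_trans[OF tail mult_left_mono[OF K]]) (use that C in auto)
  then show "\<exists>K. \<forall>t\<ge>0. \<forall>n. wt n * bsup n (\<lambda>m. of_real (semi t m) * fcoef g m) \<le> K" by blast
qed

definition ratio :: real where "ratio = 2 powr (\<alpha> + real CARD('d) / 2 - 2)"

lemma ratio: "0 < ratio" "ratio < 1"
proof -
  show "0 < ratio" by (simp add: ratio_def)
  have "2 powr (\<alpha> + real CARD('d) / 2 - 2) < 2 powr (0::real)" using alpha_lt by (intro powr_less_mono) auto
  then show "ratio < 1" by (simp add: ratio_def)
qed

text \<open>\<open>64/9\<close> is the inverse square of the inner radius \<open>3/8\<close> of an
  annulus; \<open>40/3 = 10 * 4/3\<close> comes from counting the lattice points in the ball of
  radius \<open>4/3 * 2 ^ n\<close>.\<close>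

definition Cblock :: real where "Cblock = (64 / 9) * sqrt ((40 / 3) ^ CARD('d))"

lemma Cblock_nonneg: "0 \<le> Cblock" by (simp add: Cblock_def)

text \<open>
  The only place where \<open>\<alpha> < 2 - d/2\<close> is needed: on the level \<open>n\<close> the operator gains \<open>2 powr (-2 n)\<close> in
  \<open>L\<^sup>2\<close>, and the Cauchy-Schwarz inequality over the frequencies of the block loses \<open>2 powr (n d / 2)\<close>.
\<close>

lemma duhamel_block_estimate:
  assumes w: "wpath {0..t} w" and t: "t \<ge> 0" and W: "\<And>s. s \<in> {0..t} \<Longrightarrow> l2sq (w s) \<le> W\<^sup>2" and W0: "W \<ge> 0"
  shows "wt n * bsup n (duhamel w t) \<le> Cblock * W * ratio ^ n"
proof -
  \<comment> \<open>At the zero frequency \<open>lam\<close> vanishes, and with it the coefficient;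
    all other frequencies of the block, also for \<open>n = 0\<close>, have norm at least
    \<open>3/8 * 2 ^ n\<close>.\<close>
  define F where "F = {m \<in> freqs n. bump n m \<noteq> 0 \<and> m \<noteq> 0}"
  have F: "finite F" "F \<subseteq> int_lattice" "F \<subseteq> freqs n" unfolding F_def using freqs_sub by auto
  define R where "R = (3/8 * 2 ^ n :: real) ^ 4"
  have Rp: "R > 0" by (simp add: R_def)
  have R: "R \<le> (lam m)\<^sup>2" if m: "m \<in> F" for m
  proof -
    have "3/8 * 2 ^ n \<le> norm m" using m F(2) unfolding F_def by (intro bump_support_lattice) auto
    then have "(3/8 * 2 ^ n)\<^sup>2 \<le> (norm m)\<^sup>2" by (intro power_mono) auto
    also have "(norm m)\<^sup>2 \<le> lam m" using inner_le_lam[of m] by (simp add: dot_square_norm)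
    finally have "(3/8 * 2 ^ n)\<^sup>2 \<le> lam m" .
    then have "((3/8 * 2 ^ n)\<^sup>2)\<^sup>2 \<le> (lam m)\<^sup>2" by (rule power_mono) simp
    then show ?thesis unfolding R_def power_mult[symmetric] by simp
  qed
  have "bsup n (duhamel w t) \<le> (\<Sum>m\<in>freqs n. bump n m * cmod (duhamel w t m))" by (rule bsup_le_sum)
  also have "\<dots> = (\<Sum>m\<in>F. bump n m * cmod (duhamel w t m))"
    by (rule sum.mono_neutral_right) (auto simp: F_def duhamel_def lam_def)
  also have "\<dots> \<le> (\<Sum>m\<in>F. 1 * cmod (duhamel w t m))"
    by (intro sum_mono mult_right_mono bump_le_1) simp
  also have "\<dots> \<le> sqrt (real (card F) * (W\<^sup>2 / R))"
  proof (rule real_le_rsqrt)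
    have "(\<Sum>m\<in>F. 1 * cmod (duhamel w t m))\<^sup>2 \<le> (\<Sum>m\<in>F. 1\<^sup>2) * (\<Sum>m\<in>F. (cmod (duhamel w t m))\<^sup>2)"
      by (rule Cauchy_Schwarz_ineq_sum)
    also have "\<dots> \<le> real (card F) * (W\<^sup>2 / R)"
    proof -
      have te: "(\<Sum>m\<in>F. (cmod (duhamel w t m))\<^sup>2) \<le> W\<^sup>2 / R" by (rule duhamel_tail_estimate[OF w t F(1,2) R Rp W])
      have c: "(\<Sum>m\<in>F. 1\<^sup>2) = real (card F)" by simp
      show ?thesis unfolding c by (rule mult_left_mono[OF te]) simp
    qed
    finally show "(\<Sum>m\<in>F. 1 * cmod (duhamel w t m))\<^sup>2 \<le> real (card F) * (W\<^sup>2 / R)" .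
  qed
  also have "\<dots> \<le> sqrt ((40/3 * 2 ^ n) ^ CARD('d) * (W\<^sup>2 / R))"
  proof (intro real_sqrt_le_mono mult_right_mono)
    have "1 \<le> 4/3 * (2::real) ^ n" using one_le_power[of "2::real" n] by linarith
    from card_lattice_ball[OF this, where 'd='d]
    have "real (card (freqs n)) \<le> (10 * (4/3 * 2 ^ n)) ^ CARD('d)" by (simp add: freqs_def)
    moreover have "card F \<le> card (freqs n)" by (rule card_mono[OF finite_freqs F(3)])
    ultimately show "real (card F) \<le> (40/3 * 2 ^ n) ^ CARD('d)" by simp
  qed (use Rp in simp)
  also have "\<dots> = sqrt ((40/3) ^ CARD('d)) * sqrt ((2 ^ n) ^ CARD('d)) * (W / (3/8 * 2 ^ n)\<^sup>2)"
  proof -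
    have sR: "sqrt R = (3/8 * 2 ^ n)\<^sup>2" unfolding R_def by (rule real_sqrt_unique) (simp_all add: power_mult[symmetric])
    have "sqrt ((40/3 * 2 ^ n) ^ CARD('d) * (W\<^sup>2 / R)) = sqrt ((40/3) ^ CARD('d)) * sqrt ((2 ^ n) ^ CARD('d)) * (sqrt (W\<^sup>2) / sqrt R)"
      by (simp only: power_mult_distrib[of "40/3"] real_sqrt_mult real_sqrt_divide)
    then show ?thesis unfolding sR using W0 by (simp only: real_sqrt_abs abs_of_nonneg)
  qed
  also have "\<dots> = Cblock * W * (sqrt ((2 ^ n) ^ CARD('d)) / (2 ^ n)\<^sup>2)"
  proof -
    have "W / (3/8 * 2 ^ n)\<^sup>2 = (64/9) * W / (2 ^ n)\<^sup>2" by (simp add: power_mult_distrib power_divide)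
    then show ?thesis unfolding Cblock_def by simp
  qed
  also have "sqrt ((2 ^ n) ^ CARD('d)) / (2 ^ n)\<^sup>2 = 2 powr (real n * (real CARD('d) / 2 - 2))"
  proof -
    have p: "(2::real) powr (real n * real CARD('d)) = (2 ^ n) ^ CARD('d)"
      using powr_realpow[of 2 "n * CARD('d)"] by (simp add: power_mult)
    have "sqrt ((2 ^ n) ^ CARD('d)) = (2 powr (real n * real CARD('d))) powr (1/2)"
      unfolding p by (rule powr_half_sqrt[symmetric]) simp
    also have "\<dots> = 2 powr (real n * real CARD('d) / 2)" unfolding powr_powr by simp
    finally have 1: "sqrt ((2 ^ n) ^ CARD('d)) = 2 powr (real n * real CARD('d) / 2)" .
    have 2: "((2::real) ^ n)\<^sup>2 = 2 powr (real n * 2)" 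
      using powr_realpow[of 2 "n * 2"] by (simp add: power_mult)
    show ?thesis unfolding 1 2 powr_diff[symmetric] by (simp add: algebra_simps)
  qed
  finally have "bsup n (duhamel w t) \<le> Cblock * W * 2 powr (real n * (real CARD('d) / 2 - 2))" .
  then have "wt n * bsup n (duhamel w t) \<le> 2 powr (\<alpha> * real n) * (Cblock * W * 2 powr (real n * (real CARD('d) / 2 - 2)))"
  proof (rule mult_mono[rotated])
    \<comment> \<open>The index shift in \<open>wt\<close> is dropped, which only enlarges the
      weight as \<alpha> is positive.\<close>
    show "wt n \<le> 2 powr (\<alpha> * real n)" unfolding wt_def using alpha_pos by (intro powr_mono) auto
  qed auto
  also have "\<dots> = Cblock * W * 2 powr (real n * (\<alpha> + real CARD('d) / 2 - 2))"
    by (simp add: powr_add[symmetric] algebra_simps)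
  also have "2 powr (real n * (\<alpha> + real CARD('d) / 2 - 2)) = ratio ^ n"
  proof -
    have "ratio ^ n = ratio powr real n" by (rule powr_realpow[symmetric, OF ratio(1)])
    also have "\<dots> = 2 powr ((\<alpha> + real CARD('d) / 2 - 2) * real n)" unfolding ratio_def powr_powr ..
    finally show ?thesis by (simp only: mult.commute[of "real n"])
  qed
  finally show ?thesis .
qed

definition drift :: "(real \<Rightarrow> real ^ 'd \<Rightarrow> real) \<Rightarrow> real \<Rightarrow> real ^ 'd \<Rightarrow> real" where
  "drift w t = synth (duhamel w t)"

lemma duhamel_bounded:
  assumes w: "wpath {0..t} w" and t: "t \<ge> 0" and W: "\<And>s. s \<in> {0..t} \<Longrightarrow> l2sq (w s) \<le> W\<^sup>2" and W0: "W \<ge> 0"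
  shows "wt n * bsup n (duhamel w t) \<le> Cblock * W"
proof -
  have "wt n * bsup n (duhamel w t) \<le> Cblock * W * ratio ^ n" by (rule duhamel_block_estimate[OF assms])
  also have "\<dots> \<le> Cblock * W * 1" using ratio Cblock_nonneg W0 by (intro mult_left_mono power_le_one) auto
  finally show ?thesis by simp
qed

lemma wpath_l2_bound:
  assumes w: "wpath {0..t} w"
  shows "\<exists>W\<ge>0. \<forall>s\<in>{0..t}. l2sq (w s) \<le> W\<^sup>2"
proof -
  have "compact ((\<lambda>s. l2sq (w s)) ` {0..t})" by (intro compact_continuous_image wpath_l2sq_continuous[OF w]) simp
  then obtain B where B: "\<forall>s\<in>{0..t}. l2sq (w s) \<le> B"
    using compact_imp_bounded[of "(\<lambda>s. l2sq (w s)) ` {0..t}"] unfolding bounded_iff by force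
  show ?thesis
  proof (intro exI[of _ "sqrt \<bar>B\<bar>"] conjI ballI)
    fix s assume "s \<in> {0..t}"
    then show "l2sq (w s) \<le> (sqrt \<bar>B\<bar>)\<^sup>2" using B by (simp add: order_trans[OF _ abs_ge_self])
  qed simp
qed

lemma drift_facts:
  assumes w: "wpath {0..t} w" and t: "t \<ge> 0"
  shows "continuous_on UNIV (drift w t)" "torus_periodic (drift w t)"
    "\<And>m. m \<in> int_lattice \<Longrightarrow> fourier (drift w t) m = duhamel w t m"
    "(\<lambda>n. block n (duhamel w t) x) sums drift w t x"
proof -
  obtain W where W: "W \<ge> 0" "\<And>s. s \<in> {0..t} \<Longrightarrow> l2sq (w s) \<le> W\<^sup>2" using wpath_l2_bound[OF w] by blast
  note S = synth_facts[OF duhamel_hermitian[OF w] duhamel_bounded[OF w t W(2,1)]]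
  show "continuous_on UNIV (drift w t)" "torus_periodic (drift w t)"
    "\<And>m. m \<in> int_lattice \<Longrightarrow> fourier (drift w t) m = duhamel w t m" "(\<lambda>n. block n (duhamel w t) x) sums drift w t x"
    unfolding drift_def using S by blast+
qed

lemma drift_sup:
  assumes w: "wpath {0..t} w" and t: "t \<ge> 0" and W: "\<And>s. s \<in> {0..t} \<Longrightarrow> l2sq (w s) \<le> W\<^sup>2" and W0: "W \<ge> 0"
  shows "\<bar>drift w t x\<bar> \<le> Csup * (Cblock * W)"
  unfolding drift_def by (rule synth_facts(4)[OF duhamel_hermitian[OF w] duhamel_bounded[OF w t W W0]])

lemma drift_diff:
  assumes v: "wpath {0..t} v" and w: "wpath {0..t} w" and t: "t \<ge> 0"
  shows "drift (\<lambda>s x. v s x - w s x) t x = drift v t x - drift w t x"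
proof -
  have "drift (\<lambda>s x. v s x - w s x) t = (\<lambda>x. drift v t x - drift w t x)"
    using drift_facts[OF wpath_diff[OF v w] t] drift_facts[OF v t] drift_facts[OF w t]
    by (intro fourier_eq_imp_eq) (auto intro!: continuous_intros simp: torus_periodic_def fourier_diff duhamel_diff[OF v w])
  then show ?thesis by simp
qed

text \<open>Parseval turns the sums over finite sets of modes, bounded by the energy estimate with
  \<open>R = 0\<close>, into the \<open>L\<^sup>2\<close> norm.\<close>

lemma drift_l2:
  assumes w: "wpath {0..t} w" and t: "t \<ge> 0"
  shows "l2sq (drift w t) \<le> integral {0..t} (\<lambda>s. l2sq (w s))"
proof -
  have "((\<lambda>m. (cmod (fourier (drift w t) m))\<^sup>2) has_sum l2sq (drift w t)) int_lattice"
    unfolding l2sq_def by (rule parseval[OF drift_facts(1,2)[OF w t]])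
  then show ?thesis
  proof (rule has_sum_le_finite_sums)
    fix F :: "(real ^ 'd) set" assume F: "finite F" "F \<subseteq> int_lattice"
    have "(\<Sum>m\<in>F. (cmod (fourier (drift w t) m))\<^sup>2) = (\<Sum>m\<in>F. (cmod (duhamel w t m))\<^sup>2)"
      using F by (intro sum.cong refl) (simp add: drift_facts(3)[OF w t] subset_iff)
    also have "\<dots> \<le> integral {0..t} (\<lambda>s. l2sq (w s))"
      using duhamel_l2_estimate[OF w t F, of 0] by simp
    finally show "(\<Sum>m\<in>F. (cmod (fourier (drift w t) m))\<^sup>2) \<le> integral {0..t} (\<lambda>s. l2sq (w s))" .
  qed
qed

lemma bcont_drift:
  assumes w: "wpath {0..} w" and W: "\<And>s. s \<ge> 0 \<Longrightarrow> l2sq (w s) \<le> W\<^sup>2" and W0: "W \<ge> 0"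
  shows "bcont {0..} (\<lambda>t. dist_of (drift w t))"
  unfolding drift_def
proof (rule bcont_synth)
  have wt': "wpath {0..t} w" for t by (rule wpath_subset[OF w]) auto
  show "hermitian (duhamel w t)" for t by (rule duhamel_hermitian[OF wt'])
  show "continuous_on {0..} (\<lambda>t. duhamel w t m)" for m by (rule duhamel_continuous[OF w])
  show "wt n * bsup n (duhamel w t) \<le> Cblock * W * ratio ^ n" if "t \<in> {0..}" for t n
    using that W W0 by (intro duhamel_block_estimate wt') auto
  show "(\<lambda>n. Cblock * W * ratio ^ n) \<longlonglongrightarrow> 0"
    using ratio by (intro tendsto_mult_right_zero LIMSEQ_power_zero) auto
qed

lemma bcont_wpath:
  assumes b: "bcont S h"
  shows "wpath S (\<lambda>t. fun_of (h t))"
  unfolding wpath_def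
proof (intro conjI ballI allI impI)
  have sp: "h t \<in> besov_space \<rho> \<alpha>" if "t \<in> S" for t using b that by (simp add: bcont_def)
  show "continuous_on UNIV (fun_of (h t))" "torus_periodic (fun_of (h t))" if "t \<in> S" for t
    using besov_fun_of(1,2)[OF sp[OF that]] by auto
  fix t and \<epsilon> :: real assume t: "t \<in> S" and e: "\<epsilon> > 0"
  have C1: "Csup + 1 > 0" using Csup_nonneg by linarith
  obtain \<delta> where \<delta>: "\<delta> > 0" "\<And>s. s \<in> S \<Longrightarrow> \<bar>s - t\<bar> < \<delta> \<Longrightarrow> bdist (h s) (h t) \<le> \<epsilon> / (Csup + 1)"
    using b t divide_pos_pos[OF e C1] unfolding bcont_def by blast
  have "\<bar>fun_of (h s) x - fun_of (h t) x\<bar> \<le> \<epsilon>" if s: "s \<in> S" "\<bar>s - t\<bar> < \<delta>" for s x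
  proof -
    have "\<bar>fun_of (h s) x - fun_of (h t) x\<bar> \<le> Csup * bdist (h s) (h t)" by (rule fun_of_diff_le[OF sp[OF s(1)] sp[OF t]])
    also have "\<dots> \<le> (Csup + 1) * (\<epsilon> / (Csup + 1))" using \<delta>(2)[OF s] Csup_nonneg by (intro mult_mono) auto
    also have "\<dots> = \<epsilon>" using C1 by simp
    finally show ?thesis .
  qed
  then show "\<exists>\<delta>>0. \<forall>s\<in>S. \<bar>s - t\<bar> < \<delta> \<longrightarrow> (\<forall>x. \<bar>fun_of (h s) x - fun_of (h t) x\<bar> \<le> \<epsilon>)" using \<delta>(1) by blast
qed

lemma bcont_dist_of_wpath:
  assumes b: "bcont S (\<lambda>t. dist_of (u t))" and u: "\<And>t. t \<in> S \<Longrightarrow> continuous_on UNIV (u t) \<and> torus_periodic (u t)"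
  shows "wpath S u"
proof -
  have "fun_of (dist_of (u t)) = u t" if "t \<in> S" for t using u[OF that] by (intro fun_of_dist_of) auto
  then show ?thesis using bcont_wpath[OF b] by (auto simp: wpath_def)
qed

lemma wpath_drift:
  assumes w: "wpath {0..} w" and W: "\<And>s. s \<ge> 0 \<Longrightarrow> l2sq (w s) \<le> W\<^sup>2" and W0: "W \<ge> 0"
  shows "wpath {0..} (drift w)"
proof (rule bcont_dist_of_wpath[OF bcont_drift[OF assms]])
  fix t :: real assume "t \<in> {0..}"
  then show "continuous_on UNIV (drift w t) \<and> torus_periodic (drift w t)"
    using drift_facts(1,2)[OF wpath_subset[OF w], of t] by auto
qed

end

section \<open>Uniqueness by iterating the energy estimate\<close>

lemma integral_power_fact:
  fixes t :: real assumes "t \<ge> 0"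
  shows "integral {0..t} (\<lambda>s. s ^ k / fact k) = t ^ Suc k / fact (Suc k)"
proof -
  have "((\<lambda>s. s ^ k / fact k) has_integral (t ^ Suc k / fact (Suc k) - 0 ^ Suc k / fact (Suc k))) {0..t}"
  proof (rule fundamental_theorem_of_calculus[OF assms])
    fix x :: real
    have "((\<lambda>s. s ^ Suc k / fact (Suc k)) has_real_derivative (real (Suc k) * x ^ k) / fact (Suc k)) (at x within {0..t})"
      using DERIV_power[OF DERIV_ident, of "Suc k" x] by (intro DERIV_cdivide) (auto intro: DERIV_subset)
    moreover have "(real (Suc k) * x ^ k) / fact (Suc k) = x ^ k / fact k" by (simp add: field_simps del: of_nat_Suc)
    ultimately show "((\<lambda>s. s ^ Suc k / fact (Suc k)) has_vector_derivative x ^ k / fact k) (at x within {0..t})"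
      by (simp only: has_real_derivative_iff_has_vector_derivative)
  qed
  from integral_unique[OF this] show ?thesis by (simp only: power_0_Suc div_0 diff_zero)
qed

context mild_setting
begin

text \<open>The difference of the two paths is the drift of \<open>w - w'\<close>, so its squared
  \<open>L\<^sup>2\<close> norm \<open>q\<close> satisfies \<open>q s \<le> L ^ 2\<close> times the
  integral of \<open>q\<close> over \<open>[0, s]\<close>. Iteration from a constant bound gives
  \<open>Q ^ 2 * (L ^ 2 * t) ^ k / fact k\<close>, which tends to \<open>0\<close>. The equation
  enters as an identity of coefficients only.\<close>

lemma uniqueness:
  fixes u u' w w' :: "real \<Rightarrow> real ^ 'd \<Rightarrow> real"
  assumes u: "wpath {0..T} u" and u': "wpath {0..T} u'" and L: "L > 0"
    and w: "wpath {0..T} w" and w': "wpath {0..T} w'"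
    and lip: "\<And>s x. s \<in> {0..T} \<Longrightarrow> \<bar>w s x - w' s x\<bar> \<le> L * \<bar>u s x - u' s x\<bar>"
    and eq: "\<And>t m. t \<in> {0..T} \<Longrightarrow> m \<in> int_lattice \<Longrightarrow> fourier (u t) m - fourier (u' t) m = duhamel w t m - duhamel w' t m"
    and t: "t \<in> {0..T}"
  shows "u t = u' t"
proof -
  define q where "q s = l2sq (\<lambda>x. u s x - u' s x)" for s
  note du = wpath_diff[OF u u'] and dw = wpath_diff[OF w w']
  have cq: "continuous_on {0..T} q" unfolding q_def by (rule wpath_l2sq_continuous[OF du])
  obtain Q where Q: "Q \<ge> 0" "\<And>s. s \<in> {0..T} \<Longrightarrow> q s \<le> Q\<^sup>2"
    unfolding q_def using wpath_l2_bound[OF du] by blast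
  have step: "q s \<le> L\<^sup>2 * integral {0..s} q" if s: "s \<in> {0..T}" for s
  proof -
    have sub: "{0..s} \<subseteq> {0..T}" and s0: "s \<ge> 0" using s by auto
    note dws = wpath_subset[OF dw sub]
    have "drift (\<lambda>s x. w s x - w' s x) s = (\<lambda>x. u s x - u' s x)"
    proof (rule fourier_eq_imp_eq[OF drift_facts(1,2)[OF dws s0] wpathD[OF du s]])
      fix m :: "real ^ 'd" assume m: "m \<in> int_lattice"
      show "fourier (drift (\<lambda>s x. w s x - w' s x) s) m = fourier (\<lambda>x. u s x - u' s x) m"
        using m by (simp add: drift_facts(3)[OF dws s0] duhamel_diff[OF wpath_subset[OF w sub] wpath_subset[OF w' sub]] eq[OF s m, symmetric]
            fourier_diff wpathD(1)[OF u s] wpathD(1)[OF u' s])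
    qed
    then have "q s \<le> integral {0..s} (\<lambda>r. l2sq (\<lambda>x. w r x - w' r x))"
      using drift_l2[OF dws s0] by (simp add: q_def)
    also have "\<dots> \<le> integral {0..s} (\<lambda>r. L\<^sup>2 * q r)"
    proof (rule integral_le)
      show "(\<lambda>r. l2sq (\<lambda>x. w r x - w' r x)) integrable_on {0..s}"
        by (rule integrable_continuous_interval[OF wpath_l2sq_continuous[OF dws]])
      show "(\<lambda>r. L\<^sup>2 * q r) integrable_on {0..s}"
        by (intro integrable_continuous_interval continuous_intros continuous_on_subset[OF cq sub])
      fix r assume "r \<in> {0..s}"
      then have r: "r \<in> {0..T}" using sub by auto
      show "l2sq (\<lambda>x. w r x - w' r x) \<le> L\<^sup>2 * q r"
        unfolding q_def by (rule l2sq_mono[OF wpathD(1)[OF dw r] wpathD(1)[OF du r] lip[OF r]])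
    qed
    finally show ?thesis by simp
  qed
  have qk: "q s \<le> Q\<^sup>2 * (L\<^sup>2) ^ k * (s ^ k / fact k)" if "s \<in> {0..T}" for s k
    using that
  proof (induction k arbitrary: s)
    case 0 then show ?case using Q(2)[of s] by simp
  next
    case (Suc k)
    then have sub: "{0..s} \<subseteq> {0..T}" and s0: "s \<ge> 0" by auto
    have "integral {0..s} q \<le> integral {0..s} (\<lambda>r. Q\<^sup>2 * (L\<^sup>2) ^ k * (r ^ k / fact k))"
      using sub Suc.IH by (intro integral_le integrable_continuous_interval continuous_intros continuous_on_subset[OF cq]) auto
    also have "\<dots> = Q\<^sup>2 * (L\<^sup>2) ^ k * (s ^ Suc k / fact (Suc k))"
      by (simp only: integral_mult_right integral_power_fact[OF s0])
    finally have "L\<^sup>2 * integral {0..s} q \<le> L\<^sup>2 * (Q\<^sup>2 * (L\<^sup>2) ^ k * (s ^ Suc k / fact (Suc k)))"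
      by (rule mult_left_mono) simp
    with step[OF Suc.prems] have "q s \<le> L\<^sup>2 * (Q\<^sup>2 * (L\<^sup>2) ^ k * (s ^ Suc k / fact (Suc k)))" by (rule order_trans)
    also have "\<dots> = Q\<^sup>2 * (L\<^sup>2) ^ Suc k * (s ^ Suc k / fact (Suc k))" by (simp only: power_Suc mult_ac)
    finally show ?case .
  qed
  have "(\<lambda>k. (L\<^sup>2 * t) ^ k /\<^sub>R fact k) \<longlonglongrightarrow> 0" by (rule summable_LIMSEQ_zero[OF summable_exp_generic])
  then have "(\<lambda>k. Q\<^sup>2 * ((L\<^sup>2 * t) ^ k /\<^sub>R fact k)) \<longlonglongrightarrow> 0" by (rule tendsto_mult_right_zero)
  moreover have "q t \<le> Q\<^sup>2 * ((L\<^sup>2 * t) ^ k /\<^sub>R fact k)" for k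
    using qk[OF t, of k] by (simp add: power_mult_distrib divide_inverse mult_ac)
  ultimately have "q t \<le> 0" by (intro LIMSEQ_le_const) auto
  then have "u t x - u' t x = 0" for x
    unfolding q_def l2sq_def by (intro torus_l2_zero[OF wpathD[OF du t]])
  then show ?thesis by (intro ext) simp
qed

end

section \<open>Picard iteration\<close>

lemma wpath_limit:
  fixes u :: "real \<Rightarrow> real ^ 'd::finite \<Rightarrow> real"
  assumes U: "\<And>k. wpath {0..} (U k)" and R: "\<And>T. T \<ge> 0 \<Longrightarrow> (\<lambda>k. R k T) \<longlonglongrightarrow> 0"
    and le: "\<And>k t T x. 0 \<le> t \<Longrightarrow> t \<le> T \<Longrightarrow> \<bar>u t x - U k t x\<bar> \<le> R k T"
  shows "wpath {0..} u"
  unfolding wpath_def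
proof (intro conjI ballI allI impI)
  fix t :: real assume t: "t \<in> {0..}"
  then have t0: "t \<ge> 0" by simp
  have "uniform_limit UNIV (\<lambda>k. U k t) (u t) sequentially"
  proof (rule uniform_limitI)
    fix e :: real assume "e > 0"
    then have "\<forall>\<^sub>F k in sequentially. R k t < e" using order_tendstoD(2)[OF R[OF t0]] by simp
    then show "\<forall>\<^sub>F k in sequentially. \<forall>x\<in>UNIV. dist (U k t x) (u t x) < e"
    proof eventually_elim
      case (elim k)
      show ?case
      proof
        fix x
        show "dist (U k t x) (u t x) < e" using le[OF t0 order_refl, of x k] elim by (simp add: dist_real_def abs_minus_commute)
      qed
    qed
  qed
  then show "continuous_on UNIV (u t)"
    by (rule uniform_limit_theorem[rotated]) (auto intro: always_eventually wpathD(1)[OF U t])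
  have "u t (x + m) = u t x" if m: "m \<in> int_lattice" for x m
  proof -
    have "\<bar>u t (x + m) - u t x\<bar> \<le> R k t + R k t" for k
      using le[OF t0 order_refl, of "x + m" k] le[OF t0 order_refl, of x k] torus_periodicD[OF wpathD(2)[OF U t] m, of k x] by linarith
    then have "\<exists>N. \<forall>k\<ge>N. \<bar>u t (x + m) - u t x\<bar> \<le> R k t + R k t" by blast
    moreover have "(\<lambda>k. R k t + R k t) \<longlonglongrightarrow> 0 + 0" by (intro tendsto_add R t0)
    ultimately have "\<bar>u t (x + m) - u t x\<bar> \<le> 0 + 0" by (rule LIMSEQ_le_const[rotated])
    then show ?thesis by simp
  qed
  then show "torus_periodic (u t)" by (simp add: torus_periodic_def)
next
  fix t \<epsilon> :: real assume t: "t \<in> {0..}" and e: "\<epsilon> > 0"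
  have "\<forall>\<^sub>F k in sequentially. R k (t + 1) < \<epsilon> / 3" using order_tendstoD(2)[OF R[of "t + 1"], of "\<epsilon> / 3"] t e by simp
  \<comment> \<open>The horizon \<open>t + 1\<close> covers all times \<open>s\<close> with
    \<open>\<bar>s - t\<bar> < 1\<close> at once.\<close>
  then obtain k where k: "R k (t + 1) < \<epsilon> / 3" using eventually_happens'[OF sequentially_bot] by blast
  obtain \<delta> where \<delta>: "\<delta> > 0" "\<And>s x. s \<in> {0..} \<Longrightarrow> \<bar>s - t\<bar> < \<delta> \<Longrightarrow> \<bar>U k s x - U k t x\<bar> \<le> \<epsilon> / 3"
    using wpath_continuity[OF U t, of "\<epsilon> / 3" k] e by auto
  show "\<exists>\<delta>>0. \<forall>s\<in>{0..}. \<bar>s - t\<bar> < \<delta> \<longrightarrow> (\<forall>x. \<bar>u s x - u t x\<bar> \<le> \<epsilon>)"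
  proof (intro exI[of _ "min \<delta> 1"] conjI ballI impI allI)
    fix s x assume s: "s \<in> {0..}" "\<bar>s - t\<bar> < min \<delta> 1"
    have "\<bar>u s x - U k s x\<bar> \<le> R k (t + 1)" by (rule le) (use s in auto)
    moreover have "\<bar>u t x - U k t x\<bar> \<le> R k (t + 1)" by (rule le) (use t in auto)
    moreover have "\<bar>U k s x - U k t x\<bar> \<le> \<epsilon> / 3" using \<delta>(2)[OF s(1)] s(2) by simp
    ultimately show "\<bar>u s x - u t x\<bar> \<le> \<epsilon>" using k by linarith
  qed (use \<delta>(1) in simp)
qed

context mild_setting
begin

primrec picard :: "(real \<Rightarrow> real) \<Rightarrow> (real \<Rightarrow> real ^ 'd \<Rightarrow> real) \<Rightarrow> nat \<Rightarrow> real \<Rightarrow> real ^ 'd \<Rightarrow> real" where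
  "picard P y 0 = y"
| "picard P y (Suc k) = (\<lambda>t x. y t x + drift (\<lambda>s x. P (picard P y k s x)) t x)"

text \<open>A pointwise limit, so that measurability passes to it; its convergence is in fact
  uniform in space and locally uniform in time. The index starts at \<open>Suc k\<close> to match
  the increments in \<open>picard_incr\<close>.\<close>

definition picard_limit :: "(real \<Rightarrow> real) \<Rightarrow> (real \<Rightarrow> real ^ 'd \<Rightarrow> real) \<Rightarrow> real \<Rightarrow> real ^ 'd \<Rightarrow> real" where
  "picard_limit P y t x = lim (\<lambda>k. picard P y (Suc k) t x)"

end

locale picard_setting = mild_setting \<rho> \<alpha> for \<rho> :: "int \<Rightarrow> real ^ 'd::finite \<Rightarrow> real" and \<alpha> :: real +
  fixes P :: "real \<Rightarrow> real" and L M :: real and y :: "real \<Rightarrow> real ^ 'd \<Rightarrow> real"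
  assumes lip: "\<bar>P a - P b\<bar> \<le> L * \<bar>a - b\<bar>" and L: "L > 0" and bnd: "\<bar>P a\<bar> \<le> M" and y: "wpath {0..} y"
begin

lemma bound_nonneg: "M \<ge> 0" using bnd[of 0] by linarith

abbreviation PP :: "(real \<Rightarrow> real ^ 'd \<Rightarrow> real) \<Rightarrow> real \<Rightarrow> real ^ 'd \<Rightarrow> real" where
  "PP u \<equiv> \<lambda>s x. P (u s x)"

lemma wpath_PP: "wpath S u \<Longrightarrow> wpath S (PP u)"
  using wpath_lipschitz[of S u P L] lip L by blast

lemma l2_PP: "wpath S u \<Longrightarrow> s \<in> S \<Longrightarrow> l2sq (PP u s) \<le> M\<^sup>2"
  using l2sq_le[OF wpathD(1)[OF wpath_PP] bnd] by blast

lemma wpath_picard: "wpath {0..} (picard P y k)"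
proof (induction k)
  case (Suc k)
  have "wpath {0..} (drift (PP (picard P y k)))"
    using l2_PP[OF Suc] by (intro wpath_drift[of _ M] wpath_PP Suc bound_nonneg) auto
  from wpath_add[OF y this] show ?case by simp
qed (simp add: y)

lemma wpath_restrict: "wpath {0..} u \<Longrightarrow> wpath {0..t} u"
  by (rule wpath_subset) auto

lemma wpath_PP_picard: "wpath {0..t} (PP (picard P y k))"
  by (intro wpath_restrict wpath_PP wpath_picard)

lemma picard_step:
  assumes "t \<ge> 0"
  shows "picard P y (Suc (Suc k)) t x - picard P y (Suc k) t x
    = drift (\<lambda>s x. P (picard P y (Suc k) s x) - P (picard P y k s x)) t x"
  using drift_diff[OF wpath_PP_picard[of t "Suc k"] wpath_PP_picard[of t k] assms] by simp

text \<open>Each step contributes \<open>L ^ 2\<close> and a time integral, which builds up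
  \<open>t ^ Suc k / fact (Suc k)\<close>. The start uses only the bound \<open>M\<close> on the
  nonlinearity, so its constant does not depend on the size of \<open>y\<close>.\<close>

lemma picard_l2:
  assumes "t \<ge> 0"
  shows "l2sq (\<lambda>x. picard P y (Suc k) t x - picard P y k t x) \<le> M\<^sup>2 * (L\<^sup>2) ^ k * (t ^ Suc k / fact (Suc k))"
  using assms
proof (induction k arbitrary: t)
  case 0
  have "l2sq (\<lambda>x. picard P y (Suc 0) t x - picard P y 0 t x) = l2sq (drift (PP y) t)" by simp
  also have "\<dots> \<le> integral {0..t} (\<lambda>s. l2sq (PP y s))" by (intro drift_l2 wpath_restrict wpath_PP y 0)
  also have "\<dots> \<le> integral {0..t} (\<lambda>s. M\<^sup>2)"
    by (intro integral_le integrable_continuous_interval wpath_l2sq_continuous wpath_restrict wpath_PP y continuous_intros l2_PP[OF y]) auto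
  also have "\<dots> = M\<^sup>2 * t" using 0 by simp
  finally show ?case by simp
next
  case (Suc k)
  let ?d = "\<lambda>s x. P (picard P y (Suc k) s x) - P (picard P y k s x)"
  have wd: "wpath {0..t} ?d" by (intro wpath_diff wpath_PP_picard)
  have "l2sq (\<lambda>x. picard P y (Suc (Suc k)) t x - picard P y (Suc k) t x) = l2sq (drift ?d t)"
    unfolding picard_step[OF Suc.prems] ..
  also have "\<dots> \<le> integral {0..t} (\<lambda>s. l2sq (?d s))" by (rule drift_l2[OF wd Suc.prems])
  also have "\<dots> \<le> integral {0..t} (\<lambda>s. (L\<^sup>2 * (M\<^sup>2 * (L\<^sup>2) ^ k)) * (s ^ Suc k / fact (Suc k)))"
  proof (rule integral_le)
    show "(\<lambda>s. l2sq (?d s)) integrable_on {0..t}" by (intro integrable_continuous_interval wpath_l2sq_continuous wd)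
    show "(\<lambda>s. (L\<^sup>2 * (M\<^sup>2 * (L\<^sup>2) ^ k)) * (s ^ Suc k / fact (Suc k))) integrable_on {0..t}"
      by (intro integrable_continuous_interval continuous_intros) simp
    fix s assume s: "s \<in> {0..t}"
    have "l2sq (?d s) \<le> L\<^sup>2 * l2sq (\<lambda>x. picard P y (Suc k) s x - picard P y k s x)"
      using s by (intro l2sq_mono wpathD(1)[OF wd s] continuous_intros wpathD(1)[OF wpath_picard] lip) auto
    also have "\<dots> \<le> L\<^sup>2 * (M\<^sup>2 * (L\<^sup>2) ^ k * (s ^ Suc k / fact (Suc k)))" using s by (intro mult_left_mono Suc.IH) auto
    finally show "l2sq (?d s) \<le> (L\<^sup>2 * (M\<^sup>2 * (L\<^sup>2) ^ k)) * (s ^ Suc k / fact (Suc k))" by (simp only: mult.assoc)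
  qed
  also have "\<dots> = (L\<^sup>2 * (M\<^sup>2 * (L\<^sup>2) ^ k)) * (t ^ Suc (Suc k) / fact (Suc (Suc k)))"
    by (simp only: integral_mult_right integral_power_fact[OF Suc.prems])
  also have "\<dots> = M\<^sup>2 * (L\<^sup>2) ^ Suc k * (t ^ Suc (Suc k) / fact (Suc (Suc k)))" by (simp only: power_Suc[of "L\<^sup>2"] mult_ac)
  finally show ?case .
qed

text \<open>The supremum bound involves the square root of the \<open>L\<^sup>2\<close> bound. To
  avoid the root of a factorial, the quotient is written as \<open>a * b\<close> with
  \<open>a = (1/4) ^ Suc k\<close>, and \<open>sqrt (a * b) \<le> a + b\<close> leaves a geometric
  and an exponential series.\<close>

definition incr :: "nat \<Rightarrow> real \<Rightarrow> real" where
  "incr k T = Csup * (Cblock * (M * ((1/4) ^ Suc k + (4 * (L\<^sup>2 * T)) ^ Suc k /\<^sub>R fact (Suc k))))"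

lemma incr_nonneg: "T \<ge> 0 \<Longrightarrow> 0 \<le> incr k T"
  unfolding incr_def using Csup_nonneg Cblock_nonneg bound_nonneg by simp

lemma summable_incr: "summable (\<lambda>k. incr k T)"
proof -
  have "summable (\<lambda>k. (1/4 :: real) ^ Suc k)" by (subst summable_Suc_iff) (rule summable_geometric, simp)
  moreover have "summable (\<lambda>k. (4 * (L\<^sup>2 * T)) ^ Suc k /\<^sub>R fact (Suc k))"
    by (subst summable_Suc_iff) (rule summable_exp_generic)
  ultimately show ?thesis unfolding incr_def by (intro summable_mult summable_add)
qed

lemma picard_incr:
  assumes t: "0 \<le> t" "t \<le> T"
  shows "\<bar>picard P y (Suc (Suc k)) t x - picard P y (Suc k) t x\<bar> \<le> incr k T"
  unfolding picard_step[OF t(1)] incr_def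
proof (rule drift_sup[OF _ t(1)])
  let ?d = "\<lambda>s x. P (picard P y (Suc k) s x) - P (picard P y k s x)"
  let ?a = "(1/4 :: real) ^ Suc k" and ?b = "(4 * (L\<^sup>2 * T)) ^ Suc k /\<^sub>R fact (Suc k)"
  show wd: "wpath {0..t} ?d" by (intro wpath_diff wpath_PP_picard)
  have ab: "?a \<ge> 0" "?b \<ge> 0" using t by simp_all
  then show "0 \<le> M * (?a + ?b)" using bound_nonneg by simp
  fix s assume s: "s \<in> {0..t}"
  have "l2sq (?d s) \<le> L\<^sup>2 * l2sq (\<lambda>x. picard P y (Suc k) s x - picard P y k s x)"
    using s by (intro l2sq_mono wpathD(1)[OF wd s] continuous_intros wpathD(1)[OF wpath_picard] lip) auto
  also have "\<dots> \<le> L\<^sup>2 * (M\<^sup>2 * (L\<^sup>2) ^ k * (s ^ Suc k / fact (Suc k)))" using s by (intro mult_left_mono picard_l2) auto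
  also have "\<dots> \<le> L\<^sup>2 * (M\<^sup>2 * (L\<^sup>2) ^ k * (T ^ Suc k / fact (Suc k)))"
    using s t by (intro mult_left_mono divide_right_mono power_mono mult_nonneg_nonneg) auto
  also have "\<dots> = M\<^sup>2 * (?a * ?b)"
  proof -
    have "?a * (4 * (L\<^sup>2 * T)) ^ Suc k = (L\<^sup>2 * T) ^ Suc k" unfolding power_mult_distrib[symmetric] by simp
    then have "?a * ?b = (L\<^sup>2 * T) ^ Suc k / fact (Suc k)" by (simp only: scaleR_conv_of_real of_real_eq_id id_apply divide_inverse mult_ac)
    also have "(L\<^sup>2 * T) ^ Suc k = L\<^sup>2 * (L\<^sup>2) ^ k * T ^ Suc k" by (simp only: power_mult_distrib power_Suc mult_ac)
    finally show ?thesis by (simp only: times_divide_eq_right mult_ac)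
  qed
  also have "\<dots> \<le> (M * (?a + ?b))\<^sup>2"
  proof -
    have gen: "a * b \<le> (a + b)\<^sup>2" if "a \<ge> 0" "b \<ge> 0" for a b :: real
      using zero_le_power2[of a] zero_le_power2[of b] mult_nonneg_nonneg[OF that] unfolding power2_sum by linarith
    have "?a * ?b \<le> (?a + ?b)\<^sup>2" by (rule gen[OF ab])
    then show ?thesis unfolding power_mult_distrib by (rule mult_left_mono) simp
  qed
  finally show "l2sq (?d s) \<le> (M * (?a + ?b))\<^sup>2" .
qed

definition remainder :: "nat \<Rightarrow> real \<Rightarrow> real" where
  "remainder k T = (\<Sum>j. incr (j + k) T)"

lemma remainder_tendsto: "(\<lambda>k. remainder k T) \<longlonglongrightarrow> 0"
  unfolding remainder_def by (rule suminf_exist_split2[OF summable_incr])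

lemma picard_limit_approx:
  assumes t: "0 \<le> t" "t \<le> T"
  shows "\<bar>picard_limit P y t x - picard P y (Suc k) t x\<bar> \<le> remainder k T"
    and "(\<lambda>k. picard P y (Suc k) t x) \<longlonglongrightarrow> picard_limit P y t x"
proof -
  define a where "a k = picard P y (Suc k) t x" for k
  have T0: "T \<ge> 0" using t by simp
  have inc: "\<bar>a (Suc k) - a k\<bar> \<le> incr k T" for k unfolding a_def by (rule picard_incr[OF t])
  have "summable (\<lambda>k. a (Suc k) - a k)"
    by (rule summable_comparison_test'[OF summable_incr[of T], of 0]) (simp add: inc)
  then have "(\<lambda>k. \<Sum>i<k. a (Suc i) - a i) \<longlonglongrightarrow> (\<Sum>i. a (Suc i) - a i)" by (rule summable_LIMSEQ)
  then have "(\<lambda>k. a k - a 0) \<longlonglongrightarrow> (\<Sum>i. a (Suc i) - a i)" by (simp add: sum_lessThan_telescope)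
  then have "(\<lambda>k. (a k - a 0) + a 0) \<longlonglongrightarrow> (\<Sum>i. a (Suc i) - a i) + a 0" by (intro tendsto_intros)
  then have "convergent a" by (auto simp: convergent_def)
  then have lim: "a \<longlonglongrightarrow> picard_limit P y t x"
    unfolding picard_limit_def a_def[symmetric] convergent_LIMSEQ_iff by (simp add: a_def[abs_def])
  then show "(\<lambda>k. picard P y (Suc k) t x) \<longlonglongrightarrow> picard_limit P y t x" by (simp add: a_def[abs_def])
  have "\<bar>a (n + k) - a k\<bar> \<le> remainder k T" for n
  proof -
    have "a (n + k) - a k = (\<Sum>i<n. a (Suc (i + k)) - a (i + k))"
      using sum_lessThan_telescope[of "\<lambda>i. a (i + k)" n] by simp
    also have "\<bar>\<dots>\<bar> \<le> (\<Sum>i<n. incr (i + k) T)" by (rule order_trans[OF sum_abs sum_mono]) (rule inc)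
    also have "\<dots> \<le> remainder k T" unfolding remainder_def
      by (rule sum_le_suminf) (auto simp: incr_nonneg T0 intro: summable_ignore_initial_segment[OF summable_incr])
    finally show ?thesis .
  qed
  moreover have "(\<lambda>n. \<bar>a (n + k) - a k\<bar>) \<longlonglongrightarrow> \<bar>picard_limit P y t x - a k\<bar>"
    by (intro tendsto_intros LIMSEQ_ignore_initial_segment lim)
  ultimately show "\<bar>picard_limit P y t x - picard P y (Suc k) t x\<bar> \<le> remainder k T"
    unfolding a_def[symmetric] by (intro LIMSEQ_le_const2) auto
qed

lemma wpath_picard_limit: "wpath {0..} (picard_limit P y)"
  by (rule wpath_limit[where U="\<lambda>k. picard P y (Suc k)" and R=remainder])
     (auto intro: wpath_picard remainder_tendsto picard_limit_approx(1) simp del: picard.simps)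

text \<open>The drift is Lipschitz in the supremum norm by \<open>drift_sup\<close>, so both sides
  differ by at most remainders that tend to \<open>0\<close>.\<close>

lemma picard_limit_eq:
  assumes t: "t \<ge> 0"
  shows "picard_limit P y t x = y t x + drift (PP (picard_limit P y)) t x"
proof -
  let ?u = "picard_limit P y"
  have r0: "remainder k t \<ge> 0" for k using picard_limit_approx(1)[OF t order_refl, of x k] by linarith
  have wu: "wpath {0..t} (PP ?u)" by (intro wpath_restrict wpath_PP wpath_picard_limit)
  have le: "\<bar>?u t x - (y t x + drift (PP ?u) t x)\<bar> \<le> remainder (Suc k) t + Csup * (Cblock * (L * remainder k t))" for k
  proof -
    let ?p = "picard P y (Suc k)"
    have "\<bar>drift (\<lambda>s x. P (?p s x) - P (?u s x)) t x\<bar> \<le> Csup * (Cblock * (L * remainder k t))"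
    proof (rule drift_sup[OF wpath_diff[OF wpath_PP_picard wu] t])
      show "0 \<le> L * remainder k t" using L r0 by simp
      fix s assume s: "s \<in> {0..t}"
      show "l2sq (\<lambda>x. P (?p s x) - P (?u s x)) \<le> (L * remainder k t)\<^sup>2"
      proof (rule l2sq_le)
        show "continuous_on UNIV (\<lambda>x. P (?p s x) - P (?u s x))"
          by (intro continuous_intros wpathD(1)[OF wpath_PP_picard s] wpathD(1)[OF wu s])
        fix x
        have "\<bar>P (?p s x) - P (?u s x)\<bar> \<le> L * \<bar>?p s x - ?u s x\<bar>" by (rule lip)
        also have "\<dots> \<le> L * remainder k t"
          using picard_limit_approx(1)[of s t x k] s L by (intro mult_left_mono) (auto simp: abs_minus_commute simp del: picard.simps)
        finally show "\<bar>P (?p s x) - P (?u s x)\<bar> \<le> L * remainder k t" .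
      qed
    qed
    moreover have "drift (\<lambda>s x. P (?p s x) - P (?u s x)) t x = drift (PP ?p) t x - drift (PP ?u) t x"
      by (rule drift_diff[OF wpath_PP_picard wu t])
    moreover have "picard P y (Suc (Suc k)) t x = y t x + drift (PP ?p) t x" by (simp only: picard.simps)
    moreover have "\<bar>?u t x - picard P y (Suc (Suc k)) t x\<bar> \<le> remainder (Suc k) t"
      by (rule picard_limit_approx(1)[OF t order_refl])
    ultimately show ?thesis by linarith
  qed
  have "(\<lambda>k. remainder (Suc k) t + Csup * (Cblock * (L * remainder k t))) \<longlonglongrightarrow> 0 + Csup * (Cblock * (L * 0))"
    by (intro tendsto_intros remainder_tendsto LIMSEQ_Suc)
  then have "\<bar>?u t x - (y t x + drift (PP ?u) t x)\<bar> \<le> 0 + Csup * (Cblock * (L * 0))"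
    by (rule LIMSEQ_le_const) (auto intro: le)
  then show ?thesis by simp
qed

text \<open>The iterates converge only uniformly, not in the Besov metric. Besov continuity comes
  from the fixed point equation: the drift of a bounded path is Besov continuous.\<close>

lemma bcont_picard_limit:
  assumes b: "bcont {0..} (\<lambda>t. dist_of (y t))"
  shows "bcont {0..} (\<lambda>t. dist_of (picard_limit P y t))"
proof -
  let ?w = "PP (picard_limit P y)"
  have w: "wpath {0..} ?w" by (intro wpath_PP wpath_picard_limit)
  have W: "l2sq (?w s) \<le> M\<^sup>2" if "s \<ge> 0" for s using l2_PP[OF wpath_picard_limit, of s] that by simp
  have "bcont {0..} (\<lambda>t. dist_of (\<lambda>x. y t x + drift ?w t x))"
    using wpathD[OF y] wpathD[OF wpath_drift[OF w W bound_nonneg]] by (intro bcont_add b bcont_drift[OF w W bound_nonneg]) auto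
  moreover have "(\<lambda>x. y t x + drift ?w t x) = picard_limit P y t" if "t \<in> {0..}" for t
    using picard_limit_eq[of t] that by auto
  ultimately show ?thesis unfolding bcont_def by simp
qed

end

section \<open>The weak form of the equation\<close>

text \<open>Shows the translated kernel, as a function of \<open>y\<close>, as a series in modes;
  for \<open>r > 0\<close> its coefficients decay rapidly, so a distribution can be applied term by
  term.\<close>

lemma biharmonic_kernel_eq:
  fixes x y :: "real ^ 'd::finite"
  shows "biharmonic_kernel r (y - x) = rser (\<lambda>m. of_real (semi r m) * cnj (mode m x)) y"
  unfolding biharmonic_kernel_def rser_def
proof (rule infsum_cong)
  fix m :: "real ^ 'd"
  have "norm ((2 * pi) *\<^sub>R m) ^ 4 = ((norm ((2 * pi) *\<^sub>R m))\<^sup>2)\<^sup>2" by simp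
  also have "\<dots> = (lam m)\<^sup>2" by (simp only: power2_norm_eq_inner) (simp add: lam_def power2_eq_square)
  finally have n: "norm ((2 * pi) *\<^sub>R m) ^ 4 = (lam m)\<^sup>2" .
  have eq: "of_real (semi r m) * cnj (mode m x) * mode m y = of_real (semi r m) * mode m (y - x)"
    by (simp add: mode_diff_right)
  show "cos (2 * pi * ((y - x) \<bullet> m)) * exp (- r * norm ((2 * pi) *\<^sub>R m) ^ 4) = Re (of_real (semi r m) * cnj (mode m x) * mode m y)"
    unfolding eq n by (simp add: mode_def inner_commute semi_def)
qed

lemma kernel_rdecay:
  fixes x :: "real ^ 'd::finite"
  assumes "r > 0" shows "rdecay (\<lambda>m. of_real (semi r m) * cnj (mode m x))"
  by (rule semi_rdecay[OF assms, where K=1]) simp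

lemma convolve_kernel:
  assumes f: "f \<in> distributions" and r: "r > 0"
  shows "convolve (biharmonic_kernel r) f x = rser (\<lambda>m. of_real (semi r m) * fcoef f m) x"
proof -
  have "((\<lambda>m. Re (of_real (semi r m) * cnj (mode m x) * cnj (fcoef f m))) has_sum convolve (biharmonic_kernel r) f x) int_lattice"
    unfolding convolve_def biharmonic_kernel_eq by (rule distribution_rser[OF f kernel_rdecay[OF r]])
  moreover have "Re (of_real (semi r m) * cnj (mode m x) * cnj (fcoef f m)) = Re (of_real (semi r m) * fcoef f m * mode m x)" for m
    by (simp add: algebra_simps)
  ultimately show ?thesis unfolding rser_def by (simp only: infsumI)
qed

text \<open>For \<open>r > 0\<close> the Laplacian falls on the smooth kernel; at
  \<open>r = 0\<close>, where the semigroup is the identity by definition, it falls on the test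
  function. The common formula makes the integrand continuous up to the endpoint of the time
  interval.\<close>

lemma semigroup_drift_has_sum:
  fixes w :: "real ^ 'd::finite \<Rightarrow> real"
  assumes w: "continuous_on UNIV w" "torus_periodic w" and \<phi>: "\<phi> \<in> test_funs" and r: "r \<ge> 0"
  shows "((\<lambda>m. Re (fourier \<phi> m * cnj (- of_real (lam m) * (of_real (semi r m) * fourier w m)))) has_sum
    biharmonic_semigroup r (dist_laplacian (dist_of w)) \<phi>) int_lattice"
proof (cases "r = 0")
  case True
  have rd: "rdecay (fourier \<phi>)" by (rule fourier_test_fun_rdecay[OF \<phi>])
  have "biharmonic_semigroup r (dist_laplacian (dist_of w)) \<phi> = dist_of w (laplacian (rser (fourier \<phi>)))"
    using True \<phi> by (simp add: biharmonic_semigroup_def dist_laplacian_def test_fun_rser)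
  also have "\<dots> = dist_of w (rser (\<lambda>m. - of_real (lam m) * fourier \<phi> m))" by (simp only: rser_laplacian[OF rd])
  finally have "((\<lambda>m. Re (- of_real (lam m) * fourier \<phi> m * cnj (fcoef (dist_of w) m))) has_sum
      biharmonic_semigroup r (dist_laplacian (dist_of w)) \<phi>) int_lattice"
    using distribution_rser[OF dist_of_distribution[OF w] rdecay_lam[OF rd]] by simp
  then show ?thesis
    by (rule has_sum_cong[THEN iffD1, rotated]) (simp add: True semi_def fcoef_dist_of[OF w(1)] algebra_simps)
next
  case False
  then have r0: "r > 0" using r by simp
  define d where "d m = - of_real (lam m) * (of_real (semi r m) * fourier w m)" for m
  obtain B where B: "\<And>x. \<bar>w x\<bar> \<le> B" using continuous_torus_bounded[OF w] by auto
  have rd: "rdecay d" unfolding d_def[abs_def] by (rule rdecay_lam[OF semi_rdecay[OF r0 fourier_bound[OF w(1) B]]])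
  have conv: "convolve (biharmonic_kernel r) (dist_laplacian (dist_of w)) x = rser d x" for x
  proof -
    let ?c = "\<lambda>m. of_real (semi r m) * cnj (mode m x)"
    have "convolve (biharmonic_kernel r) (dist_laplacian (dist_of w)) x = dist_of w (rser (\<lambda>m. - of_real (lam m) * ?c m))"
      unfolding convolve_def biharmonic_kernel_eq dist_laplacian_def
      using rser_test_fun[OF kernel_rdecay[OF r0, of x]] by (simp add: rser_laplacian[OF kernel_rdecay[OF r0]])
    then have "((\<lambda>m. Re (- of_real (lam m) * ?c m * cnj (fcoef (dist_of w) m))) has_sum convolve (biharmonic_kernel r) (dist_laplacian (dist_of w)) x) int_lattice"
      using distribution_rser[OF dist_of_distribution[OF w] rdecay_lam[OF kernel_rdecay[OF r0, of x]]] by simp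
    then have "((\<lambda>m. Re (d m * mode m x)) has_sum convolve (biharmonic_kernel r) (dist_laplacian (dist_of w)) x) int_lattice"
      by (rule has_sum_cong[THEN iffD1, rotated]) (simp add: d_def fcoef_dist_of[OF w(1)] algebra_simps)
    then show ?thesis unfolding rser_def by (simp only: infsumI)
  qed
  have "biharmonic_semigroup r (dist_laplacian (dist_of w)) \<phi> = (LINT x|torus. rser d x * \<phi> x)"
    using False \<phi> by (simp add: biharmonic_semigroup_def dist_of_def[of "convolve (biharmonic_kernel r) (dist_laplacian (dist_of w))"] conv)
  also have "\<dots> = dist_of \<phi> (rser d)" using rser_test_fun[OF rd] by (simp add: dist_of_def mult.commute)
  finally have "((\<lambda>m. Re (d m * cnj (fcoef (dist_of \<phi>) m))) has_sum biharmonic_semigroup r (dist_laplacian (dist_of w)) \<phi>) int_lattice"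
    using distribution_rser[OF dist_of_distribution[OF test_fun_continuous[OF \<phi>] test_fun_periodic[OF \<phi>]] rd] by simp
  then show ?thesis
    by (rule has_sum_cong[THEN iffD1, rotated])
       (simp add: d_def fcoef_dist_of[OF test_fun_continuous[OF \<phi>]] algebra_simps)
qed

text \<open>The supremum norm is a continuous function of time on a compact interval.\<close>

lemma wpath_bounded:
  fixes u :: "real \<Rightarrow> real ^ 'd::finite \<Rightarrow> real"
  assumes u: "wpath {0..T} u"
  shows "\<exists>B. \<forall>s\<in>{0..T}. \<forall>x. \<bar>u s x\<bar> \<le> B"
proof -
  define n where "n s = (SUP x. \<bar>u s x\<bar>)" for s
  have bdd: "bdd_above (range (\<lambda>x. \<bar>u s x\<bar>))" if s: "s \<in> {0..T}" for s
  proof -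
    obtain B where "\<And>x. \<bar>u s x\<bar> \<le> B" using continuous_torus_bounded[OF wpathD[OF u s]] by auto
    then show ?thesis by (rule bdd_aboveI2)
  qed
  have nle: "n s \<le> n t + e" if s: "s \<in> {0..T}" and t: "t \<in> {0..T}" and e: "\<And>x. \<bar>u s x - u t x\<bar> \<le> e" for s t e
    unfolding n_def[of s]
  proof (rule cSUP_least)
    fix x
    have "\<bar>u t x\<bar> \<le> n t" unfolding n_def by (rule cSUP_upper[OF UNIV_I bdd[OF t]])
    then show "\<bar>u s x\<bar> \<le> n t + e" using e[of x] by linarith
  qed simp
  have "continuous_on {0..T} n"
  proof (rule continuous_onI)
    fix t and e :: real assume t: "t \<in> {0..T}" and e: "e > 0"
    obtain \<delta> where \<delta>: "\<delta> > 0" "\<And>s x. s \<in> {0..T} \<Longrightarrow> \<bar>s - t\<bar> < \<delta> \<Longrightarrow> \<bar>u s x - u t x\<bar> \<le> e"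
      using wpath_continuity[OF u t e] by blast
    have "dist (n s) (n t) \<le> e" if s: "s \<in> {0..T}" "dist s t < \<delta>" for s
      using nle[OF s(1) t, of e] nle[OF t s(1), of e] \<delta>(2)[OF s(1)] s(2) by (auto simp: dist_real_def abs_minus_commute)
    then show "\<exists>d>0. \<forall>s\<in>{0..T}. dist s t < d \<longrightarrow> dist (n s) (n t) \<le> e" using \<delta>(1) by blast
  qed
  then have "compact (n ` {0..T})" by (rule compact_continuous_image[OF _ compact_Icc])
  then obtain B where B: "\<forall>a\<in>n ` {0..T}. norm a \<le> B"
    using compact_imp_bounded[of "n ` {0..T}"] unfolding bounded_iff by blast
  have "\<bar>u s x\<bar> \<le> B" if s: "s \<in> {0..T}" for s x
    using bspec[OF B imageI[OF s]] cSUP_upper[OF UNIV_I bdd[OF s], of x] unfolding n_def real_norm_def by linarith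
  then show ?thesis by blast
qed

lemma dist_of_add:
  fixes u v :: "real ^ 'd::finite \<Rightarrow> real"
  assumes "continuous_on UNIV u" "continuous_on UNIV v" "\<phi> \<in> test_funs"
  shows "dist_of (\<lambda>x. u x + v x) \<phi> = dist_of u \<phi> + dist_of v \<phi>"
proof -
  have "integrable torus (\<lambda>x. f x * \<phi> x)" if "continuous_on UNIV f" for f :: "real ^ 'd \<Rightarrow> real"
    using test_fun_continuous[OF assms(3)] by (intro integrable_torus_continuous continuous_intros that)
  then show ?thesis using assms by (simp add: dist_of_def distrib_right)
qed

context mild_setting
begin

text \<open>The series over the modes is integrated term by term. Its terms are bounded uniformly in
  time by \<open>W * lam m\<close> times the modulus of the coefficient of the test function, which
  is summable as that function is smooth.\<close>

lemma weak_drift: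
  fixes w :: "real \<Rightarrow> real ^ 'd \<Rightarrow> real"
  assumes w: "wpath {0..U} w" and U: "U \<ge> 0" and \<phi>: "\<phi> \<in> test_funs"
  defines "F \<equiv> \<lambda>q. biharmonic_semigroup (U - q) (dist_laplacian (dist_of (w q))) \<phi>"
  shows "set_integrable lborel {0..U} F" "(LINT q:{0..U}|lborel. F q) = dist_of (drift w U) \<phi>"
proof -
  define h where "h m q = Re (fourier \<phi> m * cnj (- of_real (lam m) * (of_real (semi (U - q) m) * fourier (w q) m)))" for m q
  have hs: "((\<lambda>m. h m q) has_sum F q) int_lattice" if q: "q \<in> {0..U}" for q
    unfolding h_def F_def using q by (intro semigroup_drift_has_sum wpathD[OF w q] \<phi>) auto
  have ch: "continuous_on {0..U} (h m)" for m
    unfolding h_def[abs_def] by (intro continuous_intros wpath_fourier_continuous[OF w])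
  obtain W where W: "W \<ge> 0" "\<And>s. s \<in> {0..U} \<Longrightarrow> l2sq (w s) \<le> W\<^sup>2" using wpath_l2_bound[OF w] by blast
  have fW: "cmod (fourier (w q) m) \<le> W" if q: "q \<in> {0..U}" and m: "m \<in> int_lattice" for q m
  proof -
    have "(cmod (fourier (w q) m))\<^sup>2 \<le> l2sq (w q)"
      using bessel[OF wpathD(1)[OF w q], of "{m}"] m by (simp add: l2sq_def)
    then have "(cmod (fourier (w q) m))\<^sup>2 \<le> W\<^sup>2" using W(2)[OF q] by linarith
    then show ?thesis using W(1) by (rule power2_le_imp_le)
  qed
  have hb: "norm (h m q) \<le> W * cmod (- of_real (lam m) * fourier \<phi> m)" if m: "m \<in> int_lattice" and q: "q \<in> {0..U}" for m q
  proof -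
    have "norm (h m q) \<le> cmod (fourier \<phi> m * cnj (- of_real (lam m) * (of_real (semi (U - q) m) * fourier (w q) m)))"
      unfolding h_def real_norm_def by (rule abs_Re_le_cmod)
    also have "\<dots> = cmod (fourier \<phi> m) * lam m * (semi (U - q) m * cmod (fourier (w q) m))" by (simp add: norm_mult)
    also have "\<dots> \<le> cmod (fourier \<phi> m) * lam m * (1 * W)"
      using q by (intro mult_left_mono mult_mono fW m) (auto simp: semi_def intro: mult_nonpos_nonneg)
    finally show ?thesis by (simp add: norm_mult mult_ac)
  qed
  have sm: "(\<lambda>m. W * cmod (- of_real (lam m) * fourier \<phi> m)) summable_on int_lattice"
    by (intro summable_on_cmult_right rdecay_summable[OF rdecay_lam] fourier_test_fun_rdecay \<phi>)
  have ul: "uniform_limit {0..U} (\<lambda>A q. \<Sum>m\<in>A. h m q) F (finite_subsets_at_top int_lattice)"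
    by (rule Weierstrass_m_test_general'[OF hb hs sm])
  have cA: "continuous_on {0..U} (\<lambda>q. \<Sum>m\<in>A. h m q)" for A by (intro continuous_intros ch)
  have cF: "continuous_on {0..U} F"
    by (rule uniform_limit_theorem[OF always_eventually[OF allI[OF cA]] ul]) simp
  show si: "set_integrable lborel {0..U} F" by (rule borel_integrable_atLeastAtMost'[OF cF])
  obtain I J where I: "\<And>A. ((\<lambda>q. \<Sum>m\<in>A. h m q) has_integral I A) {0..U}" and J: "(F has_integral J) {0..U}"
    and lim: "(I \<longlongrightarrow> J) (finite_subsets_at_top int_lattice)"
    using uniform_limit_integral[OF ul cA finite_subsets_at_top_neq_bot] by metis
  have ih: "integral {0..U} (h m) = Re (fourier \<phi> m * cnj (duhamel w U m))" for m
  proof -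
    let ?f = "\<lambda>q. complex_of_real (semi (U - q) m) * fourier (w q) m"
    have i: "?f integrable_on {0..U}" by (intro integrable_continuous_interval duhamel_integrand_continuous[OF w])
    have lin: "bounded_linear (\<lambda>z. Re (fourier \<phi> m * cnj (- of_real (lam m) * z)))"
      by (intro bounded_linear_Re[THEN bounded_linear_compose] bounded_linear_mult_right[THEN bounded_linear_compose] bounded_linear_cnj[THEN bounded_linear_compose] bounded_linear_mult_right)
    show ?thesis using integral_linear[OF i lin] unfolding h_def[abs_def] duhamel_def o_def by simp
  qed
  have IA: "I A = (\<Sum>m\<in>A. Re (fourier \<phi> m * cnj (duhamel w U m)))" if "finite A" for A
  proof -
    have "I A = integral {0..U} (\<lambda>q. \<Sum>m\<in>A. h m q)" using I[of A] by (simp add: integral_unique)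
    also have "\<dots> = (\<Sum>m\<in>A. integral {0..U} (h m))"
      by (intro Henstock_Kurzweil_Integration.integral_sum that integrable_continuous_interval ch)
    finally show ?thesis by (simp only: ih)
  qed
  have "((\<lambda>m. Re (fourier \<phi> m * cnj (duhamel w U m))) has_sum J) int_lattice"
    unfolding has_sum_def
    by (rule Lim_transform_eventually[OF lim]) (intro eventually_finite_subsets_at_top_weakI IA)
  moreover have "((\<lambda>m. Re (fourier \<phi> m * cnj (duhamel w U m))) has_sum dist_of (drift w U) \<phi>) int_lattice"
    using distribution_has_sum[OF dist_of_distribution[OF drift_facts(1,2)[OF w U]] \<phi>]
    by (rule has_sum_cong[THEN iffD1, rotated]) (simp add: fcoef_dist_of drift_facts[OF w U])
  ultimately have "J = dist_of (drift w U) \<phi>" by (rule has_sum_unique)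
  then show "(LINT q:{0..U}|lborel. F q) = dist_of (drift w U) \<phi>"
    using set_borel_integral_eq_integral(2)[OF si] J by (simp add: integral_unique)
qed

text \<open>For \<open>r > 0\<close> the sum of blocks agrees with the absolutely convergent Fourier
  series given by the kernel; for \<open>r = 0\<close> it is the function that \<open>g\<close>
  represents.\<close>

lemma semigroup_eq:
  assumes g: "g \<in> besov_space \<rho> \<alpha>" and r: "r \<ge> 0"
  shows "biharmonic_semigroup r g = dist_of (synth (\<lambda>m. of_real (semi r m) * fcoef g m))"
proof -
  let ?c = "\<lambda>m. of_real (semi r m) * fcoef g m"
  have gd: "g \<in> distributions" by (rule besov_distribution[OF g])
  have hc: "hermitian ?c" using fcoef_minus[OF gd] by simp
  obtain K where K: "\<And>n. wt n * bsup n ?c \<le> K" using bcont_semi(2)[OF g] r by blast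
  show ?thesis
  proof (cases "r = 0")
    case True
    have "synth ?c = fun_of g"
      by (rule synth_eqI[OF hc K]) (use besov_fun_of[OF g] True in \<open>auto simp: semi_def\<close>)
    then show ?thesis using True besov_fun_of(3)[OF g] by (simp add: biharmonic_semigroup_def)
  next
    case False
    obtain B where B: "\<And>x. \<bar>fun_of g x\<bar> \<le> B" using continuous_torus_bounded[OF besov_fun_of(1,2)[OF g]] by auto
    have "cmod (fcoef g m) \<le> B" if "m \<in> int_lattice" for m
      using fourier_bound[OF besov_fun_of(1)[OF g] B, of m] besov_fun_of(4)[OF g that] by simp
    then have rd: "rdecay ?c" using False r by (intro semi_rdecay) auto
    note sm = rdecay_summable[OF rd]
    have "synth ?c = rser ?c"
    proof (rule synth_eqI[OF hc K continuous_rser[OF sm] rser_periodic])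
      fix m :: "real ^ 'd" assume m: "m \<in> int_lattice"
      show "fourier (rser ?c) m = ?c m" by (rule fourier_rser_hermitian[OF sm m bspec[OF hc m]])
    qed
    moreover have "convolve (biharmonic_kernel r) g = rser ?c"
      using convolve_kernel[OF gd, of r] False r by (intro ext) simp
    ultimately show ?thesis using False by (simp add: biharmonic_semigroup_def)
  qed
qed

end

section \<open>The maximal solution of the equation with a given forcing path\<close>

definition cutoff :: "nat \<Rightarrow> real \<Rightarrow> real" where
  "cutoff n a = max (- real n) (min (real n) a)"

definition cubic :: "nat \<Rightarrow> real \<Rightarrow> real" where
  "cubic n a = cutoff n a ^ 3 - cutoff n a"

lemma cutoff_abs: "\<bar>cutoff n a\<bar> \<le> real n"
  by (auto simp: cutoff_def max_def min_def)

lemma cutoff_contraction: "\<bar>cutoff n a - cutoff n b\<bar> \<le> \<bar>a - b\<bar>"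
  by (auto simp: cutoff_def max_def min_def)

text \<open>The difference factors as \<open>(p ^ 2 + p * q + q ^ 2 - 1) * (p - q)\<close> in the
  clipped arguments, and clipping is a contraction.\<close>

lemma cubic_lipschitz: "\<bar>cubic n a - cubic n b\<bar> \<le> (3 * (real n)\<^sup>2 + 1) * \<bar>a - b\<bar>"
proof -
  define p q where "p = cutoff n a" and "q = cutoff n b"
  have p: "\<bar>p\<bar> \<le> real n" and q: "\<bar>q\<bar> \<le> real n" and pq: "\<bar>p - q\<bar> \<le> \<bar>a - b\<bar>"
    unfolding p_def q_def by (rule cutoff_abs cutoff_contraction)+
  have eq: "cubic n a - cubic n b = (p\<^sup>2 + p * q + q\<^sup>2 - 1) * (p - q)"
    unfolding cubic_def p_def[symmetric] q_def[symmetric] by (simp add: algebra_simps power2_eq_square power3_eq_cube)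
  have sq: "x\<^sup>2 \<le> (real n)\<^sup>2" if "\<bar>x\<bar> \<le> real n" for x
    using power_mono[OF that abs_ge_zero, of 2] by simp
  have "\<bar>p * q\<bar> \<le> real n * real n" unfolding abs_mult using p q by (intro mult_mono) auto
  then have "\<bar>p * q\<bar> \<le> (real n)\<^sup>2" by (simp add: power2_eq_square)
  then have "\<bar>p\<^sup>2 + p * q + q\<^sup>2 - 1\<bar> \<le> 3 * (real n)\<^sup>2 + 1"
    using sq[OF p] sq[OF q] zero_le_power2[of p] zero_le_power2[of q] zero_le_power2[of "real n"] by linarith
  then show ?thesis unfolding eq abs_mult using pq by (intro mult_mono) auto
qed

lemma cubic_bounded: "\<bar>cubic n a\<bar> \<le> real n ^ 3 + real n"
proof -
  have "\<bar>cutoff n a ^ 3\<bar> \<le> real n ^ 3" unfolding power_abs by (intro power_mono cutoff_abs) simp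
  then show ?thesis using cutoff_abs[of n a] unfolding cubic_def by linarith
qed

lemma cubic_eq: "\<bar>a\<bar> \<le> real n \<Longrightarrow> cubic n a = a ^ 3 - a"
proof -
  assume "\<bar>a\<bar> \<le> real n"
  then have "cutoff n a = a" by (auto simp: cutoff_def max_def min_def)
  then show ?thesis by (simp add: cubic_def)
qed

context mild_setting
begin

lemma drift_cong:
  assumes "\<And>s. s \<in> {0..t} \<Longrightarrow> w s = w' s" shows "drift w t = drift w' t"
proof -
  have "duhamel w t = duhamel w' t"
    unfolding duhamel_def fun_eq_iff using assms by (auto intro!: Henstock_Kurzweil_Integration.integral_cong)
  then show ?thesis by (simp only: drift_def)
qed

lemma drift_0: "drift w 0 x = 0"
  by (simp add: drift_def synth_def block_eq duhamel_def)

lemma bcont_subset: "bcont S h \<Longrightarrow> T \<subseteq> S \<Longrightarrow> bcont T h"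
  unfolding bcont_def by (meson subsetD)

lemma wpath_cubic: "wpath S u \<Longrightarrow> wpath S (\<lambda>s x. cubic n (u s x))"
  by (erule wpath_lipschitz[OF _ cubic_lipschitz]) (simp add: add_nonneg_pos)

end

section \<open>The truncated equations for one forcing path\<close>

locale mild_data = mild_setting \<rho> \<alpha> for \<rho> :: "int \<Rightarrow> real ^ 'd::finite \<Rightarrow> real" and \<alpha> :: real +
  fixes g :: "'d functional" and X :: "real \<Rightarrow> 'd functional"
  assumes g: "g \<in> besov_space \<rho> \<alpha>" and X: "bcont {0..} X"
begin

definition free_part :: "real \<Rightarrow> real ^ 'd \<Rightarrow> real" where
  "free_part t = synth (\<lambda>m. of_real (semi t m) * fcoef g m)"

definition y :: "real \<Rightarrow> real ^ 'd \<Rightarrow> real" where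
  "y t x = free_part t x + fun_of (X t) x"

lemma free_part:
  assumes "t \<ge> 0" shows "continuous_on UNIV (free_part t)" "torus_periodic (free_part t)"
proof -
  have hc: "hermitian (\<lambda>m. of_real (semi t m) * fcoef g m)" using fcoef_minus[OF besov_distribution[OF g]] by simp
  obtain K where K: "\<And>n. wt n * bsup n (\<lambda>m. of_real (semi t m) * fcoef g m) \<le> K" using bcont_semi(2)[OF g] assms by blast
  show "continuous_on UNIV (free_part t)" "torus_periodic (free_part t)" unfolding free_part_def by (rule synth_facts[OF hc K])+
qed

lemma X_space: "t \<ge> 0 \<Longrightarrow> X t \<in> besov_space \<rho> \<alpha>"
  using X by (simp add: bcont_def)

lemma y_bcont: "bcont {0..} (\<lambda>t. dist_of (y t))"
proof -
  have "bcont {0..} (\<lambda>t. dist_of (fun_of (X t)))"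
    using X besov_fun_of(3)[OF X_space] by (simp add: bcont_def)
  then show ?thesis unfolding y_def[abs_def]
    using bcont_semi(1)[OF g] free_part besov_fun_of(1,2)[OF X_space] by (intro bcont_add) (auto simp: free_part_def[symmetric])
qed

lemma y_wpath: "wpath {0..} y"
  using free_part besov_fun_of(1,2)[OF X_space]
  by (intro bcont_dist_of_wpath[OF y_bcont]) (auto simp: y_def[abs_def] torus_periodic_def intro!: continuous_intros)

lemma picard_setting: "picard_setting \<rho> \<alpha> (cubic n) (3 * (real n)\<^sup>2 + 1) (real n ^ 3 + real n) y"
  by unfold_locales (rule cubic_lipschitz, simp add: add_nonneg_pos, rule cubic_bounded, rule y_wpath)

definition truncated :: "nat \<Rightarrow> real \<Rightarrow> real ^ 'd \<Rightarrow> real" where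
  "truncated n = picard_limit (cubic n) y"

lemma truncated_wpath: "wpath {0..} (truncated n)"
  unfolding truncated_def by (rule picard_setting.wpath_picard_limit[OF picard_setting])

lemma truncated_eq: "t \<ge> 0 \<Longrightarrow> truncated n t x = y t x + drift (\<lambda>s x. cubic n (truncated n s x)) t x"
  unfolding truncated_def by (rule picard_setting.picard_limit_eq[OF picard_setting])

lemma truncated_bcont: "bcont {0..} (\<lambda>t. dist_of (truncated n t))"
  unfolding truncated_def by (rule picard_setting.bcont_picard_limit[OF picard_setting y_bcont])

text \<open>The truncated equation on a compact time interval as an identity of functions; solutions
  of different truncation levels are compared in this form.\<close>

definition solves :: "nat \<Rightarrow> real \<Rightarrow> (real \<Rightarrow> real ^ 'd \<Rightarrow> real) \<Rightarrow> bool" where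
  "solves n T u \<longleftrightarrow> wpath {0..T} u \<and> (\<forall>t\<in>{0..T}. u t = (\<lambda>x. y t x + drift (\<lambda>s x. cubic n (u s x)) t x))"

lemma truncated_solves: "solves n T (truncated n)"
  unfolding solves_def using wpath_subset[OF truncated_wpath, of "{0..T}" n] truncated_eq[of _ n] by auto

lemma solves_unique:
  assumes u: "solves n T u" and v: "solves n T v" and t: "t \<in> {0..T}"
  shows "u t = v t"
proof -
  have wu: "wpath {0..T} u" and wv: "wpath {0..T} v" using u v by (auto simp: solves_def)
  have f: "fourier (w t) m = fourier (y t) m + duhamel (\<lambda>s x. cubic n (w s x)) t m"
    if w: "solves n T w" and t: "t \<in> {0..T}" and m: "m \<in> int_lattice" for w t m
  proof -
    have t0: "t \<ge> 0" using t by simp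
    have "wpath {0..T} w" using w by (simp add: solves_def)
    then have c: "wpath {0..t} (\<lambda>s x. cubic n (w s x))"
      by (intro wpath_subset[OF wpath_cubic]) (use t in auto)
    have eq: "w t = (\<lambda>x. y t x + drift (\<lambda>s x. cubic n (w s x)) t x)" using w t unfolding solves_def by blast
    have "fourier (w t) m = fourier (y t) m + fourier (drift (\<lambda>s x. cubic n (w s x)) t) m"
      by (subst eq, rule fourier_add) (use drift_facts(1)[OF c t0] wpathD(1)[OF y_wpath, of t] t0 in auto)
    then show ?thesis by (simp only: drift_facts(3)[OF c t0 m])
  qed
  show ?thesis
  proof (rule uniqueness[OF wu wv _ wpath_cubic[OF wu] wpath_cubic[OF wv] cubic_lipschitz _ t])
    show "0 < 3 * (real n)\<^sup>2 + 1" by (simp add: add_nonneg_pos)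
    show "fourier (u t) m - fourier (v t) m = duhamel (\<lambda>s x. cubic n (u s x)) t m - duhamel (\<lambda>s x. cubic n (v s x)) t m"
      if "t \<in> {0..T}" "m \<in> int_lattice" for t m using f[OF u that] f[OF v that] by simp
  qed
qed

lemma solves_change:
  assumes u: "solves n T u" and b: "\<And>s x. s \<in> {0..T} \<Longrightarrow> \<bar>u s x\<bar> \<le> real n \<and> \<bar>u s x\<bar> \<le> real m"
  shows "solves m T u"
proof -
  have "drift (\<lambda>s x. cubic n (u s x)) t = drift (\<lambda>s x. cubic m (u s x)) t" if "t \<in> {0..T}" for t
    by (rule drift_cong) (use b that in \<open>auto simp: cubic_eq\<close>)
  with u show ?thesis unfolding solves_def by simp
qed

section \<open>The lifetime\<close>

text \<open>Weak inequalities on a closed time interval: the condition can be tested on dense sets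
  of times and points, and it survives the limit in time at the end of the lifetime.\<close>

definition good :: "nat \<Rightarrow> real \<Rightarrow> bool" where
  "good n t \<longleftrightarrow> 0 \<le> t \<and> (\<forall>s\<in>{0..t}. \<forall>x. \<bar>truncated n s x\<bar> \<le> real n)"

text \<open>The level \<open>m\<close> may be smaller than \<open>n\<close>; all that counts is that
  it bounds the solution of level \<open>n\<close>. The argument for blow-up needs this form, with
  \<open>m\<close> fixed while \<open>n\<close> varies with the time.\<close>

lemma good_eqI:
  assumes n: "good n t" and m: "\<And>s x. s \<in> {0..t} \<Longrightarrow> \<bar>truncated n s x\<bar> \<le> real m" and s: "s \<in> {0..t}"
  shows "truncated m s = truncated n s"
  using solves_unique[OF truncated_solves solves_change[OF truncated_solves[of n t], of m] s] n m by (auto simp: good_def)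

lemma good_eq: "good n t \<Longrightarrow> n \<le> m \<Longrightarrow> s \<in> {0..t} \<Longrightarrow> truncated m s = truncated n s"
proof (rule good_eqI)
  assume n: "good n t" and nm: "n \<le> m"
  show "\<bar>truncated n r x\<bar> \<le> real m" if "r \<in> {0..t}" for r x
    using n nm that unfolding good_def by (meson of_nat_le_iff order_trans)
qed

lemma good_subset: "good n t \<Longrightarrow> 0 \<le> s \<Longrightarrow> s \<le> t \<Longrightarrow> good n s"
  by (auto simp: good_def)

text \<open>Raising the level by one leaves room \<open>1\<close> at time \<open>t\<close>, which
  continuity turns into extra time.\<close>

lemma good_extend:
  assumes n: "good n t" shows "\<exists>t'>t. good (Suc n) t'"
proof -
  have t: "t \<in> {0..}" using n by (simp add: good_def)
  obtain \<delta> where \<delta>: "\<delta> > 0" "\<And>s x. s \<in> {0..} \<Longrightarrow> \<bar>s - t\<bar> < \<delta> \<Longrightarrow> \<bar>truncated (Suc n) s x - truncated (Suc n) t x\<bar> \<le> 1"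
    using wpath_continuity[OF truncated_wpath t zero_less_one] by blast
  have b: "\<bar>truncated (Suc n) s x\<bar> \<le> real n" if s: "s \<in> {0..t}" for s x
    unfolding good_eq[OF n le_SucI[OF order_refl] s] using n s by (simp add: good_def)
  have "good (Suc n) (t + \<delta> / 2)" unfolding good_def
  proof (intro conjI ballI allI)
    fix s x assume s: "s \<in> {0..t + \<delta> / 2}"
    show "\<bar>truncated (Suc n) s x\<bar> \<le> real (Suc n)"
    proof (cases "s \<le> t")
      case True then show ?thesis using b[of s x] s by simp
    next
      case False
      then have "\<bar>truncated (Suc n) s x - truncated (Suc n) t x\<bar> \<le> 1" using s \<delta> t by (intro \<delta>(2)) auto
      then show ?thesis using b[of t x] t by simp
    qed
  qed (use t \<delta> in auto)
  then show ?thesis using \<delta>(1) by (intro exI[of _ "t + \<delta> / 2"]) simp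
qed

lemma good_start: "\<exists>n. good n 0"
proof -
  obtain B where B: "\<And>x. \<bar>y 0 x\<bar> \<le> B" using continuous_torus_bounded[OF wpathD[OF y_wpath, of 0]] by auto
  have "truncated n 0 x = y 0 x" for n x using truncated_eq[of 0 n x] by (simp add: drift_0)
  then have "good (nat \<lceil>B\<rceil>) 0" using order_trans[OF B real_nat_ceiling_ge] by (simp add: good_def)
  then show ?thesis by blast
qed

definition life :: ennreal where
  "life = (SUP t\<in>{t. \<exists>n. good n t}. ennreal t)"

text \<open>Strictness comes from \<open>good_extend\<close>: the set of good times has no largest
  element, so the supremum is not attained.\<close>

lemma less_life:
  assumes t: "t \<ge> 0" shows "ennreal t < life \<longleftrightarrow> (\<exists>n. good n t)"
proof
  assume "ennreal t < life"
  then obtain t' n where "ennreal t < ennreal t'" "good n t'" unfolding life_def less_SUP_iff by blast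
  moreover from this have "t < t'" using t by (simp add: ennreal_less_iff)
  ultimately show "\<exists>n. good n t" using good_subset[of n t' t] t by auto
next
  assume "\<exists>n. good n t"
  then obtain n t' where t': "t < t'" "good (Suc n) t'" using good_extend by blast
  have "ennreal t < ennreal t'" using t t'(1) by (simp add: ennreal_less_iff)
  also have "\<dots> \<le> life" unfolding life_def using t' by (intro SUP_upper) blast
  finally show "ennreal t < life" .
qed

lemma life_pos: "0 < life"
  using less_life[of 0] good_start by simp

section \<open>The maximal solution and its mild equation\<close>

text \<open>Before the lifetime the sequence is eventually constant, so the limit selects the right
  level without naming it; later values of \<open>lim\<close> carry no meaning.\<close>

definition sol :: "real \<Rightarrow> 'd functional" where
  "sol t = dist_of (\<lambda>x. lim (\<lambda>n. truncated n t x))"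

lemma good_lim:
  assumes n: "good n t" and s: "s \<in> {0..t}"
  shows "(\<lambda>m. truncated m s x) \<longlonglongrightarrow> truncated n s x"
proof (rule tendsto_eventually)
  show "\<forall>\<^sub>F m in sequentially. truncated m s x = truncated n s x"
    using eventually_ge_at_top[of n] by (rule eventually_mono) (rule arg_cong[where f="\<lambda>h. h x"], rule good_eq[OF n _ s])
qed

lemma sol_eq:
  assumes n: "good n t" and s: "s \<in> {0..t}"
  shows "sol s = dist_of (truncated n s)" "fun_of (sol s) = truncated n s"
proof -
  have "lim (\<lambda>m. truncated m s x) = truncated n s x" for x by (rule limI[OF good_lim[OF assms]])
  then show e: "sol s = dist_of (truncated n s)" unfolding sol_def by simp
  show "fun_of (sol s) = truncated n s" unfolding e using wpathD[OF truncated_wpath, of s n] s by (intro fun_of_dist_of) auto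
qed

text \<open>Near each time before the lifetime, a little beyond it included, the solution coincides
  with one truncated solution.\<close>

lemma sol_bcont: "bcont {r. 0 \<le> r \<and> ennreal r < life} sol"
  unfolding bcont_def
proof (intro conjI ballI allI impI)
  fix t assume "t \<in> {r. 0 \<le> r \<and> ennreal r < life}"
  then have t0: "t \<ge> 0" and "\<exists>n. good n t" using less_life by auto
  then obtain n t' where t': "t < t'" "good n t'" using good_extend by blast
  show "sol t \<in> besov_space \<rho> \<alpha>"
    using sol_eq(1)[OF t'(2), of t] truncated_bcont[of n] t' t0 by (simp add: bcont_def)
  fix \<epsilon> :: real assume e: "\<epsilon> > 0"
  obtain \<delta> where \<delta>: "\<delta> > 0" "\<And>s. s \<ge> 0 \<Longrightarrow> \<bar>s - t\<bar> < \<delta> \<Longrightarrow> bdist (dist_of (truncated n s)) (dist_of (truncated n t)) \<le> \<epsilon>"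
    using truncated_bcont[of n] t0 e unfolding bcont_def atLeast_iff Ball_def by blast
  show "\<exists>\<delta>>0. \<forall>s\<in>{r. 0 \<le> r \<and> ennreal r < life}. \<bar>s - t\<bar> < \<delta> \<longrightarrow> bdist (sol s) (sol t) \<le> \<epsilon>"
  proof (intro exI[of _ "min \<delta> (t' - t)"] conjI ballI impI)
    show "0 < min \<delta> (t' - t)" using \<delta> t' by simp
    fix s assume "s \<in> {r. 0 \<le> r \<and> ennreal r < life}" and st: "\<bar>s - t\<bar> < min \<delta> (t' - t)"
    then have s: "s \<ge> 0" by simp
    have "s \<in> {0..t'}" "t \<in> {0..t'}" using s st t0 t'(1) by auto
    then show "bdist (sol s) (sol t) \<le> \<epsilon>" using \<delta>(2)[OF s] st by (simp add: sol_eq(1)[OF t'(2)])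
  qed
qed

text \<open>Translates the tested equation into an identity for functions with the truncated cubic.
  It is stated for an arbitrary bounded Besov continuous path, so that it serves existence and
  uniqueness alike.\<close>

lemma mild_identity:
  assumes F: "bcont {0..U} F" and U: "U \<ge> 0" and \<phi>: "\<phi> \<in> test_funs"
    and N: "\<And>q x. q \<in> {0..U} \<Longrightarrow> \<bar>fun_of (F q) x\<bar> \<le> real N"
  shows "set_integrable lborel {0..U} (\<lambda>q. biharmonic_semigroup (U - q) (cubic_drift (F q)) \<phi>)"
    "biharmonic_semigroup U g \<phi> + X U \<phi> + (LINT q:{0..U}|lborel. biharmonic_semigroup (U - q) (cubic_drift (F q)) \<phi>)
      = dist_of (\<lambda>x. y U x + drift (\<lambda>s x. cubic N (fun_of (F s) x)) U x) \<phi>"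
proof -
  let ?w = "\<lambda>s x. cubic N (fun_of (F s) x)"
  have w: "wpath {0..U} ?w" by (rule wpath_cubic[OF bcont_wpath[OF F]])
  have eq: "biharmonic_semigroup (U - q) (cubic_drift (F q)) \<phi> = biharmonic_semigroup (U - q) (dist_laplacian (dist_of (?w q))) \<phi>"
    if "q \<in> {0..U}" for q using N[OF that] by (simp add: cubic_drift_def cubic_eq)
  note W = weak_drift[OF w U \<phi>]
  show "set_integrable lborel {0..U} (\<lambda>q. biharmonic_semigroup (U - q) (cubic_drift (F q)) \<phi>)"
    using W(1) by (rule set_integrable_cong[THEN iffD1, OF refl refl, rotated]) (simp add: eq)
  have "(LINT q:{0..U}|lborel. biharmonic_semigroup (U - q) (cubic_drift (F q)) \<phi>) = dist_of (drift ?w U) \<phi>"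
    unfolding W(2)[symmetric] by (rule set_lebesgue_integral_cong) (auto simp: eq)
  moreover have "X U \<phi> = dist_of (fun_of (X U)) \<phi>" using besov_fun_of(3)[OF X_space[OF U]] by simp
  moreover have "biharmonic_semigroup U g \<phi> = dist_of (free_part U) \<phi>" by (simp add: semigroup_eq[OF g U] free_part_def)
  moreover have "dist_of (\<lambda>x. y U x + drift ?w U x) \<phi> = dist_of (y U) \<phi> + dist_of (drift ?w U) \<phi>"
    by (rule dist_of_add[OF _ _ \<phi>]) (use wpathD(1)[OF y_wpath, of U] drift_facts(1)[OF w U] U in auto)
  moreover have "dist_of (y U) \<phi> = dist_of (free_part U) \<phi> + dist_of (fun_of (X U)) \<phi>"
    unfolding y_def[abs_def] by (rule dist_of_add[OF free_part(1)[OF U] besov_fun_of(1)[OF X_space[OF U]] \<phi>])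
  ultimately show "biharmonic_semigroup U g \<phi> + X U \<phi> + (LINT q:{0..U}|lborel. biharmonic_semigroup (U - q) (cubic_drift (F q)) \<phi>)
      = dist_of (\<lambda>x. y U x + drift ?w U x) \<phi>" by simp
qed

lemma sol_mild:
  assumes U: "0 \<le> U" "ennreal U < life" and \<phi>: "\<phi> \<in> test_funs"
  shows "set_integrable lborel {0..U} (\<lambda>q. biharmonic_semigroup (U - q) (cubic_drift (sol q)) \<phi>)"
    "sol U \<phi> = biharmonic_semigroup U g \<phi> + X U \<phi> + (LINT q:{0..U}|lborel. biharmonic_semigroup (U - q) (cubic_drift (sol q)) \<phi>)"
proof -
  obtain n where n: "good n U" using less_life[OF U(1)] U(2) by blast
  have b: "bcont {0..U} sol"
  proof (rule bcont_subset[OF sol_bcont], rule subsetI)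
    fix q assume "q \<in> {0..U}"
    then show "q \<in> {r. 0 \<le> r \<and> ennreal r < life}" using le_less_trans[OF ennreal_leI U(2), of q] by auto
  qed
  have N: "\<bar>fun_of (sol q) x\<bar> \<le> real n" if "q \<in> {0..U}" for q x
    unfolding sol_eq(2)[OF n that] using n that by (simp add: good_def)
  note M = mild_identity[OF b U(1) \<phi> N]
  show "set_integrable lborel {0..U} (\<lambda>q. biharmonic_semigroup (U - q) (cubic_drift (sol q)) \<phi>)" by (rule M(1))
  have "drift (\<lambda>s x. cubic n (fun_of (sol s) x)) U = drift (\<lambda>s x. cubic n (truncated n s x)) U"
    by (rule drift_cong) (simp add: sol_eq(2)[OF n])
  then have "(\<lambda>x. y U x + drift (\<lambda>s x. cubic n (fun_of (sol s) x)) U x) = truncated n U"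
    using truncated_eq[OF U(1), of n] by auto
  then show "sol U \<phi> = biharmonic_semigroup U g \<phi> + X U \<phi> + (LINT q:{0..U}|lborel. biharmonic_semigroup (U - q) (cubic_drift (sol q)) \<phi>)"
    using M(2) sol_eq(1)[OF n, of U] U(1) by simp
qed

section \<open>Blow-up and uniqueness\<close>

lemma sol_blow_up:
  assumes fin: "life < \<infinity>"
  shows "Limsup (at_left (enn2real life)) (\<lambda>q. besov_norm \<rho> \<alpha> (sol q)) = \<infinity>"
proof (rule ccontr)
  define L where "L = enn2real life"
  have L: "life = ennreal L" using fin by (simp add: L_def)
  have L0: "L > 0" using life_pos fin by (simp add: L_def enn2real_positive_iff)
  assume "Limsup (at_left (enn2real life)) (\<lambda>q. besov_norm \<rho> \<alpha> (sol q)) \<noteq> \<infinity>"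
  then obtain c where c: "Limsup (at_left L) (\<lambda>q. besov_norm \<rho> \<alpha> (sol q)) = ennreal c" "c \<ge> 0"
    unfolding L_def by (metis ennreal_cases infinity_ennreal_def)
  \<comment> \<open>The room of \<open>1\<close> makes the inequality strict, so the bound holds on
    an interval to the left of \<open>L\<close>.\<close>
  have "Limsup (at_left L) (\<lambda>q. besov_norm \<rho> \<alpha> (sol q)) < ennreal (c + 1)"
    unfolding c(1) using c(2) by (simp add: ennreal_less_iff)
  from Limsup_lessD[OF this] obtain b where b: "b < L" "\<And>q. b < q \<Longrightarrow> q < L \<Longrightarrow> besov_norm \<rho> \<alpha> (sol q) < ennreal (c + 1)"
    unfolding eventually_at_left_field by blast
  have sp: "sol q \<in> besov_space \<rho> \<alpha>" if "q \<ge> 0" "q < L" for q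
    using sol_bcont that by (simp add: bcont_def L ennreal_less_iff)
  have lg: "\<exists>n. good n t" if "t \<ge> 0" "t < L" for t using less_life[OF that(1)] that by (simp add: L ennreal_less_iff)
  define t0 where "t0 = (max b 0 + L) / 2"
  have t0: "b < t0" "0 \<le> t0" "t0 < L" using b(1) L0 by (auto simp: t0_def field_simps max_def)
  obtain n0 where n0: "good n0 t0" using lg t0 by blast
  \<comment> \<open>One level for all times before \<open>L\<close>: \<open>n0\<close> takes care of
    the times up to \<open>t0\<close>, the embedding constant times the Besov bound of those after
    it.\<close>
  define N where "N = max n0 (nat \<lceil>Csup * (c + 1)\<rceil>)"
  have bd: "\<bar>fun_of (sol s) x\<bar> \<le> real N" if s: "0 \<le> s" "s < L" for s x
  proof (cases "s \<le> t0")
    case True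
    then have s': "s \<in> {0..t0}" using s by simp
    have "\<bar>truncated n0 s x\<bar> \<le> real n0" using n0 s' by (simp add: good_def)
    then show ?thesis unfolding sol_eq(2)[OF n0 s'] N_def by simp
  next
    case False
    then have "besov_norm \<rho> \<alpha> (sol s) \<le> ennreal (c + 1)" using b(2)[of s] t0 s by simp
    then have "wt k * bsup k (fcoef (sol s)) \<le> c + 1" for k
      using besov_norm_le_iff[OF besov_distribution[OF sp[OF s]], of "c + 1"] c(2) by simp
    then have "\<bar>fun_of (sol s) x\<bar> \<le> Csup * (c + 1)" by (rule besov_fun_of(5)[OF sp[OF s]])
    also have "\<dots> \<le> real (nat \<lceil>Csup * (c + 1)\<rceil>)" by (rule real_nat_ceiling_ge)
    also have "\<dots> \<le> real N" by (simp add: N_def)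
    finally show ?thesis .
  qed
  have uN: "\<bar>truncated N s x\<bar> \<le> real N" if s: "0 \<le> s" "s < L" for s x
  proof -
    obtain n where n: "good n s" using lg s by blast
    \<comment> \<open>Here \<open>n\<close> depends on \<open>s\<close> and may exceed
      \<open>N\<close>; the two levels agree since the solution of level \<open>n\<close> is already
      known to be bounded by \<open>N\<close>.\<close>
    have "truncated N s = truncated n s"
    proof (rule good_eqI[OF n])
      fix r x assume r: "r \<in> {0..s}"
      then show "\<bar>truncated n r x\<bar> \<le> real N" using bd[of r x] s sol_eq(2)[OF n r] by simp
    qed (use s in simp)
    then show ?thesis using bd[OF s, of x] sol_eq(2)[OF n, of s] s by simp
  qed
  \<comment> \<open>A truncated solution is continuous on the whole half-line, so the bound passes
    to the endpoint \<open>L\<close>; then \<open>L\<close> is good, which contradicts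
    \<open>less_life\<close>.\<close>
  have uL: "\<bar>truncated N L x\<bar> \<le> real N" for x
  proof (rule field_le_epsilon)
    fix e :: real assume e: "0 < e"
    obtain \<delta> where \<delta>: "\<delta> > 0" "\<And>s x. s \<in> {0..} \<Longrightarrow> \<bar>s - L\<bar> < \<delta> \<Longrightarrow> \<bar>truncated N s x - truncated N L x\<bar> \<le> e"
      using wpath_continuity[OF truncated_wpath _ e, of L] L0 by auto
    define s where "s = max 0 (L - \<delta> / 2)"
    have s: "s \<in> {0..}" "\<bar>s - L\<bar> < \<delta>" "s < L" using \<delta>(1) L0 by (auto simp: s_def max_def)
    then show "\<bar>truncated N L x\<bar> \<le> real N + e" using \<delta>(2)[OF s(1,2), of x] uN[of s x] by simp
  qed
  have "good N L" unfolding good_def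
  proof (intro conjI ballI allI)
    fix s x assume "s \<in> {0..L}"
    then show "\<bar>truncated N s x\<bar> \<le> real N" using uL[of x] uN[of s x] by (cases "s = L") auto
  qed (use L0 in simp)
  then have "ennreal L < life" using less_life[of L] L0 by auto
  then show False by (simp add: L)
qed

lemma sol_maximal: "maximal_mild_solution \<rho> \<alpha> g X life sol"
  unfolding maximal_mild_solution_def continuous_map_besov_iff
  using sol_bcont sol_mild sol_blow_up by blast

text \<open>On \<open>[0, U]\<close> the competitor is continuous, hence bounded in the supremum
  norm, and therefore solves a truncated equation, where solutions are unique.\<close>

lemma maximal_unique:
  assumes F: "maximal_mild_solution \<rho> \<alpha> g X life F" and U: "0 \<le> U" "ennreal U < life"
  shows "F U = sol U"
proof -
  have eqF: "F t \<phi> = biharmonic_semigroup t g \<phi> + X t \<phi> + (LINT q:{0..t}|lborel. biharmonic_semigroup (t - q) (cubic_drift (F q)) \<phi>)"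
    if "0 \<le> t" "ennreal t < life" "\<phi> \<in> test_funs" for t \<phi>
    using F that unfolding maximal_mild_solution_def by blast
  have bS: "bcont {r. 0 \<le> r \<and> ennreal r < life} F"
    using F unfolding maximal_mild_solution_def continuous_map_besov_iff by blast
  have lt: "ennreal q < life" if "q \<in> {0..U}" for q using le_less_trans[OF ennreal_leI U(2), of q] that by simp
  have b: "bcont {0..U} F" by (rule bcont_subset[OF bS]) (auto simp: lt)
  define u where "u t = fun_of (F t)" for t
  have wu: "wpath {0..U} u" unfolding u_def by (rule bcont_wpath[OF b])
  obtain B where B: "\<And>s x. s \<in> {0..U} \<Longrightarrow> \<bar>u s x\<bar> \<le> B" using wpath_bounded[OF wu] by blast
  obtain n where n: "good n U" using less_life[OF U(1)] U(2) by blast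
  \<comment> \<open>Large enough for the competitor and at least the level at which \<open>U\<close>
    is good.\<close>
  define N where "N = max n (nat \<lceil>B\<rceil>)"
  have uN: "\<bar>fun_of (F s) x\<bar> \<le> real N" if "s \<in> {0..U}" for s x
  proof -
    have "\<bar>fun_of (F s) x\<bar> \<le> B" using B[OF that] by (simp add: u_def)
    also have "\<dots> \<le> real (nat \<lceil>B\<rceil>)" by (rule real_nat_ceiling_ge)
    finally show ?thesis by (simp add: N_def)
  qed
  have ut: "u t = (\<lambda>x. y t x + drift (\<lambda>s x. cubic N (u s x)) t x)" if t: "t \<in> {0..U}" for t
  proof -
    let ?v = "\<lambda>x. y t x + drift (\<lambda>s x. cubic N (u s x)) t x"
    have t0: "t \<ge> 0" using t by simp
    have sub: "{0..t} \<subseteq> {0..U}" using t by auto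
    have c: "wpath {0..t} (\<lambda>s x. cubic N (u s x))" by (rule wpath_subset[OF wpath_cubic[OF wu] sub])
    have "F t = dist_of ?v"
    proof
      fix \<phi> :: "real ^ 'd \<Rightarrow> real"
      show "F t \<phi> = dist_of ?v \<phi>"
      proof (cases "\<phi> \<in> test_funs")
        case True
        have "F t \<phi> = biharmonic_semigroup t g \<phi> + X t \<phi> + (LINT q:{0..t}|lborel. biharmonic_semigroup (t - q) (cubic_drift (F q)) \<phi>)"
          by (rule eqF[OF t0 lt[OF t] True])
        also have "\<dots> = dist_of ?v \<phi>" unfolding u_def
          by (rule mild_identity(2)[OF bcont_subset[OF b sub] t0 True]) (rule uN, use sub in blast)
        finally show ?thesis .
      next
        case False
        have "F t \<in> distributions" using b t by (auto simp: bcont_def intro: besov_distribution)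
        then show ?thesis using False by (simp add: distributions_def dist_of_def)
      qed
    qed
    moreover have "continuous_on UNIV ?v" "torus_periodic ?v"
      using wpathD[OF y_wpath, of t] drift_facts(1,2)[OF c t0] t0 by (auto simp: torus_periodic_def intro!: continuous_intros)
    ultimately show ?thesis unfolding u_def[of t] by (simp only: fun_of_dist_of)
  qed
  have UU: "U \<in> {0..U}" using U by simp
  have "solves N U u" unfolding solves_def using wu ut by blast
  from solves_unique[OF this truncated_solves UU] have "u U = truncated N U" .
  also have "\<dots> = truncated n U" by (rule good_eq[OF n _ UU]) (simp add: N_def)
  finally have "dist_of (u U) = sol U" using sol_eq(1)[OF n UU] by simp
  moreover have "dist_of (u U) = F U" unfolding u_def using b UU by (intro besov_fun_of(3)) (simp add: bcont_def)
  ultimately show ?thesis by simp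
qed

end

section \<open>Measurability\<close>

lemma dense_sequence:
  obtains e :: "nat \<Rightarrow> 'b::second_countable_topology" where "\<And>X. open X \<Longrightarrow> X \<noteq> {} \<Longrightarrow> \<exists>j. e j \<in> X"
proof -
  obtain D :: "'b set" where D: "countable D" "\<And>X. open X \<Longrightarrow> X \<noteq> {} \<Longrightarrow> \<exists>d\<in>D. d \<in> X"
    by (rule countable_dense_setE) blast
  have "D \<noteq> {}" using D(2)[of UNIV] by auto
  then have "range (from_nat_into D) = D" using D(1) by (rule range_from_nat_into)
  then show thesis using D(2) by (intro that[of "from_nat_into D"]) (metis imageE)
qed

lemma continuous_le_dense:
  fixes f :: "'b::topological_space \<Rightarrow> real" and e :: "nat \<Rightarrow> 'b"
  assumes f: "continuous_on UNIV f" and e: "\<And>X. open X \<Longrightarrow> X \<noteq> {} \<Longrightarrow> \<exists>j. e j \<in> X" and le: "\<And>j. \<bar>f (e j)\<bar> \<le> B"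
  shows "\<bar>f x\<bar> \<le> B"
proof (rule ccontr)
  assume "\<not> \<bar>f x\<bar> \<le> B"
  then have "x \<in> {y. B < \<bar>f y\<bar>}" by simp
  then have "{y. B < \<bar>f y\<bar>} \<noteq> {}" by blast
  moreover have "open {y. B < \<bar>f y\<bar>}" by (intro open_Collect_less continuous_intros f)
  ultimately obtain j where "B < \<bar>f (e j)\<bar>" using e by blast
  then show False using le[of j] by simp
qed

text \<open>The second argument is replaced by the first point of a dense sequence within distance
  \<open>1 / (k + 1)\<close> of it. The approximations take countably many points only and are
  jointly measurable; they converge by continuity.\<close>

lemma measurable_caratheodory:
  fixes h :: "'a \<Rightarrow> 'b::{second_countable_topology, metric_space} \<Rightarrow> 'c::metric_space"
  assumes m: "\<And>z. (\<lambda>\<omega>. h \<omega> z) \<in> borel_measurable N" and c: "\<And>\<omega>. \<omega> \<in> space N \<Longrightarrow> continuous_on UNIV (h \<omega>)"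
  shows "(\<lambda>p. h (fst p) (snd p)) \<in> borel_measurable (N \<Otimes>\<^sub>M borel)"
proof -
  obtain e :: "nat \<Rightarrow> 'b" where e: "\<And>X. open X \<Longrightarrow> X \<noteq> {} \<Longrightarrow> \<exists>j. e j \<in> X" by (rule dense_sequence) blast
  define A where "A k z = (LEAST j. dist (e j) z < inverse (real (Suc k)))" for k z
  have A: "dist (e (A k z)) z < inverse (real (Suc k))" for k z
  proof -
    have "\<exists>j. e j \<in> ball z (inverse (real (Suc k)))" by (rule e) auto
    then have "\<exists>j. dist (e j) z < inverse (real (Suc k))" by (simp only: mem_ball dist_commute)
    from LeastI_ex[OF this] show ?thesis unfolding A_def .
  qed
  have Alim: "(\<lambda>k. e (A k z)) \<longlonglongrightarrow> z" for z
  proof -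
    have "\<forall>k. norm (dist (e (A k z)) z) \<le> inverse (real (Suc k))"
      unfolding real_norm_def abs_of_nonneg[OF zero_le_dist] using less_imp_le[OF A] by blast
    then have "(\<lambda>k. dist (e (A k z)) z) \<longlonglongrightarrow> 0"
      by (rule Lim_null_comparison[OF always_eventually LIMSEQ_inverse_real_of_nat])
    then show ?thesis by (simp only: tendsto_dist_iff[symmetric])
  qed
  show ?thesis
  proof (rule borel_measurable_LIMSEQ_metric)
    fix k
    have "(\<lambda>p. A k (snd p)) \<in> measurable (N \<Otimes>\<^sub>M borel) (count_space UNIV)"
      unfolding A_def
    proof (rule measurable_Least)
      fix j
      have "Measurable.pred borel (\<lambda>z. dist (e j) z < inverse (real (Suc k)))"
        unfolding pred_def using borel_open[OF open_ball[of "e j" "inverse (real (Suc k))"]] by (simp add: ball_def)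
      then show "(\<lambda>p. dist (e j) (snd p) < inverse (real (Suc k))) \<in> measurable (N \<Otimes>\<^sub>M borel) (count_space UNIV)"
        by (rule measurable_compose[OF measurable_snd])
    qed
    then show "(\<lambda>p. h (fst p) (e (A k (snd p)))) \<in> borel_measurable (N \<Otimes>\<^sub>M borel)"
      by (rule measurable_compose_countable[rotated]) (rule measurable_compose[OF measurable_fst m])
  next
    fix p :: "'a \<times> 'b" assume "p \<in> space (N \<Otimes>\<^sub>M borel)"
    then have "continuous_on UNIV (h (fst p))" by (intro c) (auto simp: space_pair_measure)
    then show "(\<lambda>k. h (fst p) (e (A k (snd p)))) \<longlonglongrightarrow> h (fst p) (snd p)"
      by (rule continuous_on_tendsto_compose[OF _ Alim]) auto
  qed
qed

lemma measurable_fourier: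
  fixes h :: "'a \<Rightarrow> real ^ 'd::finite \<Rightarrow> real"
  assumes m: "\<And>x. (\<lambda>\<omega>. h \<omega> x) \<in> borel_measurable N" and c: "\<And>\<omega>. \<omega> \<in> space N \<Longrightarrow> continuous_on UNIV (h \<omega>)"
  shows "(\<lambda>\<omega>. fourier (h \<omega>) m) \<in> borel_measurable N"
proof -
  let ?k = "\<lambda>\<omega> x. complex_of_real (h \<omega> x) * cnj (mode m x)"
  have "(\<lambda>p. ?k (fst p) (snd p)) \<in> borel_measurable (N \<Otimes>\<^sub>M borel)"
  proof (rule measurable_caratheodory)
    show "(\<lambda>\<omega>. ?k \<omega> x) \<in> borel_measurable N" for x using m[of x] by measurable
    show "continuous_on UNIV (?k \<omega>)" if "\<omega> \<in> space N" for \<omega> by (intro continuous_intros c that)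
  qed
  moreover have "(\<lambda>p. (fst p, snd p)) \<in> measurable (N \<Otimes>\<^sub>M torus) (N \<Otimes>\<^sub>M (borel :: (real ^ 'd) measure))"
  proof (rule measurable_Pair[OF measurable_fst])
    have "(\<lambda>x. x) \<in> measurable torus (borel :: (real ^ 'd) measure)"
      unfolding torus_def by (intro measurable_restrict_space1) simp
    then show "snd \<in> measurable (N \<Otimes>\<^sub>M torus) (borel :: (real ^ 'd) measure)" by (rule measurable_compose[OF measurable_snd])
  qed
  ultimately have "(\<lambda>p. ?k (fst p) (snd p)) \<in> borel_measurable (N \<Otimes>\<^sub>M torus)"
    using measurable_compose[of "\<lambda>p. (fst p, snd p)" _ _ "\<lambda>p. ?k (fst p) (snd p)"] by simp
  then show ?thesis unfolding fourier_def
    by (intro torus.borel_measurable_lebesgue_integral) (simp add: case_prod_beta')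
qed

lemma wpath_eval_continuous:
  assumes w: "wpath S w" shows "continuous_on S (\<lambda>s. w s x)"
proof (rule continuous_onI)
  fix t and e :: real assume t: "t \<in> S" and e: "e > 0"
  obtain \<delta> where \<delta>: "\<delta> > 0" "\<And>s x. s \<in> S \<Longrightarrow> \<bar>s - t\<bar> < \<delta> \<Longrightarrow> \<bar>w s x - w t x\<bar> \<le> e"
    using wpath_continuity[OF w t e] by blast
  then show "\<exists>d>0. \<forall>s\<in>S. dist s t < d \<longrightarrow> dist (w s x) (w t x) \<le> e" by (auto simp: dist_real_def)
qed

lemma measurable_duhamel:
  fixes w :: "'a \<Rightarrow> real \<Rightarrow> real ^ 'd::finite \<Rightarrow> real"
  assumes t: "t \<ge> 0" and w: "\<And>\<omega>. \<omega> \<in> space N \<Longrightarrow> wpath {0..t} (w \<omega>)"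
    and m: "\<And>s x. s \<in> {0..t} \<Longrightarrow> (\<lambda>\<omega>. w \<omega> s x) \<in> borel_measurable N"
  shows "(\<lambda>\<omega>. duhamel (w \<omega>) t m) \<in> borel_measurable N"
proof -
  \<comment> \<open>Clamping time to \<open>[0, t]\<close> extends the integrand continuously to the
    whole line, as \<open>measurable_caratheodory\<close> demands.\<close>
  define c where "c s = max 0 (min t s)" for s
  have c: "c s \<in> {0..t}" for s using t by (auto simp: c_def)
  have cc: "continuous_on UNIV c" unfolding c_def by (intro continuous_intros)
  define k where "k \<omega> s = complex_of_real (semi (t - c s) m) * fourier (w \<omega> (c s)) m" for \<omega> s
  have kc: "continuous_on UNIV (k \<omega>)" if "\<omega> \<in> space N" for \<omega>
  proof -
    have "continuous_on UNIV (\<lambda>s. fourier (w \<omega> (c s)) m)"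
      by (rule continuous_on_compose2[OF wpath_fourier_continuous[OF w[OF that]] cc]) (use c in blast)
    then show ?thesis unfolding k_def[abs_def] by (intro continuous_intros cc)
  qed
  have "(\<lambda>p. k (fst p) (snd p)) \<in> borel_measurable (N \<Otimes>\<^sub>M borel)"
  proof (rule measurable_caratheodory[OF _ kc])
    fix s
    have "(\<lambda>\<omega>. fourier (w \<omega> (c s)) m) \<in> borel_measurable N"
      by (intro measurable_fourier m c) (rule wpathD(1)[OF w c])
    then show "(\<lambda>\<omega>. k \<omega> s) \<in> borel_measurable N" unfolding k_def by measurable
  qed
  then have "(\<lambda>p. indicator {0..t} (snd p) *\<^sub>R k (fst p) (snd p)) \<in> borel_measurable (N \<Otimes>\<^sub>M borel)" by measurable
  then have "(\<lambda>\<omega>. LINT s:{0..t}|lborel. k \<omega> s) \<in> borel_measurable N"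
    unfolding set_lebesgue_integral_def
    by (intro lborel.borel_measurable_lebesgue_integral) (simp add: case_prod_beta' cong: measurable_cong_sets)
  moreover have "(LINT s:{0..t}|lborel. k \<omega> s) = integral {0..t} (\<lambda>s. of_real (semi (t - s) m) * fourier (w \<omega> s) m)" if \<omega>: "\<omega> \<in> space N" for \<omega>
  proof -
    have "(LINT s:{0..t}|lborel. k \<omega> s) = integral {0..t} (k \<omega>)"
      by (rule set_borel_integral_eq_integral(2)[OF borel_integrable_atLeastAtMost'[OF continuous_on_subset[OF kc[OF \<omega>]]]]) simp
    also have "\<dots> = integral {0..t} (\<lambda>s. of_real (semi (t - s) m) * fourier (w \<omega> s) m)"
      by (rule Henstock_Kurzweil_Integration.integral_cong) (simp add: k_def c_def)
    finally show ?thesis .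
  qed
  ultimately have "(\<lambda>\<omega>. integral {0..t} (\<lambda>s. of_real (semi (t - s) m) * fourier (w \<omega> s) m)) \<in> borel_measurable N"
    by (subst measurable_cong[of N _ "\<lambda>\<omega>. LINT s:{0..t}|lborel. k \<omega> s"]) simp_all
  then show ?thesis unfolding duhamel_def by measurable
qed

lemma cubic_measurable [measurable]: "cubic n \<in> borel_measurable borel"
  unfolding cubic_def[abs_def] cutoff_def by measurable

section \<open>The Borel sets of the Besov space\<close>

context besov
begin

text \<open>Point evaluation is Lipschitz for the Besov metric, so preimages of open sets are
  open.\<close>

lemma eval_measurable: "(\<lambda>f. fun_of f x) \<in> borel_measurable (besov_borel \<rho> \<alpha>)"
proof (rule borel_measurableI)
  fix S :: "real set" assume S: "open S"
  have P: "{A. openin (besov_topology \<rho> \<alpha>) A} \<subseteq> Pow (topspace (besov_topology \<rho> \<alpha>))"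
    using openin_subset by blast
  have sp: "space (besov_borel \<rho> \<alpha>) = besov_space \<rho> \<alpha>"
    unfolding besov_borel_def topspace_besov[symmetric] by (rule space_measure_of[OF P])
  have "openin (besov_topology \<rho> \<alpha>) ((\<lambda>f. fun_of f x) -` S \<inter> besov_space \<rho> \<alpha>)"
    unfolding besov_topology_eq B.openin_mtopology
  proof (intro conjI allI impI)
    fix f assume "f \<in> (\<lambda>f. fun_of f x) -` S \<inter> besov_space \<rho> \<alpha>"
    then have f: "fun_of f x \<in> S" "f \<in> besov_space \<rho> \<alpha>" by auto
    obtain e where e: "e > 0" "ball (fun_of f x) e \<subseteq> S" using openE[OF S f(1)] by blast
    \<comment> \<open>The added \<open>1\<close> permits the division, \<open>Csup\<close> being
      only known to be non-negative.\<close>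
    have C1: "Csup + 1 > 0" using Csup_nonneg by linarith
    show "\<exists>r>0. B.mball f r \<subseteq> (\<lambda>f. fun_of f x) -` S \<inter> besov_space \<rho> \<alpha>"
    proof (intro exI[of _ "e / (Csup + 1)"] conjI subsetI)
      show "0 < e / (Csup + 1)" using e C1 by simp
      fix h assume "h \<in> B.mball f (e / (Csup + 1))"
      then have h: "h \<in> besov_space \<rho> \<alpha>" "bdist f h < e / (Csup + 1)" by auto
      have "\<bar>fun_of f x - fun_of h x\<bar> \<le> Csup * bdist f h" by (rule fun_of_diff_le[OF f(2) h(1)])
      also have "\<dots> \<le> (Csup + 1) * bdist f h" by (intro mult_right_mono) auto
      also have "\<dots> < (Csup + 1) * (e / (Csup + 1))" by (rule mult_strict_left_mono[OF h(2) C1])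
      also have "\<dots> = e" using C1 by simp
      finally have "fun_of h x \<in> ball (fun_of f x) e" by (simp add: dist_real_def)
      then show "h \<in> (\<lambda>f. fun_of f x) -` S \<inter> besov_space \<rho> \<alpha>" using e(2) h(1) by auto
    qed
  qed auto
  then show "(\<lambda>f. fun_of f x) -` S \<inter> space (besov_borel \<rho> \<alpha>) \<in> sets (besov_borel \<rho> \<alpha>)"
    unfolding sp unfolding besov_borel_def sets_measure_of[OF P] by (intro sigma_sets.Basic) simp
qed

text \<open>
  The sets of all \<open>f\<close> whose coefficients up to level \<open>N\<close> are within \<open>1 / (k + 1)\<close> of those of \<open>q\<close>
  and whose further blocks have weight at most \<open>1 / (j + 1)\<close>; countably many of them form a base.
\<close>

definition cell :: "nat \<Rightarrow> nat \<Rightarrow> nat \<Rightarrow> (real ^ 'd \<Rightarrow> complex) \<Rightarrow> 'd functional set" where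
  "cell N j k q = {f \<in> besov_space \<rho> \<alpha>. (\<forall>m\<in>(\<Union>n\<le>N. freqs n). cmod (fcoef f m - q m) \<le> 1 / real (Suc k)) \<and>
     (\<forall>n. N < n \<longrightarrow> wt n * bsup n (fcoef f) \<le> 1 / real (Suc j))}"

lemma cell_diameter:
  assumes f: "f \<in> cell N j k q" and h: "h \<in> cell N j k q"
  shows "bdist f h \<le> max (2 / real (Suc j)) ((\<Sum>n\<le>N. wt n * real (card (freqs n))) * (2 / real (Suc k)))"
    (is "_ \<le> max ?a ?b")
proof (subst bdist_le_iff)
  show "f \<in> besov_space \<rho> \<alpha>" "h \<in> besov_space \<rho> \<alpha>" using f h by (auto simp: cell_def)
  show "\<forall>n. wt n * bsup n (\<lambda>m. fcoef f m - fcoef h m) \<le> max ?a ?b"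
  proof
    fix n
    show "wt n * bsup n (\<lambda>m. fcoef f m - fcoef h m) \<le> max ?a ?b"
    proof (cases "n \<le> N")
      case True
      have d: "cmod (fcoef f m - fcoef h m) \<le> 2 / real (Suc k)" if m: "m \<in> freqs n" for m
      proof -
        have "cmod (fcoef f m - q m) \<le> 1 / real (Suc k)" "cmod (fcoef h m - q m) \<le> 1 / real (Suc k)"
          using f h m True unfolding cell_def by blast+
        then show ?thesis using norm_triangle_ineq4[of "fcoef f m - q m" "fcoef h m - q m"] by simp
      qed
      have "bsup n (\<lambda>m. fcoef f m - fcoef h m) \<le> (\<Sum>m\<in>freqs n. bump n m * cmod (fcoef f m - fcoef h m))"
        by (rule bsup_le_sum)
      also have "\<dots> \<le> (\<Sum>m\<in>freqs n. 1 * (2 / real (Suc k)))" by (intro sum_mono mult_mono bump_le_1 d) auto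
      finally have "wt n * bsup n (\<lambda>m. fcoef f m - fcoef h m) \<le> wt n * (real (card (freqs n)) * (2 / real (Suc k)))"
        by (intro mult_left_mono) auto
      also have "\<dots> = (wt n * real (card (freqs n))) * (2 / real (Suc k))" by (simp only: mult.assoc)
      also have "\<dots> \<le> ?b" by (intro mult_right_mono member_le_sum) (use True in auto)
      finally show ?thesis by simp
    next
      case False
      then have "wt n * bsup n (fcoef f) \<le> 1 / real (Suc j)" "wt n * bsup n (fcoef h) \<le> 1 / real (Suc j)"
        using f h unfolding cell_def by auto
      moreover have "wt n * bsup n (\<lambda>m. fcoef f m - fcoef h m) \<le> wt n * (bsup n (fcoef f) + bsup n (fcoef h))"
        by (intro mult_left_mono bsup_diff) simp
      ultimately have "wt n * bsup n (\<lambda>m. fcoef f m - fcoef h m) \<le> ?a" by (simp add: distrib_left)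
      then show ?thesis by simp
    qed
  qed
qed (simp add: le_max_iff_disj)

text \<open>The parameters are chosen in this order: \<open>j\<close> from the radius, then
  \<open>N\<close> so that the tail of \<open>f\<close> is small, then the accuracy
  \<open>k\<close>, because the number of coefficients up to level \<open>N\<close> multiplies the
  error; last the approximating values \<open>q\<close>.\<close>

lemma cell_base:
  assumes e: "\<And>Y. open Y \<Longrightarrow> Y \<noteq> {} \<Longrightarrow> \<exists>j. (e :: nat \<Rightarrow> complex) j \<in> Y"
    and f: "f \<in> besov_space \<rho> \<alpha>" and r: "r > 0"
  obtains N j k q where "q \<in> PiE (\<Union>n\<le>N. freqs n) (\<lambda>_. range e)" "f \<in> cell N j k q" "cell N j k q \<subseteq> B.mball f r"
proof -
  obtain j where j: "inverse (real (Suc j)) < r / 2" using reals_Archimedean[of "r / 2"] r by auto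
  have "(\<lambda>n. wt n * bsup n (fcoef f)) \<longlonglongrightarrow> 0" using f besov_space_iff by blast
  then have "\<forall>\<^sub>F n in sequentially. wt n * bsup n (fcoef f) < 1 / real (Suc j)" by (rule order_tendstoD(2)) simp
  then obtain N where N: "\<And>n. n \<ge> N \<Longrightarrow> wt n * bsup n (fcoef f) < 1 / real (Suc j)" unfolding eventually_sequentially by blast
  define K where "K = (\<Sum>n\<le>N. wt n * real (card (freqs n)))"
  have K: "K \<ge> 0" unfolding K_def by (intro sum_nonneg) simp
  obtain k where k: "inverse (real (Suc k)) < r / (2 * (K + 1))" using reals_Archimedean[of "r / (2 * (K + 1))"] r K by auto
  have "\<forall>m. \<exists>i. e i \<in> ball (fcoef f m) (1 / real (Suc k))" by (intro allI e) auto
  from choice[OF this] obtain i where i: "\<forall>m. e (i m) \<in> ball (fcoef f m) (1 / real (Suc k))" by blast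
  \<comment> \<open>Restriction to the finitely many relevant frequencies puts \<open>q\<close> into
    a countable set of functions.\<close>
  define q where "q = restrict (\<lambda>m. e (i m)) (\<Union>n\<le>N. freqs n)"
  have fc: "f \<in> cell N j k q" unfolding cell_def
  proof (intro CollectI conjI f ballI allI impI)
    show "cmod (fcoef f m - q m) \<le> 1 / real (Suc k)" if "m \<in> (\<Union>n\<le>N. freqs n)" for m
    proof -
      have "q m = e (i m)" unfolding q_def by (rule restrict_apply'[OF that])
      moreover have "dist (fcoef f m) (e (i m)) < 1 / real (Suc k)" using spec[OF i, of m] by (simp only: mem_ball)
      ultimately show ?thesis unfolding dist_norm by (simp only: less_imp_le)
    qed
    show "wt n * bsup n (fcoef f) \<le> 1 / real (Suc j)" if "N < n" for n using N[of n] that by simp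
  qed
  have qP: "q \<in> PiE (\<Union>n\<le>N. freqs n) (\<lambda>_. range e)" unfolding q_def restrict_PiE_iff by blast
  have a: "2 / real (Suc j) < r"
  proof -
    have "2 / real (Suc j) = 2 * inverse (real (Suc j))" by (rule divide_inverse)
    then show ?thesis using j by linarith
  qed
  have b: "K * (2 / real (Suc k)) < r"
  proof -
    have eq: "2 / real (Suc k) = 2 * inverse (real (Suc k))" by (rule divide_inverse)
    have "K * (2 / real (Suc k)) \<le> (K + 1) * (2 * inverse (real (Suc k)))"
      unfolding eq by (intro mult_right_mono) auto
    also have "(K + 1) * (2 * inverse (real (Suc k))) < (K + 1) * (2 * (r / (2 * (K + 1))))"
      using K by (intro mult_strict_left_mono k) auto
    also have "\<dots> = r" using K by (simp add: field_simps)
    finally show ?thesis .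
  qed
  have "cell N j k q \<subseteq> B.mball f r"
  proof
    fix h assume h: "h \<in> cell N j k q"
    have "bdist f h \<le> max (2 / real (Suc j)) (K * (2 / real (Suc k)))"
      using cell_diameter[OF fc h] unfolding K_def .
    also have "\<dots> < r" unfolding max_less_iff_conj using a b by blast
    finally show "h \<in> B.mball f r" using f h by (simp add: cell_def)
  qed
  with qP fc show thesis by (rule that)
qed

text \<open>The countable base of cells makes every open set a countable union of cells, and the
  preimage of a cell is described by countably many conditions on the coefficients.\<close>

lemma besov_measurableI:
  fixes N :: "'a measure"
  assumes sp: "\<And>\<omega>. \<omega> \<in> space N \<Longrightarrow> h \<omega> \<in> besov_space \<rho> \<alpha>" and m: "\<And>m. m \<in> int_lattice \<Longrightarrow> (\<lambda>\<omega>. fcoef (h \<omega>) m) \<in> borel_measurable N"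
  shows "h \<in> measurable N (besov_borel \<rho> \<alpha>)"
  unfolding besov_borel_def
proof (rule measurable_measure_of)
  show "{A. openin (besov_topology \<rho> \<alpha>) A} \<subseteq> Pow (topspace (besov_topology \<rho> \<alpha>))" by (auto dest: openin_subset)
  show "h \<in> space N \<rightarrow> topspace (besov_topology \<rho> \<alpha>)" using sp by (simp add: topspace_besov)
  obtain d :: "nat \<Rightarrow> real ^ 'd" where d: "\<And>Y. open Y \<Longrightarrow> Y \<noteq> {} \<Longrightarrow> \<exists>j. d j \<in> Y" by (rule dense_sequence) blast
  obtain e :: "nat \<Rightarrow> complex" where e: "\<And>Y. open Y \<Longrightarrow> Y \<noteq> {} \<Longrightarrow> \<exists>j. e j \<in> Y" by (rule dense_sequence) blast
  have cell: "h -` cell M j k q \<inter> space N \<in> sets N" for M j k q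
  proof -
    have fin: "finite (\<Union>n\<le>M. freqs n)" by simp
    have blk: "(\<lambda>\<omega>. block n (fcoef (h \<omega>)) x) \<in> borel_measurable N" for n x
      unfolding block_eq using freqs_sub[of n]
      by (intro borel_measurable_sum borel_measurable_times borel_measurable_const measurable_compose[OF _ borel_measurable_Re] m) auto
    \<comment> \<open>The supremum over all points becomes a condition at the points of a dense
      sequence, as blocks are continuous.\<close>
    have bs: "wt n * bsup n c \<le> r \<longleftrightarrow> (\<forall>i. wt n * \<bar>block n c (d i)\<bar> \<le> r)" for n c r
    proof
      assume a: "wt n * bsup n c \<le> r"
      show "\<forall>i. wt n * \<bar>block n c (d i)\<bar> \<le> r"
        by (intro allI order_trans[OF mult_left_mono[OF block_le_bsup] a]) simp
    next
      assume a: "\<forall>i. wt n * \<bar>block n c (d i)\<bar> \<le> r"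
      have "\<bar>block n c x\<bar> \<le> r / wt n" for x
        by (rule continuous_le_dense[OF continuous_block d]) (use a in \<open>simp_all add: pos_le_divide_eq mult.commute\<close>)
      then have "bsup n c \<le> r / wt n" by (rule bsup_le)
      then show "wt n * bsup n c \<le> r" by (simp add: pos_le_divide_eq mult.commute)
    qed
    define P where "P f \<longleftrightarrow> (\<forall>m\<in>(\<Union>n\<le>M. freqs n). cmod (fcoef f m - q m) \<le> 1 / real (Suc k)) \<and>
       (\<forall>n. M < n \<longrightarrow> wt n * bsup n (fcoef f) \<le> 1 / real (Suc j))" for f
    have cP: "cell M j k q = {f \<in> besov_space \<rho> \<alpha>. P f}" unfolding cell_def P_def ..
    have "Measurable.pred N (\<lambda>\<omega>. P (h \<omega>))" unfolding P_def bs
    proof (intro pred_intros_logic pred_intros_finite(3)[OF fin] pred_intros_countable)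
      show "Measurable.pred N (\<lambda>\<omega>. cmod (fcoef (h \<omega>) m - q m) \<le> 1 / real (Suc k))" if "m \<in> (\<Union>n\<le>M. freqs n)" for m
      proof -
        have "m \<in> int_lattice" using that freqs_sub by blast
        from m[OF this] show ?thesis by measurable
      qed
      show "Measurable.pred N (\<lambda>\<omega>. wt n * \<bar>block n (fcoef (h \<omega>)) (d i)\<bar> \<le> 1 / real (Suc j))" for n i
        using blk[of n "d i"] by measurable
    qed (rule measurable_const, simp)
    then have "{\<omega>\<in>space N. P (h \<omega>)} \<in> sets N" unfolding pred_def .
    also have "{\<omega>\<in>space N. P (h \<omega>)} = h -` cell M j k q \<inter> space N" unfolding cP using sp by blast
    finally show ?thesis .
  qed
  fix A assume "A \<in> {A. openin (besov_topology \<rho> \<alpha>) A}"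
  then have A: "A \<subseteq> besov_space \<rho> \<alpha>" "\<And>f. f \<in> A \<Longrightarrow> \<exists>r>0. B.mball f r \<subseteq> A"
    by (auto simp: besov_topology_eq B.openin_mtopology)
  \<comment> \<open>Countable because for each \<open>N\<close> the functions \<open>q\<close> live
    on a finite set and take values in the range of a sequence.\<close>
  define I where "I = (SIGMA N:(UNIV :: nat set). (UNIV :: nat set) \<times> (UNIV :: nat set) \<times> PiE (\<Union>n\<le>N. freqs n) (\<lambda>_. range e))"
  have I: "countable I" unfolding I_def
    by (intro countable_SIGMA countable_PiE countable_image countableI_type) auto
  define C where "C i = (case i of (N, j, k, q) \<Rightarrow> cell N j k q)" for i
  have C: "C (N, j, k, q) = cell N j k q" for N j k q by (simp only: C_def prod.case)
  define J where "J = {i\<in>I. C i \<subseteq> A}"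
  have J: "countable J" unfolding J_def by (rule countable_subset[OF _ I]) blast
  have AJ: "A = (\<Union>i\<in>J. C i)"
  proof (intro equalityI subsetI)
    fix f assume f: "f \<in> A"
    obtain r where r: "r > 0" "B.mball f r \<subseteq> A" using A(2)[OF f] by blast
    have "\<exists>N j k q. q \<in> PiE (\<Union>n\<le>N. freqs n) (\<lambda>_. range e) \<and> f \<in> cell N j k q \<and> cell N j k q \<subseteq> B.mball f r"
    proof (rule cell_base[of e f r])
      show "\<exists>j. e j \<in> Y" if "open Y" "Y \<noteq> {}" for Y by (rule e[OF that])
      show "f \<in> besov_space \<rho> \<alpha>" by (rule subsetD[OF A(1) f])
      show "0 < r" by (rule r(1))
    qed (intro exI conjI)
    then obtain N j k q where q: "q \<in> PiE (\<Union>n\<le>N. freqs n) (\<lambda>_. range e)" "f \<in> cell N j k q" "cell N j k q \<subseteq> B.mball f r"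
      by (elim exE conjE) (rule that)
    show "f \<in> (\<Union>i\<in>J. C i)"
    proof (rule UN_I[of "(N, j, k, q)"])
      show "(N, j, k, q) \<in> J" unfolding J_def I_def
        by (intro CollectI conjI SigmaI UNIV_I q(1)) (simp only: C subset_trans[OF q(3) r(2)])
      show "f \<in> C (N, j, k, q)" unfolding C by (rule q(2))
    qed
  next
    fix f assume "f \<in> (\<Union>i\<in>J. C i)"
    then show "f \<in> A" unfolding J_def by blast
  qed
  have "h -` A \<inter> space N = (\<Union>i\<in>J. h -` C i \<inter> space N)" unfolding AJ by blast
  also have "\<dots> \<in> sets N"
  proof (rule sets.countable_UN''[OF J])
    show "h -` C i \<inter> space N \<in> sets N" for i by (cases i) (simp only: C cell)
  qed
  finally show "h -` A \<inter> space N \<in> sets N" .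
qed

end

context mild_setting
begin

lemma measurable_drift:
  fixes w :: "'a \<Rightarrow> real \<Rightarrow> real ^ 'd \<Rightarrow> real"
  assumes t: "t \<ge> 0" and w: "\<And>\<omega>. \<omega> \<in> space N \<Longrightarrow> wpath {0..t} (w \<omega>)"
    and m: "\<And>s x. s \<in> {0..t} \<Longrightarrow> (\<lambda>\<omega>. w \<omega> s x) \<in> borel_measurable N"
  shows "(\<lambda>\<omega>. drift (w \<omega>) t x) \<in> borel_measurable N"
proof (rule borel_measurable_LIMSEQ_real)
  show "(\<lambda>i. \<Sum>n<i. block n (duhamel (w \<omega>) t) x) \<longlonglongrightarrow> drift (w \<omega>) t x" if "\<omega> \<in> space N" for \<omega>
    using drift_facts(4)[OF w[OF that] t, of x] by (simp add: sums_def)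
  have vm: "(\<lambda>\<omega>. duhamel (w \<omega>) t m) \<in> borel_measurable N" for m by (rule measurable_duhamel[OF t w m])
  show "(\<lambda>\<omega>. \<Sum>n<i. block n (duhamel (w \<omega>) t) x) \<in> borel_measurable N" for i
    unfolding block_eq
    by (intro borel_measurable_sum borel_measurable_times borel_measurable_const measurable_compose[OF _ borel_measurable_Re] vm)
qed

end

section \<open>Adapted random data: stopping time and measurability of the solution\<close>

text \<open>Isolates what the noise supplies: an increasing family of sigma-algebras on a common
  space and an adapted forcing with continuous paths.\<close>

locale random_data = mild_setting \<rho> \<alpha> for \<rho> :: "int \<Rightarrow> real ^ 'd::finite \<Rightarrow> real" and \<alpha> :: real +
  fixes g :: "'d functional" and X :: "real \<Rightarrow> 'a \<Rightarrow> 'd functional" and F :: "ennreal \<Rightarrow> 'a measure" and \<Omega> :: "'a set"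
  assumes g: "g \<in> besov_space \<rho> \<alpha>" and X: "\<And>\<omega>. \<omega> \<in> \<Omega> \<Longrightarrow> bcont {0..} (\<lambda>r. X r \<omega>)"
    and space_F: "\<And>r. space (F r) = \<Omega>" and mono_F: "\<And>r s. r \<le> s \<Longrightarrow> sets (F r) \<subseteq> sets (F s)"
    and adapted: "\<And>r. 0 \<le> r \<Longrightarrow> X r \<in> measurable (F (ennreal r)) (besov_borel \<rho> \<alpha>)"
begin

lemma data: "\<omega> \<in> \<Omega> \<Longrightarrow> mild_data \<rho> \<alpha> g (\<lambda>r. X r \<omega>)"
  by unfold_locales (rule g, rule X)

abbreviation "Y \<omega> \<equiv> mild_data.y \<rho> g (\<lambda>r. X r \<omega>)"
abbreviation "approx \<omega> \<equiv> mild_data.truncated \<rho> g (\<lambda>r. X r \<omega>)"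
abbreviation "lifetime \<omega> \<equiv> mild_data.life \<rho> g (\<lambda>r. X r \<omega>)"
abbreviation "solution r \<omega> \<equiv> mild_data.sol \<rho> g (\<lambda>r. X r \<omega>) r"

lemma Y_measurable:
  assumes s: "0 \<le> s" "s \<le> T" shows "(\<lambda>\<omega>. Y \<omega> s x) \<in> borel_measurable (F (ennreal T))"
proof -
  have "subalgebra (F (ennreal T)) (F (ennreal s))"
    using mono_F[OF ennreal_leI[OF s(2)]] by (simp add: subalgebra_def space_F)
  then have "X s \<in> measurable (F (ennreal T)) (besov_borel \<rho> \<alpha>)" by (rule measurable_from_subalg[OF _ adapted[OF s(1)]])
  then have "(\<lambda>\<omega>. fun_of (X s \<omega>) x) \<in> borel_measurable (F (ennreal T))" by (rule measurable_compose[OF _ eval_measurable])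
  then have "(\<lambda>\<omega>. synth (\<lambda>m. of_real (semi s m) * fcoef g m) x + fun_of (X s \<omega>) x) \<in> borel_measurable (F (ennreal T))"
    by (intro borel_measurable_add borel_measurable_const)
  then show ?thesis
    by (rule measurable_cong[THEN iffD1, rotated]) (simp add: space_F mild_data.y_def[OF data] mild_data.free_part_def[OF data])
qed

lemma picard_measurable:
  assumes s: "0 \<le> s" "s \<le> T" shows "(\<lambda>\<omega>. picard (cubic n) (Y \<omega>) k s x) \<in> borel_measurable (F (ennreal T))"
  using s
proof (induction k arbitrary: s x)
  case 0 then show ?case by (simp add: Y_measurable)
next
  case (Suc k)
  have "(\<lambda>\<omega>. drift (\<lambda>s x. cubic n (picard (cubic n) (Y \<omega>) k s x)) s x) \<in> borel_measurable (F (ennreal T))"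
  proof (rule measurable_drift[OF Suc.prems(1)])
    fix \<omega> assume "\<omega> \<in> space (F (ennreal T))"
    then have \<omega>: "\<omega> \<in> \<Omega>" by (simp add: space_F)
    show "wpath {0..s} (\<lambda>s x. cubic n (picard (cubic n) (Y \<omega>) k s x))"
      by (rule picard_setting.wpath_PP_picard[OF mild_data.picard_setting[OF data[OF \<omega>]]])
  next
    fix r x assume r: "r \<in> {0..s}"
    have "(\<lambda>\<omega>. picard (cubic n) (Y \<omega>) k r x) \<in> borel_measurable (F (ennreal T))" by (rule Suc.IH) (use r Suc.prems in auto)
    then show "(\<lambda>\<omega>. cubic n (picard (cubic n) (Y \<omega>) k r x)) \<in> borel_measurable (F (ennreal T))" by measurable
  qed
  then show ?case unfolding picard.simps by (intro borel_measurable_add Y_measurable Suc.prems)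
qed

lemma truncated_measurable:
  assumes s: "0 \<le> s" "s \<le> T" shows "(\<lambda>\<omega>. approx \<omega> n s x) \<in> borel_measurable (F (ennreal T))"
proof (rule borel_measurable_LIMSEQ_real)
  show "(\<lambda>k. picard (cubic n) (Y \<omega>) (Suc k) s x) \<longlonglongrightarrow> approx \<omega> n s x" if "\<omega> \<in> space (F (ennreal T))" for \<omega>
  proof -
    have \<omega>: "\<omega> \<in> \<Omega>" using that by (simp add: space_F)
    show ?thesis unfolding mild_data.truncated_def[OF data[OF \<omega>]]
      by (rule picard_setting.picard_limit_approx(2)[OF mild_data.picard_setting[OF data[OF \<omega>]] s(1) order_refl])
  qed
  show "(\<lambda>\<omega>. picard (cubic n) (Y \<omega>) (Suc k) s x) \<in> borel_measurable (F (ennreal T))" for k by (rule picard_measurable[OF s])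
qed

text \<open>The times \<open>min t \<bar>d i\<bar>\<close> come from a dense sequence of the line,
  so two rounds of continuity, in space and then in time, replace the uncountable quantifiers by
  countable ones.\<close>

lemma good_iff:
  fixes e :: "nat \<Rightarrow> real ^ 'd" and d :: "nat \<Rightarrow> real"
  assumes \<omega>: "\<omega> \<in> \<Omega>" and t: "t \<ge> 0" and e: "\<And>Z. open Z \<Longrightarrow> Z \<noteq> {} \<Longrightarrow> \<exists>j. e j \<in> Z" and d: "\<And>Z. open Z \<Longrightarrow> Z \<noteq> {} \<Longrightarrow> \<exists>j. d j \<in> Z"
  shows "mild_data.good \<rho> g (\<lambda>r. X r \<omega>) n t \<longleftrightarrow> (\<forall>i j. \<bar>approx \<omega> n (min t \<bar>d i\<bar>) (e j)\<bar> \<le> real n)"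
proof
  assume "mild_data.good \<rho> g (\<lambda>r. X r \<omega>) n t"
  then show "\<forall>i j. \<bar>approx \<omega> n (min t \<bar>d i\<bar>) (e j)\<bar> \<le> real n" using t by (simp add: mild_data.good_def[OF data[OF \<omega>]])
next
  assume a: "\<forall>i j. \<bar>approx \<omega> n (min t \<bar>d i\<bar>) (e j)\<bar> \<le> real n"
  note w = mild_data.truncated_wpath[OF data[OF \<omega>], of n]
  have 1: "\<bar>approx \<omega> n (min t \<bar>d i\<bar>) x\<bar> \<le> real n" for i x
    by (rule continuous_le_dense[OF wpathD(1)[OF w] e]) (use a t in auto)
  have c: "continuous_on UNIV (\<lambda>s. approx \<omega> n (min t \<bar>s\<bar>) x)" for x
    by (rule continuous_on_compose2[OF wpath_eval_continuous[OF w, of x]]) (use t in \<open>auto intro!: continuous_intros\<close>)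
  have 2: "\<bar>approx \<omega> n (min t \<bar>s\<bar>) x\<bar> \<le> real n" for s x
    by (rule continuous_le_dense[OF c d]) (use 1 in auto)
  have "\<bar>approx \<omega> n s x\<bar> \<le> real n" if "s \<in> {0..t}" for s x using 2[of s x] that by simp
  then show "mild_data.good \<rho> g (\<lambda>r. X r \<omega>) n t" using t by (simp add: mild_data.good_def[OF data[OF \<omega>]])
qed

text \<open>By \<open>less_life\<close>, survival at \<open>t\<close> is a statement about truncated
  solutions on \<open>[0, t]\<close>, hence an event of the sigma-algebra at time \<open>t\<close>
  itself.\<close>

lemma alive_measurable:
  assumes t: "t \<ge> 0" shows "Measurable.pred (F (ennreal t)) (\<lambda>\<omega>. ennreal t < lifetime \<omega>)"
proof -
  obtain e :: "nat \<Rightarrow> real ^ 'd" where e: "\<And>Z. open Z \<Longrightarrow> Z \<noteq> {} \<Longrightarrow> \<exists>j. e j \<in> Z" by (rule dense_sequence) blast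
  obtain d :: "nat \<Rightarrow> real" where d: "\<And>Z. open Z \<Longrightarrow> Z \<noteq> {} \<Longrightarrow> \<exists>j. d j \<in> Z" by (rule dense_sequence) blast
  have "Measurable.pred (F (ennreal t)) (\<lambda>\<omega>. \<exists>n. \<forall>i j. \<bar>approx \<omega> n (min t \<bar>d i\<bar>) (e j)\<bar> \<le> real n)"
  proof (intro pred_intros_countable)
    fix n i j
    have "(\<lambda>\<omega>. approx \<omega> n (min t \<bar>d i\<bar>) (e j)) \<in> borel_measurable (F (ennreal t))" by (rule truncated_measurable) (use t in auto)
    then show "Measurable.pred (F (ennreal t)) (\<lambda>\<omega>. \<bar>approx \<omega> n (min t \<bar>d i\<bar>) (e j)\<bar> \<le> real n)" by measurable
  qed
  then show ?thesis
    by (rule measurable_cong[THEN iffD1, rotated]) (simp add: space_F mild_data.less_life[OF data t] good_iff[OF _ t e d])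
qed

lemma lifetime_stopping: "stopping_time F lifetime"
  unfolding stopping_time_def
proof
  fix t :: ennreal
  \<comment> \<open>At a finite time this is the complement of survival; at infinity the condition
    always holds.\<close>
  show "Measurable.pred (F t) (\<lambda>\<omega>. lifetime \<omega> \<le> t)"
  proof (cases t)
    case (real r)
    then have "Measurable.pred (F t) (\<lambda>\<omega>. \<not> ennreal r < lifetime \<omega>)" using alive_measurable[of r] by (intro pred_intros_logic) simp
    then show ?thesis using real by (simp add: not_less)
  qed simp
qed

text \<open>On the event of survival the point values are limits of the truncated solutions; they
  determine the Fourier coefficients measurably, and the coefficients determine the Besov
  element.\<close>

lemma solution_adapted: "besov_process \<rho> \<alpha> F lifetime solution"
  unfolding besov_process_def
proof (intro allI impI)
  fix r :: real assume r: "r \<ge> 0"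
  define N where "N = restrict_space (F (ennreal r)) {\<omega>. ennreal r < lifetime \<omega>}"
  have al: "\<omega> \<in> \<Omega> \<and> ennreal r < lifetime \<omega>" if "\<omega> \<in> space N" for \<omega>
    using that by (auto simp: N_def space_restrict_space space_F)
  have gd: "\<exists>n. mild_data.good \<rho> g (\<lambda>r. X r \<omega>) n r" if "\<omega> \<in> space N" for \<omega>
    using al[OF that] mild_data.less_life[OF data r] by blast
  have sp: "solution r \<omega> \<in> besov_space \<rho> \<alpha>" if "\<omega> \<in> space N" for \<omega>
    using mild_data.sol_bcont[OF data, of \<omega>] al[OF that] r by (simp add: bcont_def)
  have ev: "(\<lambda>\<omega>. fun_of (solution r \<omega>) x) \<in> borel_measurable N" for x
  proof (rule borel_measurable_LIMSEQ_real)
    show "(\<lambda>\<omega>. approx \<omega> n r x) \<in> borel_measurable N" for n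
      unfolding N_def by (intro measurable_restrict_space1 truncated_measurable[OF r order_refl])
    fix \<omega> assume \<omega>: "\<omega> \<in> space N"
    then obtain n where n: "mild_data.good \<rho> g (\<lambda>r. X r \<omega>) n r" using gd by blast
    have D: "mild_data \<rho> \<alpha> g (\<lambda>r. X r \<omega>)" using al[OF \<omega>] data by blast
    have rr: "r \<in> {0..r}" using r by simp
    show "(\<lambda>k. approx \<omega> k r x) \<longlonglongrightarrow> fun_of (solution r \<omega>) x"
      unfolding mild_data.sol_eq(2)[OF D n rr] by (rule mild_data.good_lim[OF D n rr])
  qed
  show "solution r \<in> measurable N (besov_borel \<rho> \<alpha>)" 
  proof (rule besov_measurableI[OF sp])
    fix m :: "real ^ 'd" assume m: "m \<in> int_lattice"
    have "(\<lambda>\<omega>. fourier (fun_of (solution r \<omega>)) m) \<in> borel_measurable N"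
      by (rule measurable_fourier[OF ev]) (rule besov_fun_of(1)[OF sp])
    then show "(\<lambda>\<omega>. fcoef (solution r \<omega>) m) \<in> borel_measurable N"
      by (rule measurable_cong[THEN iffD1, rotated]) (simp add: besov_fun_of(4)[OF sp m])
  qed
qed

end

section \<open>The noise filtration and the conclusion\<close>

lemma noise_filtration_mono:
  assumes "r \<le> s" shows "sets (noise_filtration M \<xi> r) \<subseteq> sets (noise_filtration M \<xi> s)"
proof -
  have P: "sets M \<inter> (\<Inter>q\<in>{q. 0 \<le> q \<and> t < ennreal q}. noise_events M \<xi> q) \<subseteq> Pow (space M)" for t
    by (rule order_trans[OF Int_lower1 sets.space_closed])
  have "{q. 0 \<le> q \<and> s < ennreal q} \<subseteq> {q. 0 \<le> q \<and> r < ennreal q}" using le_less_trans[OF assms] by blast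
  then show ?thesis
    unfolding noise_filtration_def sets_measure_of[OF P] by (intro sigma_sets_mono' Int_mono order_refl INF_superset_mono)
qed

lemma space_noise_filtration: "space (noise_filtration M \<xi> r) = space M"
  unfolding noise_filtration_def by (rule space_measure_of[OF order_trans[OF Int_lower1 sets.space_closed]])

theorem theorem2p4p2:
  fixes \<rho> :: "int \<Rightarrow> real ^ 'd::finite \<Rightarrow> real"
    and M :: "'a measure"
    and \<xi> :: "(real \<times> (real ^ 'd) \<Rightarrow> real) \<Rightarrow> 'a \<Rightarrow> real"
    and X :: "real \<Rightarrow> 'a \<Rightarrow> 'd functional"
    and \<alpha> :: real
    and g :: "'d functional"
  assumes "CARD('d) \<in> {1, 2, 3}"
    and "dyadic_partition \<rho>"
    and "prob_space M" and "complete_measure M"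
    and "white_noise M \<xi>"
    and "stochastic_convolution \<rho> M \<xi> X"
    and "0 < \<alpha>" and "\<alpha> < 2 - real CARD('d) / 2"
    and "g \<in> besov_space \<rho> \<alpha>"
  shows "\<exists>\<tau> :: 'a \<Rightarrow> ennreal.
    stopping_time (noise_filtration M \<xi>) \<tau> \<and> (\<forall>\<omega>\<in>space M. 0 < \<tau> \<omega>) \<and>
    (\<exists>f :: real \<Rightarrow> 'a \<Rightarrow> 'd functional.
       besov_process \<rho> \<alpha> (noise_filtration M \<xi>) \<tau> f \<and>
       (\<forall>\<omega>\<in>space M.
          maximal_mild_solution \<rho> \<alpha> g (\<lambda>r. X r \<omega>) (\<tau> \<omega>) (\<lambda>r. f r \<omega>)) \<and>
       (\<forall>f'. besov_process \<rho> \<alpha> (\<lambda>_. M) \<tau> f' \<and>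
          (\<forall>\<omega>\<in>space M.
             maximal_mild_solution \<rho> \<alpha> g (\<lambda>r. X r \<omega>) (\<tau> \<omega>) (\<lambda>r. f' r \<omega>)) \<longrightarrow>
          (\<forall>\<omega>\<in>space M. \<forall>r. 0 \<le> r \<and> ennreal r < \<tau> \<omega> \<longrightarrow> f' r \<omega> = f r \<omega>)))"
proof -
  interpret mild_setting \<rho> \<alpha>
    using assms(1,2,7,8) by unfold_locales auto
  \<comment> \<open>The bound \<alpha> \<open>< 2 - d/2\<close> makes \<alpha> itself an admissible
    exponent for the sample paths of \<open>X\<close>.\<close>
  have sc: "besov_process \<rho> \<alpha> (noise_filtration M \<xi>) (\<lambda>_. \<infinity>) X"
    "\<And>\<omega>. \<omega> \<in> space M \<Longrightarrow> continuous_map (top_of_set {0..}) (besov_topology \<rho> \<alpha>) (\<lambda>r. X r \<omega>)"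
    using assms(6,8) unfolding stochastic_convolution_def by blast+
  interpret random_data \<rho> \<alpha> g X "noise_filtration M \<xi>" "space M"
  proof unfold_locales
    show "bcont {0..} (\<lambda>r. X r \<omega>)" if "\<omega> \<in> space M" for \<omega>
      using sc(2)[OF that] by (simp add: continuous_map_besov_iff)
    show "X r \<in> measurable (noise_filtration M \<xi> (ennreal r)) (besov_borel \<rho> \<alpha>)" if "0 \<le> r" for r
    proof -
      \<comment> \<open>For the lifetime infinity the restriction is to the whole space, so only the
        equality of sigma-algebras remains.\<close>
      have "X r \<in> measurable (restrict_space (noise_filtration M \<xi> (ennreal r)) {\<omega>. ennreal r < \<infinity>}) (besov_borel \<rho> \<alpha>)"
        using sc(1) that unfolding besov_process_def by blast
      then show ?thesis by (rule measurable_cong_sets[THEN equalityD1, THEN subsetD, rotated 2]) (simp_all add: sets_restrict_space)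
    qed
  qed (rule assms(9) space_noise_filtration noise_filtration_mono | assumption)+
  show ?thesis
  proof (intro exI[of _ lifetime] exI[of _ solution] conjI ballI allI impI)
    show "stopping_time (noise_filtration M \<xi>) lifetime" by (rule lifetime_stopping)
    show "besov_process \<rho> \<alpha> (noise_filtration M \<xi>) lifetime solution" by (rule solution_adapted)
    fix \<omega> assume \<omega>: "\<omega> \<in> space M"
    show "0 < lifetime \<omega>" by (rule mild_data.life_pos[OF data[OF \<omega>]])
    show "maximal_mild_solution \<rho> \<alpha> g (\<lambda>r. X r \<omega>) (lifetime \<omega>) (\<lambda>r. solution r \<omega>)"
      by (rule mild_data.sol_maximal[OF data[OF \<omega>]])
    fix f' r
    assume "besov_process \<rho> \<alpha> (\<lambda>_. M) lifetime f' \<and> (\<forall>\<omega>\<in>space M. maximal_mild_solution \<rho> \<alpha> g (\<lambda>r. X r \<omega>) (lifetime \<omega>) (\<lambda>r. f' r \<omega>))"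
      and r: "0 \<le> r \<and> ennreal r < lifetime \<omega>"
    then have "maximal_mild_solution \<rho> \<alpha> g (\<lambda>r. X r \<omega>) (lifetime \<omega>) (\<lambda>r. f' r \<omega>)" using \<omega> by blast
    then show "f' r \<omega> = solution r \<omega>" using mild_data.maximal_unique[OF data[OF \<omega>]] r by blast
  qed
qed

end
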